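(* Let $\phi$ be a subharmonic, non-harmonic function on $\mathbb{C}$ such that $\mu=\Delta\phi$ is a doubling measure. Let $g$ be an entire function such that $\bar g\,k_\lambda\in L^2(e^{-2\phi})$ for every $\lambda\in\mathbb{C}$. Then the Hankel operator $H_{\bar g}$ (densely defined on $\operatorname{Span}\{k_\lambda:\lambda\in\mathbb{C}\}$) is compact on $\mathcal{F}^2_\phi$ (i.e. extends to a compact operator $\mathcal{F}^2_\phi\to L^2(e^{-2\phi})$) if and only if $|g'(\lambda)|\rho(\lambda)\to 0$ as $|\lambda|\to\infty$.
   Context: A nonnegative Borel measure $\mu$ on $\mathbb{C}$ is doubling if there is $C>0$ with $\mu(D(z,2r))\le C\mu(D(z,r))$ for all $z\in\mathbb{C}$, $r>0$. For $z\in\mathbb{C}$, $\rho(z)>0$ denotes the radius such that $\mu(D(z,\rho(z)))=1$, where $\mu=\Delta\phi$. $dm$ is Lebesgue measure on $\mathbb{C}$. $L^2(e^{-2\phi})$ is the space of measurable $f$ with $\int_{\mathbb{C}}|f|^2e^{-2\phi}\,dm<\infty$, and the generalized Fock space is $\mathcal{F}^2_\phi=\{f \text{ entire}: \int_{\mathbb{C}}|f|^2e^{-2\phi}\,dm<\infty\}$; $P$ is the orthogonal projection of $L^2(e^{-2\phi})$ onto $\mathcal{F}^2_\phi$. $K(z,\lambda)$ is the reproducing kernel of $\mathcal{F}^2_\phi$ and $k_\lambda(z)=K(z,\lambda)/K(\lambda,\lambda)^{1/2}$. For $f\in\operatorname{Span}\{k_\lambda\}$ the big Hankel operator with symbol $\bar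 g$ is $H_{\bar g}f=(I-P)(\bar g f)$. *)

theory Defs
  imports "HOL-Analysis.Analysis"
begin

definition usc :: "(complex \<Rightarrow> real) \<Rightarrow> bool" where
  "usc f \<longleftrightarrow> (\<forall>t::real. open {z. f z < t})"

definition subharmonic :: "(complex \<Rightarrow> real) \<Rightarrow> bool" where
  "subharmonic f \<longleftrightarrow> usc f \<and>
     (\<forall>z r. r > 0 \<longrightarrow>
        (\<lambda>t. f (z + complex_of_real r * cis t)) integrable_on {0..2*pi} \<and>
        f z \<le> integral {0..2*pi} (\<lambda>t. f (z + complex_of_real r * cis t)) / (2*pi))"

coinductive Cinf :: "(complex \<Rightarrow> real) \<Rightarrow> bool" where
  "\<lbrakk> \<forall>z. f differentiable (at z);
     Cinf (\<lambda>z. frechet_derivative f (at z) 1);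
     Cinf (\<lambda>z. frechet_derivative f (at z) \<i>) \<rbrakk> \<Longrightarrow> Cinf f"

definition test_fun :: "(complex \<Rightarrow> real) \<Rightarrow> bool" where
  "test_fun \<psi> \<longleftrightarrow> Cinf \<psi> \<and> compact (closure {z. \<psi> z \<noteq> 0})"

definition lap :: "(complex \<Rightarrow> real) \<Rightarrow> complex \<Rightarrow> real" where
  "lap \<psi> z =
     frechet_derivative (\<lambda>w. frechet_derivative \<psi> (at w) 1) (at z) 1
   + frechet_derivative (\<lambda>w. frechet_derivative \<psi> (at w) \<i>) (at z) \<i>"

definition is_laplacian :: "(complex \<Rightarrow> real) \<Rightarrow> complex measure \<Rightarrow> bool" where
  "is_laplacian \<phi> \<mu> \<longleftrightarrow>
     sets \<mu> = sets borel \<and>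
     (\<forall>K. compact K \<longrightarrow> emeasure \<mu> K < \<infinity>) \<and>
     (\<forall>\<psi>. test_fun \<psi> \<longrightarrow>
        integrable lborel (\<lambda>z. \<phi> z * lap \<psi> z) \<and>
        integrable \<mu> \<psi> \<and>
        (LINT z|lborel. \<phi> z * lap \<psi> z) = (LINT z|\<mu>. \<psi> z))"

definition doubling :: "complex measure \<Rightarrow> bool" where
  "doubling \<mu> \<longleftrightarrow> (\<exists>C>0. \<forall>z r. r > 0 \<longrightarrow>
      emeasure \<mu> (ball z (2*r)) \<le> ennreal C * emeasure \<mu> (ball z r))"

definition rho :: "complex measure \<Rightarrow> complex \<Rightarrow> real" where
  "rho \<mu> z = (THE r. r > 0 \<and> emeasure \<mu> (ball z r) = 1)"

definition L2w :: "(complex \<Rightarrow> real) \<Rightarrow> (complex \<Rightarrow> complex) \<Rightarrow> bool" where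
  "L2w \<phi> f \<longleftrightarrow> f \<in> borel_measurable lebesgue \<and>
     integrable lebesgue (\<lambda>z. (cmod (f z))\<^sup>2 * exp (-2 * \<phi> z))"

definition wnorm :: "(complex \<Rightarrow> real) \<Rightarrow> (complex \<Rightarrow> complex) \<Rightarrow> real" where
  "wnorm \<phi> f = sqrt (LINT z|lebesgue. (cmod (f z))\<^sup>2 * exp (-2 * \<phi> z))"

definition winner :: "(complex \<Rightarrow> real) \<Rightarrow> (complex \<Rightarrow> complex) \<Rightarrow> (complex \<Rightarrow> complex) \<Rightarrow> complex" where
  "winner \<phi> f h = (LINT z|lebesgue. f z * cnj (h z) * complex_of_real (exp (-2 * \<phi> z)))"

definition Fock :: "(complex \<Rightarrow> real) \<Rightarrow> (complex \<Rightarrow> complex) set" where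
  "Fock \<phi> = {f. f holomorphic_on UNIV \<and> L2w \<phi> f}"

definition Proj :: "(complex \<Rightarrow> real) \<Rightarrow> (complex \<Rightarrow> complex) \<Rightarrow> (complex \<Rightarrow> complex)" where
  "Proj \<phi> f = (THE p. p \<in> Fock \<phi> \<and> (\<forall>h\<in>Fock \<phi>. winner \<phi> (\<lambda>z. f z - p z) h = 0))"

definition Kern :: "(complex \<Rightarrow> real) \<Rightarrow> complex \<Rightarrow> (complex \<Rightarrow> complex)" where
  "Kern \<phi> a = (THE k. k \<in> Fock \<phi> \<and> (\<forall>f\<in>Fock \<phi>. f a = winner \<phi> f k))"

definition knorm :: "(complex \<Rightarrow> real) \<Rightarrow> complex \<Rightarrow> (complex \<Rightarrow> complex)" where
  "knorm \<phi> a = (\<lambda>z. Kern \<phi> a z / csqrt (Kern \<phi> a a))"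

definition kspan :: "(complex \<Rightarrow> real) \<Rightarrow> (complex \<Rightarrow> complex) set" where
  "kspan \<phi> = {f. \<exists>A c. finite A \<and> f = (\<lambda>z. \<Sum>a\<in>A. c a * knorm \<phi> a z)}"

definition Hankel :: "(complex \<Rightarrow> real) \<Rightarrow> (complex \<Rightarrow> complex) \<Rightarrow> (complex \<Rightarrow> complex) \<Rightarrow> (complex \<Rightarrow> complex)" where
  "Hankel \<phi> g f = (\<lambda>z. cnj (g z) * f z - Proj \<phi> (\<lambda>w. cnj (g w) * f w) z)"

text \<open>The densely defined operator \<open>H_{conj g}\<close> on the span of the normalized kernels
  is compact (i.e. extends to a compact operator \<open>F^2_phi \<rightarrow> L^2(e^{-2phi})\<close>) iff it maps
  the unit ball of its domain to a totally bounded subset of \<open>L^2(e^{-2phi})\<close>.\<close>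
definition hankel_compact :: "(complex \<Rightarrow> real) \<Rightarrow> (complex \<Rightarrow> complex) \<Rightarrow> bool" where
  "hankel_compact \<phi> g \<longleftrightarrow>
     (\<forall>\<epsilon>>0. \<exists>S. finite S \<and> (\<forall>s\<in>S. L2w \<phi> s) \<and>
        (\<forall>f\<in>kspan \<phi>. wnorm \<phi> f \<le> 1 \<longrightarrow>
           (\<exists>s\<in>S. wnorm \<phi> (\<lambda>z. Hankel \<phi> g f z - s z) < \<epsilon>)))"

end

theory Submission
  imports Defs "HOL-Complex_Analysis.Complex_Analysis"
begin

text \<open>The weight \<open>\<phi>\<close> is replaced by a \<open>C^2\<close> weight \<open>psi\<close> at bounded distance with
  \<open>\<Delta> psi \<ge> c / \<rho>^2\<close>, by sweeping \<open>\<mu>\<close> radially over discs of radius comparable to \<open>\<rho>\<close>. For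
  \<open>f\<close> in the span of the kernels, \<open>cnj g * f\<close> solves \<open>\<partial>-bar u = cnj g' * f\<close>, and \<open>H f\<close> is the
  solution of minimal norm, so Hoermander's estimate bounds \<open>|H f|\<close> by the weighted norm of
  \<open>|g'| \<rho> f\<close>. If \<open>|g'| \<rho>\<close> vanishes at infinity, Montel's theorem then gives compactness.

  Conversely, Hoermander's estimate with the weight \<open>psi - ln (1 + |z - a|^2 / m^2) / 2\<close> produces
  functions peaking at \<open>a\<close>, hence a lower bound for the normalised kernel \<open>k\<close> at \<open>a\<close> on a disc
  of radius comparable to \<open>\<rho> a\<close>. There \<open>H k / k\<close> differs from \<open>cnj g\<close> by a holomorphic
  function, so pairing it with a derivative of a bump function bounds \<open>|g' a| \<rho> a\<close> by the norm of
  \<open>H k\<close> on that disc. A finite net of a compact image has uniformly small tails, so this norm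
  tends to 0 as the disc moves to infinity.\<close>

section \<open>Smooth functions of a complex variable\<close>

text \<open>The Laplacian of \<phi> is only a measure, possibly singular, while Hoermander's
  estimate asks for a pointwise lower bound. Sweeping at a radius comparable to \<rho> spreads unit
  mass over an area of order \<open>\<rho>^2\<close>; hence the bound \<open>c / \<rho>^2\<close>,
  and through it the factor \<rho> in the criterion. At z, sweeping changes the potential only
  through mass closer to z than \<rho>(z), and that disc has measure 1. Doubling, in its reverse
  form, sums the logarithmic singularities geometrically, so the change is bounded uniformly in z.
  The peaking functions need a prescribed value at a. It is secured by a correction divisible by z -
  a. The logarithmic term in the weight pays for the multiplication by z - a, and the curvature it
  costs is absorbed because \<rho> grows with arbitrarily small slope. Mollifiers, cut-offs and
  smoothed potentials all come from one profile \<open>step\<close>, built from exp(-1/t) by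
  operations closed under differentiation, so the coinductive smoothness of test functions reduces
  to one induction.\<close>

definition D1 :: "(complex \<Rightarrow> real) \<Rightarrow> (complex \<Rightarrow> real) \<Rightarrow> (complex \<Rightarrow> real) \<Rightarrow> bool" where
  "D1 f fx fy \<longleftrightarrow> (\<forall>z. (f has_derivative (\<lambda>h. Re h * fx z + Im h * fy z)) (at z))"

text \<open>The same \<open>fxy\<close> is the vertical derivative of \<open>fx\<close> and the
  horizontal derivative of \<open>fy\<close>. Symmetry of the mixed partials is thus carried along
  by construction, and mixed terms cancel syntactically in partial integrations.\<close>

definition C2 :: "(complex \<Rightarrow> real) \<Rightarrow> (complex \<Rightarrow> real) \<Rightarrow> (complex \<Rightarrow> real) \<Rightarrow>
    (complex \<Rightarrow> real) \<Rightarrow> (complex \<Rightarrow> real) \<Rightarrow> (complex \<Rightarrow> real) \<Rightarrow> bool" where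
  "C2 f fx fy fxx fxy fyy \<longleftrightarrow> D1 f fx fy \<and> D1 fx fxx fxy \<and> D1 fy fxy fyy \<and>
     continuous_on UNIV fxx \<and> continuous_on UNIV fxy \<and> continuous_on UNIV fyy"

lemma D1D: "D1 f fx fy \<Longrightarrow> (f has_derivative (\<lambda>h. Re h * fx z + Im h * fy z)) (at z)"
  by (simp add: D1_def)

lemma D1_continuous: "D1 f fx fy \<Longrightarrow> continuous_on S f"
  by (meson D1D continuous_at_imp_continuous_on has_derivative_continuous)

lemma D1_const: "D1 (\<lambda>z. c) (\<lambda>z. 0) (\<lambda>z. 0)"
  by (simp add: D1_def)

lemma D1_Re: "D1 Re (\<lambda>z. 1) (\<lambda>z. 0)"
  by (auto simp: D1_def intro!: derivative_eq_intros)

lemma D1_Im: "D1 Im (\<lambda>z. 0) (\<lambda>z. 1)"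
  by (auto simp: D1_def intro!: derivative_eq_intros)

lemma D1_add:
  assumes "D1 f fx fy" "D1 g gx gy"
  shows "D1 (\<lambda>z. f z + g z) (\<lambda>z. fx z + gx z) (\<lambda>z. fy z + gy z)"
  unfolding D1_def
  by (auto intro!: derivative_eq_intros D1D[OF assms(1)] D1D[OF assms(2)] simp: algebra_simps)

lemma D1_diff:
  assumes "D1 f fx fy" "D1 g gx gy"
  shows "D1 (\<lambda>z. f z - g z) (\<lambda>z. fx z - gx z) (\<lambda>z. fy z - gy z)"
  unfolding D1_def
  by (auto intro!: derivative_eq_intros D1D[OF assms(1)] D1D[OF assms(2)] simp: algebra_simps)

lemma D1_mult:
  assumes "D1 f fx fy" "D1 g gx gy"
  shows "D1 (\<lambda>z. f z * g z) (\<lambda>z. fx z * g z + f z * gx z) (\<lambda>z. fy z * g z + f z * gy z)"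
  unfolding D1_def
  by (auto intro!: derivative_eq_intros D1D[OF assms(1)] D1D[OF assms(2)] simp: algebra_simps)

lemma D1_cmult:
  assumes "D1 f fx fy"
  shows "D1 (\<lambda>z. c * f z) (\<lambda>z. c * fx z) (\<lambda>z. c * fy z)"
  unfolding D1_def
  by (auto intro!: derivative_eq_intros D1D[OF assms(1)] simp: algebra_simps)

lemma D1_compose:
  assumes "D1 f fx fy" "\<And>z. (F has_real_derivative F' (f z)) (at (f z))"
  shows "D1 (\<lambda>z. F (f z)) (\<lambda>z. F' (f z) * fx z) (\<lambda>z. F' (f z) * fy z)"
  unfolding D1_def
proof
  fix z
  have "(F has_derivative (\<lambda>h. F' (f z) * h)) (at (f z))"
    using assms(2)[of z] by (simp add: has_field_derivative_def)
  from diff_chain_at[OF D1D[OF assms(1)] this]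
  show "((\<lambda>z. F (f z)) has_derivative (\<lambda>h. Re h * (F' (f z) * fx z) + Im h * (F' (f z) * fy z))) (at z)"
    by (simp add: o_def algebra_simps)
qed

lemma D1_cong: "D1 f fx fy \<Longrightarrow> (\<And>z. fx z = gx z) \<Longrightarrow> (\<And>z. fy z = gy z) \<Longrightarrow> D1 f gx gy"
  by (simp add: D1_def)


lemma D1_frechet:
  assumes "D1 f fx fy"
  shows "f differentiable (at z)" "(\<lambda>z. frechet_derivative f (at z) 1) = fx"
    "(\<lambda>z. frechet_derivative f (at z) \<i>) = fy"
proof -
  have *: "frechet_derivative f (at w) = (\<lambda>h. Re h * fx w + Im h * fy w)" for w
    using frechet_derivative_at[OF D1D[OF assms]] by simp
  show "f differentiable (at z)" using D1D[OF assms] by (auto simp: differentiable_def)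
  show "(\<lambda>z. frechet_derivative f (at z) 1) = fx" "(\<lambda>z. frechet_derivative f (at z) \<i>) = fy"
    by (simp_all add: *)
qed

lemma C2_D:
  assumes "C2 f fx fy fxx fxy fyy"
  shows "D1 f fx fy" "D1 fx fxx fxy" "D1 fy fxy fyy"
    "continuous_on S f" "continuous_on S fx" "continuous_on S fy"
    "continuous_on S fxx" "continuous_on S fxy" "continuous_on S fyy"
  using assms D1_continuous continuous_on_subset[OF _ subset_UNIV, of _ S] unfolding C2_def by blast+

lemma C2_const: "C2 (\<lambda>z. c) (\<lambda>z. 0) (\<lambda>z. 0) (\<lambda>z. 0) (\<lambda>z. 0) (\<lambda>z. 0)"
  by (simp add: C2_def D1_const)

lemma C2_Re: "C2 Re (\<lambda>z. 1) (\<lambda>z. 0) (\<lambda>z. 0) (\<lambda>z. 0) (\<lambda>z. 0)"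
  by (simp add: C2_def D1_const D1_Re)

lemma C2_Im: "C2 Im (\<lambda>z. 0) (\<lambda>z. 1) (\<lambda>z. 0) (\<lambda>z. 0) (\<lambda>z. 0)"
  by (simp add: C2_def D1_const D1_Im)

lemma C2_add:
  assumes "C2 f fx fy fxx fxy fyy" "C2 g gx gy gxx gxy gyy"
  shows "C2 (\<lambda>z. f z + g z) (\<lambda>z. fx z + gx z) (\<lambda>z. fy z + gy z)
     (\<lambda>z. fxx z + gxx z) (\<lambda>z. fxy z + gxy z) (\<lambda>z. fyy z + gyy z)"
  using assms by (auto simp: C2_def intro!: D1_add continuous_intros)

lemma C2_diff:
  assumes "C2 f fx fy fxx fxy fyy" "C2 g gx gy gxx gxy gyy"
  shows "C2 (\<lambda>z. f z - g z) (\<lambda>z. fx z - gx z) (\<lambda>z. fy z - gy z)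
     (\<lambda>z. fxx z - gxx z) (\<lambda>z. fxy z - gxy z) (\<lambda>z. fyy z - gyy z)"
  using assms by (auto simp: C2_def intro!: D1_diff continuous_intros)

lemma C2_cmult:
  assumes "C2 f fx fy fxx fxy fyy"
  shows "C2 (\<lambda>z. c * f z) (\<lambda>z. c * fx z) (\<lambda>z. c * fy z)
     (\<lambda>z. c * fxx z) (\<lambda>z. c * fxy z) (\<lambda>z. c * fyy z)"
  using assms by (auto simp: C2_def intro!: D1_cmult continuous_intros)

lemma C2_mult:
  assumes "C2 f fx fy fxx fxy fyy" "C2 g gx gy gxx gxy gyy"
  shows "C2 (\<lambda>z. f z * g z) (\<lambda>z. fx z * g z + f z * gx z) (\<lambda>z. fy z * g z + f z * gy z)
     (\<lambda>z. (fxx z * g z + fx z * gx z) + (fx z * gx z + f z * gxx z))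
     (\<lambda>z. (fxy z * g z + fx z * gy z) + (fy z * gx z + f z * gxy z))
     (\<lambda>z. (fyy z * g z + fy z * gy z) + (fy z * gy z + f z * gyy z))"
proof -
  note d = C2_D[OF assms(1)] C2_D[OF assms(2)]
  have "D1 (\<lambda>z. fy z * g z + f z * gy z)
     (\<lambda>z. (fxy z * g z + fx z * gy z) + (fy z * gx z + f z * gxy z))
     (\<lambda>z. (fyy z * g z + fy z * gy z) + (fy z * gy z + f z * gyy z))"
    using D1_add[OF D1_mult[OF d(3) d(10)] D1_mult[OF d(1) d(12)]]
    by (rule D1_cong) (simp_all add: algebra_simps)
  then show ?thesis
    unfolding C2_def
    using D1_add[OF D1_mult[OF d(2) d(10)] D1_mult[OF d(1) d(11)]]
    by (intro conjI D1_mult d continuous_intros)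
qed

lemma C2_compose:
  assumes "C2 f fx fy fxx fxy fyy"
    and F: "\<And>z. (F has_real_derivative F' (f z)) (at (f z))"
    and F': "\<And>z. (F' has_real_derivative F'' (f z)) (at (f z))"
    and c: "continuous_on UNIV (\<lambda>z. F'' (f z))"
  shows "C2 (\<lambda>z. F (f z)) (\<lambda>z. F' (f z) * fx z) (\<lambda>z. F' (f z) * fy z)
     (\<lambda>z. F'' (f z) * fx z * fx z + F' (f z) * fxx z)
     (\<lambda>z. F'' (f z) * fx z * fy z + F' (f z) * fxy z)
     (\<lambda>z. F'' (f z) * fy z * fy z + F' (f z) * fyy z)"
proof -
  note d = C2_D[OF assms(1)]
  have 1: "D1 (\<lambda>z. F' (f z)) (\<lambda>z. F'' (f z) * fx z) (\<lambda>z. F'' (f z) * fy z)"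
    by (rule D1_compose[OF d(1) F'])
  have c1: "continuous_on UNIV (\<lambda>z. F' (f z))" using 1 D1_continuous by blast
  have 2: "D1 (\<lambda>z. F' (f z) * fx z) (\<lambda>z. F'' (f z) * fx z * fx z + F' (f z) * fxx z)
     (\<lambda>z. F'' (f z) * fx z * fy z + F' (f z) * fxy z)"
    using D1_mult[OF 1 d(2)] by (rule D1_cong) (simp_all add: algebra_simps)
  have 3: "D1 (\<lambda>z. F' (f z) * fy z) (\<lambda>z. F'' (f z) * fx z * fy z + F' (f z) * fxy z)
     (\<lambda>z. F'' (f z) * fy z * fy z + F' (f z) * fyy z)"
    using D1_mult[OF 1 d(3)] by (rule D1_cong) (simp_all add: algebra_simps)
  show ?thesis
    unfolding C2_def
    by (intro conjI D1_compose[OF d(1) F] 2 3 continuous_intros c c1 d)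
qed

text \<open>The functions \<open>E_k(t) = exp(-1/t) / t^k\<close> for positive \<open>t\<close> form a family closed under
  differentiation.\<close>

definition Efl :: "nat \<Rightarrow> real \<Rightarrow> real" where
  "Efl k t = (if t > 0 then (1/t)^k * exp (-(1/t)) else 0)"

lemma Efl_nonneg: "Efl k t \<ge> 0"
  by (simp add: Efl_def)

lemma Efl_pos: "t > 0 \<Longrightarrow> Efl k t > 0"
  by (simp add: Efl_def)

lemma Efl_tendsto_0: "(Efl k \<longlongrightarrow> 0) (at_right 0)"
proof -
  have "((\<lambda>x::real. x^k * exp (-x)) \<longlongrightarrow> 0) at_top"
    using tendsto_power_div_exp_0[of k] by (simp add: exp_minus divide_inverse)
  moreover have "filterlim (\<lambda>t::real. 1/t) at_top (at_right 0)"
    using filterlim_inverse_at_top_right by (simp add: divide_inverse)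
  ultimately have "((\<lambda>t. (1/t)^k * exp (-(1/t))) \<longlongrightarrow> 0) (at_right (0::real))"
    by (rule filterlim_compose)
  then show ?thesis
    by (rule Lim_transform_eventually) (auto simp: Efl_def eventually_at_filter)
qed

text \<open>Away from 0 this is the product rule, the inner derivative of -1/t raising the power by
  two. At 0 the right difference quotient of \<open>Efl k\<close> is \<open>Efl (k+1)\<close>, which
  tends to 0; admitting every power k is what closes the family.\<close>

lemma Efl_deriv: "(Efl k has_real_derivative (Efl (k+2) t - real k * Efl (k+1) t)) (at t)"
proof -
  consider "t > 0" | "t < 0" | "t = 0" by linarith
  then show ?thesis
  proof cases
    case 1
    have "((\<lambda>t. (1/t)^k * exp (-(1/t))) has_real_derivative
        (Efl (k+2) t - real k * Efl (k+1) t)) (at t)"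
    proof (cases k)
      case 0
      show ?thesis using 1 unfolding Efl_def 0
        by (auto intro!: derivative_eq_intros simp: field_simps power2_eq_square)
    next
      case (Suc n)
      have a: "((\<lambda>t. 1/t) has_real_derivative (- (1/t * (1/t)))) (at t)"
        using 1 by (auto intro!: derivative_eq_intros simp: field_simps power2_eq_square)
      have b: "((\<lambda>t. exp (-(1/t))) has_real_derivative (exp (-(1/t)) * (1/t * (1/t)))) (at t)"
        using DERIV_chain2[OF DERIV_exp DERIV_minus[OF a]] by simp
      show ?thesis using DERIV_mult[OF DERIV_power_Suc[OF a, of n] b] 1
        unfolding Efl_def Suc by (simp add: algebra_simps)
    qed
    then show ?thesis
      by (rule has_field_derivative_transform_within_open[where S="{0<..}"]) (use 1 in \<open>auto simp: Efl_def\<close>)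
  next
    case 2
    have "((\<lambda>t. 0) has_real_derivative (Efl (k+2) t - real k * Efl (k+1) t)) (at t)"
      using 2 by (simp add: Efl_def)
    then show ?thesis
      by (rule has_field_derivative_transform_within_open[where S="{..<0}"]) (use 2 in \<open>auto simp: Efl_def\<close>)
  next
    case 3
    have r: "((\<lambda>h. (Efl k (0+h) - Efl k 0) / h) \<longlongrightarrow> 0) (at_right 0)"
      by (rule Lim_transform_eventually[OF Efl_tendsto_0[of "k+1"]])
         (auto simp: Efl_def eventually_at_filter)
    have l: "((\<lambda>h. (Efl k (0+h) - Efl k 0) / h) \<longlongrightarrow> 0) (at_left 0)"
      by (rule Lim_transform_eventually[OF tendsto_const])
         (auto simp: Efl_def eventually_at_filter)
    have "((\<lambda>h. (Efl k (0+h) - Efl k 0) / h) \<longlongrightarrow> 0) (at 0)"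
      using l r by (simp add: filterlim_at_split)
    then show ?thesis unfolding 3 by (simp add: DERIV_def Efl_def)
  qed
qed

lemma Efl_continuous: "continuous_on S (Efl k)"
  using Efl_deriv by (meson DERIV_isCont continuous_at_imp_continuous_on)

text \<open>A generated class, closed under both partial derivatives, serves as coinduction
  invariant for \<open>Cinf\<close>. \<open>Efl\<close> supplies functions that vanish on half-lines
  and \<open>inverse\<close> the radial quotients; every test function of the proof is assembled
  from these constructors, or has first partials that are.\<close>

inductive SM :: "(complex \<Rightarrow> real) \<Rightarrow> bool" where
  SM_const: "SM (\<lambda>z. c)"
| SM_Re: "SM Re"
| SM_Im: "SM Im"
| SM_add: "SM f \<Longrightarrow> SM g \<Longrightarrow> SM (\<lambda>z. f z + g z)"
| SM_mult: "SM f \<Longrightarrow> SM g \<Longrightarrow> SM (\<lambda>z. f z * g z)"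
| SM_Efl: "SM f \<Longrightarrow> SM (\<lambda>z. Efl k (f z))"
| SM_inverse: "SM f \<Longrightarrow> (\<And>z. f z \<noteq> 0) \<Longrightarrow> SM (\<lambda>z. inverse (f z))"

lemma SM_cmult: "SM f \<Longrightarrow> SM (\<lambda>z. c * f z)"
  by (intro SM_mult SM_const)

lemma SM_uminus: "SM f \<Longrightarrow> SM (\<lambda>z. - f z)"
  using SM_cmult[of f "-1"] by simp

lemma SM_diff: "SM f \<Longrightarrow> SM g \<Longrightarrow> SM (\<lambda>z. f z - g z)"
  using SM_add[OF _ SM_uminus[of g], of f] by simp


text \<open>The induction keeps the partials inside the class besides producing them. This makes the
  statement iterable, which is all that the coinduction in \<open>SM_Cinf\<close> asks for.\<close>

lemma SM_C2:
  assumes "SM f"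
  shows "\<exists>fx fy fxx fxy fyy. C2 f fx fy fxx fxy fyy \<and> SM fx \<and> SM fy \<and> SM fxx \<and> SM fxy \<and> SM fyy"
  using assms
proof induction
  case (SM_const c)
  show ?case by (rule exI)+ (auto intro!: C2_const SM.SM_const)
next
  case SM_Re
  show ?case by (rule exI)+ (auto intro!: C2_Re SM.SM_const)
next
  case SM_Im
  show ?case by (rule exI)+ (auto intro!: C2_Im SM.SM_const)
next
  case (SM_add f g)
  then obtain fx fy fxx fxy fyy gx gy gxx gxy gyy where
    f: "C2 f fx fy fxx fxy fyy" "SM fx" "SM fy" "SM fxx" "SM fxy" "SM fyy" and
    g: "C2 g gx gy gxx gxy gyy" "SM gx" "SM gy" "SM gxx" "SM gxy" "SM gyy" by blast
  show ?case by (intro exI conjI, rule C2_add[OF f(1) g(1)]) (intro SM.SM_add f g)+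
next
  case (SM_mult f g)
  then obtain fx fy fxx fxy fyy gx gy gxx gxy gyy where
    f: "C2 f fx fy fxx fxy fyy" "SM fx" "SM fy" "SM fxx" "SM fxy" "SM fyy" and
    g: "C2 g gx gy gxx gxy gyy" "SM gx" "SM gy" "SM gxx" "SM gxy" "SM gyy" by blast
  show ?case by (intro exI conjI, rule C2_mult[OF f(1) g(1)])
     (intro SM.SM_add SM.SM_mult f g SM_mult.hyps)+
next
  case (SM_Efl f k)
  then obtain fx fy fxx fxy fyy where
    f: "C2 f fx fy fxx fxy fyy" "SM fx" "SM fy" "SM fxx" "SM fxy" "SM fyy" by blast
  let ?F' = "\<lambda>t. Efl (k+2) t - real k * Efl (k+1) t"
  let ?F'' = "\<lambda>t. (Efl (k+2+2) t - real (k+2) * Efl (k+2+1) t)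
     - real k * (Efl (k+1+2) t - real (k+1) * Efl (k+1+1) t)"
  have d2: "(?F' has_real_derivative ?F'' t) (at t)" for t
    by (intro DERIV_diff Efl_deriv DERIV_cmult)
  have c: "continuous_on UNIV (\<lambda>z. ?F'' (f z))"
    by (intro continuous_intros continuous_on_compose2[OF Efl_continuous[of UNIV]] C2_D[OF f(1)]) auto
  show ?case
    by (intro exI conjI, rule C2_compose[OF f(1) Efl_deriv d2 c])
       (intro SM.SM_add SM.SM_mult SM.SM_Efl SM_diff SM_cmult f SM_Efl.hyps)+
next
  case (SM_inverse f)
  then obtain fx fy fxx fxy fyy where
    f: "C2 f fx fy fxx fxy fyy" "SM fx" "SM fy" "SM fxx" "SM fxy" "SM fyy" by blast
  let ?F' = "\<lambda>t::real. (- 1) * (inverse t * inverse t)"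
  let ?F'' = "\<lambda>t::real. 2 * (inverse t * (inverse t * inverse t))"
  have d1: "(inverse has_real_derivative ?F' (f z)) (at (f z))" for z
    using SM_inverse(2)[of z] by (auto intro!: derivative_eq_intros)
  have d2: "(?F' has_real_derivative ?F'' (f z)) (at (f z))" for z
    using SM_inverse(2)[of z] by (auto intro!: derivative_eq_intros simp: power2_eq_square)
  have c: "continuous_on UNIV (\<lambda>z. ?F'' (f z))"
    by (intro continuous_intros C2_D[OF f(1)]) (use SM_inverse(2) in auto)
  have s: "SM (\<lambda>z. inverse (f z))" using SM_inverse SM.SM_inverse by blast
  show ?case
    by (intro exI conjI, rule C2_compose[OF f(1) d1 d2 c])
       (intro SM.SM_add SM.SM_mult s SM_diff SM_cmult f)+
qed

lemma SM_continuous: "SM f \<Longrightarrow> continuous_on S f"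
  using SM_C2 C2_D(4) by blast

lemma SM_Cinf: "SM f \<Longrightarrow> Cinf f"
proof (coinduction arbitrary: f)
  case Cinf
  then obtain fx fy fxx fxy fyy where
    f: "C2 f fx fy fxx fxy fyy" "SM fx" "SM fy" "SM fxx" "SM fxy" "SM fyy" using SM_C2 by blast
  show ?case
    using D1_frechet[OF C2_D(1)[OF f(1)]] f by metis
qed

text \<open>Serves functions whose first partials are visibly in \<open>SM\<close> although they
  themselves are not, such as differences of smoothed logarithms, which are defined through an
  antiderivative.\<close>

lemma Cinf_D1: "D1 f fx fy \<Longrightarrow> SM fx \<Longrightarrow> SM fy \<Longrightarrow> Cinf f"
  by (rule Cinf.intros) (use D1_frechet[of f fx fy] SM_Cinf in auto)

section \<open>Radial mollifiers\<close>

lemma C2_lap: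
  assumes "C2 f fx fy fxx fxy fyy"
  shows "lap f z = fxx z + fyy z"
proof -
  note d = C2_D[OF assms]
  show ?thesis
    unfolding lap_def D1_frechet(2,3)[OF d(1)]
    using fun_cong[OF D1_frechet(2)[OF d(2)], of z] fun_cong[OF D1_frechet(3)[OF d(3)], of z] by simp
qed

lemma D1_shift: "D1 f fx fy \<Longrightarrow> D1 (\<lambda>z. f (z - w)) (\<lambda>z. fx (z - w)) (\<lambda>z. fy (z - w))"
  unfolding D1_def
proof
  fix z assume "\<forall>z. (f has_derivative (\<lambda>h. Re h * fx z + Im h * fy z)) (at z)"
  then have "(f has_derivative (\<lambda>h. Re h * fx (z-w) + Im h * fy (z-w))) (at (z-w))" by blast
  moreover have "((\<lambda>z. z - w) has_derivative (\<lambda>h. h)) (at z)"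
    by (auto intro!: derivative_eq_intros)
  ultimately show "((\<lambda>z. f (z - w)) has_derivative (\<lambda>h. Re h * fx (z-w) + Im h * fy (z-w))) (at z)"
    using diff_chain_at[of "\<lambda>z. z - w" "\<lambda>h. h" z f] by (simp add: o_def)
qed

lemma C2_shift: "C2 f fx fy fxx fxy fyy \<Longrightarrow>
  C2 (\<lambda>z. f (z - w)) (\<lambda>z. fx (z - w)) (\<lambda>z. fy (z - w)) (\<lambda>z. fxx (z - w)) (\<lambda>z. fxy (z - w)) (\<lambda>z. fyy (z - w))"
proof -
  have "continuous_on UNIV (\<lambda>z. f (z - w))" if "continuous_on UNIV f" for f :: "complex \<Rightarrow> real"
    by (rule continuous_on_compose2[OF that]) (auto intro!: continuous_intros)
  then show "C2 f fx fy fxx fxy fyy \<Longrightarrow> ?thesis"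
    unfolding C2_def by (auto intro: D1_shift)
qed

lemma SM_shift: "SM f \<Longrightarrow> SM (\<lambda>z. f (z - w))"
proof (induction rule: SM.induct)
  case (SM_Re) then show ?case using SM_diff[OF SM.SM_Re SM.SM_const] by simp
next
  case (SM_Im) then show ?case using SM_diff[OF SM.SM_Im SM.SM_const] by simp
qed (auto intro: SM.intros)

text \<open>Smooth transition from 0 on s \<le> 1/4 to 1 on s \<ge> 1. The factors are
  normalisations: exp(4/3) makes the inner term reach 1 exactly at s = 1, where the outer
  \<open>Efl\<close> dies, and exp(1) makes the outer term equal to 1 as long as the inner one
  vanishes. No quotient occurs, so composites stay in \<open>SM\<close>.\<close>

definition step :: "real \<Rightarrow> real" where
  "step s = 1 - exp 1 * Efl 0 (1 - exp (4/3) * Efl 0 (s - 1/4))"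

definition step' :: "real \<Rightarrow> real" where
  "step' s = exp 1 * Efl 2 (1 - exp (4/3) * Efl 0 (s - 1/4)) * (exp (4/3) * Efl 2 (s - 1/4))"

lemma step_deriv: "(step has_real_derivative step' s) (at s)"
proof -
  have 1: "((\<lambda>s. 1 - exp (4/3) * Efl 0 (s - 1/4)) has_real_derivative
      0 - exp (4/3) * ((Efl (0+2) (s - 1/4) - real 0 * Efl (0+1) (s - 1/4)) * (1 - 0))) (at s)"
    by (intro DERIV_diff DERIV_const DERIV_cmult DERIV_chain2[OF Efl_deriv] DERIV_ident)
  show ?thesis
    unfolding step_def[abs_def] step'_def
    using DERIV_diff[OF DERIV_const[of 1] DERIV_cmult[OF DERIV_chain2[OF Efl_deriv 1], of "exp 1" 0]]
    by (simp add: numeral_2_eq_2 algebra_simps)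
qed

lemma step_low: "s \<le> 1/4 \<Longrightarrow> step s = 0" "s \<le> 1/4 \<Longrightarrow> step' s = 0"
  by (auto simp: step_def step'_def Efl_def exp_minus)

lemma Efl0_mono: "s \<le> t \<Longrightarrow> Efl 0 s \<le> Efl 0 t"
  by (auto simp: Efl_def frac_le)

lemma Efl0_strict: "0 < t \<Longrightarrow> s < t \<Longrightarrow> Efl 0 s < Efl 0 t"
  by (auto simp: Efl_def divide_strict_left_mono)

lemma step_arg_ge: "s \<ge> 1 \<Longrightarrow> exp (4/3) * Efl 0 (s - 1/4) \<ge> 1"
proof -
  assume "s \<ge> 1"
  then have "Efl 0 (3/4) \<le> Efl 0 (s - 1/4)" by (intro Efl0_mono) auto
  moreover have "exp (4/3) * Efl 0 (3/4) = 1" by (simp add: Efl_def exp_minus)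
  ultimately show ?thesis by (metis mult_left_mono exp_ge_zero)
qed

lemma step_arg_less: "s < 1 \<Longrightarrow> exp (4/3) * Efl 0 (s - 1/4) < 1"
proof -
  assume "s < 1"
  then have "Efl 0 (s - 1/4) < Efl 0 (3/4)" by (intro Efl0_strict) auto
  moreover have "exp (4/3) * Efl 0 (3/4) = 1" by (simp add: Efl_def exp_minus)
  ultimately show ?thesis by (metis mult_strict_left_mono exp_gt_zero)
qed

lemma step_high: "s \<ge> 1 \<Longrightarrow> step s = 1" "s \<ge> 1 \<Longrightarrow> step' s = 0"
  using step_arg_ge[of s] by (auto simp: step_def step'_def Efl_def)

lemma step'_nonneg: "step' s \<ge> 0"
  by (simp add: step'_def Efl_nonneg)

lemma step'_pos: "1/4 < s \<Longrightarrow> s < 1 \<Longrightarrow> step' s > 0"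
  using step_arg_less[of s] by (auto simp: step'_def intro!: mult_pos_pos Efl_pos)

lemma step_bounds: "0 \<le> step s" "step s \<le> 1"
proof -
  have "Efl 0 (1 - exp (4/3) * Efl 0 (s - 1/4)) \<le> Efl 0 1"
    by (intro Efl0_mono) (simp add: Efl_nonneg)
  also have "\<dots> = exp (-1)" by (simp add: Efl_def)
  finally have "exp 1 * Efl 0 (1 - exp (4/3) * Efl 0 (s - 1/4)) \<le> exp 1 * exp (-1)"
    by (intro mult_left_mono) auto
  then show "0 \<le> step s" by (simp add: step_def exp_minus)
  show "step s \<le> 1" by (simp add: step_def Efl_nonneg)
qed

lemma step_continuous: "continuous_on S step" "continuous_on S step'"
  subgoal using step_deriv by (meson DERIV_isCont continuous_at_imp_continuous_on)
  subgoal unfolding step'_def[abs_def]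
    by (intro continuous_intros continuous_on_compose2[OF Efl_continuous[of UNIV]]) auto
  done

text \<open>The derivative 1 / (4 pi s) of ln s / (4 pi), cut off near 0. With s = |z|^2 / r^2 the
  function ln s / (4 pi) is ln |z| / (2 pi) up to a constant. The \<open>max\<close> only keeps the
  denominator positive: below 1/4 the numerator is 0.\<close>

definition slope :: "real \<Rightarrow> real" where
  "slope s = step s / (4 * pi * max s (1/4))"

definition slope' :: "real \<Rightarrow> real" where
  "slope' s = (if s \<le> 0 then 0 else (step' s - step s / s) / (4 * pi * s))"

lemma slope_nonneg: "slope s \<ge> 0"
  by (simp add: slope_def step_bounds)

lemma slope_eq: "s > 0 \<Longrightarrow> slope s = step s / (4 * pi * s)"
  using step_low(1)[of s] by (cases "s \<le> 1/4") (auto simp: slope_def max_def)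

lemma slope_deriv: "(slope has_real_derivative slope' s) (at s)"
proof (cases "s > 0")
  case True
  have "((\<lambda>s. step s / (4 * pi * s)) has_real_derivative slope' s) (at s)"
    using True by (auto intro!: derivative_eq_intros step_deriv simp: slope'_def field_simps power2_eq_square)
  then show ?thesis
    by (rule has_field_derivative_transform_within_open[where S="{0<..}"])
       (use True slope_eq in auto)
next
  case False
  have "((\<lambda>s. 0) has_real_derivative slope' s) (at s)"
    using False by (simp add: slope'_def)
  then show ?thesis
    by (rule has_field_derivative_transform_within_open[where S="{..<1/4}"])
       (use False in \<open>auto simp: slope_def step_low\<close>)
qed

lemma slope_continuous: "continuous_on S slope"
  using slope_deriv by (meson DERIV_isCont continuous_at_imp_continuous_on)

lemma slope'_continuous: "continuous_on S slope'"
proof -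
  have "continuous_on ({0<..} \<union> {..<1/4}) slope'"
  proof (rule continuous_on_open_Un)
    show "continuous_on {0<..} slope'"
      by (rule continuous_on_eq[of _ "\<lambda>s. (step' s - step s / s) / (4 * pi * s)"])
         (auto simp: slope'_def intro!: continuous_intros step_continuous)
    show "continuous_on {..<1/4} slope'"
      by (rule continuous_on_eq[of _ "\<lambda>s. 0"]) (auto simp: slope'_def step_low)
  qed auto
  moreover have "{0<..} \<union> {..<1/4} = (UNIV :: real set)" by auto
  ultimately show ?thesis using continuous_on_subset by (metis subset_UNIV)
qed

text \<open>The antiderivative of \<open>slope\<close> normalised at 1, so that it coincides with ln
  s / (4 pi) for s \<ge> 1. No closed form is available below 1; slope, monotonicity and this
  normalisation carry the argument.\<close>

definition Gfun :: "real \<Rightarrow> real" where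
  "Gfun = (SOME G. (\<forall>s. (G has_real_derivative slope s) (at s)) \<and> G 1 = 0)"

lemma Gfun: "(Gfun has_real_derivative slope s) (at s)" "Gfun 1 = 0"
proof -
  have "\<exists>F. \<forall>x. -\<infinity> < ereal x \<longrightarrow> ereal x < \<infinity> \<longrightarrow> (F has_vector_derivative slope x) (at x)"
    by (rule einterval_antiderivative) (auto intro: DERIV_isCont[OF slope_deriv])
  then obtain F where "\<And>x. (F has_real_derivative slope x) (at x)"
    by (auto simp: has_real_derivative_iff_has_vector_derivative)
  then have "(\<forall>s. ((\<lambda>s. F s - F 1) has_real_derivative slope s) (at s)) \<and> F 1 - F 1 = 0"
    by (auto intro!: derivative_eq_intros)
  then have "\<exists>G. (\<forall>s. (G has_real_derivative slope s) (at s)) \<and> G 1 = 0"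
    by (intro exI[of _ "\<lambda>s. F s - F 1"])
  from someI_ex[OF this] show "(Gfun has_real_derivative slope s) (at s)" "Gfun 1 = 0"
    by (auto simp: Gfun_def)
qed

lemma Gfun_continuous: "continuous_on S Gfun"
  using Gfun(1) by (meson DERIV_isCont continuous_at_imp_continuous_on)

lemma Gfun_mono: "s \<le> t \<Longrightarrow> Gfun s \<le> Gfun t"
  by (rule DERIV_nonneg_imp_nondecreasing) (use Gfun slope_nonneg in blast)+

lemma Gfun_ge1:
  assumes "s \<ge> 1" shows "Gfun s = ln s / (4 * pi)"
proof -
  let ?D = "\<lambda>s. Gfun s - ln s / (4 * pi)"
  have "?D s = ?D 1" if "s > 1"
  proof (rule DERIV_isconst_end[of 1 s ?D])
    show "1 < s" by fact
    show "continuous_on {1..s} ?D"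
      by (intro continuous_intros Gfun_continuous) auto
    fix x assume "1 < x" "x < s"
    then show "DERIV ?D x :> 0"
      by (auto intro!: derivative_eq_intros Gfun simp: slope_eq step_high field_simps)
  qed
  then show ?thesis using Gfun(2) assms by (cases "s = 1") auto
qed

text \<open>Below 1 the slope is at most that of the logarithm, because \<open>step\<close> is at
  most 1, and the two functions agree at 1. This inequality makes a swept potential lie above the
  original one.\<close>

lemma Gfun_ge_ln:
  assumes "s > 0" shows "Gfun s \<ge> ln s / (4 * pi)"
proof (cases "s \<ge> 1")
  case True then show ?thesis by (simp add: Gfun_ge1)
next
  case False
  let ?D = "\<lambda>s. Gfun s - ln s / (4 * pi)"
  have "?D s \<ge> ?D 1"
  proof (rule DERIV_nonpos_imp_nonincreasing[of s 1 ?D])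
    show "s \<le> 1" using False by simp
    fix x assume x: "s \<le> x" "x \<le> 1"
    then have "x > 0" using assms by simp
    have "(?D has_real_derivative slope x - 1 / x / (4 * pi)) (at x)"
      using \<open>x > 0\<close> by (auto intro!: derivative_eq_intros Gfun)
    moreover have "slope x \<le> 1 / x / (4 * pi)"
      using \<open>x > 0\<close> step_bounds(2)[of x] by (simp add: slope_eq field_simps)
    ultimately show "\<exists>y. DERIV ?D x :> y \<and> y \<le> 0" by force
  qed
  then show ?thesis using Gfun(2) by simp
qed

text \<open>The squared norm, rather than the norm, keeps radial functions differentiable at the
  origin; the polynomial form with \<open>inverse\<close> fits the constructors of
  \<open>SM\<close>.\<close>

definition nq :: "real \<Rightarrow> complex \<Rightarrow> real" where
  "nq r \<zeta> = (Re \<zeta> * Re \<zeta> + Im \<zeta> * Im \<zeta>) * inverse (r\<^sup>2)"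

lemma nq_norm: "nq r \<zeta> = (norm \<zeta> / r)\<^sup>2"
  by (simp add: nq_def cmod_def power_divide power2_eq_square divide_inverse)

lemma nq_nonneg: "nq r \<zeta> \<ge> 0"
  by (simp add: nq_norm)

lemma nq_C2: "C2 (nq r) (\<lambda>z. 2 * Re z * inverse (r\<^sup>2)) (\<lambda>z. 2 * Im z * inverse (r\<^sup>2))
   (\<lambda>z. 2 * inverse (r\<^sup>2)) (\<lambda>z. 0) (\<lambda>z. 2 * inverse (r\<^sup>2))"
  unfolding C2_def D1_def nq_def
  by (auto intro!: derivative_eq_intros continuous_intros simp: algebra_simps)

lemma SM_nq: "SM (nq r)"
  unfolding nq_def[abs_def] by (intro SM_mult SM_add SM_const SM_Re SM_Im)

text \<open>\<open>LL r\<close> is a smoothing at scale \<open>r\<close> of the fundamental solution \<open>ln |z| / (2 pi)\<close> of the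
  Laplacian, equal to it outside the disc of radius \<open>r\<close>; its Laplacian is the mollifier \<open>eta r\<close>.\<close>

definition LL :: "real \<Rightarrow> complex \<Rightarrow> real" where
  "LL r z = Gfun (nq r z) + ln r / (2 * pi)"

definition LLx :: "real \<Rightarrow> complex \<Rightarrow> real" where
  "LLx r z = slope (nq r z) * (2 * Re z * inverse (r\<^sup>2))"
definition LLy :: "real \<Rightarrow> complex \<Rightarrow> real" where
  "LLy r z = slope (nq r z) * (2 * Im z * inverse (r\<^sup>2))"
definition LLxx :: "real \<Rightarrow> complex \<Rightarrow> real" where
  "LLxx r z = slope' (nq r z) * (2 * Re z * inverse (r\<^sup>2)) * (2 * Re z * inverse (r\<^sup>2)) + slope (nq r z) * (2 * inverse (r\<^sup>2))"
definition LLxy :: "real \<Rightarrow> complex \<Rightarrow> real" where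
  "LLxy r z = slope' (nq r z) * (2 * Re z * inverse (r\<^sup>2)) * (2 * Im z * inverse (r\<^sup>2))"
definition LLyy :: "real \<Rightarrow> complex \<Rightarrow> real" where
  "LLyy r z = slope' (nq r z) * (2 * Im z * inverse (r\<^sup>2)) * (2 * Im z * inverse (r\<^sup>2)) + slope (nq r z) * (2 * inverse (r\<^sup>2))"
definition eta :: "real \<Rightarrow> complex \<Rightarrow> real" where
  "eta r z = step' (nq r z) * inverse (pi * r\<^sup>2)"

lemma nq_continuous: "continuous_on S (nq r)"
  using C2_D(4)[OF nq_C2] .

lemma LL_C2: "C2 (LL r) (LLx r) (LLy r) (LLxx r) (LLxy r) (LLyy r)"
proof -
  have "C2 (\<lambda>z. Gfun (nq r z)) (LLx r) (LLy r) (LLxx r) (LLxy r) (LLyy r)"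
    using C2_compose[OF nq_C2 Gfun(1) slope_deriv, of r]
      continuous_on_compose2[OF slope'_continuous[of UNIV] nq_continuous[of UNIV]]
    by (simp add: LLx_def[abs_def] LLy_def[abs_def] LLxx_def[abs_def] LLxy_def[abs_def] LLyy_def[abs_def])
  from C2_add[OF this C2_const[of "ln r / (2 * pi)"]] show ?thesis
    by (simp add: LL_def[abs_def])
qed

text \<open>With s = |z|^2 / r^2 the Laplacian of G(s) is 4 / r^2 times the derivative of s G'(s).
  By the choice of \<open>slope\<close>, s G'(s) = step s / (4 pi), so only \<open>step'\<close>
  survives.\<close>

lemma LL_lap:
  assumes "r > 0" shows "LLxx r z + LLyy r z = eta r z"
proof (cases "z = 0")
  case True
  then show ?thesis by (simp add: LLxx_def LLyy_def eta_def nq_def slope_def step_low)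
next
  case False
  define s where "s = nq r z"
  have s: "s > 0" using False assms by (simp add: s_def nq_norm)
  have e: "Re z * Re z + Im z * Im z = s * r\<^sup>2"
    using assms by (simp add: s_def nq_def)
  have "LLxx r z + LLyy r z = 4 * slope' s * inverse (r\<^sup>2) * inverse (r\<^sup>2) * (Re z * Re z + Im z * Im z) + 4 * slope s * inverse (r\<^sup>2)"
    by (simp add: LLxx_def LLyy_def s_def algebra_simps)
  also have "\<dots> = 4 * inverse (r\<^sup>2) * (slope' s * s + slope s)"
    unfolding e using assms by (simp add: field_simps)
  also have "slope' s * s + slope s = step' s / (4 * pi)"
    using s by (simp add: slope'_def slope_eq field_simps)
  finally show ?thesis using assms by (simp add: eta_def s_def field_simps)
qed

lemma LL_outside:
  assumes "r > 0" "norm z \<ge> r" shows "LL r z = ln (norm z) / (2 * pi)"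
proof -
  have 1: "norm z / r \<ge> 1" using assms by simp
  then have "nq r z \<ge> 1" by (simp add: nq_norm)
  then have "LL r z = ln ((norm z / r)\<^sup>2) / (4 * pi) + ln r / (2 * pi)"
    by (simp add: LL_def Gfun_ge1 nq_norm)
  also have "ln ((norm z / r)\<^sup>2) = 2 * (ln (norm z) - ln r)"
  proof -
    have "norm z > 0" using assms by linarith
    then show ?thesis using assms by (simp add: ln_realpow ln_div)
  qed
  finally show ?thesis by (simp add: field_simps)
qed

lemma LL_ge_ln:
  assumes "r > 0" "z \<noteq> 0" shows "LL r z \<ge> ln (norm z) / (2 * pi)"
proof -
  have 1: "norm z / r > 0" using assms by simp
  then have "ln ((norm z / r)\<^sup>2) / (4 * pi) \<le> Gfun (nq r z)"
    unfolding nq_norm by (intro Gfun_ge_ln zero_less_power)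
  moreover have "ln ((norm z / r)\<^sup>2) = 2 * (ln (norm z) - ln r)"
    using assms by (simp add: ln_realpow ln_div)
  ultimately show ?thesis by (simp add: LL_def field_simps)
qed

lemma LL_le: "r > 0 \<Longrightarrow> norm z \<le> r \<Longrightarrow> LL r z \<le> ln r / (2 * pi)"
  using Gfun_mono[of "nq r z" 1] Gfun(2) by (simp add: LL_def nq_norm power_le_one)

lemma LL_ge: "LL r z \<ge> Gfun 0 + ln r / (2 * pi)"
  using Gfun_mono[OF nq_nonneg] by (simp add: LL_def)

lemma eta_nonneg: "eta r z \<ge> 0"
  by (simp add: eta_def step'_nonneg)

lemma eta_outside: "r > 0 \<Longrightarrow> norm z \<ge> r \<Longrightarrow> eta r z = 0"
  by (simp add: eta_def nq_norm step_high)


lemma step_SM: "SM f \<Longrightarrow> SM (\<lambda>z. step (f z))" "SM f \<Longrightarrow> SM (\<lambda>z. step' (f z))"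
  unfolding step_def step'_def
  by (intro SM_diff SM_mult SM_const SM_Efl; assumption)+

text \<open>The \<open>max\<close> in \<open>slope\<close> is not among the constructors. The
  denominator is replaced by 4 pi (s + \<open>Efl 0 (1/4 - s)\<close>), which equals 4 pi s where
  \<open>step\<close> is nonzero and stays positive for all s \<ge> 0.\<close>

lemma slope_SM: "SM (\<lambda>z. slope (nq r z))"
proof -
  define h where "h = (\<lambda>s. 4 * pi * (s + Efl 0 (1/4 - s)))"
  have p: "h s > 0" if "s \<ge> 0" for s
  proof -
    have "s + Efl 0 (1/4 - s) > 0"
      using that Efl_pos[of "1/4 - s" 0] Efl_nonneg[of 0 "1/4 - s"]
      by (cases "s = 0") (simp, linarith)
    then show ?thesis unfolding h_def using pi_gt_zero by (metis mult_pos_pos zero_less_numeral)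
  qed
  have "slope s = step s * inverse (h s)" if "s \<ge> 0" for s
  proof (cases "s \<le> 1/4")
    case True
    then show ?thesis by (simp add: slope_def step_low)
  next
    case False
    then have "h s = 4 * pi * s" by (simp add: h_def Efl_def)
    then show ?thesis using slope_eq[of s] False by (simp only: divide_inverse not_le) simp
  qed
  then have e: "(\<lambda>z. slope (nq r z)) = (\<lambda>z. step (nq r z) * inverse (h (nq r z)))"
    using nq_nonneg by (intro ext) simp
  have "SM (\<lambda>z. (4 * pi) * (nq r z + Efl 0 (1/4 - nq r z)))"
    by (intro SM_cmult SM_add[OF SM_nq] SM_Efl SM_diff[OF SM_const SM_nq])
  then have hs: "SM (\<lambda>z. h (nq r z))"
    by (simp add: h_def)
  have "h (nq r z) \<noteq> 0" for z using p[OF nq_nonneg, of r z] by linarith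
  then show ?thesis
    unfolding e by (rule SM_mult[OF step_SM(1)[OF SM_nq] SM_inverse[OF hs]])
qed

lemma eta_SM: "SM (eta r)"
  unfolding eta_def[abs_def] by (intro SM_mult step_SM SM_const SM_nq)

lemma LLx_SM: "SM (LLx r)" and LLy_SM: "SM (LLy r)"
  unfolding LLx_def[abs_def] LLy_def[abs_def] by (intro SM_mult slope_SM SM_const SM_Re SM_Im)+

lemma compact_support_closure:
  fixes f :: "complex \<Rightarrow> real"
  assumes "\<And>z. norm (z - a) > R \<Longrightarrow> f z = 0"
  shows "compact (closure {z. f z \<noteq> 0})"
proof -
  have "{z. f z \<noteq> 0} \<subseteq> cball a R"
    using assms by (force simp: dist_norm norm_minus_commute)
  then have "bounded {z. f z \<noteq> 0}" using bounded_cball bounded_subset by blast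
  then show ?thesis by (simp add: compact_closure)
qed

lemma test_fun_eta:
  assumes "r > 0" shows "test_fun (\<lambda>w. eta r (w - z))"
  unfolding test_fun_def
  by (intro conjI SM_Cinf[OF SM_shift[OF eta_SM]] compact_support_closure[where R=r and a=z] eta_outside)
     (use assms in auto)

text \<open>Both potentials are the exact logarithm outside the larger disc, so their difference has
  compact support. Inserted in \<open>is_laplacian\<close>, it converts a comparison of two averages
  of \<phi> into an integral against \<mu>.\<close>

lemma test_fun_LL:
  assumes "r > 0" "s > 0"
  shows "test_fun (\<lambda>w. LL r (w - z) - LL s (w - z))"
    "lap (\<lambda>w. LL r (w - z) - LL s (w - z)) w = eta r (w - z) - eta s (w - z)"
proof -
  have c: "C2 (\<lambda>w. LL r (w - z) - LL s (w - z)) (\<lambda>w. LLx r (w - z) - LLx s (w - z)) (\<lambda>w. LLy r (w - z) - LLy s (w - z))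
    (\<lambda>w. LLxx r (w - z) - LLxx s (w - z)) (\<lambda>w. LLxy r (w - z) - LLxy s (w - z)) (\<lambda>w. LLyy r (w - z) - LLyy s (w - z))"
    by (intro C2_diff C2_shift LL_C2)
  have "Cinf (\<lambda>w. LL r (w - z) - LL s (w - z))"
    by (rule Cinf_D1[OF C2_D(1)[OF c]])
       (rule SM_diff[OF SM_shift[OF LLx_SM] SM_shift[OF LLx_SM]] SM_diff[OF SM_shift[OF LLy_SM] SM_shift[OF LLy_SM]])+
  moreover have "compact (closure {w. LL r (w - z) - LL s (w - z) \<noteq> 0})"
    by (rule compact_support_closure[where a=z and R="max r s"]) (use assms in \<open>auto simp: LL_outside\<close>)
  ultimately show "test_fun (\<lambda>w. LL r (w - z) - LL s (w - z))" by (simp add: test_fun_def)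
  show "lap (\<lambda>w. LL r (w - z) - LL s (w - z)) w = eta r (w - z) - eta s (w - z)"
    using C2_lap[OF c] LL_lap assms by (simp add: algebra_simps)
qed

section \<open>Differentiation under the integral sign\<close>

definition locint :: "complex measure \<Rightarrow> (complex \<Rightarrow> real) \<Rightarrow> bool" where
  "locint M v \<longleftrightarrow> v \<in> borel_measurable M \<and> (\<forall>R. integrable M (\<lambda>w. indicator (cball 0 R) w * v w))"

definition jcont :: "(complex \<Rightarrow> complex \<Rightarrow> real) \<Rightarrow> bool" where
  "jcont k \<longleftrightarrow> continuous_on UNIV (\<lambda>p. k (fst p) (snd p))"

text \<open>The bound on w may come from either factor: mollifiers confine w to a neighbourhood of
  z, whereas the localised potentials of \<open>psi_local\<close> rely on a compactly supported
  v.\<close>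

definition jsupp :: "(complex \<Rightarrow> complex \<Rightarrow> real) \<Rightarrow> (complex \<Rightarrow> real) \<Rightarrow> bool" where
  "jsupp k v \<longleftrightarrow> (\<forall>B. \<exists>R. \<forall>z w. norm z \<le> B \<longrightarrow> norm w > R \<longrightarrow> k z w = 0 \<or> v w = 0)"

lemma jcont_bound:
  assumes "jcont k"
  shows "\<exists>C\<ge>0. \<forall>z w. norm z \<le> B \<longrightarrow> norm w \<le> R \<longrightarrow> \<bar>k z w\<bar> \<le> C"
proof -
  have "compact (cball 0 B \<times> cball 0 R :: (complex \<times> complex) set)" by (intro compact_Times compact_cball)
  then have "compact ((\<lambda>p. k (fst p) (snd p)) ` (cball 0 B \<times> cball 0 R))"
    using assms unfolding jcont_def by (meson compact_continuous_image continuous_on_subset subset_UNIV)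
  then obtain C where C: "\<And>x. x \<in> (\<lambda>p. k (fst p) (snd p)) ` (cball 0 B \<times> cball 0 R) \<Longrightarrow> norm x \<le> C"
    using compact_imp_bounded bounded_iff by metis
  have "\<bar>k z w\<bar> \<le> max C 0" if "norm z \<le> B" "norm w \<le> R" for z w
    using C[of "k z w"] that by (force simp: image_iff)
  then show ?thesis by (intro exI[of _ "max C 0"]) auto
qed

lemma jcont_snd:
  assumes "jcont k" shows "continuous_on UNIV (k z)"
proof -
  have "continuous_on UNIV (\<lambda>w. (z, w))" by (intro continuous_intros)
  from continuous_on_compose2[OF assms[unfolded jcont_def] this] show ?thesis by simp
qed

lemma jcont_fst:
  assumes "jcont k" shows "continuous_on UNIV (\<lambda>z. k z w)"
proof -
  have "continuous_on UNIV (\<lambda>z. (z, w))" by (intro continuous_intros)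
  from continuous_on_compose2[OF assms[unfolded jcont_def] this] show ?thesis by simp
qed

lemma jcont_shift:
  assumes "continuous_on UNIV f" shows "jcont (\<lambda>z w. f (z - w))" "jcont (\<lambda>z w. f (w - z))" "jcont (\<lambda>z w. f (z + w))"
  unfolding jcont_def
  by (rule continuous_on_compose2[OF assms]; auto intro!: continuous_intros)+

text \<open>One integrable majorant works for all z in a disc, obtained from the maximum of the
  kernel on a compact product. It feeds every dominated-convergence argument on parameter
  integrals.\<close>

lemma kernel_bound:
  assumes M: "sets M = sets borel" and v: "locint M v" and k: "jcont k" and s: "jsupp k v"
  shows "\<exists>W. integrable M W \<and> (\<forall>z w. norm z \<le> B \<longrightarrow> \<bar>k z w * v w\<bar> \<le> W w)"
    "integrable M (\<lambda>w. k z w * v w)"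
proof -
  have "\<exists>W. integrable M W \<and> (\<forall>z w. norm z \<le> B \<longrightarrow> \<bar>k z w * v w\<bar> \<le> W w)" for B
  proof -
    obtain R where R: "\<And>z w. norm z \<le> B \<Longrightarrow> norm w > R \<Longrightarrow> k z w = 0 \<or> v w = 0"
      using s unfolding jsupp_def by blast
    obtain C where C: "C \<ge> 0" "\<And>z w. norm z \<le> B \<Longrightarrow> norm w \<le> R \<Longrightarrow> \<bar>k z w\<bar> \<le> C"
      using jcont_bound[OF k] by blast
    have "integrable M (\<lambda>w. C * \<bar>indicator (cball 0 R) w * v w\<bar>)"
      using v unfolding locint_def by (intro integrable_mult_right integrable_abs) auto
    moreover have "\<bar>k z w * v w\<bar> \<le> C * \<bar>indicator (cball 0 R) w * v w\<bar>" if "norm z \<le> B" for z w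
      using R[of z w] C that by (cases "norm w \<le> R") (force simp: abs_mult intro!: mult_right_mono)+
    ultimately show ?thesis by blast
  qed
  note B = this
  show "\<exists>W. integrable M W \<and> (\<forall>z w. norm z \<le> B \<longrightarrow> \<bar>k z w * v w\<bar> \<le> W w)" by (rule B)
  have [measurable]: "k z \<in> borel_measurable M" "v \<in> borel_measurable M"
    using borel_measurable_continuous_onI[OF jcont_snd[OF k]] M v
    by (auto simp: locint_def cong: measurable_cong_sets)
  obtain W where W: "integrable M W" "\<And>w. \<bar>k z w * v w\<bar> \<le> W w" using B[of "norm z"] by auto
  show "integrable M (\<lambda>w. k z w * v w)"
    by (rule Bochner_Integration.integrable_bound[OF W(1)]) (use W(2) in \<open>auto intro!: AE_I2 intro: order_trans[OF _ abs_ge_self]\<close>)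
qed

lemma kernel_integral_continuous:
  assumes M: "sets M = sets borel" and v: "locint M v" and k: "jcont k" and s: "jsupp k v"
  shows "continuous_on UNIV (\<lambda>z. LINT w|M. k z w * v w)"
proof (rule continuous_on_sequentiallyI)
  fix u :: "nat \<Rightarrow> complex" and a assume u: "u \<longlonglongrightarrow> a"
  then obtain B where B: "\<And>n. norm (u n) \<le> B"
    using Bseq_def convergent_imp_Bseq convergentI by metis
  obtain W where W: "integrable M W" "\<And>z w. norm z \<le> B \<Longrightarrow> \<bar>k z w * v w\<bar> \<le> W w"
    using kernel_bound(1)[OF assms] by blast
  have m: "(\<lambda>w. k z w * v w) \<in> borel_measurable M" for z
    using kernel_bound(2)[OF assms] by auto
  show "(\<lambda>n. LINT w|M. k (u n) w * v w) \<longlonglongrightarrow> (LINT w|M. k a w * v w)"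
  proof (rule integral_dominated_convergence[OF m m W(1)])
    show "AE w in M. (\<lambda>n. k (u n) w * v w) \<longlonglongrightarrow> k a w * v w"
      using u jcont_fst[OF k] by (auto intro!: AE_I2 tendsto_intros simp: continuous_on_sequentially comp_def)
    show "AE w in M. norm (k (u n) w * v w) \<le> W w" for n
      using W(2)[OF B] by auto
  qed
qed

lemma D1_increment_bound:
  assumes D: "D1 f fx fy" and b: "\<And>z. z \<in> ball a 1 \<Longrightarrow> \<bar>fx z\<bar> \<le> C \<and> \<bar>fy z\<bar> \<le> C" and h: "norm h < 1"
  shows "\<bar>f (a + h) - f a\<bar> \<le> 2 * C * norm h"
proof -
  have "norm (f (a + h) - f a) \<le> (2 * C) * norm (a + h - a)"
  proof (rule differentiable_bound[OF convex_ball, of a 1 f "\<lambda>z h. Re h * fx z + Im h * fy z"])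
    show "(f has_derivative (\<lambda>h. Re h * fx z + Im h * fy z)) (at z within ball a 1)" for z
      using D1D[OF D] has_derivative_at_withinI by blast
    show "onorm (\<lambda>h. Re h * fx z + Im h * fy z) \<le> 2 * C" if "z \<in> ball a 1" for z
    proof (rule onorm_le)
      fix h
      have "\<bar>Re h * fx z + Im h * fy z\<bar> \<le> norm h * C + norm h * C"
        using b[OF that] abs_Re_le_cmod[of h] abs_Im_le_cmod[of h]
        by (intro order_trans[OF abs_triangle_ineq] add_mono) (auto simp: abs_mult intro!: mult_mono)
      then show "norm (Re h * fx z + Im h * fy z) \<le> 2 * C * norm h" by (simp add: algebra_simps)
    qed
  qed (use h in \<open>auto simp: dist_norm\<close>)
  then show ?thesis by simp
qed

text \<open>Dominated convergence applied to the normalised first-order remainder. The mean value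
  inequality bounds it by the majorants of the two partial kernels, uniformly for increments shorter
  than 1.\<close>

lemma kernel_integral_D1:
  assumes M: "sets M = sets borel" and v: "locint M v"
    and k: "jcont k" "jcont kx" "jcont ky" and s: "jsupp k v" "jsupp kx v" "jsupp ky v"
    and D: "\<And>w. D1 (\<lambda>z. k z w) (\<lambda>z. kx z w) (\<lambda>z. ky z w)"
  shows "D1 (\<lambda>z. LINT w|M. k z w * v w) (\<lambda>z. LINT w|M. kx z w * v w) (\<lambda>z. LINT w|M. ky z w * v w)"
  unfolding D1_def
proof
  fix a :: complex
  let ?F = "\<lambda>z. LINT w|M. k z w * v w"
  let ?Fx = "LINT w|M. kx a w * v w" and ?Fy = "LINT w|M. ky a w * v w"
  note i = kernel_bound(2)[OF M v k(1) s(1)] kernel_bound(2)[OF M v k(2) s(2)] kernel_bound(2)[OF M v k(3) s(3)]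
  obtain Wx where Wx: "integrable M Wx" "\<And>z w. norm z \<le> norm a + 1 \<Longrightarrow> \<bar>kx z w * v w\<bar> \<le> Wx w"
    using kernel_bound(1)[OF M v k(2) s(2)] by blast
  obtain Wy where Wy: "integrable M Wy" "\<And>z w. norm z \<le> norm a + 1 \<Longrightarrow> \<bar>ky z w * v w\<bar> \<le> Wy w"
    using kernel_bound(1)[OF M v k(3) s(3)] by blast
  define q where "q h w = (k (a + h) w * v w - k a w * v w - (Re h * (kx a w * v w) + Im h * (ky a w * v w))) / norm h" for h w
  have iq: "integrable M (q h)" for h
    unfolding q_def by (intro integrable_divide Bochner_Integration.integrable_diff
      Bochner_Integration.integrable_add integrable_mult_right i)
  have Iq: "(LINT w|M. q h w) = (?F (a + h) - ?F a - (Re h * ?Fx + Im h * ?Fy)) / norm h" for h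
    unfolding q_def by (simp add: i)
  have dv: "D1 (\<lambda>z. k z w * v w) (\<lambda>z. kx z w * v w) (\<lambda>z. ky z w * v w)" for w
    using D1_cmult[OF D, of "v w"] by (simp add: mult.commute)
  have bq: "\<bar>q h w\<bar> \<le> 4 * (Wx w + Wy w)" if h: "norm h < 1" "h \<noteq> 0" for h w
  proof -
    have b: "\<bar>kx z w * v w\<bar> \<le> Wx w + Wy w \<and> \<bar>ky z w * v w\<bar> \<le> Wx w + Wy w" if "z \<in> ball a 1" for z
    proof -
      have "norm z \<le> norm a + 1" using that norm_triangle_sub[of z a] by (simp add: dist_norm norm_minus_commute)
      from Wx(2)[OF this, of w] Wy(2)[OF this, of w] show ?thesis by linarith
    qed
    have 1: "\<bar>k (a + h) w * v w - k a w * v w\<bar> \<le> 2 * (Wx w + Wy w) * norm h"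
      using D1_increment_bound[OF dv b h(1)] .
    have "\<bar>Re h * (kx a w * v w) + Im h * (ky a w * v w)\<bar> \<le> norm h * (Wx w + Wy w) + norm h * (Wx w + Wy w)"
      using b[of a] abs_Re_le_cmod[of h] abs_Im_le_cmod[of h]
      by (intro order_trans[OF abs_triangle_ineq] add_mono) (auto simp: abs_mult[of "Re h"] abs_mult[of "Im h"] intro!: mult_mono)
    with 1 have "\<bar>k (a + h) w * v w - k a w * v w - (Re h * (kx a w * v w) + Im h * (ky a w * v w))\<bar> \<le> 4 * (Wx w + Wy w) * norm h"
      by (simp add: algebra_simps)
    then show ?thesis using h by (simp add: q_def field_simps)
  qed
  have lim: "((\<lambda>h. q h w) \<longlongrightarrow> 0) (at 0)" for w
  proof -
    have "((\<lambda>h. norm (k (a + h) w * v w - k a w * v w - (Re h * (kx a w * v w) + Im h * (ky a w * v w))) / norm h) \<longlongrightarrow> 0) (at 0)"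
      using D1D[OF dv, of w a] unfolding has_derivative_at by auto
    then have "((\<lambda>h. norm (q h w)) \<longlongrightarrow> 0) (at 0)" by (simp add: q_def)
    then show ?thesis by (rule tendsto_norm_zero_cancel)
  qed
  have "((\<lambda>h. LINT w|M. q h w) \<longlongrightarrow> 0) (at 0)"
    unfolding tendsto_at_iff_sequentially
  proof (intro allI impI)
    fix X :: "nat \<Rightarrow> complex" assume X: "\<forall>i. X i \<in> UNIV - {0}" "X \<longlonglongrightarrow> 0"
    obtain N where N: "\<And>n. n \<ge> N \<Longrightarrow> norm (X n) < 1"
      using X(2) unfolding lim_sequentially by (metis dist_0_norm dist_commute zero_less_one)
    have "(\<lambda>n. LINT w|M. q (X (n + N)) w) \<longlonglongrightarrow> (LINT w|M. 0)"
    proof (rule integral_dominated_convergence[where w="\<lambda>w. 4 * (Wx w + Wy w)"])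
      show "integrable M (\<lambda>w. 4 * (Wx w + Wy w))" using Wx Wy by simp
      show "AE w in M. (\<lambda>n. q (X (n + N)) w) \<longlonglongrightarrow> 0"
      proof (rule AE_I2)
        fix w
        have "(\<lambda>n. q (X n) w) \<longlonglongrightarrow> 0"
          using lim[of w] X unfolding tendsto_at_iff_sequentially comp_def by blast
        then show "(\<lambda>n. q (X (n + N)) w) \<longlonglongrightarrow> 0" by (rule LIMSEQ_ignore_initial_segment)
      qed
      show "AE w in M. norm (q (X (n + N)) w) \<le> 4 * (Wx w + Wy w)" for n
        using bq[OF N] X(1) by (auto intro!: AE_I2)
    qed (use iq in auto)
    then have "(\<lambda>n. LINT w|M. q (X (n + N)) w) \<longlonglongrightarrow> 0" by simp
    then show "((\<lambda>h. LINT w|M. q h w) \<circ> X) \<longlonglongrightarrow> 0"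
      unfolding comp_def by (rule LIMSEQ_offset)
  qed
  then have "((\<lambda>h. (?F (a + h) - ?F a - (Re h * ?Fx + Im h * ?Fy)) / norm h) \<longlongrightarrow> 0) (at 0)"
    unfolding Iq .
  then have "((\<lambda>h. norm (?F (a + h) - ?F a - (Re h * ?Fx + Im h * ?Fy)) / norm h) \<longlongrightarrow> 0) (at 0)"
    using tendsto_norm_zero by fastforce
  moreover have "bounded_linear (\<lambda>h. Re h * ?Fx + Im h * ?Fy)"
    by (intro bounded_linear_add bounded_linear_mult_left bounded_linear_compose[OF bounded_linear_mult_left] bounded_linear_Re bounded_linear_Im)
  ultimately show "(?F has_derivative (\<lambda>h. Re h * ?Fx + Im h * ?Fy)) (at a)"
    unfolding has_derivative_at by blast
qed

section \<open>Integration over the plane: translation, partial integration, mass of the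
  mollifiers\<close>

lemma integrable_compact_support:
  fixes f :: "complex \<Rightarrow> 'b::{banach, second_countable_topology}"
  assumes "continuous_on UNIV f" "\<And>z. norm z > R \<Longrightarrow> f z = 0"
  shows "integrable lborel f"
proof -
  have "integrable lborel (\<lambda>x. indicator (cball 0 R) x *\<^sub>R f x)"
    by (rule borel_integrable_compact) (auto intro: continuous_on_subset[OF assms(1)])
  moreover have "(\<lambda>x. indicator (cball 0 R) x *\<^sub>R f x) = f"
    using assms(2) by (force simp: indicator_def)
  ultimately show ?thesis by simp
qed

lemma locint_const: "locint lborel (\<lambda>w. c)"
  unfolding locint_def
proof (intro conjI allI)
  fix R
  have "integrable lborel (\<lambda>x. indicator (cball 0 R) x *\<^sub>R c)"
    by (rule borel_integrable_compact) auto
  then show "integrable lborel (\<lambda>w. indicat_real (cball 0 R) w * c)" by simp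
qed simp

lemma lborel_integral_shift:
  fixes f :: "complex \<Rightarrow> 'b::{banach, second_countable_topology}"
  assumes [measurable]: "f \<in> borel_measurable borel"
  shows "(LINT w|lborel. f (c + w)) = (LINT w|lborel. f w)"
proof -
  have "(LINT w|lborel. f w) = (LINT w|distr lborel borel ((+) c). f w)"
    by (simp add: lborel_distr_plus)
  also have "\<dots> = (LINT w|lborel. f (c + w))"
    by (rule integral_distr) auto
  finally show ?thesis ..
qed

text \<open>The integral of f(z + w) over w does not depend on z by translation invariance; its
  derivative in z, computed under the integral sign, is the integral of the partials. Integration by
  parts thus comes from invariance, with no iterated integrals.\<close>

lemma integral_partial_zero:
  assumes D: "D1 f fx fy" and c: "continuous_on UNIV fx" "continuous_on UNIV fy"
    and s: "\<And>z. norm z > R \<Longrightarrow> f z = 0"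
  shows "(LINT z|lborel. fx z) = 0" "(LINT z|lborel. fy z) = 0"
proof -
  have z: "fx z = 0 \<and> fy z = 0" if "norm z > R" for z
  proof -
    have "((\<lambda>z. 0) has_derivative (\<lambda>h. Re h * fx z + Im h * fy z)) (at z)"
      by (rule has_derivative_transform_within_open[OF D1D[OF D], where s="- cball 0 R"]) (use that s in auto)
    then have "(\<lambda>h. Re h * fx z + Im h * fy z) = (\<lambda>h. 0)"
      using has_derivative_unique has_derivative_const by blast
    from fun_cong[OF this, of 1] fun_cong[OF this, of \<i>] show ?thesis by simp
  qed
  have js: "jsupp (\<lambda>z w. g (z + w)) (\<lambda>w. 1)" if "\<And>z. norm z > R \<Longrightarrow> g z = 0" for g
    unfolding jsupp_def
  proof (intro allI)
    fix B
    have "g (z + w) = 0" if "norm z \<le> B" "norm w > R + B" for z w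
      using that norm_triangle_ineq4[of "z + w" z] by (intro \<open>\<And>z. norm z > R \<Longrightarrow> g z = 0\<close>) simp
    then show "\<exists>R. \<forall>z w. norm z \<le> B \<longrightarrow> R < norm w \<longrightarrow> g (z + w) = 0 \<or> (1::real) = 0" by blast
  qed
  have D': "D1 (\<lambda>z. f (z + w)) (\<lambda>z. fx (z + w)) (\<lambda>z. fy (z + w))" for w
    using D1_shift[OF D, of "- w"] by simp
  have "D1 (\<lambda>z. LINT w|lborel. f (z + w) * 1) (\<lambda>z. LINT w|lborel. fx (z + w) * 1) (\<lambda>z. LINT w|lborel. fy (z + w) * 1)"
    by (rule kernel_integral_D1[OF sets_lborel locint_const])
       (use z s D' in \<open>auto intro!: jcont_shift js c D1_continuous[OF D]\<close>)
  moreover have "(\<lambda>z. LINT w|lborel. f (z + w) * 1) = (\<lambda>z. LINT w|lborel. f w)"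
    using lborel_integral_shift[of f] borel_measurable_continuous_onI[OF D1_continuous[OF D]] by simp
  ultimately have "D1 (\<lambda>z. LINT w|lborel. f w) (\<lambda>z. LINT w|lborel. fx (z + w)) (\<lambda>z. LINT w|lborel. fy (z + w))"
    by simp
  from D1D[OF this, of 0] have "((\<lambda>z. LINT w|lborel. f w) has_derivative
     (\<lambda>h. Re h * (LINT w|lborel. fx w) + Im h * (LINT w|lborel. fy w))) (at 0)"
    unfolding add_0 .
  from has_derivative_unique[OF this has_derivative_const]
  have "(\<lambda>h. Re h * (LINT w|lborel. fx w) + Im h * (LINT w|lborel. fy w)) = (\<lambda>h. 0)" .
  from fun_cong[OF this, of 1] fun_cong[OF this, of \<i>]
  show "(LINT z|lborel. fx z) = 0" "(LINT z|lborel. fy z) = 0" by simp_all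
qed

text \<open>Polar coordinates give the value 1. The proof carries the unevaluated constant and
  relies on its positivity and on its independence of the radius.\<close>

definition mass :: real where "mass = (LINT z|lborel. eta 1 z)"

lemma eta_continuous: "continuous_on S (eta r)"
  using SM_continuous[OF eta_SM] .

lemma eta_integrable: "r > 0 \<Longrightarrow> integrable lborel (eta r)"
  by (rule integrable_compact_support[OF eta_continuous, of r]) (simp add: eta_outside)

lemma LL_diff_C2: "C2 (\<lambda>z. LL r z - LL s z) (\<lambda>z. LLx r z - LLx s z) (\<lambda>z. LLy r z - LLy s z)
   (\<lambda>z. LLxx r z - LLxx s z) (\<lambda>z. LLxy r z - LLxy s z) (\<lambda>z. LLyy r z - LLyy s z)"
  by (intro C2_diff LL_C2)

lemma D1_support:
  assumes D: "D1 f fx fy" and s: "\<And>z. norm z > R \<Longrightarrow> f z = 0" and z: "norm z > R"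
  shows "fx z = 0" "fy z = 0"
proof -
  have "((\<lambda>z. 0) has_derivative (\<lambda>h. Re h * fx z + Im h * fy z)) (at z)"
    by (rule has_derivative_transform_within_open[OF D1D[OF D], where s="- cball 0 R"]) (use z s in auto)
  then have "(\<lambda>h. Re h * fx z + Im h * fy z) = (\<lambda>h. 0)"
    using has_derivative_unique has_derivative_const by blast
  from fun_cong[OF this, of 1] fun_cong[OF this, of \<i>] show "fx z = 0" "fy z = 0" by simp_all
qed

text \<open>The difference of two mollifiers is the Laplacian of the compactly supported function
  \<open>LL r - LL 1\<close>, so its integral vanishes by partial integration.\<close>

lemma eta_mass:
  assumes r: "r > 0" shows "(LINT z|lborel. eta r z) = mass"
proof -
  note c = LL_diff_C2[of r 1]
  have s: "LL r z - LL 1 z = 0" if "norm z > max r 1" for z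
    using that r by (simp add: LL_outside)
  note d = D1_support[OF C2_D(1)[OF c] s]
  have 1: "(LINT z|lborel. LLxx r z - LLxx 1 z) = 0"
    by (rule integral_partial_zero(1)[OF C2_D(2)[OF c] C2_D(7)[OF c] C2_D(8)[OF c] d(1)])
  have 2: "(LINT z|lborel. LLyy r z - LLyy 1 z) = 0"
    by (rule integral_partial_zero(2)[OF C2_D(3)[OF c] C2_D(8)[OF c] C2_D(9)[OF c] d(2)])
  have i: "integrable lborel (\<lambda>z. LLxx r z - LLxx 1 z)"
    by (rule integrable_compact_support[OF C2_D(7)[OF c] D1_support(1)[OF C2_D(2)[OF c] d(1)]])
  have i': "integrable lborel (\<lambda>z. LLyy r z - LLyy 1 z)"
    by (rule integrable_compact_support[OF C2_D(9)[OF c] D1_support(2)[OF C2_D(3)[OF c] d(2)]])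
  have "(LINT z|lborel. eta r z) - (LINT z|lborel. eta 1 z) = (LINT z|lborel. eta r z - eta 1 z)"
    using eta_integrable r by simp
  also have "\<dots> = (LINT z|lborel. (LLxx r z - LLxx 1 z) + (LLyy r z - LLyy 1 z))"
    using LL_lap r by (intro Bochner_Integration.integral_cong) (simp_all flip: LL_lap)
  also have "\<dots> = 0" using 1 2 i i' by simp
  finally show ?thesis by (simp add: mass_def)
qed

lemma mass_pos: "mass > 0"
proof -
  have "integral\<^sup>L lborel (eta 1) \<ge> 0" by (rule Bochner_Integration.integral_nonneg) (simp add: eta_nonneg)
  moreover have "integral\<^sup>L lborel (eta 1) \<noteq> 0"
  proof
    assume "integral\<^sup>L lborel (eta 1) = 0"
    then have ae: "AE z in lborel. eta 1 z = 0"
      using integral_nonneg_eq_0_iff_AE[of lborel "eta 1"] eta_integrable[of 1] eta_nonneg by simp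
    \<comment> \<open>On this disc 5/8 < |z| < 7/8, hence |z|^2 lies in the interval (1/4, 1) where
      \<open>step'\<close> is positive.\<close>
    have p: "eta 1 z > 0" if "z \<in> ball (3/4) (1/8)" for z
    proof -
      have "norm z < 7/8" "norm z > 5/8"
        using that norm_triangle_ineq2[of z "3/4"] norm_triangle_ineq2[of "3/4" z]
        by (auto simp: dist_norm norm_minus_commute)
      then have "(norm z)\<^sup>2 < 1" "(norm z)\<^sup>2 > (5/8)\<^sup>2"
        by (auto simp: power_less_one_iff intro!: power_strict_mono)
      then show ?thesis by (simp add: eta_def nq_norm step'_pos power2_eq_square)
    qed
    have "AE z in lborel. z \<notin> ball (3/4::complex) (1/8)"
      using ae by eventually_elim (use p in force)
    then have "ball (3/4::complex) (1/8) \<in> null_sets lborel"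
      by (subst AE_iff_null_sets) auto
    then have "negligible (ball (3/4::complex) (1/8))"
      using null_sets_completionI by (auto simp: negligible_iff_null_sets)
    then show False using open_not_negligible[of "ball (3/4::complex) (1/8)"] by auto
  qed
  ultimately show ?thesis by (simp add: mass_def)
qed

text \<open>Continuous tests approximate indicators of compact sets, a pi-system argument extends
  this from closed to Borel subsets of a disc, and a function with zero integral over every Borel
  set vanishes almost everywhere.\<close>

lemma AE_zero_if_cc:
  assumes d: "locint lborel d"
    and z: "\<And>c R. continuous_on UNIV c \<Longrightarrow> (\<And>z. norm z > R \<Longrightarrow> c z = 0) \<Longrightarrow> (LINT z|lborel. c z * d z) = 0"
  shows "AE z in lborel. d z = 0"
proof -
  have [measurable]: "d \<in> borel_measurable borel" using d by (simp add: locint_def)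
  have K: "(LINT z|lborel. indicator K z * d z) = 0" if K: "compact K" for K
  proof (cases "K = {}")
    case False
    obtain R where R: "\<And>x. x \<in> K \<Longrightarrow> norm x \<le> R"
      using compact_imp_bounded[OF K] unfolding bounded_iff by blast
    define c where "c n z = max 0 (1 - real n * infdist z K)" for n z
    have cc: "continuous_on UNIV (c n)" for n
      unfolding c_def[abs_def] by (intro continuous_intros continuous_on_infdist)
    \<comment> \<open>The shift to \<open>Suc n\<close> keeps the support within distance 1 of K;
      for n = 0 the function \<open>c\<close> is constantly 1.\<close>
    have cs: "c (Suc n) z = 0" if "norm z > R + 1" for n z
    proof -
      obtain k where k: "k \<in> K" "infdist z K = dist z k"
        using infdist_attains_inf[of K z] compact_imp_closed[OF K] False by metis
      have "dist z k \<ge> 1" using that R[OF k(1)] norm_triangle_sub[of z k] by (simp add: dist_norm)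
      then have "real (Suc n) * infdist z K \<ge> 1"
        using k(2) mult_mono[of 1 "real (Suc n)" 1 "infdist z K"] by simp
      then show ?thesis by (simp add: c_def)
    qed
    have i: "integrable lborel (\<lambda>z. indicator (cball 0 (R+1)) z * d z)" using d by (simp add: locint_def)
    have "(\<lambda>n. LINT z|lborel. c (Suc n) z * d z) \<longlonglongrightarrow> (LINT z|lborel. indicator K z * d z)"
    proof (rule integral_dominated_convergence[where w="\<lambda>z. \<bar>indicator (cball 0 (R+1)) z * d z\<bar>"])
      show "integrable lborel (\<lambda>z. \<bar>indicat_real (cball 0 (R + 1)) z * d z\<bar>)" using i by (rule integrable_abs)
      show "(\<lambda>z. c (Suc n) z * d z) \<in> borel_measurable lborel" for n
        using borel_measurable_continuous_onI[OF cc[of "Suc n"]] by simp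
      show "(\<lambda>z. indicator K z * d z) \<in> borel_measurable lborel"
        using compact_imp_closed[OF K] by simp
      show "AE z in lborel. norm (c (Suc n) z * d z) \<le> \<bar>indicat_real (cball 0 (R + 1)) z * d z\<bar>" for n
      proof (rule AE_I2)
        fix z
        have "0 \<le> c (Suc n) z" "c (Suc n) z \<le> 1" by (auto simp: c_def infdist_nonneg)
        then show "norm (c (Suc n) z * d z) \<le> \<bar>indicat_real (cball 0 (R + 1)) z * d z\<bar>"
          using cs[of z n] mult_right_mono[of "\<bar>c (Suc n) z\<bar>" 1 "\<bar>d z\<bar>"]
          by (cases "norm z > R + 1") (simp_all add: abs_mult)
      qed
      show "AE z in lborel. (\<lambda>n. c (Suc n) z * d z) \<longlonglongrightarrow> indicator K z * d z"
      proof (intro AE_I2 tendsto_mult_right)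
        fix z
        show "(\<lambda>n. c (Suc n) z) \<longlonglongrightarrow> indicator K z"
        proof (cases "z \<in> K")
          case True
          then show ?thesis by (simp add: c_def)
        next
          case F: False
          have "infdist z K > 0"
            using F False compact_imp_closed[OF K] infdist_pos_not_in_closed by blast
          then obtain N where N: "1 < real N * infdist z K"
            using reals_Archimedean3 by blast
          have "c (Suc n) z = 0" if "n \<ge> N" for n
          proof -
            have "real N * infdist z K \<le> real (Suc n) * infdist z K"
              using that by (intro mult_right_mono) (auto simp: infdist_nonneg)
            then show ?thesis using N by (simp add: c_def)
          qed
          then have "\<forall>\<^sub>F n in sequentially. c (Suc n) z = indicator K z"
            using F by (auto simp: eventually_sequentially)
          then show ?thesis by (rule tendsto_eventually)
        qed
      qed
    qed
    moreover have "(LINT z|lborel. c (Suc n) z * d z) = 0" for n by (rule z[OF cc cs])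
    ultimately show ?thesis by (simp add: LIMSEQ_const_iff)
  qed simp
  have "AE z in lborel. indicator (cball 0 R) z * d z = 0" for R
  proof (rule sigma_finite_measure.density_zero[OF sigma_finite_lborel])
    let ?f = "\<lambda>z. indicat_real (cball 0 R) z * d z"
    show i: "integrable lborel ?f" using d by (simp add: locint_def)
    fix A :: "complex set" assume "A \<in> sets lborel"
    then have A: "A \<in> sigma_sets UNIV (Collect closed)" by (simp add: borel_eq_closed)
    have tot: "(LINT z|lborel. ?f z) = 0" by (rule K) simp
    have si: "set_integrable lborel A ?f" if "A \<in> sets borel" for A
      unfolding set_integrable_def by (rule integrable_mult_indicator[OF _ i]) (use that in simp)
    have "Int_stable (Collect (closed :: complex set \<Rightarrow> bool))" by (auto simp: Int_stable_def)
    then show "set_lebesgue_integral lborel A ?f = 0"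
      using subset_UNIV[of "Collect closed", folded Pow_UNIV] A
    proof (induction rule: sigma_sets_induct_disjoint)
      case (basic A)
      then have "compact (A \<inter> cball 0 R)" by auto
      from K[OF this] show ?case
        by (simp add: set_lebesgue_integral_def indicator_inter_arith mult.assoc)
    next
      case empty show ?case by (simp add: set_lebesgue_integral_def)
    next
      case (compl A)
      then have Ab: "A \<in> sets borel" by (simp add: borel_eq_closed)
      have "set_lebesgue_integral lborel (UNIV - A) ?f = (LINT z|lborel. ?f z - indicator A z *\<^sub>R ?f z)"
        unfolding set_lebesgue_integral_def by (rule Bochner_Integration.integral_cong) (auto simp: indicator_def)
      also have "\<dots> = (LINT z|lborel. ?f z) - set_lebesgue_integral lborel A ?f"
        using i si[OF Ab] unfolding set_lebesgue_integral_def set_integrable_def by (rule Bochner_Integration.integral_diff)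
      finally show ?case using tot compl by simp
    next
      case (union A)
      then have Ab: "\<And>i. A i \<in> sets borel" by (auto simp: borel_eq_closed)
      show ?case
        using lebesgue_integral_countable_add[of A lborel ?f] union Ab si[of "\<Union>i. A i"]
        by (auto simp: disjoint_family_on_def)
    qed
  qed
  then have "AE z in lborel. \<forall>n::nat. indicator (cball 0 (real n)) z * d z = 0"
    unfolding AE_all_countable by blast
  then show ?thesis
  proof eventually_elim
    case (elim z)
    obtain n :: nat where "norm z \<le> real n" using real_arch_simple by blast
    then show ?case using elim[rule_format, of n] by simp
  qed
qed

section \<open>Mollification of locally integrable functions\<close>

lemma locint_lin:
  assumes "locint M u" "locint M v"
  shows "locint M (\<lambda>z. u z + v z)" "locint M (\<lambda>z. u z - v z)"
proof -
  have i: "integrable M (\<lambda>z. indicat_real (cball 0 R) z * u z)" "integrable M (\<lambda>z. indicat_real (cball 0 R) z * v z)" for R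
    using assms by (auto simp: locint_def)
  have m [measurable]: "u \<in> borel_measurable M" "v \<in> borel_measurable M" using assms by (auto simp: locint_def)
  show "locint M (\<lambda>z. u z + v z)"
    using Bochner_Integration.integrable_add[OF i] by (auto simp: locint_def distrib_left)
  show "locint M (\<lambda>z. u z - v z)"
    using Bochner_Integration.integrable_diff[OF i] by (auto simp: locint_def right_diff_distrib)
qed

lemma locint_cmult:
  assumes "locint M u" shows "locint M (\<lambda>z. c * u z)"
proof -
  have i: "integrable M (\<lambda>z. indicat_real (cball 0 R) z * u z)" for R
    using assms by (auto simp: locint_def)
  have m [measurable]: "u \<in> borel_measurable M" using assms by (auto simp: locint_def)
  show ?thesis
    using integrable_mult_right[OF i, of c] by (auto simp: locint_def mult.left_commute)
qed

lemma locint_bounded: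
  assumes m: "u \<in> borel_measurable borel" and b: "\<And>R. \<exists>B. \<forall>z. norm z \<le> R \<longrightarrow> \<bar>u z\<bar> \<le> B"
  shows "locint lborel u"
  unfolding locint_def
proof (intro conjI allI)
  note [measurable] = m
  show "u \<in> borel_measurable lborel" by simp
  fix R
  obtain B where B: "\<And>z. norm z \<le> R \<Longrightarrow> \<bar>u z\<bar> \<le> B" using b by blast
  have "integrable lborel (\<lambda>w::complex. indicat_real (cball 0 R) w * B)"
    using locint_const[of B, unfolded locint_def, THEN conjunct2, THEN spec, of R] .
  then show "integrable lborel (\<lambda>w. indicat_real (cball 0 R) w * u w)"
  proof (rule Bochner_Integration.integrable_bound)
    show "AE w in lborel. norm (indicat_real (cball 0 R) w * u w) \<le> norm (indicat_real (cball 0 R) w * B)"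
    proof (rule AE_I2)
      fix w show "norm (indicat_real (cball 0 R) w * u w) \<le> norm (indicat_real (cball 0 R) w * B)"
        using B[of w] by (cases "norm w \<le> R") (simp_all add: abs_mult)
    qed
  qed (auto intro!: borel_measurable_times borel_measurable_indicator m)
qed

lemma locint_continuous:
  assumes "continuous_on UNIV u" shows "locint lborel u"
proof (rule locint_bounded)
  show "u \<in> borel_measurable borel" using assms by (rule borel_measurable_continuous_onI)
  fix R
  have "compact (u ` cball 0 R)"
    by (intro compact_continuous_image continuous_on_subset[OF assms]) auto
  then obtain B where "\<forall>x\<in>u ` cball 0 R. norm x \<le> B" using compact_imp_bounded bounded_iff by metis
  then show "\<exists>B. \<forall>z. norm z \<le> R \<longrightarrow> \<bar>u z\<bar> \<le> B" by (intro exI[of _ B]) auto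
qed

lemma jsupp_eta:
  assumes "r > 0" shows "jsupp (\<lambda>z w. eta r (z - w)) v"
  unfolding jsupp_def
proof (intro allI)
  fix B
  have "eta r (z - w) = 0" if "norm z \<le> B" "norm w > B + r" for z w
    using that norm_triangle_ineq2[of w z] assms by (intro eta_outside) (auto simp: norm_minus_commute)
  then show "\<exists>R. \<forall>z w. norm z \<le> B \<longrightarrow> R < norm w \<longrightarrow> eta r (z - w) = 0 \<or> v w = 0" by blast
qed

lemma mollify_integrable:
  assumes "r > 0" "sets M = sets borel" "locint M v"
  shows "integrable M (\<lambda>w. eta r (z - w) * v w)"
  by (rule kernel_bound(2)[OF assms(2,3) jcont_shift(1)[OF eta_continuous] jsupp_eta[OF assms(1)]])

text \<open>By Fubini and evenness in the roles of z and w, smoothing moves from v to the test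
  function. Convergence is elementary there, because the test function is continuous while v is only
  locally integrable.\<close>

lemma mollify_adjoint:
  assumes v: "locint lborel v" and r: "r > 0" and c: "continuous_on UNIV c" and s: "\<And>z. norm z > R \<Longrightarrow> c z = 0"
  shows "(LINT z|lborel. c z * (LINT w|lborel. eta r (z - w) * v w)) =
         (LINT w|lborel. (LINT z|lborel. c z * eta r (z - w)) * v w)"
proof -
  have [measurable]: "v \<in> borel_measurable borel" "c \<in> borel_measurable borel" "eta r \<in> borel_measurable borel"
    using v c eta_continuous by (auto simp: locint_def intro!: borel_measurable_continuous_onI)
  let ?f = "\<lambda>z w. c z * (eta r (z - w) * v w)"
  have vv: "locint lborel (\<lambda>w. \<bar>v w\<bar>)"
  proof -
    have "integrable lborel (\<lambda>w. \<bar>indicat_real (cball 0 R) w * v w\<bar>)" for R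
      using v unfolding locint_def by (intro integrable_abs) auto
    then show ?thesis by (simp add: locint_def abs_mult)
  qed
  have "integrable (lborel \<Otimes>\<^sub>M lborel) (case_prod ?f)"
  proof (rule lborel_pair.Fubini_integrable)
    show "case_prod ?f \<in> borel_measurable (lborel \<Otimes>\<^sub>M lborel)" by measurable
    have "(\<lambda>z. LINT w|lborel. norm (case (z, w) of (z, w) \<Rightarrow> ?f z w)) = (\<lambda>z. \<bar>c z\<bar> * (LINT w|lborel. eta r (z - w) * \<bar>v w\<bar>))"
      by (simp add: abs_mult eta_nonneg)
    moreover have "integrable lborel (\<lambda>z. \<bar>c z\<bar> * (LINT w|lborel. eta r (z - w) * \<bar>v w\<bar>))"
      by (rule integrable_compact_support[of _ R])
         (use s in \<open>auto intro!: continuous_intros c kernel_integral_continuous[OF sets_lborel vv jcont_shift(1)[OF eta_continuous] jsupp_eta[OF r]]\<close>)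
    ultimately show "integrable lborel (\<lambda>z. LINT w|lborel. norm (case (z, w) of (z, w) \<Rightarrow> ?f z w))" by simp
    show "AE z in lborel. integrable lborel (\<lambda>w. case (z, w) of (z, w) \<Rightarrow> ?f z w)"
      using mollify_integrable[OF r sets_lborel v] by (auto intro!: AE_I2)
  qed
  from lborel_pair.Fubini_integral[OF this]
  have "(LINT w|lborel. LINT z|lborel. ?f z w) = (LINT z|lborel. LINT w|lborel. ?f z w)" .
  moreover have "(LINT z|lborel. ?f z w) = (LINT z|lborel. c z * eta r (z - w)) * v w" for w
    by (simp add: mult.assoc[symmetric])
  ultimately show ?thesis by simp
qed

text \<open>The limit is identified by testing: against a continuous c of compact support the
  mollifier moves to c and converges to \<open>mass\<close> times c. Existence of the pointwise
  limit and the local bound are hypotheses, which the callers read off from explicit formulas for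
  the averages.\<close>

lemma mollify_limit_AE:
  assumes v: "locint lborel v" and r: "\<And>n. r n > 0" "r \<longlonglongrightarrow> 0"
    and lim: "\<And>z. (\<lambda>n. LINT w|lborel. eta (r n) (z - w) * v w) \<longlonglongrightarrow> V z"
    and bd: "\<And>R. \<exists>B. \<forall>n z. norm z \<le> R \<longrightarrow> \<bar>LINT w|lborel. eta (r n) (z - w) * v w\<bar> \<le> B"
  shows "AE z in lborel. V z = mass * v z"
proof -
  define A where "A n z = (LINT w|lborel. eta (r n) (z - w) * v w)" for n z
  have Ac: "continuous_on UNIV (A n)" for n
    unfolding A_def[abs_def]
    by (rule kernel_integral_continuous[OF sets_lborel v jcont_shift(1)[OF eta_continuous] jsupp_eta[OF r(1)]])
  have [measurable]: "A n \<in> borel_measurable borel" for n by (rule borel_measurable_continuous_onI[OF Ac])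
  have [measurable]: "v \<in> borel_measurable borel" using v by (simp add: locint_def)
  have lim': "(\<lambda>n. A n z) \<longlonglongrightarrow> V z" for z using lim by (simp add: A_def)
  have [measurable]: "V \<in> borel_measurable borel"
    by (rule borel_measurable_LIMSEQ_real[OF lim']) simp
  have bd': "\<exists>B. \<forall>n z. norm z \<le> R \<longrightarrow> \<bar>A n z\<bar> \<le> B" for R using bd by (simp add: A_def)
  have Vb: "\<exists>B. \<forall>z. norm z \<le> R \<longrightarrow> \<bar>V z\<bar> \<le> B" for R
  proof -
    obtain B where "\<And>n z. norm z \<le> R \<Longrightarrow> \<bar>A n z\<bar> \<le> B" using bd' by blast
    then show ?thesis
      by (intro exI[of _ B] allI impI) (rule LIMSEQ_le_const2[OF tendsto_rabs[OF lim']], auto)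
  qed
  have Vl: "locint lborel V" by (rule locint_bounded[OF _ Vb]) simp
  have "AE z in lborel. V z - mass * v z = 0"
  proof (rule AE_zero_if_cc)
    show "locint lborel (\<lambda>z. V z - mass * v z)" by (intro locint_lin locint_cmult Vl v)
    fix c :: "complex \<Rightarrow> real" and R assume c: "continuous_on UNIV c" and s: "\<And>z. norm z > R \<Longrightarrow> c z = 0"
    have [measurable]: "c \<in> borel_measurable borel" using c by (rule borel_measurable_continuous_onI)
    obtain C where C: "\<And>z. \<bar>c z\<bar> \<le> C"
    proof -
      have "compact (c ` cball 0 R)" by (intro compact_continuous_image continuous_on_subset[OF c]) auto
      then obtain B where B: "\<forall>x\<in>c ` cball 0 R. norm x \<le> B" using compact_imp_bounded bounded_iff by metis
      have "\<bar>c z\<bar> \<le> max B 0" for z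
        using B[rule_format, of "c z"] s[of z] by (cases "norm z > R") auto
      then show ?thesis using that by blast
    qed
    have 1: "(\<lambda>n. LINT z|lborel. c z * A n z) \<longlonglongrightarrow> (LINT z|lborel. c z * V z)"
    proof -
      obtain B where B: "\<And>n z. norm z \<le> R \<Longrightarrow> \<bar>A n z\<bar> \<le> B" using bd' by blast
      show ?thesis
      proof (rule integral_dominated_convergence[where w="\<lambda>z. \<bar>c z\<bar> * B"])
        show "integrable lborel (\<lambda>z. \<bar>c z\<bar> * B)"
          by (rule integrable_compact_support[of _ R]) (use s in \<open>auto intro!: continuous_intros c\<close>)
        show "AE z in lborel. norm (c z * A n z) \<le> \<bar>c z\<bar> * B" for n
        proof (rule AE_I2)
          fix z show "norm (c z * A n z) \<le> \<bar>c z\<bar> * B"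
            using s[of z] B[of z n] by (cases "norm z > R") (auto simp: abs_mult intro!: mult_left_mono)
        qed
      qed (auto intro!: tendsto_intros lim')
    qed
    have 2: "(\<lambda>n. LINT w|lborel. (LINT z|lborel. c z * eta (r n) (z - w)) * v w) \<longlonglongrightarrow> (LINT w|lborel. (mass * c w) * v w)"
    proof -
      obtain rb where rb: "\<And>n. r n \<le> rb"
        using convergent_imp_Bseq[OF convergentI[OF r(2)]] unfolding Bseq_def real_norm_def by (metis abs_le_D1)
      define cn where "cn n w = (LINT z|lborel. c z * eta (r n) (z - w))" for n w
      have ic: "integrable lborel (\<lambda>z. c z * eta (r n) (z - w))" for n w
        by (rule integrable_compact_support[of _ R])
           (use s in \<open>auto intro!: continuous_intros c continuous_on_compose2[OF eta_continuous[of UNIV]]\<close>)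
      have ie: "integrable lborel (\<lambda>z. eta (r n) (z - w))" for n w
        by (rule integrable_compact_support[of _ "norm w + r n"])
          (use r(1) norm_triangle_ineq2 in \<open>auto intro!: continuous_intros continuous_on_compose2[OF eta_continuous[of UNIV]] eta_outside
             intro: order_trans[OF _ norm_triangle_ineq2]\<close>)
      have me: "(LINT z|lborel. eta (r n) (z - w)) = mass" for n w
        using lborel_integral_shift[of "eta (r n)" "-w"] eta_mass[OF r(1)] borel_measurable_continuous_onI[OF eta_continuous]
        by simp
      have mc: "cn n \<in> borel_measurable borel" for n
      proof -
        have "continuous_on UNIV (\<lambda>w. LINT z|lborel. eta (r n) (z - w) * c z)"
          by (rule kernel_integral_continuous[OF sets_lborel locint_continuous[OF c] jcont_shift(2)[OF eta_continuous]])
             (use s in \<open>auto simp: jsupp_def\<close>)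
        then show ?thesis unfolding cn_def[abs_def] by (intro borel_measurable_continuous_onI) (simp add: mult.commute)
      qed
      have bnd: "\<bar>cn n w\<bar> \<le> C * mass" for n w
      proof -
        have "\<bar>cn n w\<bar> \<le> (LINT z|lborel. \<bar>c z * eta (r n) (z - w)\<bar>)"
          unfolding cn_def using integral_norm_bound[of lborel "\<lambda>z. c z * eta (r n) (z - w)"] by simp
        also have "\<dots> \<le> (LINT z|lborel. C * eta (r n) (z - w))"
          by (intro integral_mono integrable_abs integrable_mult_right ic ie)
             (use C in \<open>auto simp: abs_mult eta_nonneg intro!: mult_right_mono\<close>)
        finally show ?thesis using me by simp
      qed
      have sup: "cn n w = 0" if "norm w > R + rb" for n w
      proof -
        have "c z * eta (r n) (z - w) = 0" for z
        proof (cases "norm z > R")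
          case False
          then have "norm (z - w) \<ge> r n"
            using that rb[of n] norm_triangle_ineq2[of w z] by (simp add: norm_minus_commute)
          then show ?thesis using eta_outside[OF r(1)] by simp
        qed (simp add: s)
        then have "(\<lambda>z. c z * eta (r n) (z - w)) = (\<lambda>z. 0)" by (rule ext)
        then show ?thesis unfolding cn_def by (simp only: Bochner_Integration.integral_zero)
      qed
      \<comment> \<open>The mollifier is nonnegative with total integral \<open>mass\<close>, so on
        its support the oscillation of c controls the error.\<close>
      have lim: "(\<lambda>n. cn n w) \<longlonglongrightarrow> mass * c w" for w
      proof (rule LIMSEQ_I)
        fix e :: real assume e: "e > 0"
        define e' where "e' = e / (2 * mass)"
        have e': "e' > 0" using e mass_pos by (simp add: e'_def)
        obtain \<delta> where \<delta>: "\<delta> > 0" "\<And>z. dist z w < \<delta> \<Longrightarrow> \<bar>c z - c w\<bar> < e'"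
          using c e' unfolding continuous_on_iff dist_real_def by (metis UNIV_I)
        obtain N where N: "\<And>n. n \<ge> N \<Longrightarrow> r n < \<delta>"
          using order_tendstoD(2)[OF r(2) \<delta>(1)] by (auto simp: eventually_sequentially)
        have "norm (cn n w - mass * c w) < e" if n: "n \<ge> N" for n
        proof -
          have "cn n w - mass * c w = (LINT z|lborel. c z * eta (r n) (z - w) - c w * eta (r n) (z - w))"
            using ic ie me by (simp add: cn_def mult.commute)
          also have "norm \<dots> \<le> (LINT z|lborel. norm (c z * eta (r n) (z - w) - c w * eta (r n) (z - w)))"
            by (rule integral_norm_bound)
          also have "\<dots> \<le> (LINT z|lborel. e' * eta (r n) (z - w))"
          proof (rule integral_mono)
            fix z
            show "norm (c z * eta (r n) (z - w) - c w * eta (r n) (z - w)) \<le> e' * eta (r n) (z - w)"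
            proof (cases "dist z w < \<delta>")
              case True
              from \<delta>(2)[OF this] show ?thesis
                by (simp add: left_diff_distrib[symmetric] abs_mult eta_nonneg mult_right_mono)
            next
              case False
              then have "eta (r n) (z - w) = 0" using N[OF n] r(1)[of n] by (intro eta_outside) (auto simp: dist_norm)
              then show ?thesis by simp
            qed
          qed (use ic ie in \<open>auto intro!: integrable_norm\<close>)
          also have "\<dots> = e / 2" using me mass_pos by (simp add: e'_def)
          finally show ?thesis using e by simp
        qed
        then show "\<exists>no. \<forall>n\<ge>no. norm (cn n w - mass * c w) < e" by blast
      qed
      have "(\<lambda>n. LINT w|lborel. cn n w * v w) \<longlonglongrightarrow> (LINT w|lborel. (mass * c w) * v w)"
      proof (rule integral_dominated_convergence[where w="\<lambda>w. C * mass * \<bar>indicator (cball 0 (R + rb)) w * v w\<bar>"])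
        show "integrable lborel (\<lambda>w. C * mass * \<bar>indicator (cball 0 (R + rb)) w * v w\<bar>)"
          using v unfolding locint_def by (intro integrable_mult_right integrable_abs) auto
        show "AE w in lborel. norm (cn n w * v w) \<le> C * mass * \<bar>indicator (cball 0 (R + rb)) w * v w\<bar>" for n
        proof (rule AE_I2)
          fix w show "norm (cn n w * v w) \<le> C * mass * \<bar>indicator (cball 0 (R + rb)) w * v w\<bar>"
            using sup[of w n] bnd[of n w] by (cases "norm w > R + rb") (auto simp: abs_mult intro!: mult_right_mono)
        qed
      qed (use mc in \<open>auto intro!: tendsto_intros lim\<close>)
      then show ?thesis by (simp add: cn_def)
    qed
    have "(LINT z|lborel. c z * A n z) = (LINT w|lborel. (LINT z|lborel. c z * eta (r n) (z - w)) * v w)" for n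
      unfolding A_def by (rule mollify_adjoint[OF v r(1) c s])
    with 1 2 have eq: "(LINT z|lborel. c z * V z) = (LINT w|lborel. (mass * c w) * v w)"
      using LIMSEQ_unique by fastforce
    have jc: "integrable lborel (\<lambda>z. c z * u z)" if "locint lborel u" for u
      by (rule kernel_bound(2)[OF sets_lborel that, of "\<lambda>_ z. c z"])
         (use s in \<open>auto simp: jsupp_def jcont_def intro!: continuous_on_compose2[OF c] continuous_intros\<close>)
    show "(LINT z|lborel. c z * (V z - mass * v z)) = 0"
      using eq jc[OF Vl] integrable_mult_right[OF jc[OF v], of mass]
      by (simp add: right_diff_distrib mult.left_commute mult.assoc)
  qed
  then show ?thesis by eventually_elim simp
qed

section \<open>Doubling measures\<close>

text \<open>That \<mu> is not the zero measure expresses the non-harmonicity of \<phi>. The doubling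
  constant is a parameter, so that the constants derived from it can be named.\<close>

locale doubling_measure =
  fixes \<mu> :: "complex measure" and C :: real
  assumes sets_mu: "sets \<mu> = sets borel"
    and fin: "\<And>K. compact K \<Longrightarrow> emeasure \<mu> K < \<infinity>"
    and nonzero: "emeasure \<mu> UNIV \<noteq> 0"
    and C_pos: "C > 0"
    and dbl: "\<And>z r. r > 0 \<Longrightarrow> emeasure \<mu> (ball z (2*r)) \<le> ennreal C * emeasure \<mu> (ball z r)"
begin

abbreviation m :: "complex \<Rightarrow> real \<Rightarrow> real" where "m z r \<equiv> measure \<mu> (ball z r)"

lemma finite_bounded: "bounded A \<Longrightarrow> A \<in> sets borel \<Longrightarrow> emeasure \<mu> A < \<infinity>"
  using fin[of "closure A"] emeasure_mono[OF closure_subset, of A \<mu>]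
  by (auto simp: compact_closure sets_mu intro: le_less_trans)

lemma fm: "bounded A \<Longrightarrow> A \<in> sets borel \<Longrightarrow> A \<in> fmeasurable \<mu>"
  using finite_bounded by (auto simp: fmeasurable_def sets_mu)

lemma m_eq: "emeasure \<mu> (ball z r) = ennreal (m z r)"
  using finite_bounded[of "ball z r"] by (intro emeasure_eq_ennreal_measure) auto

lemma measure_mono_b: "A \<subseteq> B \<Longrightarrow> A \<in> sets borel \<Longrightarrow> B \<in> sets borel \<Longrightarrow> bounded B \<Longrightarrow> measure \<mu> A \<le> measure \<mu> B"
  using fm by (intro measure_mono_fmeasurable) (auto simp: sets_mu)

lemma m_mono: "dist z w + r \<le> s \<Longrightarrow> m z r \<le> m w s"
proof (rule measure_mono_b)
  assume "dist z w + r \<le> s"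
  show "ball z r \<subseteq> ball w s"
  proof
    fix x assume "x \<in> ball z r"
    then show "x \<in> ball w s"
      using \<open>dist z w + r \<le> s\<close> dist_triangle[of w x z] by (simp add: dist_commute)
  qed
qed auto

lemma m_dbl: "r > 0 \<Longrightarrow> m z (2*r) \<le> C * m z r"
proof -
  assume "r > 0"
  from dbl[OF this, of z] have "ennreal (m z (2*r)) \<le> ennreal (C * m z r)"
    using C_pos by (simp add: m_eq ennreal_mult)
  then show ?thesis using C_pos by (subst (asm) ennreal_le_iff) auto
qed

lemma m_dbl_pow: "r > 0 \<Longrightarrow> m z (2^k*r) \<le> C^k * m z r"
proof (induction k)
  case (Suc k)
  have "m z (2^Suc k*r) \<le> C * m z (2^k*r)" using m_dbl[of "2^k*r" z] Suc by (simp add: mult.assoc)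
  also have "\<dots> \<le> C * (C^k * m z r)" using Suc C_pos by (intro mult_left_mono) auto
  finally show ?case by (simp add: mult.assoc)
qed simp

lemma m_pos: "r > 0 \<Longrightarrow> m z r > 0"
proof (rule ccontr)
  assume r: "r > 0" and "\<not> m z r > 0"
  then have "m z r = 0" using measure_nonneg[of \<mu> "ball z r"] by linarith
  then have "m z (2^k*r) \<le> 0" for k using m_dbl_pow[OF r, of z k] by simp
  then have 0: "emeasure \<mu> (ball z (2^k*r)) = 0" for k :: nat
    unfolding m_eq by (intro ennreal_neg) blast
  have "UNIV = (\<Union>k::nat. ball z (2^k*r))"
  proof -
    have "\<exists>k::nat. dist z w < 2^k*r" for w
    proof -
      obtain k where "dist z w / r < 2^k" using real_arch_pow[of 2 "dist z w / r"] by auto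
      then show ?thesis using r by (auto simp: field_simps)
    qed
    then show ?thesis by auto
  qed
  moreover have "emeasure \<mu> (\<Union>k::nat. ball z (2^k*r)) = 0"
    using 0 by (intro emeasure_UN_eq_0) (auto simp: sets_mu)
  ultimately show False using nonzero by simp
qed


definition q :: real where "q = 1 / (1 + 1 / C^2)"

lemma q_bounds: "0 < q" "q < 1"
  using C_pos by (auto simp: q_def field_simps add_pos_pos)

text \<open>A disc of radius r/4 placed at distance r/2 from z is disjoint from the inner disc and
  inside the outer one. Two doublings bound the measure of the inner disc by C^2 times that of the
  new one. Hence the inner disc holds at most the fraction 1 / (1 + 1/C^2), which is
  \<open>q\<close>.\<close>

lemma m_reverse: assumes "r > 0" shows "m z (r/4) \<le> q * m z r"
proof -
  define w where "w = z + complex_of_real (r/2)"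
  have d: "dist z w = r/2" using assms by (simp add: w_def dist_norm)
  have "m z (r/4) \<le> m w (2^2*(r/4))" by (rule m_mono) (use d assms in simp)
  also have "\<dots> \<le> C^2 * m w (r/4)" by (rule m_dbl_pow) (use assms in simp)
  finally have 1: "m z (r/4) / C^2 \<le> m w (r/4)" using C_pos by (simp add: field_simps)
  have dj: "ball z (r/4) \<inter> ball w (r/4) = {}"
  proof -
    have False if "dist z x < r/4" "dist w x < r/4" for x
      using that d dist_triangle2[of z w x] by linarith
    then show ?thesis by auto
  qed
  have "m z (r/4) + m w (r/4) = measure \<mu> (ball z (r/4) \<union> ball w (r/4))"
    using dj finite_bounded[of "ball z (r/4)"] finite_bounded[of "ball w (r/4)"]
    by (intro measure_Union[symmetric]) (auto simp: sets_mu)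
  also have "\<dots> \<le> m z r"
  proof (rule measure_mono_b)
    show "ball z (r/4) \<union> ball w (r/4) \<subseteq> ball z r"
    proof
      fix x assume "x \<in> ball z (r/4) \<union> ball w (r/4)"
      then have "dist z x < r/4 \<or> dist w x < r/4" by auto
      then show "x \<in> ball z r"
        using assms d dist_triangle[of z x w] unfolding mem_ball by linarith
    qed
  qed auto
  finally have "m z (r/4) * (1 + 1/C^2) \<le> m z r" using 1 by (simp add: algebra_simps)
  moreover have "1 + 1/C^2 > 0" using C_pos by (simp add: add_pos_pos)
  ultimately show ?thesis by (simp add: q_def field_simps)
qed

lemma m_reverse_pow: assumes "r > 0" shows "m z (r/4^k) \<le> q^k * m z r"
proof (induction k)
  case (Suc k)
  have "m z (r/4^Suc k) \<le> q * m z (r/4^k)" using m_reverse[of "r/4^k" z] assms by (simp add: field_simps)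
  also have "\<dots> \<le> q * (q^k * m z r)" using Suc q_bounds by (intro mult_left_mono) auto
  finally show ?case by (simp add: mult.assoc)
qed simp

lemma point_null: "measure \<mu> {z} = 0"
proof -
  have b: "measure \<mu> {z} \<le> q^k * m z 1" for k
    using measure_mono_b[of "{z}" "ball z (1/4^k)"] m_reverse_pow[of 1 z k] by simp
  have "(\<lambda>k. q^k * m z 1) \<longlonglongrightarrow> 0 * m z 1"
    using q_bounds by (intro tendsto_intros LIMSEQ_realpow_zero) auto
  then have "measure \<mu> {z} \<le> 0" using LIMSEQ_le_const[of _ _ "measure \<mu> {z}"] b by fastforce
  then show ?thesis using measure_nonneg[of \<mu> "{z}"] by linarith
qed

text \<open>Vitali covering of the circle by small discs, each of which is then pushed inwards. The
  pushed discs stay disjoint inside a thin annulus and have comparable measure, so the circle is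
  controlled by the annulus just inside it.\<close>

lemma sphere_bound:
  assumes r: "r > 0" and e: "e > 0" "e \<le> r/8"
  shows "measure \<mu> (sphere z r) \<le> C^5 * measure \<mu> (ball z r - cball z (r - 5*e))"
proof -
  have "compact (sphere z r)" by simp
  moreover have "sphere z r \<subseteq> \<Union> ((\<lambda>t. ball t e) ` sphere z r)" using e by auto
  ultimately obtain T where T: "T \<subseteq> sphere z r" "finite T" "sphere z r \<subseteq> \<Union> ((\<lambda>t. ball t e) ` T)"
    using compactE_image[of "sphere z r" "sphere z r" "\<lambda>t. ball t e"] by (metis open_ball)
  obtain D where D: "D \<subseteq> T" "pairwise (\<lambda>i j. disjnt (ball i e) (ball j e)) D"
      "(\<Union>i\<in>T. ball i e) \<subseteq> (\<Union>i\<in>D. ball i (5*e))"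
  proof -
    obtain D where D: "D \<subseteq> T" "pairwise (\<lambda>i j. disjnt (cball i e) (cball j e)) D"
      "\<And>i. i \<in> T \<Longrightarrow> \<exists>j. j \<in> D \<and> \<not> disjnt (cball i e) (cball j e) \<and> cball i e \<subseteq> ball j (5 * e)"
      using Vitali_covering_lemma_cballs_balls[of T "\<lambda>t. e" e "\<lambda>t. t"] e(1) by (metis order_refl)
    have "pairwise (\<lambda>i j. disjnt (ball i e) (ball j e)) D"
      using D(2) ball_subset_cball unfolding pairwise_def disjnt_def by blast
    moreover have "(\<Union>i\<in>T. ball i e) \<subseteq> (\<Union>i\<in>D. ball i (5*e))"
      using D(3) ball_subset_cball by blast
    ultimately show ?thesis using that D(1) by blast
  qed
  have fD: "finite D" using D(1) T(2) finite_subset by blast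
  \<comment> \<open>Contraction towards z by 1 - l moves points of the circle inwards by 4e. Since l
    \<le> 1/2, distances shrink at most by half: centres at distance at least 2e remain e apart, and
    discs of radius e/2 about them are disjoint.\<close>
  define l where "l = 4*e/r"
  have l: "0 < l" "l \<le> 1/2" "l * r = 4*e" using r e by (auto simp: l_def field_simps)
  define s where "s t = z + complex_of_real (1 - l) * (t - z)" for t
  have tr: "norm (t - z) = r" if "t \<in> D" for t
    using that D(1) T(1) by (force simp: dist_norm norm_minus_commute)
  have ds: "dist t (s t) = 4*e" if "t \<in> D" for t
  proof -
    have "t - s t = complex_of_real l * (t - z)" by (simp add: s_def algebra_simps)
    then show ?thesis using tr[OF that] l by (simp add: dist_norm norm_mult)
  qed
  have "measure \<mu> (sphere z r) \<le> measure \<mu> (\<Union>i\<in>D. ball i (5*e))"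
    by (rule measure_mono_b) (use T(3) D(3) fD in \<open>auto intro: bounded_UN\<close>)
  also have "\<dots> \<le> (\<Sum>i\<in>D. m i (5*e))"
    by (rule measure_UNION_le) (auto simp: fD sets_mu)
  also have "\<dots> \<le> (\<Sum>i\<in>D. C^5 * m (s i) (e/2))"
  proof (rule sum_mono)
    fix i assume i: "i \<in> D"
    \<comment> \<open>The disc of radius 5e about i lies within 9e of the pushed centre; five
      doublings of e/2 reach 16e.\<close>
    have "m i (5*e) \<le> m (s i) (2^5*(e/2))" by (rule m_mono) (use ds[OF i] e in simp)
    also have "\<dots> \<le> C^5 * m (s i) (e/2)" by (rule m_dbl_pow) (use e in simp)
    finally show "m i (5*e) \<le> C^5 * m (s i) (e/2)" .
  qed
  also have "\<dots> = C^5 * (\<Sum>i\<in>D. m (s i) (e/2))" by (simp add: sum_distrib_left)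
  also have "(\<Sum>i\<in>D. m (s i) (e/2)) = measure \<mu> (\<Union>i\<in>D. ball (s i) (e/2))"
  proof (rule measure_finite_Union[symmetric, OF fD])
    show "disjoint_family_on (\<lambda>i. ball (s i) (e/2)) D"
      unfolding disjoint_family_on_def
    proof (intro ballI impI)
      fix i j assume ij: "i \<in> D" "j \<in> D" "i \<noteq> j"
      have "dist i j \<ge> 2*e"
      proof (rule ccontr)
        assume "\<not> dist i j \<ge> 2*e"
        then have "midpoint i j \<in> ball i e \<inter> ball j e"
          by (simp add: dist_midpoint)
        moreover have "ball i e \<inter> ball j e = {}"
          using D(2) ij unfolding pairwise_def disjnt_def by blast
        ultimately show False by blast
      qed
      moreover have "dist (s i) (s j) = (1 - l) * dist i j"
      proof -
        have "s i - s j = complex_of_real (1 - l) * (i - j)" by (simp add: s_def algebra_simps)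
        then show ?thesis using l by (simp add: dist_norm norm_mult del: of_real_diff)
      qed
      moreover have "(1 - l) * dist i j \<ge> 1/2 * dist i j" using l by (intro mult_right_mono) auto
      ultimately have dij: "dist (s i) (s j) \<ge> e" by linarith
      have False if "dist (s i) x < e/2" "dist (s j) x < e/2" for x
        using that dij dist_triangle2[of "s i" "s j" x] by linarith
      then show "ball (s i) (e/2) \<inter> ball (s j) (e/2) = {}" by auto
    qed
    show "emeasure \<mu> (ball (s i) (e/2)) \<noteq> \<infinity>" for i using finite_bounded[of "ball (s i) (e/2)"] by auto
  qed (auto simp: sets_mu)
  also have "\<dots> \<le> measure \<mu> (ball z r - cball z (r - 5*e))"
  proof (rule measure_mono_b)
    show "(\<Union>i\<in>D. ball (s i) (e/2)) \<subseteq> ball z r - cball z (r - 5*e)"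
    proof
      fix x assume "x \<in> (\<Union>i\<in>D. ball (s i) (e/2))"
      then obtain i where i: "i \<in> D" "dist (s i) x < e/2" by auto
      have "dist z (s i) = r - 4*e"
      proof -
        have "dist z (s i) = (1 - l) * r" using tr[OF i(1)] l
          by (simp add: s_def dist_norm norm_mult del: of_real_diff)
        then show ?thesis using l(3) by (simp add: algebra_simps)
      qed
      then show "x \<in> ball z r - cball z (r - 5*e)"
        using i(2) e dist_triangle[of z x "s i"] dist_triangle2[of z "s i" x] by auto
    qed
  qed (use fD in auto)
  finally show ?thesis using C_pos by (simp add: mult_left_mono)
qed

text \<open>The annuli of \<open>sphere_bound\<close> decrease to the empty set. Null circles make
  the measure of a disc continuous in its radius, which is why a radius of measure exactly 1
  exists.\<close>

lemma sphere_null: assumes "r > 0" shows "measure \<mu> (sphere z r) = 0"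
proof -
  define A where "A n = ball z r - cball z (r - 5*(r/8/real (Suc n)))" for n
  have "(\<lambda>n. measure \<mu> (A n)) \<longlonglongrightarrow> measure \<mu> (\<Inter>n. A n)"
  proof (rule Lim_measure_decseq)
    show "range A \<subseteq> sets \<mu>" by (auto simp: A_def sets_mu)
    show "decseq A"
    proof (rule decseq_SucI)
      fix n
      have "r/8/real (Suc (Suc n)) \<le> r/8/real (Suc n)" using assms by (intro divide_left_mono) auto
      then show "A (Suc n) \<le> A n" unfolding A_def by auto
    qed
    show "emeasure \<mu> (A n) \<noteq> \<infinity>" for n
      using finite_bounded[of "A n"] bounded_subset[OF bounded_ball, of "A n" z r] by (auto simp: A_def)
  qed
  moreover have "(\<Inter>n. A n) = {}"
  proof -
    have False if x: "\<And>n. x \<in> A n" for x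
    proof -
      have x1: "dist z x < r" "\<And>n. dist z x > r - 5*(r/8/real (Suc n))"
        using x[unfolded A_def] by (simp, metis DiffD2 mem_cball not_le)
      obtain n where "inverse (real (Suc n)) < (r - dist z x) / r"
        using reals_Archimedean[of "(r - dist z x) / r"] x1 assms by auto
      then have "r / real (Suc n) < r - dist z x" using assms by (simp add: field_simps)
      moreover have "5*(r/8/real (Suc n)) \<le> r / real (Suc n)" using assms by (simp add: field_simps)
      ultimately show False using x1(2)[of n] by linarith
    qed
    then show ?thesis by blast
  qed
  ultimately have "(\<lambda>n. C^5 * measure \<mu> (A n)) \<longlonglongrightarrow> C^5 * 0" by (intro tendsto_intros) simp
  moreover have "measure \<mu> (sphere z r) \<le> C^5 * measure \<mu> (A n)" for n
    unfolding A_def by (rule sphere_bound) (use assms in \<open>auto simp: field_simps\<close>)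
  ultimately have "measure \<mu> (sphere z r) \<le> 0" using LIMSEQ_le_const[of _ _ "measure \<mu> (sphere z r)"] by fastforce
  then show ?thesis using measure_nonneg[of \<mu> "sphere z r"] by linarith
qed

lemma measure_cball: "r > 0 \<Longrightarrow> measure \<mu> (cball z r) = m z r"
proof -
  assume r: "r > 0"
  have "measure \<mu> (ball z r \<union> sphere z r) = m z r + measure \<mu> (sphere z r)"
    by (rule measure_Union) (use finite_bounded[of "ball z r"] finite_bounded[of "sphere z r"] in \<open>auto simp: sets_mu\<close>)
  moreover have "ball z r \<union> sphere z r = cball z r" by auto
  ultimately show ?thesis using sphere_null[OF r] by simp
qed

text \<open>A disc fits into the annulus between the two radii and has positive measure. Strict
  growth gives uniqueness of the radius \<rho>.\<close>

lemma m_strict: assumes "0 < r" "r < s" shows "m z r < m z s"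
proof -
  define w where "w = z + complex_of_real ((r+s)/2)"
  have d: "dist z w = (r+s)/2" using assms by (simp add: w_def dist_norm del: of_real_add of_real_divide)
  define e where "e = (s-r)/2"
  have e: "e > 0" using assms by (simp add: e_def)
  have dj: "ball z r \<inter> ball w e = {}"
  proof -
    have False if "dist z x < r" "dist w x < e" for x
      using that d dist_triangle2[of z w x] unfolding e_def by (simp add: field_simps)
    then show ?thesis by auto
  qed
  have "m z r + m w e = measure \<mu> (ball z r \<union> ball w e)"
    using dj finite_bounded[of "ball z r"] finite_bounded[of "ball w e"]
    by (intro measure_Union[symmetric]) (auto simp: sets_mu)
  also have "\<dots> \<le> m z s"
  proof (rule measure_mono_b)
    show "ball z r \<union> ball w e \<subseteq> ball z s"
    proof
      fix x assume "x \<in> ball z r \<union> ball w e"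
      then show "x \<in> ball z s"
        using assms d dist_triangle[of z x w] unfolding e_def by (auto simp: field_simps)
    qed
  qed auto
  finally show ?thesis using m_pos[OF e, of w] by linarith
qed

lemma m_large:
  assumes "r > 0" shows "\<exists>k. m z (4^k * r) \<ge> B"
proof -
  note that = assms
  have "m z r / (\<bar>B\<bar> + 1) > 0" using m_pos[OF that, of z] by simp
  then obtain k where k: "q^k < m z r / (\<bar>B\<bar> + 1)"
    using real_arch_pow_inv[of "m z r / (\<bar>B\<bar> + 1)" q] q_bounds by auto
  have "m z r \<le> q^k * m z (4^k*r)" using m_reverse_pow[of "4^k*r" z k] that by simp
  then have "m z r / q^k \<le> m z (4^k*r)" using q_bounds by (simp add: field_simps)
  moreover have "\<bar>B\<bar> + 1 \<le> m z r / q^k" using k q_bounds by (simp add: field_simps add_pos_nonneg)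
  ultimately show ?thesis by (intro exI[of _ k]) linarith
qed

text \<open>The radius is the supremum of all radii of measure at most 1. Exhaustion by smaller
  discs gives measure at most 1 there; shrinking larger discs gives measure at least 1 for the
  closed disc, and its boundary is null.\<close>

lemma rho_ex: "\<exists>!r. r > 0 \<and> emeasure \<mu> (ball z r) = 1"
proof -
  obtain k where k: "q^k < 1 / m z 1"
    using real_arch_pow_inv[of "1 / m z 1" q] q_bounds m_pos[of 1 z] by force
  define r0 :: real where "r0 = 1/4^k"
  have r0: "r0 > 0" "m z r0 < 1"
  proof -
    have "m z r0 \<le> q^k * m z 1" using m_reverse_pow[of 1 z k] by (simp add: r0_def)
    also have "\<dots> < 1" using k m_pos[of 1 z] by (simp add: field_simps)
    finally show "m z r0 < 1" .
  qed (simp add: r0_def)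
  obtain k' where k': "m z (4^k' * 1) \<ge> 2" using m_large[where r=1 and z=z and B=2] by auto
  define S where "S = {r. r > 0 \<and> m z r \<le> 1}"
  have r0S: "r0 \<in> S" using r0 by (simp add: S_def)
  have bdd: "bdd_above S"
  proof (rule bdd_aboveI[of _ "4^k'"])
    fix r assume "r \<in> S"
    show "r \<le> 4^k'"
    proof (rule ccontr)
      assume "\<not> ?thesis"
      then have "m z (4^k') \<le> m z r" by (intro m_mono) simp
      then show False using k' \<open>r \<in> S\<close> by (simp add: S_def)
    qed
  qed
  define R where "R = Sup S"
  have R: "R > 0" using cSup_upper[OF r0S bdd] r0 by (simp add: R_def)
  have below: "m z r \<le> 1" if rR: "r < R" for r
  proof -
    obtain s where "s \<in> S" "r < s" using rR less_cSup_iff[of S r] r0S bdd unfolding R_def by blast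
    then show ?thesis using m_mono[of z z r s] by (simp add: S_def)
  qed
  have "m z R \<le> 1"
  proof -
    define A where "A n = ball z (R - 1 / real (Suc n))" for n
    have "(\<lambda>n. measure \<mu> (A n)) \<longlonglongrightarrow> measure \<mu> (\<Union>n. A n)"
    proof (rule Lim_measure_incseq)
      show "incseq A" unfolding A_def by (intro incseq_SucI subset_ball) (simp add: field_simps)
      have "(\<Union>n. A n) \<subseteq> ball z R"
        unfolding A_def by (intro UN_least subset_ball) simp
      then have "bounded (\<Union>n. A n)" by (rule bounded_subset[OF bounded_ball])
      then have "emeasure \<mu> (\<Union>n. A n) < \<infinity>"
        by (rule finite_bounded) (auto simp: A_def)
      then show "emeasure \<mu> (\<Union>n. A n) \<noteq> \<infinity>" by simp
    qed (auto simp: A_def sets_mu)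
    moreover have "(\<Union>n. A n) = ball z R"
    proof
      show "(\<Union>n. A n) \<subseteq> ball z R"
        unfolding A_def by (intro UN_least subset_ball) simp
      show "ball z R \<subseteq> (\<Union>n. A n)"
      proof
        fix x assume "x \<in> ball z R"
        then obtain n where "inverse (real (Suc n)) < R - dist z x" using reals_Archimedean[of "R - dist z x"] by auto
        then have "x \<in> A n" by (simp add: A_def inverse_eq_divide)
        then show "x \<in> (\<Union>n. A n)" by blast
      qed
    qed
    ultimately have "(\<lambda>n. measure \<mu> (A n)) \<longlonglongrightarrow> m z R" by simp
    moreover have "measure \<mu> (A n) \<le> 1" for n unfolding A_def by (rule below) simp
    ultimately show ?thesis using LIMSEQ_le_const2 by blast
  qed
  moreover have "m z R \<ge> 1"
  proof -
    define A where "A n = ball z (R + 1 / real (Suc n))" for n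
    have "(\<lambda>n. measure \<mu> (A n)) \<longlonglongrightarrow> measure \<mu> (\<Inter>n. A n)"
    proof (rule Lim_measure_decseq)
      show "decseq A" unfolding A_def by (intro decseq_SucI subset_ball) (simp add: field_simps)
      show "emeasure \<mu> (A n) \<noteq> \<infinity>" for n using finite_bounded[of "A n"] by (auto simp: A_def)
    qed (auto simp: A_def sets_mu)
    moreover have "(\<Inter>n. A n) = cball z R"
    proof
      show "cball z R \<subseteq> (\<Inter>n. A n)"
      proof
        fix x assume "x \<in> cball z R"
        then show "x \<in> (\<Inter>n. A n)" by (auto simp: A_def intro: le_less_trans)
      qed
      show "(\<Inter>n. A n) \<subseteq> cball z R"
      proof
        fix x assume x: "x \<in> (\<Inter>n. A n)"
        show "x \<in> cball z R"
        proof (rule ccontr)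
          assume "x \<notin> cball z R"
          then obtain n where "inverse (real (Suc n)) < dist z x - R" using reals_Archimedean[of "dist z x - R"] by auto
          moreover have "dist z x < R + 1 / real (Suc n)" using x by (auto simp: A_def)
          ultimately show False by (simp add: inverse_eq_divide)
        qed
      qed
    qed
    ultimately have "(\<lambda>n. measure \<mu> (A n)) \<longlonglongrightarrow> m z R" by (simp add: measure_cball[OF R])
    moreover have "measure \<mu> (A n) \<ge> 1" for n
    proof (rule ccontr)
      assume "\<not> ?thesis"
      then have "R + 1 / real (Suc n) \<in> S" using R by (simp add: S_def A_def add_pos_pos)
      then have "R + 1 / real (Suc n) \<le> R" unfolding R_def by (rule cSup_upper[OF _ bdd])
      then show False by simp
    qed
    ultimately show ?thesis using LIMSEQ_le_const by blast
  qed
  ultimately have mR: "m z R = 1" by simp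
  show ?thesis
  proof (rule ex1I[of _ R])
    show "R > 0 \<and> emeasure \<mu> (ball z R) = 1" using R mR by (simp add: m_eq)
    fix r assume r: "r > 0 \<and> emeasure \<mu> (ball z r) = 1"
    then have "m z r = 1" by (simp add: measure_def)
    then show "r = R" using m_strict[of r R z] m_strict[of R r z] r R mR by (cases r R rule: linorder_cases) auto
  qed
qed

abbreviation \<rho> :: "complex \<Rightarrow> real" where "\<rho> \<equiv> rho \<mu>"

lemma rho_pos: "\<rho> z > 0" and rho_m: "m z (\<rho> z) = 1"
  using theI'[OF rho_ex[of z]] by (auto simp: rho_def measure_def)

lemma rho_le_iff: "r > 0 \<Longrightarrow> \<rho> z \<le> r \<longleftrightarrow> 1 \<le> m z r"
  using m_strict[of r "\<rho> z" z] m_mono[of z z "\<rho> z" r] rho_pos[of z] rho_m[of z] by (cases "\<rho> z \<le> r") auto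

lemma rho_lipschitz: "\<rho> z \<le> \<rho> w + dist z w"
proof -
  have "m w (\<rho> w) \<le> m z (\<rho> w + dist z w)" by (rule m_mono) (simp add: dist_commute)
  then show ?thesis using rho_pos[of w] rho_m[of w] by (subst rho_le_iff) (auto intro: add_pos_nonneg)
qed

lemma rho_continuous: "continuous_on S \<rho>"
proof (rule continuous_on_subset[OF _ subset_UNIV])
  have "\<bar>\<rho> z - \<rho> w\<bar> \<le> dist z w" for z w
    using rho_lipschitz[of z w] rho_lipschitz[of w z] by (simp add: dist_commute abs_le_iff)
  then show "continuous_on UNIV \<rho>"
    unfolding continuous_on_iff dist_real_def using le_less_trans by blast
qed

end

section \<open>Truncated logarithms and their integrals against the measure\<close>

definition lg :: "real \<Rightarrow> complex \<Rightarrow> real" where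
  "lg R \<zeta> = (if \<zeta> \<noteq> 0 \<and> norm \<zeta> < R then ln (R / norm \<zeta>) else 0)"

lemma lg_nonneg: "lg R \<zeta> \<ge> 0"
  by (auto simp: lg_def)

lemma lg_mono: "R \<le> S \<Longrightarrow> lg R \<zeta> \<le> lg S \<zeta>"
proof -
  assume RS: "R \<le> S"
  show ?thesis
  proof (cases "\<zeta> \<noteq> 0 \<and> norm \<zeta> < R")
    case True
    then have "norm \<zeta> > 0" "R > 0" by (auto intro: le_less_trans[OF norm_ge_zero])
    then have "ln (R / norm \<zeta>) \<le> ln (S / norm \<zeta>)"
      using RS by (subst ln_le_cancel_iff) (auto intro: divide_right_mono)
    then show ?thesis using True RS by (simp add: lg_def)
  next
    case False
    then have "lg R \<zeta> = 0" by (auto simp: lg_def)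
    then show ?thesis using lg_nonneg by simp
  qed
qed

lemma lg_measurable [measurable]: "lg R \<in> borel_measurable borel"
  unfolding lg_def[abs_def] by measurable

text \<open>The gain in potential when a unit mass at 0 is swept over the disc of radius r:
  nonnegative and supported in that disc. The value at 0 is a convention, harmless because \<mu> has
  no atoms.\<close>

definition kap :: "real \<Rightarrow> complex \<Rightarrow> real" where
  "kap r \<zeta> = (if \<zeta> = 0 then 0 else LL r \<zeta> - ln (norm \<zeta>) / (2 * pi))"

lemma kap_nonneg: "r > 0 \<Longrightarrow> kap r \<zeta> \<ge> 0"
  using LL_ge_ln by (simp add: kap_def)

lemma kap_outside: "r > 0 \<Longrightarrow> norm \<zeta> \<ge> r \<Longrightarrow> kap r \<zeta> = 0"
  by (simp add: kap_def LL_outside)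

lemma kap_le: "r > 0 \<Longrightarrow> kap r \<zeta> \<le> lg r \<zeta>"
proof -
  assume r: "r > 0"
  consider "\<zeta> = 0" | "norm \<zeta> \<ge> r" | "\<zeta> \<noteq> 0" "norm \<zeta> < r" by linarith
  then show ?thesis
  proof cases
    case 1 then show ?thesis by (simp add: kap_def lg_def)
  next
    case 2 then show ?thesis using kap_outside[OF r 2] lg_nonneg by simp
  next
    case 3
    have "kap r \<zeta> \<le> (ln r - ln (norm \<zeta>)) / (2 * pi)"
      using LL_le[OF r, of \<zeta>] 3 by (simp add: kap_def diff_divide_distrib)
    also have "\<dots> \<le> (ln r - ln (norm \<zeta>)) / 1"
      using 3 r pi_gt3 by (intro divide_left_mono) auto
    finally show ?thesis using 3 r by (simp add: lg_def ln_div)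
  qed
qed

lemma LL_diff_kap: "\<zeta> \<noteq> 0 \<Longrightarrow> LL r \<zeta> - LL s \<zeta> = kap r \<zeta> - kap s \<zeta>"
  by (simp add: kap_def)

context doubling_measure
begin

text \<open>Slice by the discs of radius R / 4^k: the logarithm gains at most ln 4 from one to the
  next, and their measures decay like q^k by reverse doubling. The geometric series gives the factor
  ln 4 / (1 - q).\<close>

lemma lg_integral:
  assumes R: "R > 0"
  shows "integrable \<mu> (\<lambda>w. lg R (z - w))" "(LINT w|\<mu>. lg R (z - w)) \<le> ln 4 / (1 - q) * m z R"
proof -
  have mm [measurable_cong]: "sets \<mu> = sets borel" by (rule sets_mu)
  have mb [measurable]: "(\<lambda>w. lg R (z - w)) \<in> borel_measurable \<mu>" by measurable
  have pw: "ennreal (lg R (z - w)) \<le> (\<Sum>k. ennreal (ln 4) * indicator (ball z (R/4^k)) w)" for w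
  proof (cases "z - w \<noteq> 0 \<and> norm (z - w) < R")
    case True
    define t where "t = norm (z - w)"
    have t: "0 < t" "t < R" using True by (auto simp: t_def)
    obtain n where n: "(1/4)^n < t / R" using real_arch_pow_inv[of "t/R" "1/4"] t R by auto
    \<comment> \<open>By minimality w lies in the discs with index below k, each contributing ln 4,
      while ln (R/t) \<le> k ln 4.\<close>
    define k where "k = (LEAST n. R/4^n \<le> t)"
    have "R/4^n \<le> t" using n R by (simp add: field_simps power_divide)
    then have k: "R/4^k \<le> t" unfolding k_def by (rule LeastI)
    have less: "t < R/4^j" if "j < k" for j
      using not_less_Least[of j "\<lambda>n. R/4^n \<le> t"] that by (simp add: k_def)
    have "ln (R/t) \<le> ln (4^k)"
      using k t R by (subst ln_le_cancel_iff) (auto simp: field_simps)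
    then have "lg R (z - w) \<le> (\<Sum>j<k. ln 4)"
      using True by (simp add: lg_def t_def ln_realpow)
    then have "ennreal (lg R (z - w)) \<le> (\<Sum>j<k. ennreal (ln 4))"
      by (simp add: sum_ennreal ennreal_leI flip: ennreal_of_nat_eq_real_of_nat ennreal_mult)
         (simp add: ennreal_leI ennreal_mult ennreal_of_nat_eq_real_of_nat flip: ennreal_mult)
    also have "\<dots> = (\<Sum>j<k. ennreal (ln 4) * indicator (ball z (R/4^j)) w)"
      by (intro sum.cong) (use less in \<open>auto simp: t_def dist_norm\<close>)
    also have "\<dots> \<le> (\<Sum>j. ennreal (ln 4) * indicator (ball z (R/4^j)) w)"
      by (rule sum_le_suminf) auto
    finally show ?thesis .
  next
    case False
    then have "lg R (z - w) = 0" by (auto simp: lg_def)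
    then show ?thesis by simp
  qed
  have "(\<integral>\<^sup>+ w. lg R (z - w) \<partial>\<mu>) \<le> (\<integral>\<^sup>+ w. (\<Sum>k. ennreal (ln 4) * indicator (ball z (R/4^k)) w) \<partial>\<mu>)"
    by (intro nn_integral_mono pw)
  also have "\<dots> = (\<Sum>k. ennreal (ln 4) * emeasure \<mu> (ball z (R/4^k)))"
    by (subst nn_integral_suminf)
       (auto simp: nn_integral_cmult_indicator sets_mu intro!: borel_measurable_times_ennreal borel_measurable_indicator)
  also have "\<dots> \<le> (\<Sum>k. ennreal (ln 4 * m z R * q^k))"
  proof (intro suminf_le allI)
    fix k
    have "ln 4 * m z (R/4^k) \<le> ln 4 * (q^k * m z R)"
      by (intro mult_left_mono m_reverse_pow R) auto
    then show "ennreal (ln 4) * emeasure \<mu> (ball z (R/4^k)) \<le> ennreal (ln 4 * m z R * q^k)"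
      by (simp add: m_eq ennreal_leI mult.commute mult.left_commute flip: ennreal_mult)
  qed auto
  also have "\<dots> = ennreal (ln 4 * m z R * (1 / (1 - q)))"
  proof -
    have "(\<lambda>k. ln 4 * m z R * q^k) sums (ln 4 * m z R * (1 / (1 - q)))"
      using q_bounds by (intro sums_mult geometric_sums) auto
    then show ?thesis
      using q_bounds by (intro suminf_ennreal_eq) auto
  qed
  finally have b: "(\<integral>\<^sup>+ w. lg R (z - w) \<partial>\<mu>) \<le> ennreal (ln 4 / (1 - q) * m z R)"
    by (simp add: mult.commute)
  then have "(\<integral>\<^sup>+ w. lg R (z - w) \<partial>\<mu>) < \<infinity>" using le_less_trans by fastforce
  then show i: "integrable \<mu> (\<lambda>w. lg R (z - w))"
    by (intro integrableI_nonneg mb) (auto simp: lg_nonneg)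
  have "(LINT w|\<mu>. lg R (z - w)) = enn2real (\<integral>\<^sup>+ w. lg R (z - w) \<partial>\<mu>)"
    by (rule integral_eq_nn_integral[OF mb]) (simp add: lg_nonneg)
  also have "\<dots> \<le> ln 4 / (1 - q) * m z R"
    using b q_bounds by (intro enn2real_leI) (auto intro!: mult_nonneg_nonneg divide_nonneg_pos)
  finally show "(LINT w|\<mu>. lg R (z - w)) \<le> ln 4 / (1 - q) * m z R" .
qed

text \<open>Since \<rho> is 1-Lipschitz, a fraction of \<rho> below 1 keeps the scale comparable at
  every point of the swept disc. The value 1/8 leaves room for the numerical estimates in
  \<open>near_rad\<close> and \<open>dens_lower\<close>.\<close>

definition rad :: "complex \<Rightarrow> real" where "rad w = \<rho> w / 8"

lemma rad_pos: "rad w > 0" using rho_pos by (simp add: rad_def)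

lemma rad_continuous: "continuous_on S rad"
  unfolding rad_def[abs_def] by (intro continuous_intros rho_continuous) auto

lemma near_rad: assumes "norm (z - w) < rad w" shows "\<rho> w \<le> 8/7 * \<rho> z" "norm (z - w) < \<rho> z / 7"
  using rho_lipschitz[of w z] assms by (auto simp: rad_def dist_norm norm_minus_commute)

lemma kap_rad_le: "kap (rad w) (z - w) \<le> lg (\<rho> z) (z - w)"
proof (cases "norm (z - w) < rad w")
  case True
  have "rad w \<le> \<rho> z" using near_rad[OF True] rho_pos[of z] by (simp add: rad_def)
  then show ?thesis using kap_le[OF rad_pos, of w "z - w"] lg_mono[of "rad w" "\<rho> z" "z - w"] by linarith
next
  case False
  then show ?thesis using kap_outside[OF rad_pos] lg_nonneg by simp
qed

definition logconst :: real where "logconst = ln 4 / (1 - q)"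

lemma kap_measurable:
  assumes "continuous_on UNIV r" "\<And>w. r w > 0"
  shows "(\<lambda>w. kap (r w) (z - w)) \<in> borel_measurable \<mu>"
proof -
  have [measurable]: "r \<in> borel_measurable borel" using assms(1) by (rule borel_measurable_continuous_onI)
  have [measurable]: "Gfun \<in> borel_measurable borel"
    using Gfun_continuous by (rule borel_measurable_continuous_onI)
  have "(\<lambda>w. kap (r w) (z - w)) \<in> borel_measurable borel"
    unfolding kap_def LL_def nq_norm by measurable
  then show ?thesis by (simp add: sets_mu cong: measurable_cong_sets)
qed

text \<open>Only centres w closer to z than \<rho>(z) contribute, and that disc has measure 1. This
  is what makes the bound independent of z.\<close>

lemma kap_rad_integral:
  shows "integrable \<mu> (\<lambda>w. kap (rad w) (z - w))"
    "0 \<le> (LINT w|\<mu>. kap (rad w) (z - w))" "(LINT w|\<mu>. kap (rad w) (z - w)) \<le> logconst"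
proof -
  show i: "integrable \<mu> (\<lambda>w. kap (rad w) (z - w))"
    by (rule Bochner_Integration.integrable_bound[OF lg_integral(1)[OF rho_pos[of z]] kap_measurable[OF rad_continuous rad_pos]])
       (use kap_rad_le kap_nonneg[OF rad_pos] lg_nonneg in auto)
  show "0 \<le> (LINT w|\<mu>. kap (rad w) (z - w))"
    by (rule Bochner_Integration.integral_nonneg) (rule kap_nonneg[OF rad_pos])
  have "(LINT w|\<mu>. kap (rad w) (z - w)) \<le> (LINT w|\<mu>. lg (\<rho> z) (z - w))"
    by (rule integral_mono[OF i lg_integral(1)[OF rho_pos] kap_rad_le])
  also have "\<dots> \<le> logconst" using lg_integral(2)[OF rho_pos, of z z] by (simp add: rho_m logconst_def)
  finally show "(LINT w|\<mu>. kap (rad w) (z - w)) \<le> logconst" .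
qed

lemma kap_integrable:
  assumes "r > 0" shows "integrable \<mu> (\<lambda>w. kap r (z - w))" "(LINT w|\<mu>. kap r (z - w)) \<le> logconst * m z r"
proof -
  show i: "integrable \<mu> (\<lambda>w. kap r (z - w))"
    by (rule Bochner_Integration.integrable_bound[OF lg_integral(1)[OF assms] kap_measurable])
       (use kap_le[OF assms] kap_nonneg[OF assms] lg_nonneg assms in auto)
  have "(LINT w|\<mu>. kap r (z - w)) \<le> (LINT w|\<mu>. lg r (z - w))"
    by (rule integral_mono[OF i lg_integral(1)[OF assms] kap_le[OF assms]])
  also have "\<dots> \<le> logconst * m z r" using lg_integral(2)[OF assms, of z] by (simp add: logconst_def)
  finally show "(LINT w|\<mu>. kap r (z - w)) \<le> logconst * m z r" .
qed

lemma AE_neq: "AE w in \<mu>. z - w \<noteq> 0"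
proof -
  have "{z} \<in> null_sets \<mu>"
    using point_null[of z] finite_bounded[of "{z}"]
    by (auto simp: null_sets_def sets_mu emeasure_eq_ennreal_measure)
  from AE_not_in[OF this] show ?thesis by eventually_elim auto
qed

lemma locint_mu_cc: assumes "continuous_on UNIV v" shows "locint \<mu> v"
  unfolding locint_def
proof (intro conjI allI)
  show mb: "v \<in> borel_measurable \<mu>"
    using borel_measurable_continuous_onI[OF assms] by (simp add: sets_mu cong: measurable_cong_sets)
  fix R
  have "compact (v ` cball 0 R)"
    by (intro compact_continuous_image continuous_on_subset[OF assms]) auto
  then obtain B where B: "\<forall>x\<in>v ` cball 0 R. norm x \<le> B" using compact_imp_bounded bounded_iff by metis
  show "integrable \<mu> (\<lambda>w. indicat_real (cball 0 R) w * v w)"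
  proof (rule Bochner_Integration.integrable_bound[where f="\<lambda>w. B * indicat_real (cball 0 R) w"])
    show "integrable \<mu> (\<lambda>w. B * indicat_real (cball 0 R) w)"
      by (intro integrable_mult_right integrable_real_indicator) (use finite_bounded[of "cball 0 R"] in \<open>auto simp: sets_mu\<close>)
    show "(\<lambda>w. indicat_real (cball 0 R) w * v w) \<in> borel_measurable \<mu>"
      by (intro borel_measurable_times borel_measurable_indicator mb) (simp add: sets_mu)
    show "AE w in \<mu>. norm (indicat_real (cball 0 R) w * v w) \<le> norm (B * indicat_real (cball 0 R) w)"
    proof (rule AE_I2)
      fix w show "norm (indicat_real (cball 0 R) w * v w) \<le> norm (B * indicat_real (cball 0 R) w)"
        using B[rule_format, of "v w"] by (cases "norm w \<le> R") auto
    qed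
  qed
qed

end

section \<open>The regularised weight\<close>

lemma D1_reflect: "D1 f fx fy \<Longrightarrow> D1 (\<lambda>z. f (w - z)) (\<lambda>z. - fx (w - z)) (\<lambda>z. - fy (w - z))"
  unfolding D1_def
proof
  fix z assume "\<forall>z. (f has_derivative (\<lambda>h. Re h * fx z + Im h * fy z)) (at z)"
  then have "(f has_derivative (\<lambda>h. Re h * fx (w-z) + Im h * fy (w-z))) (at (w-z))" by blast
  moreover have "((\<lambda>z. w - z) has_derivative (\<lambda>h. -h)) (at z)"
    by (auto intro!: derivative_eq_intros)
  ultimately show "((\<lambda>z. f (w - z)) has_derivative (\<lambda>h. Re h * - fx (w-z) + Im h * - fy (w-z))) (at z)"
    using diff_chain_at[of "\<lambda>z. w - z" "\<lambda>h. -h" z f "\<lambda>h. Re h * fx (w-z) + Im h * fy (w-z)"]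
    by (simp add: o_def)
qed

lemma eta_even: "eta r (w - z) = eta r (z - w)"
  by (simp add: eta_def nq_norm norm_minus_commute)

lemma LL_even: "LL r (w - z) = LL r (z - w)"
  by (simp add: LL_def nq_norm norm_minus_commute)

lemma LL_diff_support:
  assumes "r > 0" "s > 0" "norm z > max r s"
  shows "LL r z - LL s z = 0" "LLx r z - LLx s z = 0" "LLy r z - LLy s z = 0"
    "LLxx r z - LLxx s z = 0" "LLxy r z - LLxy s z = 0" "LLyy r z - LLyy s z = 0"
proof -
  note c = LL_diff_C2[of r s]
  have 0: "LL r z - LL s z = 0" if "norm z > max r s" for z
    using that assms by (simp add: LL_outside)
  have d: "LLx r z - LLx s z = 0" "LLy r z - LLy s z = 0" if "norm z > max r s" for z
    using that 0 by (rule_tac D1_support[OF C2_D(1)[OF c], of "max r s"]; blast)+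
  have d1: "LLxx r z - LLxx s z = 0" "LLxy r z - LLxy s z = 0" "LLyy r z - LLyy s z = 0" if "norm z > max r s" for z
    using that d D1_support[OF C2_D(2)[OF c], of "max r s" z] D1_support[OF C2_D(3)[OF c], of "max r s" z] by blast+
  show "LL r z - LL s z = 0" "LLx r z - LLx s z = 0" "LLy r z - LLy s z = 0"
    "LLxx r z - LLxx s z = 0" "LLxy r z - LLxy s z = 0" "LLyy r z - LLyy s z = 0"
    using assms(3) 0 d d1 by blast+
qed

lemma LL_joint_continuous:
  fixes r :: "complex \<Rightarrow> real"
  assumes r: "continuous_on UNIV r" "\<And>w. r w > 0"
  shows "jcont (\<lambda>z w. LL (r w) (z - w))" "jcont (\<lambda>z w. LLx (r w) (z - w))" "jcont (\<lambda>z w. LLy (r w) (z - w))"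
    "jcont (\<lambda>z w. LLxx (r w) (z - w))" "jcont (\<lambda>z w. LLxy (r w) (z - w))" "jcont (\<lambda>z w. LLyy (r w) (z - w))"
    "jcont (\<lambda>z w. eta (r w) (z - w))"
proof -
  have nz: "r w \<noteq> 0" for w using r(2)[of w] by simp
  have rc: "continuous_on UNIV (\<lambda>p::complex \<times> complex. r (snd p))"
    by (rule continuous_on_compose2[OF r(1)]) (auto intro!: continuous_intros)
  have i: "continuous_on UNIV (\<lambda>p::complex \<times> complex. inverse ((r (snd p))\<^sup>2))"
    by (intro continuous_intros rc) (use nz in auto)
  have n: "continuous_on UNIV (\<lambda>p::complex \<times> complex. nq (r (snd p)) (fst p - snd p))"
    unfolding nq_def by (intro continuous_intros rc) (use nz in auto)
  note c = continuous_on_compose2[OF Gfun_continuous[of UNIV] n] continuous_on_compose2[OF slope_continuous[of UNIV] n]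
    continuous_on_compose2[OF slope'_continuous[of UNIV] n] continuous_on_compose2[OF step_continuous(2)[of UNIV] n]
  note c' = c[simplified]
  show "jcont (\<lambda>z w. LL (r w) (z - w))"
    unfolding jcont_def LL_def by (intro continuous_intros c' rc) (use nz in auto)
  show "jcont (\<lambda>z w. LLx (r w) (z - w))" "jcont (\<lambda>z w. LLy (r w) (z - w))"
    "jcont (\<lambda>z w. LLxx (r w) (z - w))" "jcont (\<lambda>z w. LLxy (r w) (z - w))" "jcont (\<lambda>z w. LLyy (r w) (z - w))"
    unfolding jcont_def LLx_def LLy_def LLxx_def LLxy_def LLyy_def
    by (intro continuous_intros c' i)+
  have ip: "continuous_on UNIV (\<lambda>p::complex \<times> complex. inverse (pi * (r (snd p))\<^sup>2))"
    by (intro continuous_intros rc) (use nz in auto)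
  show "jcont (\<lambda>z w. eta (r w) (z - w))"
    unfolding jcont_def eta_def by (intro continuous_on_mult c' ip)
qed

lemma jcont_diff: "jcont k \<Longrightarrow> jcont l \<Longrightarrow> jcont (\<lambda>z w. k z w - l z w)"
  unfolding jcont_def by (intro continuous_intros)

lemma kernel_integral_C2:
  assumes M: "sets M = sets borel" and v: "locint M v"
    and k: "jcont k" "jcont kx" "jcont ky" "jcont kxx" "jcont kxy" "jcont kyy"
    and s: "jsupp k v" "jsupp kx v" "jsupp ky v" "jsupp kxx v" "jsupp kxy v" "jsupp kyy v"
    and D: "\<And>w. C2 (\<lambda>z. k z w) (\<lambda>z. kx z w) (\<lambda>z. ky z w) (\<lambda>z. kxx z w) (\<lambda>z. kxy z w) (\<lambda>z. kyy z w)"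
  shows "C2 (\<lambda>z. LINT w|M. k z w * v w) (\<lambda>z. LINT w|M. kx z w * v w) (\<lambda>z. LINT w|M. ky z w * v w)
     (\<lambda>z. LINT w|M. kxx z w * v w) (\<lambda>z. LINT w|M. kxy z w * v w) (\<lambda>z. LINT w|M. kyy z w * v w)"
  unfolding C2_def
  by (intro conjI kernel_integral_D1[OF M v] kernel_integral_continuous[OF M v] k s C2_D(1-3)[OF D])

locale laplace_weight = doubling_measure +
  fixes \<phi> :: "complex \<Rightarrow> real"
  assumes phi_meas: "\<phi> \<in> borel_measurable borel"
    and phi_lap: "is_laplacian \<phi> \<mu>"
begin

lemma phi_test:
  assumes "test_fun t"
  shows "integrable lborel (\<lambda>z. \<phi> z * lap t z)" "integrable \<mu> t" "(LINT z|lborel. \<phi> z * lap t z) = (LINT z|\<mu>. t z)"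
  using phi_lap assms unfolding is_laplacian_def by blast+

text \<open>Local integrability is extracted from the integrability clause for test functions. The
  Laplacian of \<open>LL 8 - LL 2\<close> is bounded below by a positive constant on the annulus of
  radii 5 to 7, so testing with its translates controls \<phi> on unit discs.\<close>

lemma phi_locint: "locint lborel \<phi>"
proof -
  define K where "K = {\<zeta>::complex. 5 \<le> norm \<zeta> \<and> norm \<zeta> \<le> 7}"
  have Kc: "compact K"
  proof -
    have "K = cball 0 7 - ball 0 5" by (auto simp: K_def)
    then show ?thesis by (simp add: compact_diff)
  qed
  have "\<exists>x\<in>K. \<forall>y\<in>K. eta 8 x \<le> eta 8 y"
    by (rule continuous_attains_inf[OF Kc _ eta_continuous]) (auto simp: K_def intro!: exI[of _ 6])
  then obtain x where x: "x \<in> K" "\<And>y. y \<in> K \<Longrightarrow> eta 8 x \<le> eta 8 y" by blast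
  define c where "c = eta 8 x"
  have c: "c > 0"
  proof -
    have "(5/8)\<^sup>2 \<le> (norm x / 8)\<^sup>2" "(norm x / 8)\<^sup>2 \<le> (7/8)\<^sup>2" using x(1) by (intro power_mono; simp add: K_def)+
    then show ?thesis by (simp add: c_def eta_def nq_norm step'_pos power2_eq_square)
  qed
  have loc: "integrable lborel (\<lambda>w. indicat_real (cball p 1) w * \<phi> w)" for p
  proof -
    \<comment> \<open>Seen from p - 6, the unit disc about p lies in the annulus of radii 5 to 7,
      where \<open>eta 2\<close> vanishes and \<open>eta 8\<close> is at least c.\<close>
    define z where "z = p - 6"
    have i: "integrable lborel (\<lambda>w. (1/c) * (\<phi> w * (eta 8 (w - z) - eta 2 (w - z))))"
      using phi_test(1)[OF test_fun_LL(1)[of 8 2 z]] unfolding test_fun_LL(2)[of 8 2 z, simplified]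
      by (intro integrable_mult_right) simp
    show ?thesis
    proof (rule Bochner_Integration.integrable_bound[OF i])
      show "(\<lambda>w. indicat_real (cball p 1) w * \<phi> w) \<in> borel_measurable lborel"
        using phi_meas by (intro borel_measurable_times borel_measurable_indicator) auto
      show "AE w in lborel. norm (indicat_real (cball p 1) w * \<phi> w) \<le> norm ((1/c) * (\<phi> w * (eta 8 (w - z) - eta 2 (w - z))))"
      proof (rule AE_I2)
        fix w
        show "norm (indicat_real (cball p 1) w * \<phi> w) \<le> norm ((1/c) * (\<phi> w * (eta 8 (w - z) - eta 2 (w - z))))"
        proof (cases "w \<in> cball p 1")
          case True
          then have "norm (w - p) \<le> 1" by (simp add: dist_norm norm_minus_commute)
          moreover have "norm (w - z) = norm ((w - p) + 6)" by (rule arg_cong[of _ _ norm]) (simp add: z_def)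
          ultimately have n: "5 \<le> norm (w - z)" "norm (w - z) \<le> 7"
            using norm_triangle_ineq[of "w - p" 6] norm_diff_ineq[of 6 "w - p"]
            unfolding add.commute[of 6] by simp_all
          then have "c \<le> eta 8 (w - z) - eta 2 (w - z)"
            using x(2)[of "w - z"] eta_outside[of 2 "w - z"] by (simp add: c_def K_def)
          then have "1 \<le> (1/c) * (eta 8 (w - z) - eta 2 (w - z))" using c by (simp add: field_simps)
          then have "\<bar>\<phi> w\<bar> * 1 \<le> \<bar>\<phi> w\<bar> * ((1/c) * (eta 8 (w - z) - eta 2 (w - z)))" by (intro mult_left_mono) auto
          also have "\<dots> \<le> norm ((1/c) * (\<phi> w * (eta 8 (w - z) - eta 2 (w - z))))"
            using c by (simp add: abs_mult divide_right_mono mult_left_mono)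
          finally show ?thesis using True by simp
        qed auto
      qed
    qed
  qed
  show ?thesis
    unfolding locint_def
  proof (intro conjI allI)
    show pm: "\<phi> \<in> borel_measurable lborel" using phi_meas by simp
    fix R :: real
    have "cball 0 R \<subseteq> \<Union> ((\<lambda>p. ball p 1) ` cball (0::complex) R)" by auto
    then obtain T where T: "finite T" "cball (0::complex) R \<subseteq> \<Union> ((\<lambda>p. ball p 1) ` T)"
      using compactE_image[of "cball (0::complex) R" "cball 0 R" "\<lambda>p. ball p 1"] by (metis compact_cball open_ball)
    have i: "integrable lborel (\<lambda>w. \<Sum>p\<in>T. \<bar>indicat_real (cball p 1) w * \<phi> w\<bar>)"
      by (intro Bochner_Integration.integrable_sum integrable_abs loc)
    show "integrable lborel (\<lambda>w. indicat_real (cball 0 R) w * \<phi> w)"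
    proof (rule Bochner_Integration.integrable_bound[OF i])
      show "(\<lambda>w. indicat_real (cball 0 R) w * \<phi> w) \<in> borel_measurable lborel"
        using phi_meas by (intro borel_measurable_times borel_measurable_indicator) auto
      show "AE w in lborel. norm (indicat_real (cball 0 R) w * \<phi> w) \<le> norm (\<Sum>p\<in>T. \<bar>indicat_real (cball p 1) w * \<phi> w\<bar>)"
      proof (rule AE_I2)
        fix w
        show "norm (indicat_real (cball 0 R) w * \<phi> w) \<le> norm (\<Sum>p\<in>T. \<bar>indicat_real (cball p 1) w * \<phi> w\<bar>)"
        proof (cases "w \<in> cball 0 R")
          case True
          then obtain p where p: "p \<in> T" "w \<in> ball p 1" using T(2) by auto
          have "\<bar>indicat_real (cball p 1) w * \<phi> w\<bar> \<le> (\<Sum>p\<in>T. \<bar>indicat_real (cball p 1) w * \<phi> w\<bar>)"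
            by (rule member_le_sum[OF p(1)]) (auto simp: T(1))
          then show ?thesis using True p(2) by auto
        qed auto
      qed
    qed
  qed
qed

definition Av :: "real \<Rightarrow> complex \<Rightarrow> real" where
  "Av r z = (LINT w|lborel. eta r (z - w) * \<phi> w)"

lemma Av_continuous: "r > 0 \<Longrightarrow> continuous_on UNIV (Av r)"
  unfolding Av_def[abs_def]
  by (rule kernel_integral_continuous[OF sets_lborel phi_locint jcont_shift(1)[OF eta_continuous] jsupp_eta])

text \<open>The Laplacian identity tested with \<open>LL r - LL s\<close>. The logarithms cancel in
  the difference, which leaves the two localised gains off the \<mu>-null point z.\<close>

lemma Av_diff:
  assumes "r > 0" "s > 0"
  shows "Av r z - Av s z = (LINT w|\<mu>. kap r (z - w)) - (LINT w|\<mu>. kap s (z - w))"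
proof -
  have "Av r z - Av s z = (LINT w|lborel. eta r (z - w) * \<phi> w - eta s (z - w) * \<phi> w)"
    unfolding Av_def using assms
    by (intro Bochner_Integration.integral_diff[symmetric] mollify_integrable phi_locint) auto
  also have "\<dots> = (LINT w|lborel. \<phi> w * lap (\<lambda>w. LL r (w - z) - LL s (w - z)) w)"
    unfolding test_fun_LL(2)[OF assms] by (simp add: eta_even[of _ _ z] algebra_simps)
  also have "\<dots> = (LINT w|\<mu>. LL r (w - z) - LL s (w - z))"
    by (rule phi_test(3)[OF test_fun_LL(1)[OF assms]])
  also have "\<dots> = (LINT w|\<mu>. kap r (z - w) - kap s (z - w))"
  proof (rule integral_cong_AE)
    show "(\<lambda>w. LL r (w - z) - LL s (w - z)) \<in> borel_measurable \<mu>"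
      using phi_test(2)[OF test_fun_LL(1)[OF assms]] by auto
    show "(\<lambda>w. kap r (z - w) - kap s (z - w)) \<in> borel_measurable \<mu>"
      using kap_integrable(1)[OF assms(1)] kap_integrable(1)[OF assms(2)] by auto
    show "AE w in \<mu>. LL r (w - z) - LL s (w - z) = kap r (z - w) - kap s (z - w)"
      using AE_neq[of z] by eventually_elim (simp add: LL_diff_kap LL_even[of _ _ z])
  qed
  finally show ?thesis using kap_integrable(1) assms by simp
qed

text \<open>By \<open>Av_diff\<close> the averages at scale 4^(-n) equal the left side plus a gain
  that tends to 0 like q^n. They therefore converge everywhere, and \<open>mollify_limit_AE\<close>
  identifies the limit with \<phi> times \<open>mass\<close>.\<close>

lemma phi_representation: "AE z in lborel. Av 1 z - (LINT w|\<mu>. kap 1 (z - w)) = mass * \<phi> z"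
proof (rule mollify_limit_AE[OF phi_locint, of "\<lambda>n. 1 / 4^n"])
  have AvE: "Av (1/4^n) z = Av 1 z - (LINT w|\<mu>. kap 1 (z - w)) + (LINT w|\<mu>. kap (1/4^n) (z - w))" for n z
    using Av_diff[of 1 "1/4^n" z] by simp
  have kb: "0 \<le> (LINT w|\<mu>. kap (1/4^n) (z - w))" "(LINT w|\<mu>. kap (1/4^n) (z - w)) \<le> logconst * (q^n * m z 1)" for n z
  proof -
    show "0 \<le> (LINT w|\<mu>. kap (1/4^n) (z - w))" by (rule Bochner_Integration.integral_nonneg) (simp add: kap_nonneg)
    have "(LINT w|\<mu>. kap (1/4^n) (z - w)) \<le> logconst * m z (1/4^n)" by (rule kap_integrable) simp
    also have "\<dots> \<le> logconst * (q^n * m z 1)"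
      using m_reverse_pow[of 1 z n] q_bounds by (intro mult_left_mono) (auto simp: logconst_def)
    finally show "(LINT w|\<mu>. kap (1/4^n) (z - w)) \<le> logconst * (q^n * m z 1)" .
  qed
  show "(1::real) / 4^n > 0" for n by simp
  show "(\<lambda>n. 1 / 4^n) \<longlonglongrightarrow> (0::real)"
    using LIMSEQ_realpow_zero[of "1/4"] by (simp add: power_divide)
  have lc: "logconst \<ge> 0" using q_bounds by (simp add: logconst_def)
  fix z
  have "(\<lambda>n. LINT w|\<mu>. kap (1/4^n) (z - w)) \<longlonglongrightarrow> 0"
  proof (rule tendsto_sandwich[OF _ _ tendsto_const])
    show "(\<lambda>n. logconst * (q^n * m z 1)) \<longlonglongrightarrow> 0"
      using tendsto_mult[OF tendsto_const[of logconst] tendsto_mult[OF LIMSEQ_realpow_zero[of q] tendsto_const[of "m z 1"]]] q_bounds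
      by simp
  qed (use kb in auto)
  then have "(\<lambda>n. Av 1 z - (LINT w|\<mu>. kap 1 (z - w)) + (LINT w|\<mu>. kap (1/4^n) (z - w)))
     \<longlonglongrightarrow> Av 1 z - (LINT w|\<mu>. kap 1 (z - w)) + 0" by (intro tendsto_intros)
  then show "(\<lambda>n. LINT w|lborel. eta (1/4^n) (z - w) * \<phi> w) \<longlonglongrightarrow> Av 1 z - (LINT w|\<mu>. kap 1 (z - w))"
    unfolding AvE[symmetric] by (simp add: Av_def)
next
  fix R :: real
  have lc: "logconst \<ge> 0" using q_bounds by (simp add: logconst_def)
  have "compact (Av 1 ` cball 0 R)"
    by (intro compact_continuous_image continuous_on_subset[OF Av_continuous]) auto
  then obtain B where B: "\<forall>x\<in>Av 1 ` cball 0 R. norm x \<le> B" using compact_imp_bounded bounded_iff by metis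
  have "\<bar>Av (1/4^n) z\<bar> \<le> B + 2 * (logconst * m 0 (R + 1))" if z: "norm z \<le> R" for n z
  proof -
    have k: "0 \<le> (LINT w|\<mu>. kap r (z - w)) \<and> (LINT w|\<mu>. kap r (z - w)) \<le> logconst * m 0 (R + 1)" if r: "0 < r" "r \<le> 1" for r
    proof
      show "0 \<le> (LINT w|\<mu>. kap r (z - w))" by (rule Bochner_Integration.integral_nonneg) (simp add: kap_nonneg r)
      have "(LINT w|\<mu>. kap r (z - w)) \<le> logconst * m z r" by (rule kap_integrable[OF r(1)])
      also have "\<dots> \<le> logconst * m 0 (R + 1)" by (intro mult_left_mono lc m_mono) (use z r in \<open>auto simp: dist_norm\<close>)
      finally show "(LINT w|\<mu>. kap r (z - w)) \<le> logconst * m 0 (R + 1)" .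
    qed
    have "\<bar>Av 1 z\<bar> \<le> B" using B z by auto
    moreover have "Av 1 z - Av (1/4^n) z = (LINT w|\<mu>. kap 1 (z - w)) - (LINT w|\<mu>. kap (1/4^n) (z - w))"
      by (rule Av_diff) auto
    moreover have "0 \<le> (LINT w|\<mu>. kap 1 (z - w))" "(LINT w|\<mu>. kap 1 (z - w)) \<le> logconst * m 0 (R + 1)"
      using k[of 1] by auto
    moreover have "0 \<le> (LINT w|\<mu>. kap (1/4^n) (z - w))" "(LINT w|\<mu>. kap (1/4^n) (z - w)) \<le> logconst * m 0 (R + 1)"
      using k[of "1/4^n"] by auto
    ultimately show ?thesis by linarith
  qed
  then show "\<exists>B. \<forall>n z. norm z \<le> R \<longrightarrow> \<bar>LINT w|lborel. eta (1/4^n) (z - w) * \<phi> w\<bar> \<le> B"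
    unfolding Av_def by blast
qed

text \<open>The regularised weight: each point mass of \<open>\<mu>\<close> at \<open>w\<close> is swept radially over a disc of
  radius comparable to \<open>\<rho> w\<close>. The potential does not change outside that disc.\<close>

definition psi :: "complex \<Rightarrow> real" where
  "psi z = inverse mass * (Av 1 z - (LINT w|\<mu>. (LL 1 (z - w) - LL (rad w) (z - w)) * 1))"

definition dens :: "complex \<Rightarrow> real" where
  "dens z = inverse mass * (LINT w|\<mu>. eta (rad w) (z - w) * 1)"

text \<open>The unit-scale terms of \<open>psi\<close> recombine with the representation of \<phi>,
  so that \<open>psi\<close> minus \<phi> is the total gain from sweeping, divided by
  \<open>mass\<close>. It holds almost everywhere because the representation of \<phi> does.\<close>

lemma phi_psi: "AE z in lborel. \<phi> z \<le> psi z \<and> psi z \<le> \<phi> z + logconst / mass"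
  using phi_representation
proof eventually_elim
  case (elim z)
  have "(LINT w|\<mu>. (LL 1 (z - w) - LL (rad w) (z - w)) * 1) = (LINT w|\<mu>. kap 1 (z - w) - kap (rad w) (z - w))"
  proof (rule integral_cong_AE)
    have "continuous_on UNIV (\<lambda>w. LL 1 (z - w) - LL (rad w) (z - w))"
      by (rule jcont_snd[OF jcont_diff]) (auto intro: LL_joint_continuous rad_continuous rad_pos)
    then show "(\<lambda>w. (LL 1 (z - w) - LL (rad w) (z - w)) * 1) \<in> borel_measurable \<mu>"
      using borel_measurable_continuous_onI by (simp add: sets_mu cong: measurable_cong_sets)
    show "(\<lambda>w. kap 1 (z - w) - kap (rad w) (z - w)) \<in> borel_measurable \<mu>"
      using kap_integrable(1)[of 1] kap_rad_integral(1) by auto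
    show "AE w in \<mu>. (LL 1 (z - w) - LL (rad w) (z - w)) * 1 = kap 1 (z - w) - kap (rad w) (z - w)"
      using AE_neq[of z] by eventually_elim (simp add: LL_diff_kap)
  qed
  also have "\<dots> = (LINT w|\<mu>. kap 1 (z - w)) - (LINT w|\<mu>. kap (rad w) (z - w))"
    using kap_integrable(1)[of 1] kap_rad_integral(1) by simp
  finally have "psi z = \<phi> z + inverse mass * (LINT w|\<mu>. kap (rad w) (z - w))"
    using elim mass_pos by (simp add: psi_def field_simps)
  moreover have "inverse mass * (LINT w|\<mu>. kap (rad w) (z - w)) \<le> inverse mass * logconst"
    using kap_rad_integral(3) mass_pos by (intro mult_left_mono) auto
  moreover have "inverse mass * (LINT w|\<mu>. kap (rad w) (z - w)) \<ge> 0"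
    using kap_rad_integral(2) mass_pos by simp
  ultimately show ?case by (simp add: divide_inverse mult.commute)
qed

text \<open>Derivatives fall on the mollifier. Their Laplacian, integrated against \<phi>, is the
  distributional Laplacian tested with a translate of \<open>eta 1\<close>.\<close>

lemma Av_C2: "\<exists>fx fy fxx fxy fyy. C2 (Av 1) fx fy fxx fxy fyy \<and> (\<forall>z. fxx z + fyy z = (LINT w|\<mu>. eta 1 (z - w) * 1))"
proof -
  obtain ex ey exx exy eyy where e: "C2 (eta 1) ex ey exx exy eyy" using SM_C2[OF eta_SM] by blast
  note d = C2_D[OF e]
  have s0: "eta 1 z = 0" if "norm z > 1" for z using that by (simp add: eta_outside)
  note s1 = D1_support[OF d(1) s0]
  note s2 = D1_support[OF d(2) s1(1)] D1_support[OF d(3) s1(2)]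
  have js: "jsupp (\<lambda>z w. g (w - z)) \<phi>" if g: "\<And>z. norm z > 1 \<Longrightarrow> g z = 0" for g :: "complex \<Rightarrow> real"
    unfolding jsupp_def
  proof (intro allI)
    fix B
    have "g (w - z) = 0" if "norm z \<le> B" "norm w > B + 1" for z w
      using that norm_triangle_ineq2[of w z] by (intro g) simp
    then show "\<exists>R. \<forall>z w. norm z \<le> B \<longrightarrow> R < norm w \<longrightarrow> g (w - z) = 0 \<or> \<phi> w = 0" by blast
  qed
  have c: "C2 (\<lambda>z. LINT w|lborel. eta 1 (w - z) * \<phi> w) (\<lambda>z. LINT w|lborel. - ex (w - z) * \<phi> w) (\<lambda>z. LINT w|lborel. - ey (w - z) * \<phi> w)
     (\<lambda>z. LINT w|lborel. exx (w - z) * \<phi> w) (\<lambda>z. LINT w|lborel. exy (w - z) * \<phi> w) (\<lambda>z. LINT w|lborel. eyy (w - z) * \<phi> w)"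
  proof (rule kernel_integral_C2[OF sets_lborel phi_locint])
    show "jcont (\<lambda>z w. - ex (w - z))" "jcont (\<lambda>z w. - ey (w - z))"
      using jcont_shift(2)[of "\<lambda>z. - ex z"] jcont_shift(2)[of "\<lambda>z. - ey z"] d by (auto intro: continuous_intros)
    show "jsupp (\<lambda>z w. - ex (w - z)) \<phi>" "jsupp (\<lambda>z w. - ey (w - z)) \<phi>"
      using js[of "\<lambda>z. - ex z"] js[of "\<lambda>z. - ey z"] s1 by auto
    fix w
    have r: "D1 (\<lambda>z. - f (w - z)) (\<lambda>z. fx (w - z)) (\<lambda>z. fy (w - z))" if "D1 f fx fy" for f fx fy
      using D1_cmult[OF D1_reflect[OF that], of "-1" w] by simp
    have cc: "continuous_on UNIV (\<lambda>z. f (w - z))" if "continuous_on UNIV f" for f :: "complex \<Rightarrow> real"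
      by (rule continuous_on_compose2[OF that]) (auto intro!: continuous_intros)
    show "C2 (\<lambda>z. eta 1 (w - z)) (\<lambda>z. - ex (w - z)) (\<lambda>z. - ey (w - z)) (\<lambda>z. exx (w - z)) (\<lambda>z. exy (w - z)) (\<lambda>z. eyy (w - z))"
      unfolding C2_def by (intro conjI D1_reflect r cc d)
  qed (use d s0 s1 s2 in \<open>auto intro!: jcont_shift js\<close>)
  have l: "(LINT w|lborel. exx (w - z) * \<phi> w) + (LINT w|lborel. eyy (w - z) * \<phi> w) = (LINT w|\<mu>. eta 1 (z - w) * 1)" for z
  proof -
    have i: "integrable lborel (\<lambda>w. exx (w - z) * \<phi> w)" "integrable lborel (\<lambda>w. eyy (w - z) * \<phi> w)"
      by (rule kernel_bound(2)[OF sets_lborel phi_locint jcont_shift(2)[OF d(7)] js[OF s2(1)]]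
        kernel_bound(2)[OF sets_lborel phi_locint jcont_shift(2)[OF d(9)] js[OF s2(4)]]; assumption)+
    have "(LINT w|lborel. exx (w - z) * \<phi> w) + (LINT w|lborel. eyy (w - z) * \<phi> w) = (LINT w|lborel. \<phi> w * lap (\<lambda>w. eta 1 (w - z)) w)"
      unfolding C2_lap[OF C2_shift[OF e]] using i by (simp add: algebra_simps)
    also have "\<dots> = (LINT w|\<mu>. eta 1 (w - z))"
      by (rule phi_test(3)[OF test_fun_eta]) simp
    finally show ?thesis by (simp add: eta_even[of _ _ z])
  qed
  have e: "Av 1 = (\<lambda>z. LINT w|lborel. eta 1 (w - z) * \<phi> w)"
    by (rule ext) (simp only: Av_def eta_even)
  show ?thesis
    unfolding e by (intro exI conjI allI, rule c) (rule l)
qed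

text \<open>The radius \<open>rad w\<close> may grow with w, but it is only an eighth of \<rho>(w),
  and the Lipschitz bound then forces w to be close to z. So centres whose disc reaches a bounded
  set form a bounded set.\<close>

lemma jsupp_rad: 
  assumes "\<And>z w. norm (z - w) > max 1 (rad w) \<Longrightarrow> k z w = 0"
  shows "jsupp k v"
  unfolding jsupp_def
proof (intro allI)
  fix B
  have "k z w = 0" if z: "norm z \<le> B" and w: "norm w > B + 1 + (\<rho> 0 + B)" for z w
  proof (rule assms)
    have b: "norm (z - w) > 1 + (\<rho> 0 + B)" using z w norm_triangle_ineq2[of w z] by (simp add: norm_minus_commute)
    have "\<rho> z \<le> \<rho> 0 + B" using rho_lipschitz[of z 0] z by (simp add: dist_norm)
    then have "norm (z - w) > \<rho> z + 1" using b by linarith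
    moreover have "\<not> norm (z - w) < rad w" using near_rad(2)[of z w] rho_pos[of z] \<open>norm (z - w) > \<rho> z + 1\<close> by linarith
    moreover have "\<not> norm (z - w) = rad w"
    proof
      assume "norm (z - w) = rad w"
      moreover have "\<rho> w \<le> \<rho> z + norm (z - w)" using rho_lipschitz[of w z] by (simp add: dist_norm norm_minus_commute)
      ultimately show False using \<open>norm (z - w) > \<rho> z + 1\<close> rho_pos[of z] by (simp add: rad_def)
    qed
    ultimately show "norm (z - w) > max 1 (rad w)" using rho_pos[of z] by simp
  qed
  then show "\<exists>R. \<forall>z w. norm z \<le> B \<longrightarrow> R < norm w \<longrightarrow> k z w = 0 \<or> v w = 0" by blast
qed

lemma dens_kernel: "jcont (\<lambda>z w. eta (rad w) (z - w))" "jsupp (\<lambda>z w. eta (rad w) (z - w)) v"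
  by (auto intro!: LL_joint_continuous rad_continuous rad_pos jsupp_rad eta_outside)

lemma dens_integrable: "integrable \<mu> (\<lambda>w. eta (rad w) (z - w))"
  using kernel_bound(2)[OF sets_mu locint_mu_cc dens_kernel, of "\<lambda>w. 1"] by simp

text \<open>The average contributes \<mu> swept at unit scale; the correction removes exactly this
  and puts in \<mu> swept at scale \<open>rad\<close>.\<close>

lemma psi_C2: "\<exists>fx fy fxx fxy fyy. C2 psi fx fy fxx fxy fyy \<and> (\<forall>z. fxx z + fyy z = dens z)"
proof -
  obtain ax ay axx axy ayy where a: "C2 (Av 1) ax ay axx axy ayy" "\<And>z. axx z + ayy z = (LINT w|\<mu>. eta 1 (z - w) * 1)"
    using Av_C2 by blast
  have l1: "locint \<mu> (\<lambda>w. 1)" by (rule locint_mu_cc) simp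
  note jc = jcont_diff[OF LL_joint_continuous(1)[of "\<lambda>w. 1"] LL_joint_continuous(1)[OF rad_continuous rad_pos]]
     jcont_diff[OF LL_joint_continuous(2)[of "\<lambda>w. 1"] LL_joint_continuous(2)[OF rad_continuous rad_pos]]
     jcont_diff[OF LL_joint_continuous(3)[of "\<lambda>w. 1"] LL_joint_continuous(3)[OF rad_continuous rad_pos]]
     jcont_diff[OF LL_joint_continuous(4)[of "\<lambda>w. 1"] LL_joint_continuous(4)[OF rad_continuous rad_pos]]
     jcont_diff[OF LL_joint_continuous(5)[of "\<lambda>w. 1"] LL_joint_continuous(5)[OF rad_continuous rad_pos]]
     jcont_diff[OF LL_joint_continuous(6)[of "\<lambda>w. 1"] LL_joint_continuous(6)[OF rad_continuous rad_pos]]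
  note sp = LL_diff_support[OF zero_less_one rad_pos]
  have c: "C2 (\<lambda>z. LINT w|\<mu>. (LL 1 (z - w) - LL (rad w) (z - w)) * 1)
     (\<lambda>z. LINT w|\<mu>. (LLx 1 (z - w) - LLx (rad w) (z - w)) * 1) (\<lambda>z. LINT w|\<mu>. (LLy 1 (z - w) - LLy (rad w) (z - w)) * 1)
     (\<lambda>z. LINT w|\<mu>. (LLxx 1 (z - w) - LLxx (rad w) (z - w)) * 1) (\<lambda>z. LINT w|\<mu>. (LLxy 1 (z - w) - LLxy (rad w) (z - w)) * 1)
     (\<lambda>z. LINT w|\<mu>. (LLyy 1 (z - w) - LLyy (rad w) (z - w)) * 1)"
    by (rule kernel_integral_C2[OF sets_mu l1])
       (use jc sp C2_shift[OF LL_diff_C2] in \<open>auto intro!: jsupp_rad\<close>)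
  define bxx where "bxx z = (LINT w|\<mu>. (LLxx 1 (z - w) - LLxx (rad w) (z - w)) * 1)" for z
  define byy where "byy z = (LINT w|\<mu>. (LLyy 1 (z - w) - LLyy (rad w) (z - w)) * 1)" for z
  have b: "bxx z + byy z = (LINT w|\<mu>. eta 1 (z - w) * 1) - (LINT w|\<mu>. eta (rad w) (z - w) * 1)" for z
  proof -
    have i: "integrable \<mu> (\<lambda>w. (LLxx 1 (z - w) - LLxx (rad w) (z - w)) * 1)"
      by (rule kernel_bound(2)[OF sets_mu l1]) (use jc sp in \<open>auto intro!: jsupp_rad\<close>)
    have i': "integrable \<mu> (\<lambda>w. (LLyy 1 (z - w) - LLyy (rad w) (z - w)) * 1)"
      by (rule kernel_bound(2)[OF sets_mu l1]) (use jc sp in \<open>auto intro!: jsupp_rad\<close>)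
    have j: "integrable \<mu> (\<lambda>w. eta 1 (z - w) * 1)"
      by (rule kernel_bound(2)[OF sets_mu l1 jcont_shift(1)[OF eta_continuous] jsupp_eta]) simp
    have "bxx z + byy z = (LINT w|\<mu>. (LLxx 1 (z - w) + LLyy 1 (z - w)) - (LLxx (rad w) (z - w) + LLyy (rad w) (z - w)))"
      unfolding bxx_def byy_def using i i' by (simp add: Bochner_Integration.integral_add[symmetric] algebra_simps)
    also have "\<dots> = (LINT w|\<mu>. eta 1 (z - w) - eta (rad w) (z - w))"
      by (simp add: LL_lap rad_pos)
    finally show ?thesis using j dens_integrable by simp
  qed
  have "C2 psi (\<lambda>z. inverse mass * (ax z - (LINT w|\<mu>. (LLx 1 (z - w) - LLx (rad w) (z - w)) * 1)))
     (\<lambda>z. inverse mass * (ay z - (LINT w|\<mu>. (LLy 1 (z - w) - LLy (rad w) (z - w)) * 1)))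
     (\<lambda>z. inverse mass * (axx z - bxx z))
     (\<lambda>z. inverse mass * (axy z - (LINT w|\<mu>. (LLxy 1 (z - w) - LLxy (rad w) (z - w)) * 1)))
     (\<lambda>z. inverse mass * (ayy z - byy z))"
    unfolding psi_def[abs_def] bxx_def byy_def by (rule C2_cmult[OF C2_diff[OF a(1) c]])
  moreover have "inverse mass * (axx z - bxx z) + inverse mass * (ayy z - byy z) = dens z" for z
  proof -
    have "inverse mass * (axx z - bxx z) + inverse mass * (ayy z - byy z) = inverse mass * ((axx z + ayy z) - (bxx z + byy z))"
      by (simp add: algebra_simps)
    then show ?thesis unfolding a(2) b by (simp add: dens_def)
  qed
  ultimately show ?thesis by blast
qed

text \<open>It is enough to find one disc of radius \<rho>(z)/64 whose centres w see z in the middle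
  of their profile, where \<open>step'\<close> is bounded below. By doubling that disc carries a
  fixed fraction of the unit mass, and the mollifier has height of order 1 / \<rho>^2.\<close>

lemma dens_lower: "\<exists>c>0. \<forall>z. dens z \<ge> c / (\<rho> z)\<^sup>2"
proof -
  have "\<exists>x\<in>{3/10..99/100}. \<forall>y\<in>{3/10..99/100}. step' x \<le> step' y"
    by (rule continuous_attains_inf[OF _ _ step_continuous(2)]) auto
  then obtain x where x: "x \<in> {3/10..99/100}" "\<And>y. y \<in> {3/10..99/100} \<Longrightarrow> step' x \<le> step' y" by blast
  define c where "c = step' x"
  have c: "c > 0" using x(1) step'_pos[of x] by (simp add: c_def)
  have "dens z \<ge> (inverse mass * c / C^7) / (\<rho> z)\<^sup>2" for z
  proof -
    define r where "r = \<rho> z"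
    have r: "r > 0" using rho_pos by (simp add: r_def)
    \<comment> \<open>Points of the disc of radius r/64 about p have distance between 5r/64 and
      7r/64 from z. Divided by \<rho>(w)/8 this ratio lies between 0.56 and 0.99, with squares in
      the interval on which c was chosen.\<close>
    define p where "p = z + complex_of_real (3*r/32)"
    have dp: "dist z p = 3*r/32" using r by (simp add: p_def dist_norm)
    have "1 = m z r" by (simp add: r_def rho_m)
    also have "\<dots> \<le> m p (2^7*(r/64))" by (rule m_mono) (use dp r in simp)
    also have "\<dots> \<le> C^7 * m p (r/64)" by (rule m_dbl_pow) (use r in simp)
    finally have mp: "m p (r/64) \<ge> 1 / C^7" using C_pos by (simp add: field_simps)
    have e: "eta (rad w) (z - w) \<ge> c / r\<^sup>2 * indicator (ball p (r/64)) w" for w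
    proof (cases "w \<in> ball p (r/64)")
      case True
      define t where "t = dist z w"
      have t: "5/64*r \<le> t" "t \<le> 7/64*r"
        using True dp dist_triangle[of z w p] dist_triangle2[of z p w] by (auto simp: t_def)
      have rw: "\<rho> w \<le> r + t" "\<rho> w \<ge> r - t"
        using rho_lipschitz[of w z] rho_lipschitz[of z w] by (auto simp: r_def t_def dist_commute)
      have n: "nq (rad w) (z - w) = (8 * t / \<rho> w)\<^sup>2"
        by (simp add: nq_norm rad_def t_def dist_norm mult.commute)
      have "8 * t / \<rho> w \<ge> 56/100" using rw t rho_pos[of w] by (simp add: field_simps)
      moreover have "8 * t / \<rho> w \<le> 99/100" using rw t rho_pos[of w] by (simp add: field_simps)
      ultimately have "(56/100)\<^sup>2 \<le> (8 * t / \<rho> w)\<^sup>2" "(8 * t / \<rho> w)\<^sup>2 \<le> (99/100)\<^sup>2"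
        by (intro power_mono; simp add: t_def rho_pos less_imp_le)+
      then have s: "step' (nq (rad w) (z - w)) \<ge> c"
        unfolding n c_def by (intro x(2)) (auto simp: power2_eq_square)
      have "\<rho> w \<le> 2 * r" using rw t r by simp
      then have "(\<rho> w)\<^sup>2 \<le> (2 * r)\<^sup>2" using rho_pos[of w] by (intro power_mono) auto
      then have "pi * (rad w)\<^sup>2 \<le> 4 * (r\<^sup>2 / 16)"
        unfolding rad_def using pi_less_4 by (intro mult_mono) (auto simp: power_divide power_mult_distrib)
      then have "pi * (rad w)\<^sup>2 \<le> r\<^sup>2" by (rule order_trans) simp
      then have "inverse (pi * (rad w)\<^sup>2) \<ge> inverse (r\<^sup>2)"
        using rad_pos[of w] by (intro le_imp_inverse_le) auto
      then have "c * inverse (r\<^sup>2) \<le> eta (rad w) (z - w)"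
        unfolding eta_def using s c r by (intro mult_mono) (simp_all add: step'_nonneg)
      then have "c / r\<^sup>2 \<le> eta (rad w) (z - w)" by (simp only: divide_inverse)
      then show ?thesis using True by simp
    next
      case False
      then show ?thesis by (simp add: eta_nonneg)
    qed
    have "c / r\<^sup>2 * m p (r/64) = (LINT w|\<mu>. c / r\<^sup>2 * indicator (ball p (r/64)) w)"
      by (simp add: sets_mu)
    also have "\<dots> \<le> (LINT w|\<mu>. eta (rad w) (z - w))"
      by (rule integral_mono[OF _ dens_integrable e])
         (intro integrable_mult_right integrable_real_indicator, use finite_bounded[of "ball p (r/64)"] in \<open>auto simp: sets_mu\<close>)
    finally have "c / r\<^sup>2 * (1 / C^7) \<le> (LINT w|\<mu>. eta (rad w) (z - w))"
      using mp c mult_left_mono[OF mp, of "c / r\<^sup>2"] by simp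
    then have "inverse mass * (c / r\<^sup>2 * (1 / C^7)) \<le> inverse mass * (LINT w|\<mu>. eta (rad w) (z - w))"
      using mass_pos by (intro mult_left_mono) auto
    then show ?thesis by (simp add: dens_def r_def mult.assoc mult.left_commute mult.commute)
  qed
  moreover have "inverse mass * c / C^7 > 0" using c mass_pos C_pos by simp
  ultimately show ?thesis by blast
qed

end

text \<open>The function hx - i hy satisfies the Cauchy-Riemann equations by harmonicity and
  symmetry of the mixed partials. The real part of a primitive has the gradient of h and differs
  from h by a constant.\<close>

lemma harmonic_eq_Re_holomorphic:
  assumes c: "C2 h hx hy hxx hxy hyy" and l: "\<And>z. z \<in> ball a r \<Longrightarrow> hxx z + hyy z = 0"
  shows "\<exists>G. G holomorphic_on ball a r \<and> (\<forall>z\<in>ball a r. Re (G z) = h z)"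
proof -
  define f where "f z = complex_of_real (hx z) - \<i> * complex_of_real (hy z)" for z
  have fd: "(f has_field_derivative (complex_of_real (hxx z) - \<i> * complex_of_real (hxy z))) (at z)"
    if z: "z \<in> ball a r" for z
  proof -
    have "(f has_derivative (\<lambda>h. complex_of_real (Re h * hxx z + Im h * hxy z) - \<i> * complex_of_real (Re h * hxy z + Im h * hyy z))) (at z)"
      unfolding f_def[abs_def]
      by (intro has_derivative_diff has_derivative_mult_right has_derivative_of_real D1D[OF C2_D(2)[OF c]] D1D[OF C2_D(3)[OF c]])
    moreover have "(\<lambda>h. complex_of_real (Re h * hxx z + Im h * hxy z) - \<i> * complex_of_real (Re h * hxy z + Im h * hyy z))
        = (*) (complex_of_real (hxx z) - \<i> * complex_of_real (hxy z))"
    proof -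
      have "hyy z = - hxx z" using l[OF z] by simp
      then show ?thesis by (auto simp: fun_eq_iff complex_eq_iff algebra_simps)
    qed
    ultimately show ?thesis by (simp add: has_field_derivative_def)
  qed
  then have "f holomorphic_on ball a r"
    unfolding holomorphic_on_open[OF open_ball] using fd by blast
  then obtain g where g: "\<And>z. z \<in> ball a r \<Longrightarrow> (g has_field_derivative f z) (at z within ball a r)"
    using holomorphic_convex_primitive'[of "ball a r" f] convex_ball open_ball by blast
  have g': "(g has_field_derivative f z) (at z)" if "z \<in> ball a r" for z
    using g[OF that] unfolding at_within_open[OF that open_ball] .
  have "((\<lambda>z. Re (g z) - h z) has_derivative (\<lambda>h. 0)) (at z within ball a r)" if z: "z \<in> ball a r" for z
  proof -
    have "(g has_derivative (\<lambda>h. f z * h)) (at z)" using g'[OF z] by (simp add: has_field_derivative_def)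
    then have "((\<lambda>z. Re (g z) - h z) has_derivative (\<lambda>k. Re (f z * k) - (Re k * hx z + Im k * hy z))) (at z)"
      by (intro has_derivative_diff has_derivative_Re D1D[OF C2_D(1)[OF c]])
    moreover have "(\<lambda>k. Re (f z * k) - (Re k * hx z + Im k * hy z)) = (\<lambda>k. 0)"
      by (auto simp: f_def algebra_simps)
    ultimately show ?thesis using has_derivative_at_withinI by metis
  qed
  then obtain k where k: "\<And>z. z \<in> ball a r \<Longrightarrow> Re (g z) - h z = k"
    using has_derivative_zero_constant[OF convex_ball, of a r "\<lambda>z. Re (g z) - h z"] by blast
  show ?thesis
  proof (intro exI conjI ballI)
    show "(\<lambda>z. g z - complex_of_real k) holomorphic_on ball a r"
    proof (intro holomorphic_intros)
      show "g holomorphic_on ball a r" unfolding holomorphic_on_open[OF open_ball] using g' by blast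
    qed
    show "Re (g z - complex_of_real k) = h z" if "z \<in> ball a r" for z using k[OF that] by simp
  qed
qed

section \<open>Comparison of the scale at different points\<close>

context doubling_measure
begin

lemma m_two_rho: "m a (4 * \<rho> a) \<le> C^2"
  using m_dbl_pow[OF rho_pos[of a], of a 2] by (simp add: rho_m)

text \<open>If \<rho>(w) were below \<rho>(a) / 4^k, a disc of that radius about w would have
  measure at least 1. Reverse doubling inside the disc of radius 4 \<rho>(a), of measure at most
  C^2, makes it smaller than 1 once q^k < 1 / C^2.\<close>

lemma rho_comparable: "\<exists>c>0. c \<le> 1 \<and> (\<forall>a w. dist a w \<le> 2 * \<rho> a \<longrightarrow> c * \<rho> a \<le> \<rho> w)"
proof -
  obtain k where k: "q^k < 1 / C^2" using real_arch_pow_inv[of "1/C^2" q] q_bounds C_pos by auto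
  have "1 / 4^k * \<rho> a \<le> \<rho> w" if d: "dist a w \<le> 2 * \<rho> a" for a w
  proof (rule ccontr)
    assume "\<not> ?thesis"
    then have "1 \<le> m w (\<rho> a / 4^k)" using rho_le_iff[of "\<rho> a / 4^k" w] rho_pos[of a] by simp
    also have "\<dots> \<le> q^k * m w (\<rho> a)" by (rule m_reverse_pow[OF rho_pos])
    also have "\<dots> \<le> q^k * m a (4 * \<rho> a)"
      using d rho_pos[of a] q_bounds by (intro mult_left_mono m_mono) (auto simp: dist_commute)
    also have "\<dots> \<le> q^k * C^2" using q_bounds m_two_rho by (intro mult_left_mono) auto
    also have "\<dots> < 1" using k C_pos by (simp add: field_simps)
    finally show False by simp
  qed
  then show ?thesis by (intro exI[of _ "1/4^k"]) auto
qed

text \<open>The scale grows with arbitrarily small slope e, at the price of a large M. A disc of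
  radius M \<rho>(a) has measure at least q^(-k) with M = 4^k; it lies in the disc about z enlarged
  j times, and j halvings lose only C^j. In \<open>peak_function\<close> this absorbs the
  logarithmic term of the weight.\<close>

lemma rho_growth:
  assumes "e > 0" shows "\<exists>M\<ge>1. \<forall>a z. \<rho> z \<le> e * (M * \<rho> a + dist z a)"
proof -
  obtain j where j: "1 / e < 2^j" using real_arch_pow[of 2 "1/e"] by auto
  then have je: "2^j * e \<ge> 1" using assms by (simp add: field_simps)
  obtain k where k: "q^k < 1 / C^j" using real_arch_pow_inv[of "1/C^j" q] q_bounds C_pos by auto
  define M :: real where "M = 4^k"
  have M: "M \<ge> 1" by (simp add: M_def)
  have "\<rho> z \<le> e * (M * \<rho> a + dist z a)" for a z
  proof -
    define t where "t = e * (M * \<rho> a + dist z a)"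
    have t: "t > 0" using assms M rho_pos[of a] by (auto simp: t_def intro!: mult_pos_pos add_pos_nonneg)
    have "1 = m a (\<rho> a)" by (simp add: rho_m)
    also have "\<dots> \<le> q^k * m a (M * \<rho> a)"
      using m_reverse_pow[of "M * \<rho> a" a k] rho_pos[of a] by (simp add: M_def)
    also have "m a (M * \<rho> a) \<le> m z (2^j * t)"
    proof (rule m_mono)
      have "1 * (M * \<rho> a + dist z a) \<le> 2^j * e * (M * \<rho> a + dist z a)"
        using je M rho_pos[of a] by (intro mult_right_mono) auto
      then show "dist a z + M * \<rho> a \<le> 2^j * t" by (simp add: t_def mult.assoc dist_commute)
    qed
    also have "m z (2^j * t) \<le> C^j * m z t" by (rule m_dbl_pow[OF t])
    finally have "1 \<le> q^k * (C^j * m z t)" using q_bounds by (simp add: mult_left_mono)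
    also have "\<dots> \<le> 1 * m z t"
      unfolding mult.assoc[symmetric] using k C_pos by (intro mult_right_mono) (auto simp: field_simps)
    finally have "1 \<le> m z t" by simp
    then show ?thesis using rho_le_iff[OF t] by (simp add: t_def)
  qed
  then show ?thesis using M by blast
qed

end

section \<open>Local approximation of the regularised weight by harmonic functions\<close>

context laplace_weight
begin

lemma locint_indicator: "locint \<mu> (indicat_real (cball a r))"
  unfolding locint_def
proof (intro conjI allI)
  show "indicat_real (cball a r) \<in> borel_measurable \<mu>"
    by (intro borel_measurable_indicator) (simp add: sets_mu)
  fix R
  have "integrable \<mu> (indicat_real (cball 0 R \<inter> cball a r))"
    by (rule integrable_real_indicator) (use finite_bounded[of "cball 0 R \<inter> cball a r"] in \<open>auto simp: sets_mu\<close>)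
  moreover have "indicat_real (cball 0 R \<inter> cball a r) = (\<lambda>w. indicat_real (cball 0 R) w * indicat_real (cball a r) w)"
    by (auto simp: fun_eq_iff indicator_def)
  ultimately show "integrable \<mu> (\<lambda>w. indicat_real (cball 0 R) w * indicat_real (cball a r) w)"
    by simp
qed

text \<open>Subtracting the potential of the swept mass near a leaves a function harmonic on the
  disc of radius \<rho>(a), hence the real part of a holomorphic G. The subtracted potential is
  bounded: its mass is at most C^2, and at scale \<rho>(a) the smoothed logarithms are bounded above
  and below.\<close>

lemma psi_local: "\<exists>K\<ge>0. \<forall>a. \<exists>G. G holomorphic_on ball a (\<rho> a) \<and> (\<forall>z\<in>ball a (\<rho> a). \<bar>psi z - Re (G z)\<bar> \<le> K)"
proof -
  obtain c where c: "c > 0" "c \<le> 1" "\<And>a w. dist a w \<le> 2 * \<rho> a \<Longrightarrow> c * \<rho> a \<le> \<rho> w" using rho_comparable by blast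
  \<comment> \<open>The two terms bound the normalised kernel: from below because
    \<open>rad w\<close> is at least c/8 times the scale, from above because \<open>rad w\<close>
    and |z - w| are at most three times the scale.\<close>
  define B where "B = \<bar>Gfun 0 + ln (c/8) / (2*pi)\<bar> + ln 3 / (2*pi)"
  have B: "B \<ge> 0" by (simp add: B_def)
  define K where "K = inverse mass * (B * C^2)"
  have "\<exists>G. G holomorphic_on ball a (\<rho> a) \<and> (\<forall>z\<in>ball a (\<rho> a). \<bar>psi z - Re (G z)\<bar> \<le> K)" for a
  proof -
    define r where "r = \<rho> a"
    have r: "r > 0" using rho_pos by (simp add: r_def)
    \<comment> \<open>Twice the radius suffices: a swept disc that meets the disc of radius r about
      a has its centre within 2r of a.\<close>
    define v where "v = indicat_real (cball a (2*r))"
    have lv: "locint \<mu> v" unfolding v_def by (rule locint_indicator)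
    have v0: "v w = 0" if "norm w > norm a + 2*r" for w
      using that norm_triangle_ineq2[of w a] by (simp add: v_def dist_norm norm_minus_commute)
    have js: "jsupp k v" for k
      unfolding jsupp_def using v0 by blast
    note jc = LL_joint_continuous[OF rad_continuous rad_pos]
    have jk: "jcont (\<lambda>z w. LL (rad w) (z - w) - ln r / (2*pi))"
      using jc(1) unfolding jcont_def by (intro continuous_intros)
    \<comment> \<open>Subtracting ln r / (2 pi) turns the kernel into one of the scale-free ratio |z
      - w| / r. It alters U by a constant only, so the Laplacian is unaffected.\<close>
    define U where "U z = (LINT w|\<mu>. (LL (rad w) (z - w) - ln r / (2*pi)) * v w)" for z
    have cU: "C2 U (\<lambda>z. LINT w|\<mu>. LLx (rad w) (z - w) * v w) (\<lambda>z. LINT w|\<mu>. LLy (rad w) (z - w) * v w)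
      (\<lambda>z. LINT w|\<mu>. LLxx (rad w) (z - w) * v w) (\<lambda>z. LINT w|\<mu>. LLxy (rad w) (z - w) * v w) (\<lambda>z. LINT w|\<mu>. LLyy (rad w) (z - w) * v w)"
      unfolding U_def[abs_def]
    proof (rule kernel_integral_C2[OF sets_mu lv jk jc(2-6) js js js js js js])
      fix w
      show "C2 (\<lambda>z. LL (rad w) (z - w) - ln r / (2*pi)) (\<lambda>z. LLx (rad w) (z - w)) (\<lambda>z. LLy (rad w) (z - w))
          (\<lambda>z. LLxx (rad w) (z - w)) (\<lambda>z. LLxy (rad w) (z - w)) (\<lambda>z. LLyy (rad w) (z - w))"
        using C2_diff[OF C2_shift[OF LL_C2[of "rad w"], of w] C2_const[of "ln r / (2*pi)"]] by simp
    qed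
    have lU: "(LINT w|\<mu>. LLxx (rad w) (z - w) * v w) + (LINT w|\<mu>. LLyy (rad w) (z - w) * v w) = (LINT w|\<mu>. eta (rad w) (z - w) * 1)"
      if z: "z \<in> ball a r" for z
    proof -
      have i: "integrable \<mu> (\<lambda>w. LLxx (rad w) (z - w) * v w)" "integrable \<mu> (\<lambda>w. LLyy (rad w) (z - w) * v w)"
        by (rule kernel_bound(2)[OF sets_mu lv jc(4) js] kernel_bound(2)[OF sets_mu lv jc(6) js])+
      have "(LINT w|\<mu>. LLxx (rad w) (z - w) * v w) + (LINT w|\<mu>. LLyy (rad w) (z - w) * v w) = (LINT w|\<mu>. (LLxx (rad w) (z - w) + LLyy (rad w) (z - w)) * v w)"
        using i by (simp add: distrib_right)
      also have "\<dots> = (LINT w|\<mu>. eta (rad w) (z - w) * 1)"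
      proof (rule Bochner_Integration.integral_cong[OF refl])
        fix w
        show "(LLxx (rad w) (z - w) + LLyy (rad w) (z - w)) * v w = eta (rad w) (z - w) * 1"
        proof (cases "norm (z - w) < rad w")
          case True
          have "\<rho> z \<le> 2 * r" using rho_lipschitz[of z a] z by (simp add: r_def dist_commute)
          then have "norm (z - w) \<le> r" using near_rad(2)[OF True] rho_pos[of z] by linarith
          then have "dist a w \<le> 2*r" using z dist_triangle[of a w z] by (simp add: dist_norm)
          then show ?thesis by (simp add: v_def LL_lap rad_pos)
        next
          case False
          then show ?thesis by (simp add: LL_lap rad_pos eta_outside)
        qed
      qed
      finally show ?thesis .
    qed
    obtain fx fy fxx fxy fyy where p: "C2 psi fx fy fxx fxy fyy" "\<And>z. fxx z + fyy z = dens z" using psi_C2 by blast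
    obtain G where G: "G holomorphic_on ball a r" "\<And>z. z \<in> ball a r \<Longrightarrow> Re (G z) = psi z - inverse mass * U z"
      using harmonic_eq_Re_holomorphic[OF C2_diff[OF p(1) C2_cmult[OF cU, of "inverse mass"]], of a r]
    proof -
      have "fxx z - inverse mass * (LINT w|\<mu>. LLxx (rad w) (z - w) * v w) + (fyy z - inverse mass * (LINT w|\<mu>. LLyy (rad w) (z - w) * v w)) = 0"
        if "z \<in> ball a r" for z
      proof -
        have "fxx z - inverse mass * (LINT w|\<mu>. LLxx (rad w) (z - w) * v w) + (fyy z - inverse mass * (LINT w|\<mu>. LLyy (rad w) (z - w) * v w))
          = (fxx z + fyy z) - inverse mass * ((LINT w|\<mu>. LLxx (rad w) (z - w) * v w) + (LINT w|\<mu>. LLyy (rad w) (z - w) * v w))"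
          by (simp add: algebra_simps)
        then show ?thesis unfolding p(2) lU[OF that] by (simp add: dens_def)
      qed
      then show ?thesis
        using harmonic_eq_Re_holomorphic[OF C2_diff[OF p(1) C2_cmult[OF cU, of "inverse mass"]], of a r] that by blast
    qed
    have bU: "\<bar>U z\<bar> \<le> B * C^2" if z: "z \<in> ball a r" for z
    proof -
      have b: "\<bar>(LL (rad w) (z - w) - ln r / (2*pi)) * v w\<bar> \<le> B * indicat_real (cball a (2*r)) w" for w
      proof (cases "w \<in> cball a (2*r)")
        case True
        define s where "s = rad w"
        have s: "s > 0" using rad_pos by (simp add: s_def)
        have s1: "s \<ge> c/8 * r" using c(3)[of a w] True by (simp add: s_def rad_def r_def)
        have s2: "s \<le> 3 * r" using rho_lipschitz[of w a] True r by (simp add: s_def rad_def r_def dist_commute)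
        have "norm (z - w) \<le> dist a z + dist a w" using dist_triangle2[of z w a] by (simp add: dist_norm norm_minus_commute)
        then have zw: "norm (z - w) \<le> 3 * r" using z True by simp
        have "ln s \<ge> ln (c/8 * r)" using s1 c r s by (subst ln_le_cancel_iff) auto
        then have "ln s \<ge> ln (c/8) + ln r" using c r ln_mult[of "c/8" r] by simp
        then have "(ln (c/8) + ln r) / (2*pi) \<le> ln s / (2*pi)" by (intro divide_right_mono) auto
        then have lo: "LL s (z - w) - ln r / (2*pi) \<ge> Gfun 0 + ln (c/8) / (2*pi)"
          using LL_ge[of s "z - w"] by (simp add: add_divide_distrib)
        have "LL s (z - w) \<le> ln (3 * r) / (2*pi)"
        proof (cases "norm (z - w) \<le> s")
          case True
          have "LL s (z - w) \<le> ln s / (2*pi)" by (rule LL_le[OF s True])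
          also have "\<dots> \<le> ln (3*r) / (2*pi)" using s s2 r by (intro divide_right_mono) (auto simp: ln_le_cancel_iff)
          finally show ?thesis .
        next
          case False
          then have "LL s (z - w) = ln (norm (z - w)) / (2*pi)" by (intro LL_outside s) auto
          also have "\<dots> \<le> ln (3*r) / (2*pi)"
          proof (intro divide_right_mono)
            have "norm (z - w) > 0" using False s by linarith
            then show "ln (norm (z - w)) \<le> ln (3*r)" using zw r by (subst ln_le_cancel_iff) auto
          qed auto
          finally show ?thesis .
        qed
        then have up: "LL s (z - w) - ln r / (2*pi) \<le> ln 3 / (2*pi)"
          using r ln_mult[of 3 r] by (simp add: add_divide_distrib)
        have "0 \<le> ln 3 / (2*pi)" by simp
        then have "\<bar>LL s (z - w) - ln r / (2*pi)\<bar> \<le> B" using lo up unfolding B_def by linarith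
        then show ?thesis using True by (simp add: v_def s_def)
      qed (simp add: v_def)
      have i: "integrable \<mu> (\<lambda>w. (LL (rad w) (z - w) - ln r / (2*pi)) * v w)"
        by (rule kernel_bound(2)[OF sets_mu lv jk js])
      have i2: "integrable \<mu> (\<lambda>w. B * indicat_real (cball a (2*r)) w)"
        by (intro integrable_mult_right integrable_real_indicator) (use finite_bounded[of "cball a (2*r)"] in \<open>auto simp: sets_mu\<close>)
      have "\<bar>U z\<bar> \<le> (LINT w|\<mu>. \<bar>(LL (rad w) (z - w) - ln r / (2*pi)) * v w\<bar>)"
        unfolding U_def by (rule integral_abs_bound)
      also have "\<dots> \<le> (LINT w|\<mu>. B * indicat_real (cball a (2*r)) w)"
        by (rule integral_mono[OF integrable_abs[OF i] i2 b])
      also have "\<dots> = B * measure \<mu> (cball a (2*r))" by (simp add: sets_mu)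
      also have "\<dots> \<le> B * C^2"
      proof (intro mult_left_mono B)
        have "measure \<mu> (cball a (2*r)) \<le> m a (4*r)" by (rule measure_mono_b) (use r in \<open>auto simp: subset_iff\<close>)
        then show "measure \<mu> (cball a (2*r)) \<le> C^2" using m_two_rho[of a] by (simp add: r_def)
      qed
      finally show ?thesis .
    qed
    have "\<bar>psi z - Re (G z)\<bar> \<le> K" if "z \<in> ball a r" for z
    proof -
      have "\<bar>psi z - Re (G z)\<bar> = inverse mass * \<bar>U z\<bar>" using G(2)[OF that] mass_pos by (simp add: abs_mult)
      also have "\<dots> \<le> K" unfolding K_def using bU[OF that] mass_pos by (intro mult_left_mono) auto
      finally show ?thesis .
    qed
    then show ?thesis using G(1) by (auto simp: r_def)
  qed
  moreover have "K \<ge> 0" using B mass_pos C_pos by (simp add: K_def)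
  ultimately show ?thesis by blast
qed

end

section \<open>Square-integrable functions\<close>

text \<open>Functions rather than classes: \<open>nrm\<close> is a seminorm and almost-everywhere
  equality is stated explicitly, because members of the Fock space have to be genuine entire
  functions.\<close>

definition L2 :: "'a measure \<Rightarrow> ('a \<Rightarrow> complex) \<Rightarrow> bool" where
  "L2 M f \<longleftrightarrow> f \<in> borel_measurable M \<and> integrable M (\<lambda>x. (cmod (f x))\<^sup>2)"

definition ip :: "'a measure \<Rightarrow> ('a \<Rightarrow> complex) \<Rightarrow> ('a \<Rightarrow> complex) \<Rightarrow> complex" where
  "ip M f g = (LINT x|M. f x * cnj (g x))"

definition nrm :: "'a measure \<Rightarrow> ('a \<Rightarrow> complex) \<Rightarrow> real" where
  "nrm M f = sqrt (LINT x|M. (cmod (f x))\<^sup>2)"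

lemma L2_measurable: "L2 M f \<Longrightarrow> f \<in> borel_measurable M"
  by (simp add: L2_def)

lemma L2_sq: "L2 M f \<Longrightarrow> integrable M (\<lambda>x. (cmod (f x))\<^sup>2)"
  by (simp add: L2_def)

lemma borel_measurable_cnj [measurable]:
  "f \<in> borel_measurable M \<Longrightarrow> (\<lambda>x. cnj (f x)) \<in> borel_measurable M"
  by (rule borel_measurable_continuous_on[where f=cnj]) (auto intro: continuous_intros)

lemma ip_integrable:
  assumes "L2 M f" "L2 M g" shows "integrable M (\<lambda>x. f x * cnj (g x))"
proof (rule Bochner_Integration.integrable_bound[of M "\<lambda>x. (cmod (f x))\<^sup>2 + (cmod (g x))\<^sup>2"])
  have [measurable]: "f \<in> borel_measurable M" "g \<in> borel_measurable M" using assms by (auto simp: L2_def)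
  show "integrable M (\<lambda>x. (cmod (f x))\<^sup>2 + (cmod (g x))\<^sup>2)" using assms by (simp add: L2_def)
  show "(\<lambda>x. f x * cnj (g x)) \<in> borel_measurable M" by measurable
  have "cmod (f x * cnj (g x)) \<le> (cmod (f x))\<^sup>2 + (cmod (g x))\<^sup>2" for x
    using sum_squares_bound[of "cmod (f x)" "cmod (g x)"] mult_nonneg_nonneg[of "cmod (f x)" "cmod (g x)", OF norm_ge_zero norm_ge_zero]
    unfolding norm_mult complex_mod_cnj mult.assoc by linarith
  then show "AE x in M. norm (f x * cnj (g x)) \<le> norm ((cmod (f x))\<^sup>2 + (cmod (g x))\<^sup>2)" by auto
qed

lemma L2_cmult: "L2 M f \<Longrightarrow> L2 M (\<lambda>x. c * f x)"
  by (auto simp: L2_def norm_mult power_mult_distrib)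

lemma L2_add:
  assumes "L2 M f" "L2 M g" shows "L2 M (\<lambda>x. f x + g x)"
proof -
  have [measurable]: "f \<in> borel_measurable M" "g \<in> borel_measurable M" using assms by (auto simp: L2_def)
  have "integrable M (\<lambda>x. (cmod (f x + g x))\<^sup>2)"
  proof (rule Bochner_Integration.integrable_bound[of M "\<lambda>x. 2 * ((cmod (f x))\<^sup>2 + (cmod (g x))\<^sup>2)"])
    show "integrable M (\<lambda>x. 2 * ((cmod (f x))\<^sup>2 + (cmod (g x))\<^sup>2))" using assms by (simp add: L2_def)
    show "(\<lambda>x. (cmod (f x + g x))\<^sup>2) \<in> borel_measurable M" by measurable
    have "(cmod (f x + g x))\<^sup>2 \<le> 2 * ((cmod (f x))\<^sup>2 + (cmod (g x))\<^sup>2)" for x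
    proof -
      have "(cmod (f x + g x))\<^sup>2 \<le> (cmod (f x) + cmod (g x))\<^sup>2" by (intro power_mono norm_triangle_ineq) auto
      then show ?thesis using sum_squares_bound[of "cmod (f x)" "cmod (g x)"] by (simp add: power2_sum)
    qed
    then show "AE x in M. norm ((cmod (f x + g x))\<^sup>2) \<le> norm (2 * ((cmod (f x))\<^sup>2 + (cmod (g x))\<^sup>2))" by auto
  qed
  then show ?thesis by (simp add: L2_def)
qed

lemma L2_diff: "L2 M f \<Longrightarrow> L2 M g \<Longrightarrow> L2 M (\<lambda>x. f x - g x)"
  using L2_add[of M f "\<lambda>x. (-1) * g x"] L2_cmult[of M g "-1"] by simp

lemma L2_zero: "L2 M (\<lambda>x. 0)"
  by (simp add: L2_def)

lemma L2_sum: "finite A \<Longrightarrow> (\<And>a. a \<in> A \<Longrightarrow> L2 M (f a)) \<Longrightarrow> L2 M (\<lambda>x. \<Sum>a\<in>A. f a x)"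
  by (induction A rule: finite_induct) (auto intro: L2_zero L2_add)

lemma ip_add: "L2 M f \<Longrightarrow> L2 M g \<Longrightarrow> L2 M h \<Longrightarrow> ip M (\<lambda>x. f x + g x) h = ip M f h + ip M g h"
  by (simp add: ip_def distrib_right ip_integrable)

lemma ip_diff: "L2 M f \<Longrightarrow> L2 M g \<Longrightarrow> L2 M h \<Longrightarrow> ip M (\<lambda>x. f x - g x) h = ip M f h - ip M g h"
  by (simp add: ip_def left_diff_distrib ip_integrable)

lemma ip_diff_right: "L2 M f \<Longrightarrow> L2 M g \<Longrightarrow> L2 M h \<Longrightarrow> ip M f (\<lambda>x. g x - h x) = ip M f g - ip M f h"
  by (simp add: ip_def right_diff_distrib ip_integrable)

lemma ip_cmult: "ip M (\<lambda>x. c * f x) h = c * ip M f h"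
  by (simp add: ip_def mult.assoc)

lemma ip_cmult_right: "ip M f (\<lambda>x. c * h x) = cnj c * ip M f h"
  by (simp add: ip_def mult.left_commute)

lemma ip_cnj: "ip M g f = cnj (ip M f g)"
proof -
  have "(LINT x|M. cnj (f x * cnj (g x))) = cnj (LINT x|M. f x * cnj (g x))"
    by (rule Bochner_Integration.integral_cnj)
  then show ?thesis by (simp add: ip_def mult.commute)
qed

lemma nrm_nonneg: "nrm M f \<ge> 0"
  by (simp add: nrm_def)

lemma nrm_sq: "(nrm M f)\<^sup>2 = (LINT x|M. (cmod (f x))\<^sup>2)"
  by (simp add: nrm_def)

lemma ip_self: "ip M f f = complex_of_real ((nrm M f)\<^sup>2)"
  unfolding ip_def nrm_sq by (simp only: complex_norm_square[symmetric] integral_complex_of_real)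

lemma nrm_cmult: "nrm M (\<lambda>x. c * f x) = cmod c * nrm M f"
  by (simp add: nrm_def norm_mult power_mult_distrib real_sqrt_mult)

lemma nrm_minus_commute: "nrm M (\<lambda>x. f x - g x) = nrm M (\<lambda>x. g x - f x)"
  by (simp add: nrm_def norm_minus_commute)

lemma nrm_sq_add:
  assumes "L2 M f" "L2 M g"
  shows "(nrm M (\<lambda>x. f x + g x))\<^sup>2 = (nrm M f)\<^sup>2 + 2 * Re (ip M f g) + (nrm M g)\<^sup>2"
proof -
  have "complex_of_real ((nrm M (\<lambda>x. f x + g x))\<^sup>2) = ip M (\<lambda>x. f x + g x) (\<lambda>x. f x + g x)" by (simp add: ip_self)
  also have "\<dots> = ip M f (\<lambda>x. f x + g x) + ip M g (\<lambda>x. f x + g x)" by (intro ip_add L2_add assms)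
  also have "ip M f (\<lambda>x. f x + g x) = cnj (ip M (\<lambda>x. f x + g x) f)" by (rule ip_cnj)
  also have "\<dots> = cnj (ip M f f) + ip M f g" using assms by (simp add: ip_add ip_cnj[of M f g, symmetric] flip: ip_cnj[of M g f])
  also have "ip M g (\<lambda>x. f x + g x) = cnj (ip M (\<lambda>x. f x + g x) g)" by (rule ip_cnj)
  also have "\<dots> = cnj (ip M f g) + cnj (ip M g g)" using assms by (simp add: ip_add)
  finally have "Re (complex_of_real ((nrm M (\<lambda>x. f x + g x))\<^sup>2)) = Re (cnj (ip M f f) + ip M f g + (cnj (ip M f g) + cnj (ip M g g)))" by simp
  then show ?thesis by (simp add: ip_self)
qed

lemma ip_zero_norm:
  assumes "L2 M f" "L2 M g" "nrm M g = 0" shows "ip M f g = 0"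
proof -
  have "(LINT x|M. (cmod (g x))\<^sup>2) = 0" using assms(3) nrm_sq[of M g] by simp
  then have "AE x in M. (cmod (g x))\<^sup>2 = 0"
    using integral_nonneg_eq_0_iff_AE[OF L2_sq[OF assms(2)]] by simp
  then have "AE x in M. f x * cnj (g x) = 0" by eventually_elim simp
  then show ?thesis unfolding ip_def by (rule integral_eq_zero_AE)
qed

lemma Cauchy_Schwarz:
  assumes "L2 M f" "L2 M g" shows "cmod (ip M f g) \<le> nrm M f * nrm M g"
proof (cases "nrm M g = 0")
  case True
  then show ?thesis using ip_zero_norm[OF assms] by simp
next
  case False
  define B where "B = (nrm M g)\<^sup>2"
  have B: "B > 0" using False nrm_nonneg[of M g] by (simp add: B_def)
  define c where "c = - ip M f g"
  \<comment> \<open>The norm of |g|^2 f - <f,g> g, the projection remainder cleared of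
    denominators.\<close>
  have "0 \<le> (nrm M (\<lambda>x. complex_of_real B * f x + c * g x))\<^sup>2" by simp
  also have "\<dots> = (B * nrm M f)\<^sup>2 + 2 * Re (complex_of_real B * (cnj c * ip M f g)) + (cmod c * nrm M g)\<^sup>2"
    using assms B by (subst nrm_sq_add) (auto intro!: L2_cmult simp: nrm_cmult ip_cmult ip_cmult_right)
  also have "cnj c * ip M f g = - complex_of_real ((cmod (ip M f g))\<^sup>2)"
    unfolding complex_norm_square by (simp add: c_def mult.commute)
  also have "(B * nrm M f)\<^sup>2 + 2 * Re (complex_of_real B * - complex_of_real ((cmod (ip M f g))\<^sup>2)) + (cmod c * nrm M g)\<^sup>2
     = B * (B * (nrm M f)\<^sup>2 - (cmod (ip M f g))\<^sup>2)"
    by (simp add: c_def B_def power2_eq_square algebra_simps)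
  finally have "0 \<le> B * (nrm M f)\<^sup>2 - (cmod (ip M f g))\<^sup>2" using B by (simp add: zero_le_mult_iff)
  then have "(cmod (ip M f g))\<^sup>2 \<le> (nrm M f * nrm M g)\<^sup>2" by (simp add: B_def power_mult_distrib mult.commute)
  then show ?thesis by (rule power2_le_imp_le) (simp add: nrm_nonneg)
qed

lemma nrm_triangle:
  assumes "L2 M f" "L2 M g" shows "nrm M (\<lambda>x. f x + g x) \<le> nrm M f + nrm M g"
proof (rule power2_le_imp_le)
  have "Re (ip M f g) \<le> nrm M f * nrm M g" using Cauchy_Schwarz[OF assms] complex_Re_le_cmod order_trans by blast
  then show "(nrm M (\<lambda>x. f x + g x))\<^sup>2 \<le> (nrm M f + nrm M g)\<^sup>2"
    unfolding nrm_sq_add[OF assms] by (simp add: power2_sum)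
qed (simp add: nrm_nonneg)

lemma nrm_triangle_diff:
  assumes "L2 M f" "L2 M g" "L2 M h"
  shows "nrm M (\<lambda>x. f x - h x) \<le> nrm M (\<lambda>x. f x - g x) + nrm M (\<lambda>x. g x - h x)"
  using nrm_triangle[of M "\<lambda>x. f x - g x" "\<lambda>x. g x - h x"] assms by (simp add: L2_diff)

lemma nrm_AE_cong:
  assumes "AE x in M. f x = g x" "f \<in> borel_measurable M" "g \<in> borel_measurable M" shows "nrm M f = nrm M g"
proof -
  have "(LINT x|M. (cmod (f x))\<^sup>2) = (LINT x|M. (cmod (g x))\<^sup>2)"
  proof (rule integral_cong_AE)
    show "AE x in M. (cmod (f x))\<^sup>2 = (cmod (g x))\<^sup>2" using assms(1) by eventually_elim simp
  qed (use assms(2,3) in measurable)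
  then show ?thesis by (simp add: nrm_def)
qed

lemma L2_AE_cong:
  assumes "L2 M f" "AE x in M. f x = g x" "g \<in> borel_measurable M" shows "L2 M g"
proof -
  have [measurable]: "f \<in> borel_measurable M" "g \<in> borel_measurable M" using assms by (auto simp: L2_def)
  have "integrable M (\<lambda>x. (cmod (g x))\<^sup>2)"
  proof (rule integrable_cong_AE_imp[OF L2_sq[OF assms(1)]])
    show "AE x in M. (cmod (f x))\<^sup>2 = (cmod (g x))\<^sup>2" using assms(2) by eventually_elim simp
  qed measurable
  then show ?thesis using assms(3) by (simp add: L2_def)
qed

text \<open>Riesz-Fischer for a fast sequence. The fixed rate yields almost everywhere convergence
  of the whole sequence, which later identifies an L2-limit of entire functions with their locally
  uniform limit.\<close>

lemma L2_complete:
  assumes L: "\<And>n. L2 M (f n)" and d: "\<And>n. (nrm M (\<lambda>x. f (Suc n) x - f n x))\<^sup>2 \<le> (1/8)^n"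
  shows "\<exists>u. L2 M u \<and> (AE x in M. (\<lambda>n. f n x) \<longlonglongrightarrow> u x) \<and> (\<lambda>n. nrm M (\<lambda>x. f n x - u x)) \<longlonglongrightarrow> 0"
proof -
  have mf [measurable]: "f n \<in> borel_measurable M" for n using L by (simp add: L2_def)
  define D where "D n x = (cmod (f (Suc n) x - f n x))\<^sup>2" for n x
  have [measurable]: "D n \<in> borel_measurable M" for n unfolding D_def by measurable
  have iD: "integrable M (D n)" for n unfolding D_def by (rule L2_sq[OF L2_diff[OF L L]])
  have nD: "(\<integral>\<^sup>+x. ennreal (2^n * D n x) \<partial>M) \<le> ennreal ((1/4)^n)" for n
  proof -
    have "(\<integral>\<^sup>+x. ennreal (2^n * D n x) \<partial>M) = ennreal (LINT x|M. 2^n * D n x)"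
      by (rule nn_integral_eq_integral[OF integrable_mult_right[OF iD]]) (auto simp: D_def)
    also have "(LINT x|M. 2^n * D n x) = 2^n * (nrm M (\<lambda>x. f (Suc n) x - f n x))\<^sup>2"
      by (simp add: nrm_sq D_def)
    also have "\<dots> \<le> 2^n * (1/8)^n" using d by (intro mult_left_mono) auto
    also have "(2::real)^n * (1/8)^n = (1/4)^n" by (simp flip: power_mult_distrib)
    finally show ?thesis by (simp add: ennreal_leI)
  qed
  have "(\<integral>\<^sup>+x. (\<Sum>n. ennreal (2^n * D n x)) \<partial>M) = (\<Sum>n. \<integral>\<^sup>+x. ennreal (2^n * D n x) \<partial>M)"
    by (rule nn_integral_suminf) measurable
  also have "\<dots> \<le> (\<Sum>n. ennreal ((1/4)^n))" by (intro suminf_le nD) auto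
  also have "\<dots> < \<infinity>"
  proof -
    have "(\<Sum>n. ennreal ((1/4)^n)) = ennreal (1 / (1 - 1/4))"
      by (rule suminf_ennreal_eq[OF _ geometric_sums]) auto
    then show ?thesis by simp
  qed
  finally have "AE x in M. (\<Sum>n. ennreal (2^n * D n x)) \<noteq> \<infinity>"
    by (intro nn_integral_PInf_AE) auto
  then have conv: "AE x in M. convergent (\<lambda>n. f n x)"
  proof eventually_elim
    case (elim x)
    obtain K where K: "K \<ge> 0" "(\<Sum>n. ennreal (2^n * D n x)) = ennreal K" using elim by (cases "\<Sum>n. ennreal (2^n * D n x)") auto
    \<comment> \<open>The weights 2^n still leave a summable series against 8^(-n); finiteness at x
      then forces geometric decay of the increments.\<close>
    have b: "cmod (f (Suc n) x - f n x) \<le> sqrt K * (1 / sqrt 2)^n" for n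
    proof -
      have "ennreal (2^n * D n x) = (\<Sum>k\<in>{n}. ennreal (2^k * D k x))" by simp
      also have "\<dots> \<le> (\<Sum>k. ennreal (2^k * D k x))" by (rule sum_le_suminf) auto
      finally have "2^n * D n x \<le> K" using K by (simp add: ennreal_le_iff)
      then have "D n x \<le> K * (1/2)^n" by (simp add: field_simps power_divide)
      then have "sqrt (D n x) \<le> sqrt (K * (1/2)^n)" by (rule real_sqrt_le_mono)
      then show ?thesis by (simp add: D_def real_sqrt_mult real_sqrt_power real_sqrt_divide)
    qed
    have "summable (\<lambda>n. f (Suc n) x - f n x)"
    proof (rule summable_comparison_test)
      show "\<exists>N. \<forall>n\<ge>N. norm (f (Suc n) x - f n x) \<le> sqrt K * (1 / sqrt 2)^n" using b by blast
      show "summable (\<lambda>n. sqrt K * (1 / sqrt 2)^n)" by (intro summable_mult summable_geometric) auto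
    qed
    then have "convergent (\<lambda>n. \<Sum>k<n. f (Suc k) x - f k x)" by (simp add: summable_iff_convergent)
    then have "convergent (\<lambda>n. f n x - f 0 x)" by (simp add: sum_lessThan_telescope[of "\<lambda>n. f n x"])
    then have "convergent (\<lambda>n. (f n x - f 0 x) + f 0 x)" by (intro convergent_add convergent_const)
    then show ?case by simp
  qed
  define u where "u x = lim (\<lambda>n. f n x)" for x
  have mu [measurable]: "u \<in> borel_measurable M" unfolding u_def[abs_def] by measurable
  have lim: "AE x in M. (\<lambda>n. f n x) \<longlonglongrightarrow> u x"
    using conv by eventually_elim (simp add: u_def convergent_LIMSEQ_iff)
  define a where "a = sqrt (1/8)"
  have a: "0 < a" "a < 1" by (auto simp: a_def)
  have d': "nrm M (\<lambda>x. f (Suc n) x - f n x) \<le> a^n" for n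
    using real_sqrt_le_mono[OF d[of n]] by (simp add: a_def real_sqrt_power nrm_nonneg)
  have tail: "nrm M (\<lambda>x. f (n + k) x - f n x) \<le> a^n / (1 - a)" for n k
  proof -
    have "nrm M (\<lambda>x. f (n + k) x - f n x) \<le> (\<Sum>j<k. a^(n+j))" for k
    proof (induction k)
      case 0
      show ?case by (simp add: nrm_def)
    next
      case (Suc k)
      have "nrm M (\<lambda>x. f (n + Suc k) x - f n x) \<le> nrm M (\<lambda>x. f (n + Suc k) x - f (n + k) x) + nrm M (\<lambda>x. f (n + k) x - f n x)"
        by (rule nrm_triangle_diff[OF L L L])
      then show ?case using Suc d'[of "n+k"] by simp
    qed
    also have "(\<Sum>j<k. a^(n+j)) = a^n * (\<Sum>j<k. a^j)" by (simp add: power_add sum_distrib_left)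
    also have "\<dots> \<le> a^n * (1 / (1 - a))"
    proof (rule mult_left_mono)
      have "(\<Sum>j<k. a^j) \<le> (\<Sum>j. a^j)" by (rule sum_le_suminf) (use a in auto)
      then show "(\<Sum>j<k. a^j) \<le> 1 / (1 - a)" using a by (simp add: suminf_geometric)
    qed (use a in auto)
    finally show ?thesis by simp
  qed
  \<comment> \<open>Fatou's lemma passes the tail estimate, uniform in k, to the pointwise
    limit.\<close>
  have fat: "(\<integral>\<^sup>+x. ennreal ((cmod (f n x - u x))\<^sup>2) \<partial>M) \<le> ennreal ((a^n / (1 - a))\<^sup>2)" for n
  proof -
    have "(\<integral>\<^sup>+x. ennreal ((cmod (f n x - u x))\<^sup>2) \<partial>M) = (\<integral>\<^sup>+x. liminf (\<lambda>k. ennreal ((cmod (f (n + k) x - f n x))\<^sup>2)) \<partial>M)"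
    proof (rule nn_integral_cong_AE)
      show "AE x in M. ennreal ((cmod (f n x - u x))\<^sup>2) = liminf (\<lambda>k. ennreal ((cmod (f (n + k) x - f n x))\<^sup>2))"
        using lim
      proof eventually_elim
        case (elim x)
        have "(\<lambda>k. f (k + n) x) \<longlonglongrightarrow> u x" using elim by (rule LIMSEQ_ignore_initial_segment)
        then have "(\<lambda>k. ennreal ((cmod (f (n + k) x - f n x))\<^sup>2)) \<longlonglongrightarrow> ennreal ((cmod (u x - f n x))\<^sup>2)"
          by (intro tendsto_ennrealI tendsto_intros) (simp add: add.commute)
        from lim_imp_Liminf[OF sequentially_bot this] show ?case
          by (simp only: norm_minus_commute[of "f n x" "u x"])
      qed
    qed
    also have "\<dots> \<le> liminf (\<lambda>k. \<integral>\<^sup>+x. ennreal ((cmod (f (n + k) x - f n x))\<^sup>2) \<partial>M)"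
      by (rule nn_integral_liminf) measurable
    also have "\<dots> \<le> liminf (\<lambda>k::nat. ennreal ((a^n / (1 - a))\<^sup>2))"
    proof (rule Liminf_mono, rule always_eventually, rule allI)
      fix k
      have "(\<integral>\<^sup>+x. ennreal ((cmod (f (n + k) x - f n x))\<^sup>2) \<partial>M) = ennreal ((nrm M (\<lambda>x. f (n + k) x - f n x))\<^sup>2)"
        unfolding nrm_sq by (rule nn_integral_eq_integral[OF L2_sq[OF L2_diff[OF L L]]]) auto
      also have "\<dots> \<le> ennreal ((a^n / (1 - a))\<^sup>2)"
        by (intro ennreal_leI power_mono tail nrm_nonneg)
      finally show "(\<integral>\<^sup>+x. ennreal ((cmod (f (n + k) x - f n x))\<^sup>2) \<partial>M) \<le> ennreal ((a^n / (1 - a))\<^sup>2)" .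
    qed
    finally show ?thesis by (simp add: Liminf_const)
  qed
  have ifu: "integrable M (\<lambda>x. (cmod (f n x - u x))\<^sup>2)" for n
    using le_less_trans[OF fat[of n] ennreal_less_top] by (intro integrableI_nonneg) auto
  have Ld: "L2 M (\<lambda>x. f n x - u x)" for n using ifu by (simp add: L2_def)
  have "L2 M (\<lambda>x. f 0 x - (f 0 x - u x))" by (rule L2_diff[OF L Ld])
  then have Lu: "L2 M u" by simp
  have nb: "nrm M (\<lambda>x. f n x - u x) \<le> a^n / (1 - a)" for n
  proof -
    have "ennreal ((nrm M (\<lambda>x. f n x - u x))\<^sup>2) = (\<integral>\<^sup>+x. ennreal ((cmod (f n x - u x))\<^sup>2) \<partial>M)"
      unfolding nrm_sq by (rule nn_integral_eq_integral[OF ifu, symmetric]) auto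
    then have "(nrm M (\<lambda>x. f n x - u x))\<^sup>2 \<le> (a^n / (1 - a))\<^sup>2"
      using fat[of n] by (metis ennreal_le_iff zero_le_power2)
    then show ?thesis by (rule power2_le_imp_le) (use a in auto)
  qed
  have "(\<lambda>n. nrm M (\<lambda>x. f n x - u x)) \<longlonglongrightarrow> 0"
  proof (rule tendsto_sandwich[OF _ _ tendsto_const])
    have "(\<lambda>n. a^n / (1 - a)) \<longlonglongrightarrow> 0 / (1 - a)" using a by (intro tendsto_intros LIMSEQ_realpow_zero) auto
    then show "(\<lambda>n. a^n / (1 - a)) \<longlonglongrightarrow> 0" by simp
    show "\<forall>\<^sub>F n in sequentially. 0 \<le> nrm M (\<lambda>x. f n x - u x)"
      by (rule always_eventually, rule allI, rule nrm_nonneg)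
  qed (use nb in auto)
  then show ?thesis using Lu lim by blast
qed

section \<open>Hoermander's estimate for the d-bar equation\<close>

text \<open>Proved by minimising \<open>|T f|^2 - 2 Re (l f)\<close>, so the image of \<open>T\<close> need not be closed.\<close>

lemma Riesz_representation:
  fixes T :: "('b \<Rightarrow> complex) \<Rightarrow> 'a \<Rightarrow> complex"
  assumes X0: "X \<noteq> {}"
    and Xadd: "\<And>f g. f \<in> X \<Longrightarrow> g \<in> X \<Longrightarrow> (\<lambda>z. f z + g z) \<in> X"
    and Xmul: "\<And>c f. f \<in> X \<Longrightarrow> (\<lambda>z. c * f z) \<in> X"
    and TL: "\<And>f. f \<in> X \<Longrightarrow> L2 M (T f)"
    and Tadd: "\<And>f g. f \<in> X \<Longrightarrow> g \<in> X \<Longrightarrow> T (\<lambda>z. f z + g z) = (\<lambda>x. T f x + T g x)"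
    and Tmul: "\<And>c f. f \<in> X \<Longrightarrow> T (\<lambda>z. c * f z) = (\<lambda>x. c * T f x)"
    and ladd: "\<And>f g. f \<in> X \<Longrightarrow> g \<in> X \<Longrightarrow> l (\<lambda>z. f z + g z) = l f + (l g :: complex)"
    and lmul: "\<And>c f. f \<in> X \<Longrightarrow> l (\<lambda>z. c * f z) = c * l f"
    and bd: "\<And>f. f \<in> X \<Longrightarrow> cmod (l f) \<le> B * nrm M (T f)" and B: "B \<ge> 0"
  shows "\<exists>u F. L2 M u \<and> nrm M u \<le> B \<and> (\<forall>f\<in>X. ip M (T f) u = l f) \<and> (\<forall>n::nat. F n \<in> X) \<and>
     (AE x in M. (\<lambda>n. T (F n) x) \<longlonglongrightarrow> u x) \<and> (\<lambda>n. nrm M (\<lambda>x. T (F n) x - u x)) \<longlonglongrightarrow> 0"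
proof -
  define J where "J f = (nrm M (T f))\<^sup>2 - 2 * Re (l f)" for f
  have Jl: "J f \<ge> - B\<^sup>2" if "f \<in> X" for f
  proof -
    have "Re (l f) \<le> B * nrm M (T f)" using bd[OF that] complex_Re_le_cmod order_trans by blast
    moreover have "2 * (B * nrm M (T f)) \<le> (nrm M (T f))\<^sup>2 + B\<^sup>2"
      using sum_squares_bound[of B "nrm M (T f)"] by simp
    ultimately show ?thesis by (simp add: J_def)
  qed
  define m where "m = Inf (J ` X)"
  have bb: "bdd_below (J ` X)" using Jl by (auto intro!: bdd_belowI)
  have mJ: "m \<le> J f" if "f \<in> X" for f unfolding m_def using that by (intro cINF_lower bb)
  \<comment> \<open>The accuracy is tuned so that the parallelogram law, applied to consecutive
    terms and their midpoint, produces the rate required by \<open>L2_complete\<close>.\<close>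
  have "\<exists>f. f \<in> X \<and> J f < m + (1/8)^n / 4" for n :: nat
    using cInf_lessD[of "J ` X" "m + (1/8)^n / 4"] X0 by (auto simp: m_def)
  then obtain F where F: "\<And>n. F n \<in> X" "\<And>n. J (F n) < m + (1/8)^n / 4" by metis
  have par: "(nrm M (\<lambda>x. T (F (Suc n)) x - T (F n) x))\<^sup>2 \<le> (1/8)^n" for n
  proof -
    define f g where "f = F (Suc n)" and "g = F n"
    have fg: "f \<in> X" "g \<in> X" using F by (auto simp: f_def g_def)
    define h where "h = (\<lambda>z. (1/2) * (f z + g z))"
    have h: "h \<in> X" unfolding h_def using Xmul[OF Xadd[OF fg], of "1/2"] by simp
    have Th: "T h = (\<lambda>x. (1/2) * (T f x + T g x))"
      unfolding h_def Tmul[OF Xadd[OF fg]] Tadd[OF fg] by simp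
    have lh: "l h = (1/2) * (l f + l g)" unfolding h_def lmul[OF Xadd[OF fg]] ladd[OF fg] by simp
    have Lg: "L2 M (\<lambda>x. - T g x)" using L2_cmult[OF TL[OF fg(2)], of "-1"] by simp
    have 1: "(nrm M (\<lambda>x. T f x + T g x))\<^sup>2 = (nrm M (T f))\<^sup>2 + 2 * Re (ip M (T f) (T g)) + (nrm M (T g))\<^sup>2"
      by (rule nrm_sq_add[OF TL[OF fg(1)] TL[OF fg(2)]])
    have 2: "(nrm M (\<lambda>x. T f x - T g x))\<^sup>2 = (nrm M (T f))\<^sup>2 - 2 * Re (ip M (T f) (T g)) + (nrm M (T g))\<^sup>2"
      using nrm_sq_add[OF TL[OF fg(1)] Lg] ip_cmult_right[of M "T f" "-1" "T g"] nrm_cmult[of M "-1" "T g"] by simp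
    have "(nrm M (T h))\<^sup>2 = 1/4 * (nrm M (\<lambda>x. T f x + T g x))\<^sup>2"
      unfolding Th nrm_cmult by (simp add: power_mult_distrib power2_eq_square norm_divide)
    then have "(nrm M (\<lambda>x. T f x - T g x))\<^sup>2 = 2 * J f + 2 * J g - 4 * J h"
      using 1 2 by (simp add: J_def lh algebra_simps)
    also have "\<dots> \<le> 2 * (m + (1/8)^Suc n / 4) + 2 * (m + (1/8)^n / 4) - 4 * m"
      using mJ[OF h] F(2)[of n] F(2)[of "Suc n"] by (simp add: f_def g_def)
    also have "\<dots> \<le> (1/8)^n" by simp
    finally show ?thesis by (simp add: f_def g_def)
  qed
  obtain u where u: "L2 M u" "AE x in M. (\<lambda>n. T (F n) x) \<longlonglongrightarrow> u x" "(\<lambda>n. nrm M (\<lambda>x. T (F n) x - u x)) \<longlonglongrightarrow> 0"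
    using L2_complete[OF TL[OF F(1)] par] by blast
  have ipl: "(\<lambda>n. ip M g (T (F n))) \<longlonglongrightarrow> ip M g u" if g: "L2 M g" for g
  proof (rule Lim_transform2)
    show "(\<lambda>n. ip M g u) \<longlonglongrightarrow> ip M g u" by simp
    show "(\<lambda>n. ip M g u - ip M g (T (F n))) \<longlonglongrightarrow> 0"
    proof (rule Lim_null_comparison)
      have "cmod (ip M g u - ip M g (T (F n))) \<le> nrm M g * nrm M (\<lambda>x. T (F n) x - u x)" for n
        using Cauchy_Schwarz[OF g L2_diff[OF u(1) TL[OF F(1)[of n]]]] ip_diff_right[OF g u(1) TL[OF F(1)[of n]]]
        by (simp add: nrm_minus_commute[of M u])
      then show "\<forall>\<^sub>F n in sequentially. norm (ip M g u - ip M g (T (F n))) \<le> nrm M g * nrm M (\<lambda>x. T (F n) x - u x)" by simp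
      show "(\<lambda>n. nrm M g * nrm M (\<lambda>x. T (F n) x - u x)) \<longlonglongrightarrow> 0" using tendsto_mult_right_zero[OF u(3)] .
    qed
  qed
  \<comment> \<open>First variation: perturbing the minimising sequence by t f and passing to the
    limit shows that 2 t a + t^2 N is nonnegative for all real t, which forces a = 0.\<close>
  have re: "Re (ip M (T f) u - l f) = 0" if f: "f \<in> X" for f
  proof -
    define N where "N = (nrm M (T f))\<^sup>2"
    define a where "a = Re (ip M (T f) u - l f)"
    have "0 \<le> 2 * t * a + t\<^sup>2 * N" for t
    proof -
      have "0 \<le> (1/8)^n + (2 * t * Re (ip M (T f) (T (F n)) - l f) + t\<^sup>2 * N)" for n
      proof -
        define g where "g = (\<lambda>z. F n z + complex_of_real t * f z)"
        have tf: "(\<lambda>z. complex_of_real t * f z) \<in> X" by (rule Xmul[OF f])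
        have g: "g \<in> X" unfolding g_def by (rule Xadd[OF F(1) tf])
        have "T g = (\<lambda>x. T (F n) x + complex_of_real t * T f x)" unfolding g_def Tadd[OF F(1) tf] Tmul[OF f] ..
        then have "(nrm M (T g))\<^sup>2 = (nrm M (T (F n)))\<^sup>2 + 2 * Re (ip M (T (F n)) (\<lambda>x. complex_of_real t * T f x)) + (nrm M (\<lambda>x. complex_of_real t * T f x))\<^sup>2"
          using nrm_sq_add[OF TL[OF F(1)] L2_cmult[OF TL[OF f]]] by simp
        also have "Re (ip M (T (F n)) (\<lambda>x. complex_of_real t * T f x)) = t * Re (ip M (T f) (T (F n)))"
          unfolding ip_cmult_right using ip_cnj[of M "T (F n)" "T f"] by simp
        also have "(nrm M (\<lambda>x. complex_of_real t * T f x))\<^sup>2 = t\<^sup>2 * N" by (simp add: nrm_cmult N_def power_mult_distrib)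
        finally have "J g = J (F n) + (2 * t * Re (ip M (T f) (T (F n)) - l f) + t\<^sup>2 * N)"
          unfolding J_def g_def ladd[OF F(1) tf] lmul[OF f] by (simp add: algebra_simps)
        then show ?thesis using mJ[OF g] F(2)[of n] zero_le_power[of "1/8::real" n] by linarith
      qed
      moreover have "(\<lambda>n. (1/8)^n + (2 * t * Re (ip M (T f) (T (F n)) - l f) + t\<^sup>2 * N)) \<longlonglongrightarrow> 0 + (2 * t * a + t\<^sup>2 * N)"
        unfolding a_def by (intro tendsto_intros ipl TL f LIMSEQ_realpow_zero) auto
      ultimately have "0 \<le> 0 + (2 * t * a + t\<^sup>2 * N)" using LIMSEQ_le_const by blast
      then show ?thesis by simp
    qed
    note nonneg = this
    have N: "N + 1 > 0" by (simp add: N_def add_nonneg_pos)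
    \<comment> \<open>The denominator N + 1 covers the degenerate case N = 0; at t = -s the
      quadratic equals -s^2 (N + 2).\<close>
    define s where "s = a / (N + 1)"
    have as: "a = s * (N + 1)" using N by (simp add: s_def)
    have "0 \<le> 2 * (- s) * (s * (N + 1)) + (- s)\<^sup>2 * N" using nonneg[of "- s"] unfolding as .
    then have "s\<^sup>2 * (N + 2) \<le> 0" by (simp add: algebra_simps power2_eq_square)
    then have "s = 0" using N by (simp add: mult_le_0_iff)
    then have "a = 0" by (simp add: as)
    then show ?thesis by (simp add: a_def)
  qed
  have eq: "ip M (T f) u = l f" if f: "f \<in> X" for f
  proof (rule complex_eqI)
    show "Re (ip M (T f) u) = Re (l f)" using re[OF f] by simp
    have "Re (ip M (T (\<lambda>z. \<i> * f z)) u - l (\<lambda>z. \<i> * f z)) = 0" by (rule re[OF Xmul[OF f]])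
    then show "Im (ip M (T f) u) = Im (l f)" unfolding Tmul[OF f] lmul[OF f] ip_cmult by simp
  qed
  have nu: "nrm M u \<le> B"
  proof -
    have tn: "(\<lambda>n. nrm M (T (F n))) \<longlonglongrightarrow> nrm M u"
    proof (rule Lim_transform2)
      show "(\<lambda>n. nrm M u) \<longlonglongrightarrow> nrm M u" by simp
      show "(\<lambda>n. nrm M u - nrm M (T (F n))) \<longlonglongrightarrow> 0"
      proof (rule Lim_null_comparison[OF _ u(3)], rule always_eventually, rule allI)
        fix n
        show "norm (nrm M u - nrm M (T (F n))) \<le> nrm M (\<lambda>x. T (F n) x - u x)"
          using nrm_triangle_diff[OF u(1) TL[OF F(1)[of n]] L2_zero] nrm_triangle_diff[OF TL[OF F(1)[of n]] u(1) L2_zero]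
          by (simp add: nrm_minus_commute[of M u] abs_le_iff)
      qed
    qed
    have "cmod (ip M u (T (F n))) \<le> B * nrm M (T (F n))" for n
      using bd[OF F(1)[of n]] eq[OF F(1)[of n]] ip_cnj[of M u "T (F n)"] by simp
    then have "cmod (ip M u u) \<le> B * nrm M u"
      using LIMSEQ_le[OF tendsto_norm[OF ipl[OF u(1)]] tendsto_mult_left[OF tn, of B]] by blast
    then have "nrm M u * nrm M u \<le> B * nrm M u" by (simp add: ip_self norm_mult power2_eq_square)
    then show ?thesis using nrm_nonneg[of M u] B by (cases "nrm M u = 0") auto
  qed
  show ?thesis using u nu eq F(1) by blast
qed

text \<open>The commutator identity behind Hoermander's estimate. With w = (a + i b) e^p,
  \<open>A\<close> is the weighted square of the holomorphic derivative, \<open>Q\<close> that of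
  the twisted antiholomorphic one. They differ by twice the Laplacian of p times |w|^2, up to a
  divergence that integrates to zero. Dropping \<open>Q\<close> gives the claim.\<close>

lemma integral_C2_weighted_ineq:
  assumes p: "C2 p px py pxx pxy pyy" and a: "C2 a ax ay axx axy ayy" and b: "C2 b bx by bxx bxy byy"
    and s: "\<And>z. norm z > R \<Longrightarrow> a z = 0" "\<And>z. norm z > R \<Longrightarrow> b z = 0"
  shows "2 * (LINT z|lborel. (pxx z + pyy z) * ((a z)\<^sup>2 + (b z)\<^sup>2) * exp (2 * p z))
      \<le> (LINT z|lborel. ((ax z + by z)\<^sup>2 + (bx z - ay z)\<^sup>2) * exp (2 * p z))"
proof -
  note P = C2_D[OF p]
  have ex: "C2 (\<lambda>z. exp (p z)) (\<lambda>z. exp (p z) * px z) (\<lambda>z. exp (p z) * py z)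
     (\<lambda>z. exp (p z) * px z * px z + exp (p z) * pxx z)
     (\<lambda>z. exp (p z) * px z * py z + exp (p z) * pxy z)
     (\<lambda>z. exp (p z) * py z * py z + exp (p z) * pyy z)"
    by (rule C2_compose[OF p]) (auto intro!: derivative_eq_intros continuous_intros P)
  obtain u ux uy uxx uxy uyy where u: "C2 u ux uy uxx uxy uyy" "u = (\<lambda>z. a z * exp (p z))"
     "ux = (\<lambda>z. ax z * exp (p z) + a z * (exp (p z) * px z))" "uy = (\<lambda>z. ay z * exp (p z) + a z * (exp (p z) * py z))"
    using C2_mult[OF a ex] by blast
  obtain v vx vy vxx vxy vyy where v: "C2 v vx vy vxx vxy vyy" "v = (\<lambda>z. b z * exp (p z))"
     "vx = (\<lambda>z. bx z * exp (p z) + b z * (exp (p z) * px z))" "vy = (\<lambda>z. by z * exp (p z) + b z * (exp (p z) * py z))"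
    using C2_mult[OF b ex] by blast
  note U = C2_D[OF u(1)] and V = C2_D[OF v(1)]
  have us: "u z = 0" "v z = 0" if "norm z > R" for z using s that by (auto simp: u(2) v(2))
  have us1: "ux z = 0" "uy z = 0" "vx z = 0" "vy z = 0" if "norm z > R" for z
    using D1_support[OF U(1) us(1) that] D1_support[OF V(1) us(2) that] by auto
  \<comment> \<open>In complex notation \<open>A\<close> is |e^p (d/dx - i d/dy)(e^(-p) w)|^2 and
    \<open>Q\<close> in the next line is |e^(-p) (d/dx + i d/dy)(e^p w)|^2, where w = u + i
    v.\<close>
  define A where "A z = (ux z + vy z - px z * u z - py z * v z)\<^sup>2 + (vx z - uy z - px z * v z + py z * u z)\<^sup>2" for z
  define Q where "Q z = (ux z - vy z + px z * u z - py z * v z)\<^sup>2 + (vx z + uy z + px z * v z + py z * u z)\<^sup>2" for z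
  define E where "E z = (pxx z + pyy z) * ((u z)\<^sup>2 + (v z)\<^sup>2)" for z
  have n: "D1 (\<lambda>z. u z * u z + v z * v z) (\<lambda>z. (ux z * u z + u z * ux z) + (vx z * v z + v z * vx z)) (\<lambda>z. (uy z * u z + u z * uy z) + (vy z * v z + v z * vy z))"
    by (intro D1_add D1_mult U V)
  \<comment> \<open>\<open>X\<close> and \<open>Y\<close> are the components of a vector field whose
    divergence is the discrepancy in the identity; the mixed terms with \<open>vxy\<close> cancel in
    the sum.\<close>
  have X: "D1 (\<lambda>z. 4 * (u z * vy z) - 2 * (px z * (u z * u z + v z * v z)))
    (\<lambda>z. 4 * (ux z * vy z + u z * vxy z) - 2 * (pxx z * (u z * u z + v z * v z) + px z * ((ux z * u z + u z * ux z) + (vx z * v z + v z * vx z))))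
    (\<lambda>z. 4 * (uy z * vy z + u z * vyy z) - 2 * (pxy z * (u z * u z + v z * v z) + px z * ((uy z * u z + u z * uy z) + (vy z * v z + v z * vy z))))"
    by (intro D1_diff D1_cmult D1_mult n U V P)
  have Y: "D1 (\<lambda>z. (- 4) * (u z * vx z) - 2 * (py z * (u z * u z + v z * v z)))
    (\<lambda>z. (- 4) * (ux z * vx z + u z * vxx z) - 2 * (pxy z * (u z * u z + v z * v z) + py z * ((ux z * u z + u z * ux z) + (vx z * v z + v z * vx z))))
    (\<lambda>z. (- 4) * (uy z * vx z + u z * vxy z) - 2 * (pyy z * (u z * u z + v z * v z) + py z * ((uy z * u z + u z * uy z) + (vy z * v z + v z * vy z))))"
    by (intro D1_diff D1_cmult D1_mult n U V P)
  define Xx where "Xx = (\<lambda>z. 4 * (ux z * vy z + u z * vxy z) - 2 * (pxx z * (u z * u z + v z * v z) + px z * ((ux z * u z + u z * ux z) + (vx z * v z + v z * vx z))))"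
  define Yy where "Yy = (\<lambda>z. (- 4) * (uy z * vx z + u z * vxy z) - 2 * (pyy z * (u z * u z + v z * v z) + py z * ((uy z * u z + u z * uy z) + (vy z * v z + v z * vy z))))"
  have cc: "continuous_on UNIV Xx" "continuous_on UNIV Yy" "continuous_on UNIV A" "continuous_on UNIV Q" "continuous_on UNIV E"
    unfolding Xx_def Yy_def A_def[abs_def] Q_def[abs_def] E_def[abs_def] by (intro continuous_intros U V P)+
  have iX: "integrable lborel Xx" "integrable lborel Yy" "integrable lborel A" "integrable lborel Q" "integrable lborel E"
    by (rule integrable_compact_support[OF cc(1), of R] integrable_compact_support[OF cc(2), of R] integrable_compact_support[OF cc(3), of R]
      integrable_compact_support[OF cc(4), of R] integrable_compact_support[OF cc(5), of R]; simp add: Xx_def Yy_def A_def Q_def E_def us us1)+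
  have X0: "(LINT z|lborel. Xx z) = 0"
    unfolding Xx_def by (rule integral_partial_zero(1)[OF X, of R]) (auto intro!: continuous_intros U V P simp: us)
  have Y0: "(LINT z|lborel. Yy z) = 0"
    unfolding Yy_def by (rule integral_partial_zero(2)[OF Y, of R]) (auto intro!: continuous_intros U V P simp: us)
  have id: "A z = Q z + 2 * E z + (Xx z + Yy z)" for z
    unfolding A_def Q_def E_def Xx_def Yy_def by (simp add: power2_eq_square algebra_simps)
  have "(LINT z|lborel. A z) = (LINT z|lborel. Q z + 2 * E z + (Xx z + Yy z))" using id by simp
  also have "\<dots> = (LINT z|lborel. Q z) + 2 * (LINT z|lborel. E z) + (0 + 0)"
    using iX X0 Y0 by simp
  finally have eqA: "(LINT z|lborel. A z) = (LINT z|lborel. Q z) + 2 * (LINT z|lborel. E z)" by simp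
  have e2: "exp (2 * p z) = (exp (p z))\<^sup>2" for z by (rule exp_double)
  from eqA have "(LINT z|lborel. A z) = (LINT z|lborel. Q z) + 2 * (LINT z|lborel. E z)" .
  moreover have "(LINT z|lborel. Q z) \<ge> 0" by (rule Bochner_Integration.integral_nonneg) (simp add: Q_def)
  moreover have "E z = (pxx z + pyy z) * ((a z)\<^sup>2 + (b z)\<^sup>2) * exp (2 * p z)" for z
    unfolding e2 by (simp add: E_def u(2) v(2) power_mult_distrib algebra_simps)
  moreover have "A z = ((ax z + by z)\<^sup>2 + (bx z - ay z)\<^sup>2) * exp (2 * p z)" for z
  proof -
    have q: "ux z + vy z - px z * u z - py z * v z = (ax z + by z) * exp (p z)"
      "vx z - uy z - px z * v z + py z * u z = (bx z - ay z) * exp (p z)"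
      by (simp_all add: u(2-4) v(2-4) algebra_simps)
    show ?thesis unfolding e2 A_def q power_mult_distrib by (rule distrib_right[symmetric])
  qed
  ultimately show ?thesis by simp
qed

section \<open>Complex test functions and the d-bar operator in real coordinates\<close>

definition dx :: "(complex \<Rightarrow> real) \<Rightarrow> complex \<Rightarrow> real" where
  "dx f = (\<lambda>z. frechet_derivative f (at z) 1)"
definition dy :: "(complex \<Rightarrow> real) \<Rightarrow> complex \<Rightarrow> real" where
  "dy f = (\<lambda>z. frechet_derivative f (at z) \<i>)"

lemma dx_eq: "D1 f fx fy \<Longrightarrow> dx f = fx" and dy_eq: "D1 f fx fy \<Longrightarrow> dy f = fy"
  using D1_frechet by (auto simp: dx_def dy_def)

text \<open>For complex functions \<open>dz b = 2 \<partial> b\<close> and \<open>dzb b = 2 \<partial>-bar b\<close>.\<close>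

definition dz :: "(complex \<Rightarrow> complex) \<Rightarrow> complex \<Rightarrow> complex" where
  "dz b z = Complex (dx (\<lambda>z. Re (b z)) z + dy (\<lambda>z. Im (b z)) z) (dx (\<lambda>z. Im (b z)) z - dy (\<lambda>z. Re (b z)) z)"
definition dzb :: "(complex \<Rightarrow> complex) \<Rightarrow> complex \<Rightarrow> complex" where
  "dzb b z = Complex (dx (\<lambda>z. Re (b z)) z - dy (\<lambda>z. Im (b z)) z) (dx (\<lambda>z. Im (b z)) z + dy (\<lambda>z. Re (b z)) z)"

text \<open>Components come from the generated class, which is closed under the operations applied
  to test functions and contains the mollifiers and the potential gradients with which weak
  holomorphy is tested.\<close>

definition TF :: "(complex \<Rightarrow> complex) set" where
  "TF = {b. SM (\<lambda>z. Re (b z)) \<and> SM (\<lambda>z. Im (b z)) \<and> (\<exists>R. \<forall>z. norm z > R \<longrightarrow> b z = 0)}"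

lemma SM_D1: "SM f \<Longrightarrow> D1 f (dx f) (dy f)" "SM f \<Longrightarrow> SM (dx f)" "SM f \<Longrightarrow> SM (dy f)"
proof -
  assume "SM f"
  then obtain fx fy fxx fxy fyy where f: "C2 f fx fy fxx fxy fyy" "SM fx" "SM fy" using SM_C2 by blast
  then show "D1 f (dx f) (dy f)" "SM (dx f)" "SM (dy f)"
    using dx_eq[OF C2_D(1)[OF f(1)]] dy_eq[OF C2_D(1)[OF f(1)]] C2_D(1)[OF f(1)] by auto
qed

lemma SM_C2_dx: "SM f \<Longrightarrow> C2 f (dx f) (dy f) (dx (dx f)) (dy (dx f)) (dy (dy f))"
proof -
  assume "SM f"
  then obtain fx fy fxx fxy fyy where f: "C2 f fx fy fxx fxy fyy" using SM_C2 by blast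
  note d = C2_D[OF f]
  have "dx f = fx" "dy f = fy" "dx fx = fxx" "dy fx = fxy" "dy fy = fyy"
    using dx_eq dy_eq d by blast+
  then show ?thesis using f by simp
qed

lemma TF_D:
  assumes "b \<in> TF"
  shows "SM (\<lambda>z. Re (b z))" "SM (\<lambda>z. Im (b z))"
    "D1 (\<lambda>z. Re (b z)) (dx (\<lambda>z. Re (b z))) (dy (\<lambda>z. Re (b z)))"
    "D1 (\<lambda>z. Im (b z)) (dx (\<lambda>z. Im (b z))) (dy (\<lambda>z. Im (b z)))"
  using assms SM_D1 by (auto simp: TF_def)

lemma TF_supp: "b \<in> TF \<Longrightarrow> \<exists>R. \<forall>z. norm z > R \<longrightarrow> b z = 0 \<and> dz b z = 0 \<and> dzb b z = 0"
proof -
  assume b: "b \<in> TF"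
  then obtain R where R: "\<And>z. norm z > R \<Longrightarrow> b z = 0" by (auto simp: TF_def)
  have r: "Re (b z) = 0" "Im (b z) = 0" if "norm z > R" for z using R[OF that] by auto
  note s = D1_support[OF TF_D(3)[OF b], of R] D1_support[OF TF_D(4)[OF b], of R]
  have "dz b z = 0 \<and> dzb b z = 0" if "norm z > R" for z
    using s[of z] r that by (simp add: dz_def dzb_def complex_eq_iff)
  then show ?thesis using R by blast
qed

lemma TF_continuous: assumes "b \<in> TF" shows "continuous_on UNIV b" "continuous_on UNIV (dz b)" "continuous_on UNIV (dzb b)"
proof -
  note s = TF_D(1,2)[OF assms]
  note c = SM_continuous[OF s(1)] SM_continuous[OF s(2)] SM_continuous[OF SM_D1(2)[OF s(1)]] SM_continuous[OF SM_D1(3)[OF s(1)]]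
    SM_continuous[OF SM_D1(2)[OF s(2)]] SM_continuous[OF SM_D1(3)[OF s(2)]]
  have "continuous_on UNIV (\<lambda>z. Complex (Re (b z)) (Im (b z)))"
    unfolding Complex_eq by (intro continuous_intros c)
  then show "continuous_on UNIV b" by simp
  show "continuous_on UNIV (dz b)" unfolding dz_def[abs_def] Complex_eq by (intro continuous_intros c)
  show "continuous_on UNIV (dzb b)" unfolding dzb_def[abs_def] Complex_eq by (intro continuous_intros c)
qed

lemma TF_add:
  assumes "b \<in> TF" "c \<in> TF"
  shows "(\<lambda>z. b z + c z) \<in> TF" "dz (\<lambda>z. b z + c z) z = dz b z + dz c z"
proof -
  obtain R where R: "\<And>z. norm z > R \<Longrightarrow> b z = 0" using assms(1) by (auto simp: TF_def)
  obtain S where S: "\<And>z. norm z > S \<Longrightarrow> c z = 0" using assms(2) by (auto simp: TF_def)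
  have "\<exists>R. \<forall>z. norm z > R \<longrightarrow> b z + c z = 0" by (rule exI[of _ "max R S"]) (simp add: R S)
  then show "(\<lambda>z. b z + c z) \<in> TF"
    using TF_D(1,2)[OF assms(1)] TF_D(1,2)[OF assms(2)] by (auto simp: TF_def intro: SM_add)
  note d = D1_add[OF TF_D(3)[OF assms(1)] TF_D(3)[OF assms(2)]] D1_add[OF TF_D(4)[OF assms(1)] TF_D(4)[OF assms(2)]]
  show "dz (\<lambda>z. b z + c z) z = dz b z + dz c z"
    using dx_eq[OF d(1)] dy_eq[OF d(1)] dx_eq[OF d(2)] dy_eq[OF d(2)] by (simp add: dz_def complex_eq_iff)
qed

lemma TF_cmult:
  assumes "b \<in> TF"
  shows "(\<lambda>z. k * b z) \<in> TF" "dz (\<lambda>z. k * b z) z = k * dz b z"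
proof -
  note t = TF_D[OF assms]
  have e: "(\<lambda>z. Re (k * b z)) = (\<lambda>z. Re k * Re (b z) - Im k * Im (b z))" "(\<lambda>z. Im (k * b z)) = (\<lambda>z. Re k * Im (b z) + Im k * Re (b z))" by auto
  have "SM (\<lambda>z. Re (k * b z))" "SM (\<lambda>z. Im (k * b z))"
    unfolding e by (intro SM_diff SM_add SM_cmult t)+
  then show "(\<lambda>z. k * b z) \<in> TF" using assms by (auto simp: TF_def)
  have d: "D1 (\<lambda>z. Re (k * b z)) (\<lambda>z. Re k * dx (\<lambda>z. Re (b z)) z - Im k * dx (\<lambda>z. Im (b z)) z) (\<lambda>z. Re k * dy (\<lambda>z. Re (b z)) z - Im k * dy (\<lambda>z. Im (b z)) z)"
    "D1 (\<lambda>z. Im (k * b z)) (\<lambda>z. Re k * dx (\<lambda>z. Im (b z)) z + Im k * dx (\<lambda>z. Re (b z)) z) (\<lambda>z. Re k * dy (\<lambda>z. Im (b z)) z + Im k * dy (\<lambda>z. Re (b z)) z)"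
    unfolding e by (intro D1_diff D1_add D1_cmult t)+
  show "dz (\<lambda>z. k * b z) z = k * dz b z"
    unfolding dz_def dx_eq[OF d(1)] dy_eq[OF d(1)] dx_eq[OF d(2)] dy_eq[OF d(2)] by (simp add: complex_eq_iff algebra_simps)
qed

lemma TF_cnj:
  assumes "b \<in> TF"
  shows "(\<lambda>z. cnj (b z)) \<in> TF" "dz (\<lambda>z. cnj (b z)) z = cnj (dzb b z)"
proof -
  note t = TF_D[OF assms]
  show "(\<lambda>z. cnj (b z)) \<in> TF" using assms by (auto simp: TF_def intro: SM_uminus)
  have d: "D1 (\<lambda>z. - Im (b z)) (\<lambda>z. - dx (\<lambda>z. Im (b z)) z) (\<lambda>z. - dy (\<lambda>z. Im (b z)) z)"
    using D1_cmult[OF t(4), of "-1"] by simp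
  show "dz (\<lambda>z. cnj (b z)) z = cnj (dzb b z)"
    by (simp add: dz_def dzb_def dx_eq[OF d(1)] dy_eq[OF d(1)] complex_eq_iff)
qed

text \<open>Putting the weight into the measure makes the weighted spaces instances of
  \<open>L2\<close>. The base measure varies too: the Fock space refers to \<open>lebesgue\<close>,
  the estimates to \<open>lborel\<close>.\<close>

definition Mw :: "complex measure \<Rightarrow> (complex \<Rightarrow> real) \<Rightarrow> complex measure" where
  "Mw M p = density M (\<lambda>z. ennreal (exp (-2 * p z)))"

lemma Mw_L2:
  assumes [measurable]: "p \<in> borel_measurable M"
  shows "L2 (Mw M p) f \<longleftrightarrow> f \<in> borel_measurable M \<and> integrable M (\<lambda>z. (cmod (f z))\<^sup>2 * exp (-2 * p z))"
proof (cases "f \<in> borel_measurable M")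
  case True
  note [measurable] = True
  have "integrable (Mw M p) (\<lambda>z. (cmod (f z))\<^sup>2) \<longleftrightarrow> integrable M (\<lambda>z. exp (-2 * p z) *\<^sub>R (cmod (f z))\<^sup>2)"
    unfolding Mw_def by (rule integrable_density) auto
  then show ?thesis using True by (simp add: L2_def Mw_def mult.commute)
qed (simp add: L2_def Mw_def)

lemma Mw_nrm:
  assumes [measurable]: "p \<in> borel_measurable M" "f \<in> borel_measurable M"
  shows "(nrm (Mw M p) f)\<^sup>2 = (LINT z|M. (cmod (f z))\<^sup>2 * exp (-2 * p z))"
  unfolding nrm_sq Mw_def by (subst integral_density) (auto simp: mult.commute)

lemma Mw_ip:
  assumes [measurable]: "p \<in> borel_measurable M" "f \<in> borel_measurable M" "g \<in> borel_measurable M"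
  shows "ip (Mw M p) f g = (LINT z|M. f z * cnj (g z) * complex_of_real (exp (-2 * p z)))"
  unfolding ip_def Mw_def by (subst integral_density) (auto simp: scaleR_conv_of_real mult.commute mult.left_commute)

lemma integral_cong_eq: "(\<And>x. f x = g x) \<Longrightarrow> (LINT x|M. f x) = (LINT x|M. g x)"
  by simp

text \<open>The factor 2 in the weak equation makes \<open>u\<close> a solution of \<open>\<partial>-bar u = f\<close>, as \<open>dzb = 2 \<partial>-bar\<close>.\<close>

lemma dbar_solution:
  assumes p: "C2 p px py pxx pxy pyy" and N: "\<And>z. N z > 0" "\<And>z. N z \<le> pxx z + pyy z" "N \<in> borel_measurable borel"
    and f: "f \<in> borel_measurable borel" "integrable lborel (\<lambda>z. (cmod (f z))\<^sup>2 * exp (-2 * p z) / N z)"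
  shows "\<exists>u. L2 (Mw lborel p) u \<and> (nrm (Mw lborel p) u)\<^sup>2 \<le> 2 * (LINT z|lborel. (cmod (f z))\<^sup>2 * exp (-2 * p z) / N z) \<and>
     (\<forall>b\<in>TF. (LINT z|lborel. u z * dzb b z) = -2 * (LINT z|lborel. f z * b z))"
proof -
  note P = C2_D[OF p]
  have [measurable]: "p \<in> borel_measurable borel" using P(4) by (rule borel_measurable_continuous_onI)
  note [measurable] = N(3) f(1)
  define I where "I = (LINT z|lborel. (cmod (f z))\<^sup>2 * exp (-2 * p z) / N z)"
  have I0: "I \<ge> 0" unfolding I_def by (rule Bochner_Integration.integral_nonneg) (simp add: N(1) less_imp_le)
  \<comment> \<open>The factor e^(2p) cancels the weight, so that
    \<open>ip (Mw lborel p) (T b) u\<close> is the unweighted pairing of \<open>dz b\<close> with u.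
    A u that represents \<open>l\<close> on the image of \<open>T\<close> is a weak
    solution.\<close>
  define T where "T b = (\<lambda>z. complex_of_real (exp (2 * p z)) * dz b z)" for b
  define l where "l b = -2 * (LINT z|lborel. b z * cnj (f z))" for b
  have Lf: "L2 lborel (\<lambda>z. f z * complex_of_real (exp (- p z) / sqrt (N z)))"
  proof -
    have "(cmod (f z * complex_of_real (exp (- p z) / sqrt (N z))))\<^sup>2 = (cmod (f z))\<^sup>2 * exp (-2 * p z) / N z" for z
      using N(1)[of z] exp_double[of "- p z"] by (simp add: norm_mult norm_divide power_mult_distrib power_divide)
    then show ?thesis using f(2) unfolding L2_def by simp
  qed
  have nf: "(nrm lborel (\<lambda>z. f z * complex_of_real (exp (- p z) / sqrt (N z))))\<^sup>2 = I"
  proof -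
    have "(cmod (f z * complex_of_real (exp (- p z) / sqrt (N z))))\<^sup>2 = (cmod (f z))\<^sup>2 * exp (-2 * p z) / N z" for z
      using N(1)[of z] exp_double[of "- p z"] by (simp add: norm_mult norm_divide power_mult_distrib power_divide)
    then show ?thesis unfolding nrm_sq I_def by simp
  qed
  have b: "integrable lborel (\<lambda>z. b z * cnj (f z)) \<and> L2 (Mw lborel p) (T b) \<and> cmod (l b) \<le> sqrt (2 * I) * nrm (Mw lborel p) (T b)"
    if b: "b \<in> TF" for b
  proof -
    obtain R where R: "\<And>z. norm z > R \<Longrightarrow> b z = 0 \<and> dz b z = 0" using TF_supp[OF b] by blast
    have [measurable]: "b \<in> borel_measurable borel" "dz b \<in> borel_measurable borel"
      using TF_continuous[OF b] by (auto intro: borel_measurable_continuous_onI)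
    have Tm [measurable]: "T b \<in> borel_measurable borel" unfolding T_def by measurable
    have sqT: "(cmod (T b z))\<^sup>2 * exp (-2 * p z) = (cmod (dz b z))\<^sup>2 * exp (2 * p z)" for z
      by (simp add: T_def norm_mult power_mult_distrib exp_minus field_simps power2_eq_square)
    have iT: "integrable lborel (\<lambda>z. (cmod (dz b z))\<^sup>2 * exp (2 * p z))"
      by (rule integrable_compact_support[of _ R]) (auto intro!: continuous_intros TF_continuous[OF b] P simp: R)
    have LT: "L2 (Mw lborel p) (T b)" using iT Mw_L2[of p lborel "T b"] unfolding sqT by simp
    have nT: "(nrm (Mw lborel p) (T b))\<^sup>2 = (LINT z|lborel. (cmod (dz b z))\<^sup>2 * exp (2 * p z))"
      using Mw_nrm[of p lborel "T b"] unfolding sqT by simp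
    \<comment> \<open>The pairing of b with f is split as b e^p sqrt(N) against f e^(-p) / sqrt(N).
      The first factor is controlled by \<open>integral_C2_weighted_ineq\<close>, the second has
      squared norm I.\<close>
    define h where "h z = b z * complex_of_real (exp (p z) * sqrt (N z))" for z
    have sqh: "(cmod (h z))\<^sup>2 = N z * (cmod (b z))\<^sup>2 * exp (2 * p z)" for z
      using N(1)[of z] exp_double[of "p z"] by (simp add: h_def norm_mult power_mult_distrib)
    define D where "D z = (pxx z + pyy z) * ((Re (b z))\<^sup>2 + (Im (b z))\<^sup>2) * exp (2 * p z)" for z
    have iD: "integrable lborel D"
      unfolding D_def[abs_def]
      by (rule integrable_compact_support[of _ R]) (auto intro!: continuous_intros TF_continuous[OF b] P simp: R)
    have hD: "(cmod (h z))\<^sup>2 \<le> D z" for z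
      unfolding sqh D_def cmod_power2[of "b z"] using N(2)[of z] by (intro mult_right_mono) auto
    have hm [measurable]: "h \<in> borel_measurable borel" unfolding h_def by measurable
    have ih: "integrable lborel (\<lambda>z. (cmod (h z))\<^sup>2)"
      by (rule Bochner_Integration.integrable_bound[OF iD]) (use hD in \<open>auto intro: order_trans[OF _ abs_ge_self]\<close>)
    have Lh: "L2 lborel h" using ih by (simp add: L2_def)
    have "2 * (nrm lborel h)\<^sup>2 \<le> (nrm (Mw lborel p) (T b))\<^sup>2"
    proof -
      have "(nrm lborel h)\<^sup>2 \<le> (LINT z|lborel. D z)" unfolding nrm_sq by (rule integral_mono[OF ih iD hD])
      moreover have "2 * (LINT z|lborel. D z) \<le> (LINT z|lborel. (cmod (dz b z))\<^sup>2 * exp (2 * p z))"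
      proof -
        have "(cmod (dz b z))\<^sup>2 = (dx (\<lambda>z. Re (b z)) z + dy (\<lambda>z. Im (b z)) z)\<^sup>2 + (dx (\<lambda>z. Im (b z)) z - dy (\<lambda>z. Re (b z)) z)\<^sup>2" for z
          by (simp add: dz_def cmod_power2)
        then show ?thesis
          unfolding D_def using integral_C2_weighted_ineq[OF p SM_C2_dx[OF TF_D(1)[OF b]] SM_C2_dx[OF TF_D(2)[OF b]], of R] R by simp
      qed
      ultimately show ?thesis unfolding nT by linarith
    qed
    then have nh: "sqrt 2 * nrm lborel h \<le> nrm (Mw lborel p) (T b)"
      using real_sqrt_le_mono[of "2 * (nrm lborel h)\<^sup>2" "(nrm (Mw lborel p) (T b))\<^sup>2"] by (simp add: real_sqrt_mult nrm_nonneg)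
    have e: "h z * cnj (f z * complex_of_real (exp (- p z) / sqrt (N z))) = b z * cnj (f z)" for z
    proof -
      have "complex_of_real (exp (p z) * sqrt (N z)) * complex_of_real (exp (- p z) / sqrt (N z)) = 1"
      proof -
        have r: "(exp (p z) * sqrt (N z)) * (exp (- p z) / sqrt (N z)) = 1"
          using N(1)[of z] by (simp add: exp_minus)
        show ?thesis unfolding of_real_mult[symmetric] r by simp
      qed
      then show ?thesis using N(1)[of z] unfolding h_def by (auto simp add: mult_ac)
    qed
    have ib: "integrable lborel (\<lambda>z. b z * cnj (f z))"
      using ip_integrable[OF Lh Lf] unfolding e .
    have "l b = -2 * ip lborel h (\<lambda>z. f z * complex_of_real (exp (- p z) / sqrt (N z)))"
      unfolding l_def ip_def e ..
    then have "cmod (l b) \<le> 2 * (nrm lborel h * nrm lborel (\<lambda>z. f z * complex_of_real (exp (- p z) / sqrt (N z))))"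
      using Cauchy_Schwarz[OF Lh Lf] by (simp add: norm_mult)
    also have "nrm lborel (\<lambda>z. f z * complex_of_real (exp (- p z) / sqrt (N z))) = sqrt I"
      using nf nrm_nonneg real_sqrt_unique by metis
    also have "2 * (nrm lborel h * sqrt I) = sqrt (2 * I) * (sqrt 2 * nrm lborel h)"
      by (simp add: real_sqrt_mult)
    also have "\<dots> \<le> sqrt (2 * I) * nrm (Mw lborel p) (T b)" using nh I0 by (intro mult_left_mono) auto
    finally show ?thesis using ib LT by blast
  qed
  have "\<exists>u F. L2 (Mw lborel p) u \<and> nrm (Mw lborel p) u \<le> sqrt (2 * I) \<and> (\<forall>b\<in>TF. ip (Mw lborel p) (T b) u = l b) \<and> (\<forall>n::nat. F n \<in> TF) \<and>
     (AE x in Mw lborel p. (\<lambda>n. T (F n) x) \<longlonglongrightarrow> u x) \<and> (\<lambda>n. nrm (Mw lborel p) (\<lambda>x. T (F n) x - u x)) \<longlonglongrightarrow> 0"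
  proof (rule Riesz_representation)
    show "TF \<noteq> {}" by (auto simp: TF_def intro!: exI[of _ "\<lambda>z. 0"] SM_const)
    show "l (\<lambda>z. f z + g z) = l f + l g" if "f \<in> TF" "g \<in> TF" for f g
      using b[OF that(1)] b[OF that(2)] by (simp add: l_def distrib_right)
    show "l (\<lambda>z. c * f z) = c * l f" for c f by (simp add: l_def mult.assoc)
    show "T (\<lambda>z. f z + g z) = (\<lambda>x. T f x + T g x)" if "f \<in> TF" "g \<in> TF" for f g
      unfolding T_def TF_add(2)[OF that] by (simp add: algebra_simps)
    show "T (\<lambda>z. c * f z) = (\<lambda>x. c * T f x)" if "f \<in> TF" for c f
      unfolding T_def TF_cmult(2)[OF that] by (simp add: mult_ac)
  qed (use b TF_add TF_cmult I0 in auto)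
  then obtain u where u: "L2 (Mw lborel p) u" "nrm (Mw lborel p) u \<le> sqrt (2 * I)" "\<And>b. b \<in> TF \<Longrightarrow> ip (Mw lborel p) (T b) u = l b"
    by blast
  have um [measurable]: "u \<in> borel_measurable borel" using L2_measurable[OF u(1)] by (simp add: Mw_def)
  have "(nrm (Mw lborel p) u)\<^sup>2 \<le> 2 * I"
    using power_mono[OF u(2) nrm_nonneg, of 2] I0 by simp
  moreover have "(LINT z|lborel. u z * dzb b z) = -2 * (LINT z|lborel. f z * b z)" if b: "b \<in> TF" for b
  proof -
    \<comment> \<open>Conjugation exchanges \<open>dz\<close> and \<open>dzb\<close>, which turns
      the representation of \<open>l\<close> at c into the weak equation tested with b.\<close>
    define c where "c = (\<lambda>z. cnj (b z))"
    have c: "c \<in> TF" unfolding c_def by (rule TF_cnj[OF b])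
    have [measurable]: "dz c \<in> borel_measurable borel"
      using TF_continuous[OF c] by (auto intro: borel_measurable_continuous_onI)
    have Tm: "T c \<in> borel_measurable borel" unfolding T_def by measurable
    have "ip (Mw lborel p) (T c) u = (LINT z|lborel. T c z * cnj (u z) * complex_of_real (exp (-2 * p z)))"
      by (rule Mw_ip) (use Tm in auto)
    also have "\<dots> = (LINT z|lborel. cnj (u z * dzb b z))"
    proof (rule integral_cong_eq)
      fix z
      have "complex_of_real (exp (2 * p z)) * complex_of_real (exp (-2 * p z)) = 1"
      proof -
        have r: "exp (2 * p z) * exp (-2 * p z) = 1" by (simp add: exp_minus)
        show ?thesis unfolding of_real_mult[symmetric] r by simp
      qed
      then show "T c z * cnj (u z) * complex_of_real (exp (-2 * p z)) = cnj (u z * dzb b z)"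
        by (simp add: T_def c_def TF_cnj(2)[OF b] mult_ac)
    qed
    also have "\<dots> = cnj (LINT z|lborel. u z * dzb b z)" by (rule Bochner_Integration.integral_cnj)
    finally have "cnj (LINT z|lborel. u z * dzb b z) = -2 * (LINT z|lborel. cnj (f z * b z))"
      using u(3)[OF c] by (simp add: l_def c_def mult.commute)
    then have "cnj (LINT z|lborel. u z * dzb b z) = cnj (-2 * (LINT z|lborel. f z * b z))"
      unfolding Bochner_Integration.integral_cnj by simp
    then show ?thesis by (simp only: complex_cnj_cancel_iff)
  qed
  ultimately show ?thesis using u(1) by (auto simp: I_def)
qed

section \<open>Weakly holomorphic functions\<close>

text \<open>Allows factors such as exp(G), controlled only on a disc, to be multiplied by bumps
  supported inside it and integrated over the plane.\<close>

lemma continuous_glue: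
  fixes f g :: "complex \<Rightarrow> complex"
  assumes "open S" "closed K" "K \<subseteq> S" "continuous_on S f" "continuous_on UNIV g" "\<And>w. w \<notin> K \<Longrightarrow> g w = 0"
  shows "continuous_on UNIV (\<lambda>w. f w * g w)"
proof -
  have "continuous_on (S \<union> - K) (\<lambda>w. f w * g w)"
  proof (rule continuous_on_open_Un)
    show "continuous_on S (\<lambda>w. f w * g w)"
      by (intro continuous_intros assms continuous_on_subset[OF assms(5)]) auto
    show "continuous_on (- K) (\<lambda>w. f w * g w)"
      by (rule continuous_on_eq[of _ "\<lambda>_. 0"]) (use assms in auto)
  qed (use assms in auto)
  moreover have "S \<union> - K = UNIV" using assms by auto
  ultimately show ?thesis by simp
qed

lemma TF_derivative:
  assumes "b \<in> TF"
  shows "(b has_derivative (\<lambda>h. complex_of_real (Re h) * Complex (dx (\<lambda>z. Re (b z)) z) (dx (\<lambda>z. Im (b z)) z)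
     + complex_of_real (Im h) * Complex (dy (\<lambda>z. Re (b z)) z) (dy (\<lambda>z. Im (b z)) z))) (at z)"
proof -
  note d = D1D[OF TF_D(3)[OF assms], of z] D1D[OF TF_D(4)[OF assms], of z]
  have "((\<lambda>z. complex_of_real (Re (b z)) + \<i> * complex_of_real (Im (b z))) has_derivative
    (\<lambda>h. complex_of_real (Re h * dx (\<lambda>z. Re (b z)) z + Im h * dy (\<lambda>z. Re (b z)) z) + \<i> * complex_of_real (Re h * dx (\<lambda>z. Im (b z)) z + Im h * dy (\<lambda>z. Im (b z)) z))) (at z)"
    by (intro has_derivative_add has_derivative_mult_right has_derivative_of_real d)
  moreover have "(\<lambda>z. complex_of_real (Re (b z)) + \<i> * complex_of_real (Im (b z))) = b"
    by (simp add: fun_eq_iff complex_eq_iff)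
  ultimately show ?thesis
    by (rule_tac has_derivative_eq_rhs) (auto simp: fun_eq_iff complex_eq_iff)
qed

lemma integral_dbar_zero:
  assumes h: "\<And>z. (h has_derivative (\<lambda>k. complex_of_real (Re k) * hx z + complex_of_real (Im k) * hy z)) (at z)"
    and c: "continuous_on UNIV hx" "continuous_on UNIV hy" and s: "\<And>z. norm z > R \<Longrightarrow> h z = (0::complex)"
  shows "(LINT z|lborel. hx z + \<i> * hy z) = 0"
proof -
  have r: "D1 (\<lambda>z. Re (h z)) (\<lambda>z. Re (hx z)) (\<lambda>z. Re (hy z))" and i: "D1 (\<lambda>z. Im (h z)) (\<lambda>z. Im (hx z)) (\<lambda>z. Im (hy z))"
    unfolding D1_def using has_derivative_Re[OF h] has_derivative_Im[OF h] by auto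
  have c': "continuous_on UNIV (\<lambda>z. Re (hx z))" "continuous_on UNIV (\<lambda>z. Re (hy z))" "continuous_on UNIV (\<lambda>z. Im (hx z))" "continuous_on UNIV (\<lambda>z. Im (hy z))"
    by (intro continuous_intros c)+
  have rs: "Re (h z) = 0" "Im (h z) = 0" if "norm z > R" for z using s[OF that] by auto
  have z: "hx z = 0" "hy z = 0" if "norm z > R" for z
    using D1_support[OF r, of R z] D1_support[OF i, of R z] rs that by (auto simp: complex_eq_iff)
  have int: "integrable lborel hx" "integrable lborel hy"
    by (rule integrable_compact_support[OF c(1)] integrable_compact_support[OF c(2)], rule z, assumption)+
  have "(LINT z|lborel. hx z) = 0"
    by (rule complex_eqI)
       (use integral_partial_zero(1)[OF r c'(1,2) rs(1)] integral_partial_zero(1)[OF i c'(3,4) rs(2)] int in \<open>simp_all flip: integral_Re integral_Im\<close>)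
  moreover have "(LINT z|lborel. hy z) = 0"
    by (rule complex_eqI)
       (use integral_partial_zero(2)[OF r c'(1,2) rs(1)] integral_partial_zero(2)[OF i c'(3,4) rs(2)] int in \<open>simp_all flip: integral_Re integral_Im\<close>)
  ultimately show ?thesis using int by simp
qed

text \<open>The Leibniz rule for F b and \<open>integral_dbar_zero\<close>. F is differentiable only
  near the support of b, so the product is treated on S and on the complement of K
  separately.\<close>

lemma dbar_by_parts:
  assumes S: "open S" "closed K" "K \<subseteq> S" and b: "b \<in> TF" "\<And>w. w \<notin> K \<Longrightarrow> b w = 0"
    and F: "\<And>z. z \<in> S \<Longrightarrow> (F has_derivative (\<lambda>k. complex_of_real (Re k) * Fx z + complex_of_real (Im k) * Fy z)) (at z)"
    and c: "continuous_on S Fx" "continuous_on S Fy"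
  shows "(LINT w|lborel. F w * dzb b w) = - (LINT w|lborel. (Fx w + \<i> * Fy w) * b w)"
    "integrable lborel (\<lambda>w. F w * dzb b w)" "integrable lborel (\<lambda>w. (Fx w + \<i> * Fy w) * b w)"
proof -
  obtain R where R: "\<And>z. norm z > R \<Longrightarrow> b z = 0 \<and> dzb b z = 0" using TF_supp[OF b(1)] by blast
  define bx where "bx z = Complex (dx (\<lambda>z. Re (b z)) z) (dx (\<lambda>z. Im (b z)) z)" for z
  define by' where "by' z = Complex (dy (\<lambda>z. Re (b z)) z) (dy (\<lambda>z. Im (b z)) z)" for z
  have bd: "(b has_derivative (\<lambda>h. complex_of_real (Re h) * bx z + complex_of_real (Im h) * by' z)) (at z)" for z
    unfolding bx_def by'_def by (rule TF_derivative[OF b(1)])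
  have bz: "dzb b z = bx z + \<i> * by' z" for z by (simp add: dzb_def bx_def by'_def complex_eq_iff)
  have b0: "bx w = 0 \<and> by' w = 0" if "w \<notin> K" for w
  proof -
    have "((\<lambda>z. 0) has_derivative (\<lambda>h. complex_of_real (Re h) * bx w + complex_of_real (Im h) * by' w)) (at w)"
      by (rule has_derivative_transform_within_open[OF bd, where s="- K"]) (use that b S in auto)
    from has_derivative_unique[OF this has_derivative_const]
    have "(\<lambda>h. complex_of_real (Re h) * bx w + complex_of_real (Im h) * by' w) = (\<lambda>h. 0)" .
    from fun_cong[OF this, of 1] fun_cong[OF this, of \<i>] show ?thesis by simp
  qed
  have dz0: "dzb b w = 0" if "w \<notin> K" for w using b0[OF that] by (simp add: bz)
  have sm: "SM (\<lambda>z. Re (b z))" "SM (\<lambda>z. Im (b z))" using TF_D[OF b(1)] by auto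
  have cb: "continuous_on UNIV bx" "continuous_on UNIV by'"
    unfolding bx_def by'_def Complex_eq
    by (intro continuous_intros SM_continuous[OF SM_D1(2)[OF sm(1)]] SM_continuous[OF SM_D1(3)[OF sm(1)]]
      SM_continuous[OF SM_D1(2)[OF sm(2)]] SM_continuous[OF SM_D1(3)[OF sm(2)]])+
  have cF: "continuous_on S F" using F by (meson continuous_at_imp_continuous_on has_derivative_continuous)
  define hx where "hx z = Fx z * b z + F z * bx z" for z
  define hy where "hy z = Fy z * b z + F z * by' z" for z
  note gl = continuous_glue[OF S]
  note TFc = TF_continuous[OF b(1)]
  have ch: "continuous_on UNIV hx" "continuous_on UNIV hy"
    unfolding hx_def hy_def using b0 by (intro continuous_on_add gl c cF TFc cb b(2); auto)+
  have hd: "((\<lambda>z. F z * b z) has_derivative (\<lambda>k. complex_of_real (Re k) * hx z + complex_of_real (Im k) * hy z)) (at z)" for z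
  proof (cases "z \<in> S")
    case True
    show ?thesis
      by (rule has_derivative_eq_rhs[OF has_derivative_mult[OF F[OF True] bd]]) (auto simp: hx_def hy_def fun_eq_iff algebra_simps)
  next
    case False
    then have zK: "z \<in> - K" using S by auto
    have h0: "hx z = 0" "hy z = 0" using b0[of z] b(2)[of z] zK by (auto simp: hx_def hy_def)
    have "((\<lambda>z. 0) has_derivative (\<lambda>k. 0)) (at z)" by simp
    then have "((\<lambda>z. F z * b z) has_derivative (\<lambda>k. 0)) (at z)"
      by (rule has_derivative_transform_within_open[where s="- K"]) (use zK b S in auto)
    then show ?thesis by (simp add: h0)
  qed
  have z: "(LINT z|lborel. hx z + \<i> * hy z) = 0"
    by (rule integral_dbar_zero[OF hd ch]) (use R in auto)
  have e: "hx z + \<i> * hy z = (Fx z + \<i> * Fy z) * b z + F z * dzb b z" for z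
    by (simp add: hx_def hy_def bz algebra_simps)
  have i1: "integrable lborel (\<lambda>w. F w * dzb b w)"
    by (rule integrable_compact_support[OF gl[OF cF TFc(3) dz0], where R=R]) (use R in auto)
  have i2: "integrable lborel (\<lambda>w. (Fx w + \<i> * Fy w) * b w)"
    by (rule integrable_compact_support[OF gl[OF _ TFc(1) b(2)], where R=R]) (use R c in \<open>auto intro!: continuous_on_add continuous_on_mult continuous_on_const\<close>)
  show "integrable lborel (\<lambda>w. F w * dzb b w)" "integrable lborel (\<lambda>w. (Fx w + \<i> * Fy w) * b w)" by fact+
  show "(LINT w|lborel. F w * dzb b w) = - (LINT w|lborel. (Fx w + \<i> * Fy w) * b w)"
    using z i1 i2 unfolding e by (simp add: eq_neg_iff_add_eq_0 add.commute)
qed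

lemma holomorphic_partials:
  assumes "P holomorphic_on S" "open S" "z \<in> S"
  shows "(P has_derivative (\<lambda>k. complex_of_real (Re k) * deriv P z + complex_of_real (Im k) * (\<i> * deriv P z))) (at z)"
proof -
  have "(P has_derivative (\<lambda>k. deriv P z * k)) (at z)"
    using holomorphic_derivI[OF assms(1,2,3)] by (simp add: has_field_derivative_def)
  then show ?thesis
    by (rule has_derivative_eq_rhs) (auto simp: fun_eq_iff complex_eq_iff algebra_simps)
qed

lemma holomorphic_test_zero:
  assumes P: "P holomorphic_on S" and S: "open S" "closed K" "K \<subseteq> S" and b: "b \<in> TF" "\<And>w. w \<notin> K \<Longrightarrow> b w = 0"
  shows "(LINT w|lborel. P w * dzb b w) = 0"
proof -
  have c: "continuous_on S (deriv P)" using P S holomorphic_deriv holomorphic_on_imp_continuous_on by blast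
  have "(LINT w|lborel. P w * dzb b w) = - (LINT w|lborel. (deriv P w + \<i> * (\<i> * deriv P w)) * b w)"
    by (rule dbar_by_parts(1)[OF S b holomorphic_partials[OF P S(1)]]) (auto intro!: continuous_intros c)
  also have "\<dots> = 0" by (simp add: mult.assoc[symmetric])
  finally show ?thesis .
qed

lemma TF_eta:
  assumes "r > 0"
  shows "(\<lambda>w. complex_of_real (eta r (w - a))) \<in> TF"
    "\<And>w. w \<notin> cball a r \<Longrightarrow> complex_of_real (eta r (w - a)) = 0"
proof -
  have "\<exists>R. \<forall>z::complex. norm z > R \<longrightarrow> eta r (z - a) = 0"
  proof (intro exI[of _ "norm a + r"] allI impI)
    fix z :: complex assume "norm z > norm a + r"
    then have "norm (z - a) \<ge> r" using norm_triangle_ineq2[of z a] by simp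
    then show "eta r (z - a) = 0" by (rule eta_outside[OF assms])
  qed
  then show "(\<lambda>w. complex_of_real (eta r (w - a))) \<in> TF"
    unfolding TF_def by (auto simp: SM_const intro: SM_shift[OF eta_SM])
  fix w assume "w \<notin> cball a r"
  then show "complex_of_real (eta r (w - a)) = 0" by (simp add: eta_outside assms dist_norm norm_minus_commute)
qed

text \<open>\<open>B\<close> is \<open>dz\<close> of a difference of smoothed logarithms, and
  \<open>dzb\<close> of it is the Laplacian. Testing a weakly holomorphic function with
  \<open>B\<close> therefore equates its averages at two scales.\<close>

lemma TF_LL:
  fixes a :: complex
  assumes "r > 0" "s > 0"
  defines "B \<equiv> (\<lambda>w. Complex (LLx r (w - a) - LLx s (w - a)) (- (LLy r (w - a) - LLy s (w - a))))"
  shows "B \<in> TF" "\<And>w. w \<notin> cball a (max r s) \<Longrightarrow> B w = 0" "dzb B w = complex_of_real (eta r (w - a) - eta s (w - a))"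
proof -
  note l = LL_diff_support[OF assms(1,2)]
  show 0: "B w = 0" if "w \<notin> cball a (max r s)" for w
  proof -
    have "norm (w - a) > max r s" using that by (auto simp: dist_norm norm_minus_commute)
    from l(2)[OF this] l(3)[OF this] show ?thesis by (simp add: B_def complex_eq_iff)
  qed
  have "\<exists>R. \<forall>z. norm z > R \<longrightarrow> B z = 0"
  proof (intro exI[of _ "norm a + max r s"] allI impI)
    fix z :: complex assume "norm z > norm a + max r s"
    then have "norm (z - a) > max r s" using norm_triangle_ineq2[of z a] by linarith
    then have "z \<notin> cball a (max r s)" unfolding mem_cball dist_norm norm_minus_commute[of a z] by linarith
    then show "B z = 0" by (rule 0)
  qed
  moreover have "SM (\<lambda>z. LLx r (z - a) - LLx s (z - a))" "SM (\<lambda>z. - (LLy r (z - a) - LLy s (z - a)))"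
    by (rule SM_diff[OF SM_shift[OF LLx_SM] SM_shift[OF LLx_SM]] SM_uminus[OF SM_diff[OF SM_shift[OF LLy_SM] SM_shift[OF LLy_SM]]])+
  ultimately show "B \<in> TF" by (simp add: TF_def B_def)
  note d = C2_D[OF C2_shift[OF LL_diff_C2[of r s], of a]]
  have d3: "D1 (\<lambda>z. - (LLy r (z - a) - LLy s (z - a))) (\<lambda>z. - (LLxy r (z - a) - LLxy s (z - a))) (\<lambda>z. - (LLyy r (z - a) - LLyy s (z - a)))"
    using D1_cmult[OF d(3), of "-1"] by simp
  show "dzb B w = complex_of_real (eta r (w - a) - eta s (w - a))"
    using LL_lap[OF assms(1), of "w - a"] LL_lap[OF assms(2), of "w - a"]
    unfolding dzb_def B_def complex.sel dx_eq[OF d(2)] dy_eq[OF d(2)] dx_eq[OF d3] dy_eq[OF d3]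
    by (simp add: complex_eq_iff)
qed

lemma eta_glue_integrable:
  assumes "continuous_on (ball a R) P" "0 < r" "r < R"
  shows "integrable lborel (\<lambda>w. P w * complex_of_real (eta r (w - a)))"
proof (rule integrable_compact_support[of _ "norm a + r"])
  show "continuous_on UNIV (\<lambda>w. P w * complex_of_real (eta r (w - a)))"
    by (rule continuous_glue[of "ball a R" "cball a r"])
       (use assms TF_eta[OF assms(2)] TF_continuous(1)[OF TF_eta(1)[OF assms(2)]] in auto)
  fix z :: complex assume "norm z > norm a + r"
  then have "norm (z - a) \<ge> r" using norm_triangle_ineq2[of z a] by simp
  then show "P z * complex_of_real (eta r (z - a)) = 0" by (simp add: eta_outside assms)
qed

lemma eta_shift_integral: "r > 0 \<Longrightarrow> integrable lborel (\<lambda>w. eta r (w - a))" "r > 0 \<Longrightarrow> (LINT w|lborel. eta r (w - a)) = mass"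
proof -
  assume r: "r > 0"
  show "integrable lborel (\<lambda>w. eta r (w - a))"
    using integrable_Re[OF eta_glue_integrable[of a "r+1" "\<lambda>_. 1" r]] r by simp
  show "(LINT w|lborel. eta r (w - a)) = mass"
    using lborel_integral_shift[of "eta r" "-a"] eta_mass[OF r] borel_measurable_continuous_onI[OF eta_continuous] by simp
qed

text \<open>Averages at different radii agree by \<open>TF_LL\<close>, and at small radii continuity
  makes them close to \<open>mass\<close> times the value at the centre.\<close>

lemma mean_value_eta:
  assumes P: "P holomorphic_on ball a R" and r: "0 < r" "r < R"
  shows "(LINT w|lborel. P w * complex_of_real (eta r (w - a))) = complex_of_real mass * P a"
proof -
  define I where "I r = (LINT w|lborel. P w * complex_of_real (eta r (w - a)))" for r
  have cP: "continuous_on (ball a R) P" using P holomorphic_on_imp_continuous_on by blast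
  have eq: "I r = I s" if "0 < s" "s < R" for s
  proof -
    have "(LINT w|lborel. P w * dzb (\<lambda>w. Complex (LLx r (w - a) - LLx s (w - a)) (- (LLy r (w - a) - LLy s (w - a)))) w) = 0"
      by (rule holomorphic_test_zero[OF P, of "cball a (max r s)"]) (use TF_LL[OF r(1) that(1)] r that in auto)
    then have "(LINT w|lborel. P w * complex_of_real (eta r (w - a)) - P w * complex_of_real (eta s (w - a))) = 0"
      unfolding TF_LL(3)[OF r(1) that(1)] by (simp add: right_diff_distrib)
    then show ?thesis
      using eta_glue_integrable[OF cP r] eta_glue_integrable[OF cP that] by (simp add: I_def)
  qed
  have "norm (I r - complex_of_real mass * P a) \<le> e" if e: "e > 0" for e
  proof -
    define e' where "e' = e / mass"
    have e': "e' > 0" using e mass_pos by (simp add: e'_def)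
    have "isCont P a" using cP r by (simp add: continuous_on_eq_continuous_at)
    then obtain \<delta> where \<delta>: "\<delta> > 0" "\<And>w. dist w a < \<delta> \<Longrightarrow> dist (P w) (P a) < e'"
      unfolding continuous_at_eps_delta using e' by blast
    define s where "s = min r (\<delta>/2)"
    have s: "0 < s" "s < R" "s < \<delta>" using r \<delta> by (auto simp: s_def)
    note i = eta_glue_integrable[OF cP s(1,2)]
    have ic: "integrable lborel (\<lambda>w. P a * complex_of_real (eta s (w - a)))"
      using eta_shift_integral(1)[OF s(1)] by simp
    have "I s - complex_of_real mass * P a = (LINT w|lborel. P w * complex_of_real (eta s (w - a)) - P a * complex_of_real (eta s (w - a)))"
      using i ic eta_shift_integral(2)[OF s(1), of a] by (simp add: I_def mult.commute)
    also have "norm \<dots> \<le> (LINT w|lborel. norm (P w * complex_of_real (eta s (w - a)) - P a * complex_of_real (eta s (w - a))))"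
      by (rule integral_norm_bound)
    also have "\<dots> \<le> (LINT w|lborel. e' * eta s (w - a))"
    proof (rule integral_mono)
      show "integrable lborel (\<lambda>w. norm (P w * complex_of_real (eta s (w - a)) - P a * complex_of_real (eta s (w - a))))"
        using i ic by (intro integrable_norm Bochner_Integration.integrable_diff)
      show "integrable lborel (\<lambda>w. e' * eta s (w - a))" using eta_shift_integral(1)[OF s(1)] by simp
      fix w
      show "norm (P w * complex_of_real (eta s (w - a)) - P a * complex_of_real (eta s (w - a))) \<le> e' * eta s (w - a)"
      proof (cases "dist w a < s")
        case True
        then have "norm (P w - P a) \<le> e'" using \<delta>(2)[of w] s by (simp add: dist_norm)
        then show ?thesis by (simp add: left_diff_distrib[symmetric] norm_mult eta_nonneg mult_right_mono)
      next
        case False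
        then show ?thesis by (simp add: eta_outside s dist_norm)
      qed
    qed
    also have "\<dots> = e" using eta_shift_integral(2)[OF s(1), of a] mass_pos by (simp add: e'_def)
    finally show ?thesis using eq[OF s(1,2)] by simp
  qed
  then have "norm (I r - complex_of_real mass * P a) \<le> 0" by (rule field_le_epsilon[where y=0, simplified]) 
  then show ?thesis by (simp add: I_def)
qed

lemma Cauchy_Riemann_holomorphic:
  assumes "D1 P Px Py" "D1 Q Qx Qy" "\<And>z. Px z = Qy z" "\<And>z. Py z = - Qx z"
  shows "(\<lambda>z. complex_of_real (P z) + \<i> * complex_of_real (Q z)) holomorphic_on UNIV"
proof -
  have "((\<lambda>z. complex_of_real (P z) + \<i> * complex_of_real (Q z)) has_field_derivative (complex_of_real (Px z) + \<i> * complex_of_real (Qx z))) (at z)" for z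
  proof -
    have "((\<lambda>z. complex_of_real (P z) + \<i> * complex_of_real (Q z)) has_derivative
      (\<lambda>h. complex_of_real (Re h * Px z + Im h * Py z) + \<i> * complex_of_real (Re h * Qx z + Im h * Qy z))) (at z)"
      by (intro has_derivative_add has_derivative_mult_right has_derivative_of_real D1D[OF assms(1)] D1D[OF assms(2)])
    then show ?thesis
      unfolding has_field_derivative_def
      by (rule has_derivative_eq_rhs) (use assms(3,4)[of z] in \<open>auto simp: fun_eq_iff complex_eq_iff algebra_simps\<close>)
  qed
  then show ?thesis unfolding holomorphic_on_open[OF open_UNIV] by blast
qed

lemma locint_mult_integrable:
  assumes v: "locint lborel v" and c: "continuous_on UNIV c" "\<And>z. norm z > R \<Longrightarrow> c z = 0"
  shows "integrable lborel (\<lambda>z. c z * v z)"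
  by (rule kernel_bound(2)[OF sets_lborel v, of "\<lambda>_ z. c z"])
     (use c in \<open>auto simp: jsupp_def jcont_def intro!: continuous_on_compose2[OF c(1)] continuous_intros\<close>)

text \<open>Weyl's lemma for \<open>\<partial>-bar\<close>: the averages over all scales of a weakly holomorphic function
  coincide, so they are holomorphic and equal to the function almost everywhere.\<close>

lemma weakly_holomorphic:
  assumes L: "locint lborel (\<lambda>z. Re (u z))" "locint lborel (\<lambda>z. Im (u z))"
    and t: "\<And>b. b \<in> TF \<Longrightarrow> (LINT z|lborel. u z * dzb b z) = 0"
  shows "\<exists>W. W holomorphic_on UNIV \<and> (AE z in lborel. u z = W z)"
proof -
  define p where "p z = Re (u z)" for z
  define q where "q z = Im (u z)" for z
  have Lp: "locint lborel p" and Lq: "locint lborel q" using L by (auto simp: p_def[abs_def] q_def[abs_def])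
  have split: "(LINT z|lborel. Re (dzb b z) * p z) - (LINT z|lborel. Im (dzb b z) * q z) = 0
     \<and> (LINT z|lborel. Im (dzb b z) * p z) + (LINT z|lborel. Re (dzb b z) * q z) = 0" if b: "b \<in> TF" for b
  proof -
    obtain R where R: "\<And>z. norm z > R \<Longrightarrow> dzb b z = 0" using TF_supp[OF b] by blast
    have c: "continuous_on UNIV (\<lambda>z. Re (dzb b z))" "continuous_on UNIV (\<lambda>z. Im (dzb b z))" by (intro continuous_intros TF_continuous[OF b])+
    have i: "integrable lborel (\<lambda>z. Re (dzb b z) * p z)" "integrable lborel (\<lambda>z. Im (dzb b z) * p z)"
       "integrable lborel (\<lambda>z. Re (dzb b z) * q z)" "integrable lborel (\<lambda>z. Im (dzb b z) * q z)"
      by (rule locint_mult_integrable[OF Lp c(1), of R] locint_mult_integrable[OF Lp c(2), of R]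
         locint_mult_integrable[OF Lq c(1), of R] locint_mult_integrable[OF Lq c(2), of R]; simp add: R)+
    have e: "u z * dzb b z = complex_of_real (Re (dzb b z) * p z - Im (dzb b z) * q z) + \<i> * complex_of_real (Im (dzb b z) * p z + Re (dzb b z) * q z)" for z
      by (simp add: p_def q_def complex_eq_iff algebra_simps)
    have "(LINT z|lborel. complex_of_real (Re (dzb b z) * p z - Im (dzb b z) * q z) + \<i> * complex_of_real (Im (dzb b z) * p z + Re (dzb b z) * q z)) = 0"
      using t[OF b] unfolding e .
    moreover have "(LINT z|lborel. complex_of_real (Re (dzb b z) * p z - Im (dzb b z) * q z) + \<i> * complex_of_real (Im (dzb b z) * p z + Re (dzb b z) * q z))
       = complex_of_real ((LINT z|lborel. Re (dzb b z) * p z) - (LINT z|lborel. Im (dzb b z) * q z)) + \<i> * complex_of_real ((LINT z|lborel. Im (dzb b z) * p z) + (LINT z|lborel. Re (dzb b z) * q z))"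
    proof -
      have i': "integrable lborel (\<lambda>z. Re (dzb b z) * p z - Im (dzb b z) * q z)" "integrable lborel (\<lambda>z. Im (dzb b z) * p z + Re (dzb b z) * q z)"
        using i by auto
      have "(LINT z|lborel. complex_of_real (Re (dzb b z) * p z - Im (dzb b z) * q z) + \<i> * complex_of_real (Im (dzb b z) * p z + Re (dzb b z) * q z))
         = (LINT z|lborel. complex_of_real (Re (dzb b z) * p z - Im (dzb b z) * q z)) + (LINT z|lborel. \<i> * complex_of_real (Im (dzb b z) * p z + Re (dzb b z) * q z))"
        by (intro Bochner_Integration.integral_add integrable_mult_right integrable_of_real i')
      then show ?thesis using i unfolding integral_mult_right_zero integral_complex_of_real by simp
    qed
    ultimately show ?thesis by (simp add: complex_eq_iff)
  qed
  \<comment> \<open>Testing with the potential gradient of \<open>TF_LL\<close> at scales r and 1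
    shows that the averages do not depend on the scale.\<close>
  have inv: "(LINT w|lborel. eta r (z - w) * p w) = (LINT w|lborel. eta 1 (z - w) * p w)"
     "(LINT w|lborel. eta r (z - w) * q w) = (LINT w|lborel. eta 1 (z - w) * q w)" if r: "r > 0" for r z
  proof -
    have "(LINT w|lborel. (eta r (w - z) - eta 1 (w - z)) * p w) = 0 \<and> (LINT w|lborel. (eta r (w - z) - eta 1 (w - z)) * q w) = 0"
      using split[OF TF_LL(1)[OF r zero_less_one]] unfolding TF_LL(3)[OF r zero_less_one] by simp
    then show "(LINT w|lborel. eta r (z - w) * p w) = (LINT w|lborel. eta 1 (z - w) * p w)"
     "(LINT w|lborel. eta r (z - w) * q w) = (LINT w|lborel. eta 1 (z - w) * q w)"
      using mollify_integrable[OF r sets_lborel Lp, of z] mollify_integrable[OF r sets_lborel Lq, of z]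
        mollify_integrable[OF zero_less_one sets_lborel Lp, of z] mollify_integrable[OF zero_less_one sets_lborel Lq, of z]
      by (simp_all add: eta_even[of _ _ z] left_diff_distrib)
  qed
  have AE: "AE z in lborel. (LINT w|lborel. eta 1 (z - w) * v w) = mass * v z"
    if v: "locint lborel v" and i: "\<And>r z. r > 0 \<Longrightarrow> (LINT w|lborel. eta r (z - w) * v w) = (LINT w|lborel. eta 1 (z - w) * v w)" for v
  proof (rule mollify_limit_AE[OF v, of "\<lambda>n. 1 / real (Suc n)"])
    show "(\<lambda>n. 1 / real (Suc n)) \<longlonglongrightarrow> 0" using LIMSEQ_inverse_real_of_nat by (simp add: inverse_eq_divide)
    have e: "(LINT w|lborel. eta (1 / real (Suc n)) (z - w) * v w) = (LINT w|lborel. eta 1 (z - w) * v w)" for n z by (rule i) simp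
    show "(\<lambda>n. LINT w|lborel. eta (1 / real (Suc n)) (z - w) * v w) \<longlonglongrightarrow> (LINT w|lborel. eta 1 (z - w) * v w)" for z
      unfolding e by simp
    fix R :: real
    define V where "V z = (LINT w|lborel. eta 1 (z - w) * v w)" for z
    have "continuous_on UNIV V"
      unfolding V_def[abs_def]
      by (rule kernel_integral_continuous[OF sets_lborel v jcont_shift(1)[OF eta_continuous] jsupp_eta]) simp
    then have "compact (V ` cball 0 R)"
      by (intro compact_continuous_image) (auto intro: continuous_on_subset)
    then obtain B where B: "\<forall>x\<in>V ` cball 0 R. norm x \<le> B" using compact_imp_bounded bounded_iff by metis
    have "\<forall>n z. norm z \<le> R \<longrightarrow> \<bar>V z\<bar> \<le> B" using B by auto
    then show "\<exists>B. \<forall>n z. norm z \<le> R \<longrightarrow> \<bar>LINT w|lborel. eta (1 / real (Suc n)) (z - w) * v w\<bar> \<le> B"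
      unfolding e V_def by blast
  qed simp
  define P where "P z = (LINT w|lborel. eta 1 (w - z) * p w)" for z
  define Q where "Q z = (LINT w|lborel. eta 1 (w - z) * q w)" for z
  define ex where "ex = dx (eta 1)"
  define ey where "ey = dy (eta 1)"
  have de: "D1 (eta 1) ex ey" unfolding ex_def ey_def by (rule SM_D1(1)[OF eta_SM])
  have ce: "continuous_on UNIV ex" "continuous_on UNIV ey"
    unfolding ex_def ey_def by (rule SM_continuous[OF SM_D1(2)[OF eta_SM]] SM_continuous[OF SM_D1(3)[OF eta_SM]])+
  have s0: "eta 1 z = 0" if "norm z > 1" for z using that by (simp add: eta_outside)
  note s1 = D1_support[OF de s0]
  have js: "jsupp (\<lambda>z w. g (w - z)) v" if g: "\<And>z. norm z > 1 \<Longrightarrow> g z = 0" for g :: "complex \<Rightarrow> real" and v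
    unfolding jsupp_def
  proof (intro allI)
    fix B
    have "g (w - z) = 0" if "norm z \<le> B" "norm w > B + 1" for z w
      using that norm_triangle_ineq2[of w z] by (intro g) simp
    then show "\<exists>R. \<forall>z w. norm z \<le> B \<longrightarrow> R < norm w \<longrightarrow> g (w - z) = 0 \<or> v w = 0" by blast
  qed
  have D: "D1 (\<lambda>z. LINT w|lborel. eta 1 (w - z) * v w) (\<lambda>z. LINT w|lborel. - ex (w - z) * v w) (\<lambda>z. LINT w|lborel. - ey (w - z) * v w)"
    if v: "locint lborel v" for v
  proof (rule kernel_integral_D1[OF sets_lborel v])
    show "jcont (\<lambda>z w. - ex (w - z))" "jcont (\<lambda>z w. - ey (w - z))"
      using jcont_shift(2)[of "\<lambda>z. - ex z"] jcont_shift(2)[of "\<lambda>z. - ey z"] ce by (auto intro: continuous_intros)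
    show "jsupp (\<lambda>z w. - ex (w - z)) v" "jsupp (\<lambda>z w. - ey (w - z)) v"
      using js[of "\<lambda>z. - ex z"] js[of "\<lambda>z. - ey z"] s1 by auto
    show "D1 (\<lambda>z. eta 1 (w - z)) (\<lambda>z. - ex (w - z)) (\<lambda>z. - ey (w - z))" for w by (rule D1_reflect[OF de])
  qed (use s0 in \<open>auto intro!: jcont_shift eta_continuous js\<close>)
  \<comment> \<open>Testing with a translate of the mollifier itself yields the Cauchy-Riemann
    equations for the averages at scale 1.\<close>
  have CR: "(LINT w|lborel. - ex (w - z) * p w) = (LINT w|lborel. - ey (w - z) * q w) \<and>
     (LINT w|lborel. - ey (w - z) * p w) = - (LINT w|lborel. - ex (w - z) * q w)" for z
  proof -
    have d: "D1 (\<lambda>w. eta 1 (w - z)) (\<lambda>w. ex (w - z)) (\<lambda>w. ey (w - z))" by (rule D1_shift[OF de])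
    have "dzb (\<lambda>w. complex_of_real (eta 1 (w - z))) w = Complex (ex (w - z)) (ey (w - z))" for w
      using dx_eq[OF d] dy_eq[OF d] dx_eq[OF D1_const[of 0]] dy_eq[OF D1_const[of 0]] by (simp add: dzb_def)
    then show ?thesis
      using split[OF TF_eta(1)[of 1 z]] by (simp add: add.commute)
  qed
  have hol: "(\<lambda>z. complex_of_real (P z) + \<i> * complex_of_real (Q z)) holomorphic_on UNIV"
    unfolding P_def Q_def by (rule Cauchy_Riemann_holomorphic[OF D[OF Lp] D[OF Lq]]) (use CR in auto)
  define W where "W = (\<lambda>z. (complex_of_real (P z) + \<i> * complex_of_real (Q z)) / complex_of_real mass)"
  have "W holomorphic_on UNIV" unfolding W_def by (intro holomorphic_intros hol) (use mass_pos in auto)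
  moreover have "AE z in lborel. (LINT w|lborel. eta 1 (z - w) * p w) = mass * p z"
    by (rule AE[OF Lp]) (rule inv(1))
  moreover have "AE z in lborel. (LINT w|lborel. eta 1 (z - w) * q w) = mass * q z"
    by (rule AE[OF Lq]) (rule inv(2))
  ultimately have hW: "W holomorphic_on UNIV" and
    ae: "AE z in lborel. (LINT w|lborel. eta 1 (z - w) * p w) = mass * p z"
      "AE z in lborel. (LINT w|lborel. eta 1 (z - w) * q w) = mass * q z" by auto
  have "AE z in lborel. u z = W z"
    using ae
  proof eventually_elim
    case (elim z)
    then have "P z = mass * p z" "Q z = mass * q z" by (simp_all add: P_def Q_def eta_even[of 1 _ z])
    then show ?case using mass_pos by (simp add: W_def complex_eq_iff p_def q_def)
  qed
  then show ?thesis using hW by blast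
qed

section \<open>The generalised Fock space\<close>

definition etasup :: real where "etasup = (SOME S. S > 0 \<and> (\<forall>s. step' s \<le> S * pi))"

lemma etasup: "etasup > 0" "step' s \<le> etasup * pi"
proof -
  have "compact (step' ` {0..1})" by (intro compact_continuous_image step_continuous) auto
  then obtain B where B: "\<forall>x\<in>step' ` {0..1}. norm x \<le> B" using compact_imp_bounded bounded_iff by metis
  define S where "S = (\<bar>B\<bar> + 1) / pi"
  have "step' s \<le> S * pi" for s
  proof (cases "s \<in> {0..1}")
    case True
    then have "\<bar>step' s\<bar> \<le> B" using B by auto
    then show ?thesis by (simp add: S_def)
  next
    case False
    then have "step' s = 0" using step_low(2)[of s] step_high(2)[of s] by auto
    then show ?thesis by (simp add: S_def)
  qed
  moreover have "S > 0" by (simp add: S_def add_nonneg_pos)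
  ultimately have "\<exists>S. S > 0 \<and> (\<forall>s. step' s \<le> S * pi)" by blast
  from someI_ex[OF this] show "etasup > 0" "step' s \<le> etasup * pi" by (auto simp: etasup_def)
qed

lemma eta_le: "r > 0 \<Longrightarrow> eta r z \<le> etasup / r\<^sup>2"
  using etasup(2)[of "nq r z"] by (simp add: eta_def field_simps)

text \<open>The mean value property of the holomorphic function P^2, followed by the triangle
  inequality for integrals.\<close>

lemma mean_square_eta:
  assumes P: "P holomorphic_on ball a R" and r: "0 < r" "r < R"
  shows "mass * (cmod (P a))\<^sup>2 \<le> (LINT w|lborel. (cmod (P w))\<^sup>2 * eta r (w - a))"
    "integrable lborel (\<lambda>w. (cmod (P w))\<^sup>2 * eta r (w - a))"
proof -
  have P2: "(\<lambda>w. (P w)\<^sup>2) holomorphic_on ball a R" using P by (intro holomorphic_intros)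
  have i: "integrable lborel (\<lambda>w. (P w)\<^sup>2 * complex_of_real (eta r (w - a)))"
    by (rule eta_glue_integrable[OF holomorphic_on_imp_continuous_on[OF P2] r])
  have e: "norm ((P w)\<^sup>2 * complex_of_real (eta r (w - a))) = (cmod (P w))\<^sup>2 * eta r (w - a)" for w
    by (simp add: norm_mult norm_power eta_nonneg)
  show "integrable lborel (\<lambda>w. (cmod (P w))\<^sup>2 * eta r (w - a))"
    using integrable_norm[OF i] unfolding e .
  have "mass * (cmod (P a))\<^sup>2 = norm (LINT w|lborel. (P w)\<^sup>2 * complex_of_real (eta r (w - a)))"
    unfolding mean_value_eta[OF P2 r] using mass_pos by (simp add: norm_mult norm_power)
  also have "\<dots> \<le> (LINT w|lborel. (cmod (P w))\<^sup>2 * eta r (w - a))"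
    using integral_norm_bound[of lborel "\<lambda>w. (P w)\<^sup>2 * complex_of_real (eta r (w - a))"] unfolding e .
  finally show "mass * (cmod (P a))\<^sup>2 \<le> (LINT w|lborel. (cmod (P w))\<^sup>2 * eta r (w - a))" .
qed

lemma Mw_lebesgue_lborel:
  assumes [measurable]: "p \<in> borel_measurable borel" "f \<in> borel_measurable borel"
  shows "L2 (Mw lebesgue p) f \<longleftrightarrow> L2 (Mw lborel p) f" "nrm (Mw lebesgue p) f = nrm (Mw lborel p) f"
proof -
  have pl [measurable]: "p \<in> borel_measurable lebesgue" "f \<in> borel_measurable lebesgue"
    using assms by (auto intro: measurable_completion)
  have m: "(\<lambda>z. (cmod (f z))\<^sup>2 * exp (-2 * p z)) \<in> borel_measurable lborel" by measurable
  show "L2 (Mw lebesgue p) f \<longleftrightarrow> L2 (Mw lborel p) f"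
    using integrable_completion[OF m] pl by (simp add: Mw_L2)
  have "(nrm (Mw lebesgue p) f)\<^sup>2 = (nrm (Mw lborel p) f)\<^sup>2"
    using integral_completion[OF m] pl by (simp add: Mw_nrm)
  then show "nrm (Mw lebesgue p) f = nrm (Mw lborel p) f"
    using nrm_nonneg by (metis power2_eq_iff_nonneg)
qed

section \<open>Equivalence of the two weights, point evaluations, kernel and projection\<close>

context laplace_weight
begin

abbreviation M\<phi> :: "complex measure" where "M\<phi> \<equiv> Mw lebesgue \<phi>"

lemma phi_leb [measurable]: "\<phi> \<in> borel_measurable lebesgue"
  using phi_meas by (auto intro: measurable_completion)

lemma L2w_iff: "L2w \<phi> f \<longleftrightarrow> L2 M\<phi> f"
  by (simp add: L2w_def Mw_L2)

lemma wnorm_eq: "L2 M\<phi> f \<Longrightarrow> wnorm \<phi> f = nrm M\<phi> f"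
proof -
  assume "L2 M\<phi> f"
  then have "f \<in> borel_measurable lebesgue" by (simp add: Mw_L2)
  then have "(nrm M\<phi> f)\<^sup>2 = (LINT z|lebesgue. (cmod (f z))\<^sup>2 * exp (-2 * \<phi> z))" by (simp add: Mw_nrm)
  then show ?thesis unfolding wnorm_def using nrm_nonneg by (metis real_sqrt_unique)
qed

lemma winner_eq: "L2 M\<phi> f \<Longrightarrow> L2 M\<phi> h \<Longrightarrow> winner \<phi> f h = ip M\<phi> f h"
  by (simp add: winner_def Mw_ip Mw_L2)

lemma psi_continuous: "continuous_on S psi"
  using psi_C2 C2_D(4) by blast

lemma psi_borel [measurable]: "psi \<in> borel_measurable borel"
  using psi_continuous by (rule borel_measurable_continuous_onI)

definition gap :: real where "gap = logconst / mass"


text \<open>Since \<open>psi\<close> exceeds \<phi> by an amount between 0 and \<open>gap\<close>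
  almost everywhere, one norm comparison has constant 1 and the reverse one costs
  exp(\<open>gap\<close>).\<close>

lemma L2_psi_phi:
  assumes f [measurable]: "f \<in> borel_measurable borel"
  shows "L2 (Mw lborel psi) f \<longleftrightarrow> L2 M\<phi> f"
    "L2 M\<phi> f \<Longrightarrow> nrm (Mw lborel psi) f \<le> nrm M\<phi> f"
    "L2 M\<phi> f \<Longrightarrow> nrm M\<phi> f \<le> exp gap * nrm (Mw lborel psi) f"
proof -
  note [measurable] = phi_meas
  let ?a = "\<lambda>z. (cmod (f z))\<^sup>2 * exp (-2 * psi z)" and ?b = "\<lambda>z. (cmod (f z))\<^sup>2 * exp (-2 * \<phi> z)"
  have ab: "AE z in lborel. ?a z \<le> ?b z"
    using phi_psi by eventually_elim (auto intro!: mult_left_mono)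
  have ba: "AE z in lborel. ?b z \<le> exp (2 * gap) * ?a z"
    using phi_psi
  proof eventually_elim
    case (elim z)
    have "exp (-2 * \<phi> z) \<le> exp (2 * gap + -2 * psi z)" using elim by (simp add: gap_def)
    then have "exp (-2 * \<phi> z) \<le> exp (2 * gap) * exp (-2 * psi z)" by (simp only: exp_add)
    then have "(cmod (f z))\<^sup>2 * exp (-2 * \<phi> z) \<le> (cmod (f z))\<^sup>2 * (exp (2 * gap) * exp (-2 * psi z))"
      by (intro mult_left_mono) auto
    then show ?case by (simp add: mult_ac)
  qed
  have lb: "L2 M\<phi> f \<longleftrightarrow> integrable lborel ?b" "L2 (Mw lborel psi) f \<longleftrightarrow> integrable lborel ?a"
    using Mw_lebesgue_lborel[OF phi_meas f] by (simp_all add: Mw_L2)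
  have i1: "integrable lborel ?a" if "integrable lborel ?b"
    by (rule Bochner_Integration.integrable_bound[OF that]) (use ab in \<open>auto\<close>)
  have i2: "integrable lborel ?b" if "integrable lborel ?a"
    by (rule Bochner_Integration.integrable_bound[OF integrable_mult_right[OF that, of "exp (2 * gap)"]]) (use ba in \<open>auto\<close>)
  show "L2 (Mw lborel psi) f \<longleftrightarrow> L2 M\<phi> f" unfolding lb using i1 i2 by blast
  assume L: "L2 M\<phi> f"
  then have ib: "integrable lborel ?b" and ia: "integrable lborel ?a" using i1 lb by auto
  have nb: "(nrm M\<phi> f)\<^sup>2 = (LINT z|lborel. ?b z)" "(nrm (Mw lborel psi) f)\<^sup>2 = (LINT z|lborel. ?a z)"
    using Mw_lebesgue_lborel[OF phi_meas f] by (simp_all add: Mw_nrm)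
  have "(LINT z|lborel. ?a z) \<le> (LINT z|lborel. ?b z)" by (rule integral_mono_AE[OF ia ib ab])
  then show "nrm (Mw lborel psi) f \<le> nrm M\<phi> f"
    by (rule_tac power2_le_imp_le) (auto simp: nb nrm_nonneg)
  have "(LINT z|lborel. ?b z) \<le> (LINT z|lborel. exp (2 * gap) * ?a z)"
    by (rule integral_mono_AE[OF ib integrable_mult_right[OF ia] ba])
  then have "(nrm M\<phi> f)\<^sup>2 \<le> (exp gap * nrm (Mw lborel psi) f)\<^sup>2"
    by (simp add: nb power_mult_distrib exp_double)
  then show "nrm M\<phi> f \<le> exp gap * nrm (Mw lborel psi) f"
    by (rule power2_le_imp_le) (simp add: nrm_nonneg)
qed

lemma Fock_iff: "f \<in> Fock \<phi> \<longleftrightarrow> f holomorphic_on UNIV \<and> L2 M\<phi> f"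
  by (simp add: Fock_def L2w_iff)

lemma Fock_L2: "f \<in> Fock \<phi> \<Longrightarrow> L2 M\<phi> f" by (simp add: Fock_iff)

lemma holomorphic_borel: "f holomorphic_on UNIV \<Longrightarrow> f \<in> borel_measurable borel"
  by (intro borel_measurable_continuous_onI holomorphic_on_imp_continuous_on)

lemma Fock_lin:
  assumes "f \<in> Fock \<phi>" "g \<in> Fock \<phi>"
  shows "(\<lambda>z. f z + g z) \<in> Fock \<phi>" "(\<lambda>z. f z - g z) \<in> Fock \<phi>"
  using assms holomorphic_on_add[of f UNIV g] holomorphic_on_diff[of f UNIV g] L2_add[of M\<phi> f g] L2_diff[of M\<phi> f g]
  unfolding Fock_iff by blast+

lemma Fock_cmult: "f \<in> Fock \<phi> \<Longrightarrow> (\<lambda>z. c * f z) \<in> Fock \<phi>"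
  using holomorphic_on_mult[OF holomorphic_on_const, of f UNIV c] L2_cmult[of M\<phi> f c]
  unfolding Fock_iff by blast

lemma Fock_zero: "(\<lambda>z. 0) \<in> Fock \<phi>"
  unfolding Fock_iff by (intro conjI holomorphic_on_const L2_zero)

text \<open>Mean square over the unit disc about z, on which the continuous weight
  \<open>psi\<close> is bounded. Continuity of point evaluations drives the reproducing kernel, the
  identification of L2-limits and the use of Montel's theorem.\<close>

lemma Fock_bound: "\<exists>B\<ge>0. \<forall>f\<in>Fock \<phi>. \<forall>z. norm z \<le> R \<longrightarrow> cmod (f z) \<le> B * nrm M\<phi> f"
proof -
  have "compact (psi ` cball 0 (R + 1))" by (intro compact_continuous_image psi_continuous) auto
  then obtain K where K: "\<forall>x\<in>psi ` cball 0 (R + 1). norm x \<le> K" using compact_imp_bounded bounded_iff by metis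
  define E where "E = etasup * exp (2 * K) / mass"
  have E: "E \<ge> 0" using etasup(1) mass_pos by (simp add: E_def)
  have "cmod (f z) \<le> sqrt E * nrm M\<phi> f" if f: "f \<in> Fock \<phi>" and z: "norm z \<le> R" for f z
  proof -
    have hol: "f holomorphic_on UNIV" and L: "L2 M\<phi> f" using f by (auto simp: Fock_iff)
    have [measurable]: "f \<in> borel_measurable borel" by (rule holomorphic_borel[OF hol])
    have Lp: "L2 (Mw lborel psi) f" using L2_psi_phi(1) L by simp
    then have i: "integrable lborel (\<lambda>z. (cmod (f z))\<^sup>2 * exp (-2 * psi z))" by (simp add: Mw_L2)
    have hb: "f holomorphic_on ball z 2" using hol by (rule holomorphic_on_subset) auto
    have "mass * (cmod (f z))\<^sup>2 \<le> (LINT w|lborel. (cmod (f w))\<^sup>2 * eta 1 (w - z))"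
      by (rule mean_square_eta(1)[OF hb]) auto
    also have "\<dots> \<le> (LINT w|lborel. (etasup * exp (2 * K)) * ((cmod (f w))\<^sup>2 * exp (-2 * psi w)))"
    proof (rule integral_mono)
      show "integrable lborel (\<lambda>w. (cmod (f w))\<^sup>2 * eta 1 (w - z))" by (rule mean_square_eta(2)[OF hb]) auto
      show "integrable lborel (\<lambda>w. (etasup * exp (2 * K)) * ((cmod (f w))\<^sup>2 * exp (-2 * psi w)))" using i by (rule integrable_mult_right)
      fix w
      show "(cmod (f w))\<^sup>2 * eta 1 (w - z) \<le> (etasup * exp (2 * K)) * ((cmod (f w))\<^sup>2 * exp (-2 * psi w))"
      proof (cases "norm (w - z) < 1")
        case True
        then have "norm w \<le> R + 1" using z norm_triangle_sub[of w z] by simp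
        then have "\<bar>psi w\<bar> \<le> K" using K by auto
        then have "1 \<le> exp (2 * K) * exp (-2 * psi w)" by (simp flip: exp_add)
        then have "etasup * 1 \<le> etasup * (exp (2 * K) * exp (-2 * psi w))" using etasup(1) by (intro mult_left_mono) auto
        moreover have "eta 1 (w - z) \<le> etasup" using eta_le[of 1 "w - z"] by simp
        ultimately have "eta 1 (w - z) \<le> etasup * exp (2 * K) * exp (-2 * psi w)" by (simp add: mult.assoc)
        then have "(cmod (f w))\<^sup>2 * eta 1 (w - z) \<le> (cmod (f w))\<^sup>2 * (etasup * exp (2 * K) * exp (-2 * psi w))"
          by (intro mult_left_mono) auto
        then show ?thesis by (simp only: mult_ac)
      next
        case False
        then show ?thesis using etasup(1) by (simp add: eta_outside)
      qed
    qed
    also have "\<dots> = (etasup * exp (2 * K)) * (nrm (Mw lborel psi) f)\<^sup>2" by (simp add: Mw_nrm)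
    also have "\<dots> \<le> (etasup * exp (2 * K)) * (nrm M\<phi> f)\<^sup>2"
      using L2_psi_phi(2)[OF _ L] etasup(1) nrm_nonneg by (intro mult_left_mono power_mono) auto
    finally have "(cmod (f z))\<^sup>2 \<le> E * (nrm M\<phi> f)\<^sup>2" using mass_pos by (simp add: E_def field_simps)
    then have "(cmod (f z))\<^sup>2 \<le> (sqrt E * nrm M\<phi> f)\<^sup>2" using E by (simp add: power_mult_distrib)
    then show ?thesis by (rule power2_le_imp_le) (use E in \<open>simp add: nrm_nonneg\<close>)
  qed
  then show ?thesis using E by (intro exI[of _ "sqrt E"]) auto
qed

lemma Fock_norm_zero: "f \<in> Fock \<phi> \<Longrightarrow> nrm M\<phi> f = 0 \<Longrightarrow> f = (\<lambda>z. 0)"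
proof
  fix z :: complex assume f: "f \<in> Fock \<phi>" "nrm M\<phi> f = 0"
  obtain B where "\<forall>f\<in>Fock \<phi>. \<forall>w. norm w \<le> norm z \<longrightarrow> cmod (f w) \<le> B * nrm M\<phi> f" using Fock_bound by blast
  then have "cmod (f z) \<le> B * nrm M\<phi> f" using f(1) by blast
  then show "f z = 0" using f(2) by simp
qed

text \<open>The L2-representer is a limit of members of the Fock space, in norm and almost
  everywhere. Point evaluations being bounded, the sequence converges locally uniformly, so the
  representer has an entire version. Kernel and projection both arise from this statement, which
  makes the definite descriptions in their definitions meaningful.\<close>

lemma Fock_Riesz:
  assumes ladd: "\<And>f g. f \<in> Fock \<phi> \<Longrightarrow> g \<in> Fock \<phi> \<Longrightarrow> l (\<lambda>z. f z + g z) = l f + (l g :: complex)"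
    and lmul: "\<And>c f. f \<in> Fock \<phi> \<Longrightarrow> l (\<lambda>z. c * f z) = c * l f"
    and bd: "\<And>f. f \<in> Fock \<phi> \<Longrightarrow> cmod (l f) \<le> B * nrm M\<phi> f" and B: "B \<ge> 0"
  shows "\<exists>!k. k \<in> Fock \<phi> \<and> (\<forall>f\<in>Fock \<phi>. ip M\<phi> f k = l f)"
proof -
  have "\<exists>u F. L2 M\<phi> u \<and> nrm M\<phi> u \<le> B \<and> (\<forall>f\<in>Fock \<phi>. ip M\<phi> ((\<lambda>f. f) f) u = l f) \<and> (\<forall>n::nat. F n \<in> Fock \<phi>) \<and>
     (AE x in M\<phi>. (\<lambda>n. (\<lambda>f. f) (F n) x) \<longlonglongrightarrow> u x) \<and> (\<lambda>n. nrm M\<phi> (\<lambda>x. (\<lambda>f. f) (F n) x - u x)) \<longlonglongrightarrow> 0"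
    by (rule Riesz_representation) (use assms Fock_lin Fock_cmult Fock_L2 Fock_zero in auto)
  then obtain u F where u: "L2 M\<phi> u" "\<And>f. f \<in> Fock \<phi> \<Longrightarrow> ip M\<phi> f u = l f" and F: "\<And>n. F n \<in> Fock \<phi>"
     and ae: "AE x in M\<phi>. (\<lambda>n. F n x) \<longlonglongrightarrow> u x" and lim: "(\<lambda>n. nrm M\<phi> (\<lambda>x. F n x - u x)) \<longlonglongrightarrow> 0" by (auto simp: conj_assoc)
  \<comment> \<open>\<open>Fock_bound\<close> turns the Cauchy property in norm into uniform
    convergence on discs.\<close>
  have uc: "uniformly_Cauchy_on (cball 0 R) F" for R
    unfolding uniformly_Cauchy_on_def
  proof (intro allI impI)
    fix e :: real assume e: "e > 0"
    obtain B where B: "B \<ge> 0" "\<And>f z. f \<in> Fock \<phi> \<Longrightarrow> norm z \<le> R \<Longrightarrow> cmod (f z) \<le> B * nrm M\<phi> f" using Fock_bound[of R] by blast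
    define d where "d = e / (2 * (B + 1))"
    have d: "d > 0" using e B by (simp add: d_def)
    obtain N where N: "\<And>n. n \<ge> N \<Longrightarrow> nrm M\<phi> (\<lambda>x. F n x - u x) < d"
      using order_tendstoD(2)[OF lim d] by (auto simp: eventually_sequentially)
    have "dist (F n x) (F m x) < e" if "x \<in> cball 0 R" "m \<ge> N" "n \<ge> N" for x m n
    proof -
      have "nrm M\<phi> (\<lambda>x. F n x - F m x) \<le> nrm M\<phi> (\<lambda>x. F n x - u x) + nrm M\<phi> (\<lambda>x. u x - F m x)"
        by (rule nrm_triangle_diff[OF Fock_L2[OF F] u(1) Fock_L2[OF F]])
      also have "\<dots> < d + d" using N[of n] N[of m] that by (simp add: nrm_minus_commute[of _ u])
      finally have n: "nrm M\<phi> (\<lambda>x. F n x - F m x) \<le> 2 * d" by simp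
      have "cmod (F n x - F m x) \<le> B * nrm M\<phi> (\<lambda>x. F n x - F m x)"
        using B(2)[OF Fock_lin(2)[OF F F]] that by simp
      also have "\<dots> \<le> B * (2 * d)" using n B(1) by (intro mult_left_mono) auto
      also have "\<dots> < (B + 1) * (2 * d)" using d by simp
      also have "\<dots> = e" using B(1) d by (simp add: d_def divide_simps)
      finally show ?thesis by (simp add: dist_norm)
    qed
    then show "\<exists>M. \<forall>x\<in>cball 0 R. \<forall>m\<ge>M. \<forall>n\<ge>M. dist (F m x) (F n x) < e" by (intro exI[of _ N]) blast
  qed
  define k where "k z = lim (\<lambda>n. F n z)" for z
  have ul: "uniform_limit (cball 0 R) F k sequentially" for R
  proof -
    have "uniformly_convergent_on (cball 0 R) F" using uc Cauchy_uniformly_convergent by blast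
    then show ?thesis unfolding k_def using uniformly_convergent_uniform_limit_iff by blast
  qed
  have kh: "k holomorphic_on UNIV"
  proof (rule holomorphic_uniform_sequence[OF open_UNIV])
    show "F n holomorphic_on UNIV" for n using F by (simp add: Fock_iff)
    fix x :: complex
    have "uniform_limit (cball x 1) F k sequentially"
    proof (rule uniform_limit_on_subset[OF ul[of "norm x + 1"]])
      show "cball x 1 \<subseteq> cball 0 (norm x + 1)"
      proof
        fix y assume "y \<in> cball x 1"
        then have "norm (y - x) \<le> 1" by (simp add: dist_norm norm_minus_commute)
        then show "y \<in> cball 0 (norm x + 1)" using norm_triangle_sub[of y x] by simp
      qed
    qed
    then show "\<exists>d>0. cball x d \<subseteq> UNIV \<and> uniform_limit (cball x d) F k sequentially" by (intro exI[of _ 1]) auto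
  qed
  have lk: "(\<lambda>n. F n z) \<longlonglongrightarrow> k z" for z
    by (rule tendsto_uniform_limitI[OF ul[of "norm z"]]) simp
  have uk: "AE x in M\<phi>. u x = k x" using ae by eventually_elim (use lk LIMSEQ_unique in blast)
  have km: "k \<in> borel_measurable M\<phi>"
    using holomorphic_borel[OF kh] by (auto simp: Mw_def intro: measurable_completion)
  have kF: "k \<in> Fock \<phi>" unfolding Fock_iff using kh L2_AE_cong[OF u(1) uk km] by simp
  have ek: "ip M\<phi> f k = l f" if f: "f \<in> Fock \<phi>" for f
  proof -
    have "ip M\<phi> f k = ip M\<phi> f u"
      unfolding ip_def
    proof (rule integral_cong_AE)
      show "(\<lambda>x. f x * cnj (k x)) \<in> borel_measurable M\<phi>" using ip_integrable[OF Fock_L2[OF f] Fock_L2[OF kF]] by auto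
      show "(\<lambda>x. f x * cnj (u x)) \<in> borel_measurable M\<phi>" using ip_integrable[OF Fock_L2[OF f] u(1)] by auto
      show "AE x in M\<phi>. f x * cnj (k x) = f x * cnj (u x)" using uk by eventually_elim simp
    qed
    then show ?thesis using u(2)[OF f] by simp
  qed
  show ?thesis
  proof (rule ex1I[of _ k])
    show "k \<in> Fock \<phi> \<and> (\<forall>f\<in>Fock \<phi>. ip M\<phi> f k = l f)" using kF ek by blast
    fix j assume j: "j \<in> Fock \<phi> \<and> (\<forall>f\<in>Fock \<phi>. ip M\<phi> f j = l f)"
    have d: "(\<lambda>z. j z - k z) \<in> Fock \<phi>" using Fock_lin j kF by blast
    have "ip M\<phi> (\<lambda>z. j z - k z) (\<lambda>z. j z - k z) = 0"
      using j kF ek[OF d] d by (subst ip_diff_right) (auto simp: Fock_L2)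
    then have "nrm M\<phi> (\<lambda>z. j z - k z) = 0" by (simp add: ip_self)
    from Fock_norm_zero[OF d this] show "j = k" by (auto simp: fun_eq_iff)
  qed
qed

lemma Kern: "Kern \<phi> a \<in> Fock \<phi>" "f \<in> Fock \<phi> \<Longrightarrow> f a = ip M\<phi> f (Kern \<phi> a)"
proof -
  obtain B where B: "B \<ge> 0" "\<And>f z. f \<in> Fock \<phi> \<Longrightarrow> norm z \<le> norm a \<Longrightarrow> cmod (f z) \<le> B * nrm M\<phi> f" using Fock_bound[of "norm a"] by blast
  have "\<exists>!k. k \<in> Fock \<phi> \<and> (\<forall>f\<in>Fock \<phi>. ip M\<phi> f k = (\<lambda>f. f a) f)"
    by (rule Fock_Riesz[OF _ _ _ B(1)]) (use B in auto)
  then have "\<exists>!k. k \<in> Fock \<phi> \<and> (\<forall>f\<in>Fock \<phi>. ip M\<phi> f k = f a)" .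
  moreover have "(k \<in> Fock \<phi> \<and> (\<forall>f\<in>Fock \<phi>. f a = winner \<phi> f k)) = (k \<in> Fock \<phi> \<and> (\<forall>f\<in>Fock \<phi>. ip M\<phi> f k = f a))" for k
    using winner_eq Fock_L2 by metis
  ultimately have "\<exists>!k. k \<in> Fock \<phi> \<and> (\<forall>f\<in>Fock \<phi>. f a = winner \<phi> f k)" by simp
  from theI'[OF this] have "Kern \<phi> a \<in> Fock \<phi> \<and> (\<forall>f\<in>Fock \<phi>. f a = winner \<phi> f (Kern \<phi> a))" by (simp add: Kern_def)
  then show "Kern \<phi> a \<in> Fock \<phi>" "f \<in> Fock \<phi> \<Longrightarrow> f a = ip M\<phi> f (Kern \<phi> a)" using winner_eq Fock_L2 by auto
qed

text \<open>The projection of F is the representer of the functional that pairs h with F;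
  orthogonality of the remainder is the conjugate of this identity.\<close>

lemma Proj_ex:
  assumes L: "L2 M\<phi> F"
  shows "\<exists>!p. p \<in> Fock \<phi> \<and> (\<forall>h\<in>Fock \<phi>. winner \<phi> (\<lambda>z. F z - p z) h = 0)"
proof -
  have "\<exists>!k. k \<in> Fock \<phi> \<and> (\<forall>f\<in>Fock \<phi>. ip M\<phi> f k = (\<lambda>h. ip M\<phi> h F) f)"
  proof (rule Fock_Riesz)
    show "cmod (ip M\<phi> f F) \<le> nrm M\<phi> F * nrm M\<phi> f" if "f \<in> Fock \<phi>" for f
      using Cauchy_Schwarz[OF Fock_L2[OF that] L] by (simp add: mult.commute)
  qed (use L in \<open>auto simp: ip_add Fock_L2 ip_cmult nrm_nonneg\<close>)
  moreover have "(p \<in> Fock \<phi> \<and> (\<forall>h\<in>Fock \<phi>. winner \<phi> (\<lambda>z. F z - p z) h = 0)) = (p \<in> Fock \<phi> \<and> (\<forall>h\<in>Fock \<phi>. ip M\<phi> h p = ip M\<phi> h F))" for p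
  proof -
    have "winner \<phi> (\<lambda>z. F z - p z) h = 0 \<longleftrightarrow> ip M\<phi> h p = ip M\<phi> h F" if p: "p \<in> Fock \<phi>" and h: "h \<in> Fock \<phi>" for h
    proof -
      have "winner \<phi> (\<lambda>z. F z - p z) h = ip M\<phi> F h - ip M\<phi> p h"
        using winner_eq[OF L2_diff[OF L Fock_L2[OF p]] Fock_L2[OF h]] ip_diff[OF L Fock_L2[OF p] Fock_L2[OF h]] by simp
      also have "\<dots> = cnj (ip M\<phi> h F - ip M\<phi> h p)" by (simp add: ip_cnj[of M\<phi> F h] ip_cnj[of M\<phi> p h])
      finally have "winner \<phi> (\<lambda>z. F z - p z) h = 0 \<longleftrightarrow> ip M\<phi> h F - ip M\<phi> h p = 0" by simp
      then show ?thesis by auto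
    qed
    then show ?thesis by blast
  qed
  ultimately show ?thesis by simp
qed

lemma Proj:
  assumes "L2 M\<phi> F"
  shows "Proj \<phi> F \<in> Fock \<phi>" "h \<in> Fock \<phi> \<Longrightarrow> ip M\<phi> (\<lambda>z. F z - Proj \<phi> F z) h = 0"
proof -
  from theI'[OF Proj_ex[OF assms]]
  have p: "Proj \<phi> F \<in> Fock \<phi> \<and> (\<forall>h\<in>Fock \<phi>. winner \<phi> (\<lambda>z. F z - Proj \<phi> F z) h = 0)" by (simp add: Proj_def)
  then show "Proj \<phi> F \<in> Fock \<phi>" by blast
  then show "h \<in> Fock \<phi> \<Longrightarrow> ip M\<phi> (\<lambda>z. F z - Proj \<phi> F z) h = 0"
    using p winner_eq[OF L2_diff[OF assms Fock_L2] Fock_L2] by metis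
qed

lemma Proj_unique:
  assumes L: "L2 M\<phi> F" and p: "p \<in> Fock \<phi>" "\<And>h. h \<in> Fock \<phi> \<Longrightarrow> ip M\<phi> (\<lambda>z. F z - p z) h = 0"
  shows "Proj \<phi> F = p"
proof -
  have "p \<in> Fock \<phi> \<and> (\<forall>h\<in>Fock \<phi>. winner \<phi> (\<lambda>z. F z - p z) h = 0)"
    using p winner_eq[OF L2_diff[OF L Fock_L2[OF p(1)]] Fock_L2] by auto
  then show ?thesis unfolding Proj_def by (rule the1_equality[OF Proj_ex[OF L]])
qed

lemma Proj_diff:
  assumes F: "L2 M\<phi> F" and G: "L2 M\<phi> G"
  shows "Proj \<phi> (\<lambda>z. F z - G z) = (\<lambda>z. Proj \<phi> F z - Proj \<phi> G z)"
proof (rule Proj_unique[OF L2_diff[OF F G] Fock_lin(2)[OF Proj(1)[OF F] Proj(1)[OF G]]])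
  fix h assume h: "h \<in> Fock \<phi>"
  have "(\<lambda>z. F z - G z - (Proj \<phi> F z - Proj \<phi> G z)) = (\<lambda>z. (F z - Proj \<phi> F z) - (G z - Proj \<phi> G z))" by (auto simp: algebra_simps)
  then show "ip M\<phi> (\<lambda>z. F z - G z - (Proj \<phi> F z - Proj \<phi> G z)) h = 0"
    using ip_diff[OF L2_diff[OF F Fock_L2[OF Proj(1)[OF F]]] L2_diff[OF G Fock_L2[OF Proj(1)[OF G]]] Fock_L2[OF h]]
      Proj(2)[OF F h] Proj(2)[OF G h] by simp
qed

lemma Proj_minimal:
  assumes F: "L2 M\<phi> F" and h: "h \<in> Fock \<phi>"
  shows "nrm M\<phi> (\<lambda>z. F z - Proj \<phi> F z) \<le> nrm M\<phi> (\<lambda>z. F z - h z)"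
proof (rule power2_le_imp_le)
  note P = Proj(1)[OF F]
  have d: "(\<lambda>z. Proj \<phi> F z - h z) \<in> Fock \<phi>" by (rule Fock_lin(2)[OF P h])
  have "(nrm M\<phi> (\<lambda>z. F z - h z))\<^sup>2 = (nrm M\<phi> (\<lambda>z. (F z - Proj \<phi> F z) + (Proj \<phi> F z - h z)))\<^sup>2" by simp
  also have "\<dots> = (nrm M\<phi> (\<lambda>z. F z - Proj \<phi> F z))\<^sup>2 + 2 * Re (ip M\<phi> (\<lambda>z. F z - Proj \<phi> F z) (\<lambda>z. Proj \<phi> F z - h z)) + (nrm M\<phi> (\<lambda>z. Proj \<phi> F z - h z))\<^sup>2"
    by (rule nrm_sq_add[OF L2_diff[OF F Fock_L2[OF P]] Fock_L2[OF d]])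
  finally show "(nrm M\<phi> (\<lambda>z. F z - Proj \<phi> F z))\<^sup>2 \<le> (nrm M\<phi> (\<lambda>z. F z - h z))\<^sup>2"
    using Proj(2)[OF F d] by simp
qed (rule nrm_nonneg)

end

section \<open>Compactness from decay of the symbol\<close>

lemma AE_Mw:
  assumes "AE z in M. P z" "p \<in> borel_measurable M" shows "AE z in Mw M p. P z"
proof -
  note [measurable] = assms(2)
  have "(\<lambda>z. ennreal (exp (-2 * p z))) \<in> borel_measurable M" by measurable
  then show ?thesis unfolding Mw_def using assms(1) by (simp add: AE_density)
qed

text \<open>Greedy choice: each new element is separated from the finite set collected so far.
  Applied to the negation of total boundedness, it produces the sequence that contradicts Montel's
  theorem.\<close>

lemma infinitely_many_separated:
  assumes "\<And>T. finite T \<Longrightarrow> T \<subseteq> B \<Longrightarrow> \<exists>f\<in>B. \<forall>t\<in>T. R f t"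
  shows "\<exists>f. \<forall>n::nat. f n \<in> B \<and> (\<forall>m<n. R (f n) (f m))"
proof -
  obtain pick where pick: "\<And>T. finite T \<Longrightarrow> T \<subseteq> B \<Longrightarrow> pick T \<in> B \<and> (\<forall>t\<in>T. R (pick T) t)"
    using assms by metis
  define T where "T = rec_nat {} (\<lambda>n T. insert (pick T) T)"
  have TS: "T (Suc n) = insert (pick (T n)) (T n)" "T 0 = {}" for n by (simp_all add: T_def)
  have T: "finite (T n) \<and> T n \<subseteq> B" for n
    by (induction n) (use pick in \<open>auto simp: TS\<close>)
  have mem: "m < n \<Longrightarrow> pick (T m) \<in> T n" for m n
    by (induction n) (auto simp: TS less_Suc_eq)
  have "pick (T n) \<in> B \<and> (\<forall>m<n. R (pick (T n)) (pick (T m)))" for n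
  proof -
    have "pick (T n) \<in> B \<and> (\<forall>t\<in>T n. R (pick (T n)) t)" using T[of n] by (intro pick) auto
    then show ?thesis using mem by auto
  qed
  then show ?thesis by (intro exI[of _ "\<lambda>n. pick (T n)"]) simp
qed

context laplace_weight
begin

lemma L2_psi_integrable:
  assumes L: "L2 (Mw lborel psi) f" and c: "continuous_on UNIV c" "\<And>z. norm z > R \<Longrightarrow> c z = 0"
  shows "integrable lborel (\<lambda>z. f z * c z)"
proof -
  have fm [measurable]: "f \<in> borel_measurable borel" and i: "integrable lborel (\<lambda>z. (cmod (f z))\<^sup>2 * exp (-2 * psi z))"
    using L by (auto simp: Mw_L2)
  have 1: "L2 lborel (\<lambda>z. f z * complex_of_real (exp (- psi z)))"
  proof -
    have "(cmod (f z * complex_of_real (exp (- psi z))))\<^sup>2 = (cmod (f z))\<^sup>2 * exp (-2 * psi z)" for z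
      using exp_double[of "- psi z"] by (simp add: norm_mult power_mult_distrib)
    then show ?thesis using i unfolding L2_def by simp
  qed
  have cc: "continuous_on UNIV (\<lambda>z. cnj (c z) * complex_of_real (exp (psi z)))"
    by (intro continuous_intros c psi_continuous)
  have 2: "L2 lborel (\<lambda>z. cnj (c z) * complex_of_real (exp (psi z)))"
    unfolding L2_def
  proof
    show "(\<lambda>z. cnj (c z) * complex_of_real (exp (psi z))) \<in> borel_measurable lborel"
      using borel_measurable_continuous_onI[OF cc] by simp
    show "integrable lborel (\<lambda>z. (cmod (cnj (c z) * complex_of_real (exp (psi z))))\<^sup>2)"
      by (rule integrable_compact_support[of _ R]) (intro continuous_intros cc, simp add: c)
  qed
  have eq: "f z * complex_of_real (exp (- psi z)) * cnj (cnj (c z) * complex_of_real (exp (psi z))) = f z * c z" for z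
  proof -
    have "exp (- psi z) * exp (psi z) = 1" by (simp flip: exp_add)
    then have "complex_of_real (exp (- psi z)) * complex_of_real (exp (psi z)) = 1" unfolding of_real_mult[symmetric] by simp
    then show ?thesis by (simp add: mult_ac)
  qed
  show ?thesis using ip_integrable[OF 1 2] unfolding eq .
qed

lemma L2_psi_locint:
  assumes L: "L2 (Mw lborel psi) f"
  shows "locint lborel (\<lambda>z. Re (f z))" "locint lborel (\<lambda>z. Im (f z))"
proof -
  have fm [measurable]: "f \<in> borel_measurable borel" using L by (auto simp: Mw_L2)
  have i: "integrable lborel (\<lambda>z. complex_of_real (indicator (cball 0 R) z) * f z)" for R
  proof -
    define c where "c z = complex_of_real (max 0 (min 1 (R + 1 - norm z)))" for z :: complex
    have cc: "continuous_on UNIV c" unfolding c_def by (intro continuous_intros)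
    have "integrable lborel (\<lambda>z. f z * c z)"
      by (rule L2_psi_integrable[OF L cc, of "R + 1"]) (simp add: c_def)
    then show ?thesis
    proof (rule Bochner_Integration.integrable_bound)
      show "(\<lambda>z. complex_of_real (indicator (cball 0 R) z) * f z) \<in> borel_measurable lborel"
      proof -
        have [measurable]: "cball (0::complex) R \<in> sets borel" by simp
        have "(\<lambda>z. complex_of_real (indicator (cball 0 R) z) * f z) \<in> borel_measurable borel" by measurable
        then show ?thesis by simp
      qed
      show "AE z in lborel. norm (complex_of_real (indicator (cball 0 R) z) * f z) \<le> norm (f z * c z)"
      proof (rule AE_I2)
        fix z show "norm (complex_of_real (indicator (cball 0 R) z) * f z) \<le> norm (f z * c z)"
          by (cases "norm z \<le> R") (auto simp: c_def norm_mult)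
      qed
    qed
  qed
  show "locint lborel (\<lambda>z. Re (f z))" "locint lborel (\<lambda>z. Im (f z))"
    using integrable_Re[OF i] integrable_Im[OF i] unfolding locint_def by auto
qed

text \<open>Two functions with the same weak d-bar derivative differ by a weakly holomorphic one,
  which has an entire version by \<open>weakly_holomorphic\<close>. Square integrability is
  inherited through the equivalence of the weights.\<close>

lemma distance_to_Fock:
  assumes F: "L2 M\<phi> F" "F \<in> borel_measurable borel" and u: "L2 (Mw lborel psi) u"
    and t: "\<And>b. b \<in> TF \<Longrightarrow> (LINT z|lborel. F z * dzb b z) = (LINT z|lborel. u z * dzb b z)"
  shows "\<exists>W\<in>Fock \<phi>. (AE z in lborel. F z - u z = W z)"
proof -
  have um: "u \<in> borel_measurable borel" using u by (auto simp: Mw_L2)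
  have LF: "L2 (Mw lborel psi) F" using L2_psi_phi(1)[OF F(2)] F(1) by simp
  have Ld: "L2 (Mw lborel psi) (\<lambda>z. F z - u z)" by (rule L2_diff[OF LF u])
  have "\<exists>W. W holomorphic_on UNIV \<and> (AE z in lborel. F z - u z = W z)"
  proof (rule weakly_holomorphic[OF L2_psi_locint[OF Ld]])
    fix b assume b: "b \<in> TF"
    obtain R where R: "\<And>z. norm z > R \<Longrightarrow> dzb b z = 0" using TF_supp[OF b] by blast
    note i = L2_psi_integrable[OF LF TF_continuous(3)[OF b] R] L2_psi_integrable[OF u TF_continuous(3)[OF b] R]
    show "(LINT z|lborel. (F z - u z) * dzb b z) = 0"
      using t[OF b] i by (simp add: left_diff_distrib)
  qed
  then obtain W where W: "W holomorphic_on UNIV" "AE z in lborel. F z - u z = W z" by blast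
  have Wm: "W \<in> borel_measurable borel" by (rule holomorphic_borel[OF W(1)])
  have "L2 (Mw lborel psi) W"
    by (rule L2_AE_cong[OF Ld AE_Mw[OF W(2)]]) (use Wm in \<open>auto simp: Mw_def\<close>)
  then have "W \<in> Fock \<phi>" using L2_psi_phi(1)[OF Wm] W(1) by (simp add: Fock_iff)
  then show ?thesis using W(2) by blast
qed

lemma Fock_sum: "finite A \<Longrightarrow> (\<And>a. a \<in> A \<Longrightarrow> f a \<in> Fock \<phi>) \<Longrightarrow> (\<lambda>z. \<Sum>a\<in>A. f a z) \<in> Fock \<phi>"
  by (induction A rule: finite_induct) (auto intro: Fock_zero Fock_lin)

lemma knorm_Fock: "knorm \<phi> a \<in> Fock \<phi>"
  using Fock_cmult[OF Kern(1)[of a], of "1 / csqrt (Kern \<phi> a a)"] by (simp add: knorm_def)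

lemma kspan_Fock: "f \<in> kspan \<phi> \<Longrightarrow> f \<in> Fock \<phi>"
  unfolding kspan_def using Fock_sum[OF _ Fock_cmult[OF knorm_Fock]] by auto

lemma kspan_diff:
  assumes "f \<in> kspan \<phi>" "h \<in> kspan \<phi>" shows "(\<lambda>z. f z - h z) \<in> kspan \<phi>"
proof -
  obtain A c where f: "finite A" "f = (\<lambda>z. \<Sum>a\<in>A. c a * knorm \<phi> a z)" using assms(1) by (auto simp: kspan_def)
  obtain D d where h: "finite D" "h = (\<lambda>z. \<Sum>a\<in>D. d a * knorm \<phi> a z)" using assms(2) by (auto simp: kspan_def)
  define e where "e a = (if a \<in> A then c a else 0) - (if a \<in> D then d a else 0)" for a
  have "f z - h z = (\<Sum>a\<in>A \<union> D. e a * knorm \<phi> a z)" for z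
  proof -
    have "(\<Sum>a\<in>A. c a * knorm \<phi> a z) = (\<Sum>a\<in>A \<union> D. (if a \<in> A then c a else 0) * knorm \<phi> a z)"
      by (rule sum.mono_neutral_cong_left) (use f h in auto)
    moreover have "(\<Sum>a\<in>D. d a * knorm \<phi> a z) = (\<Sum>a\<in>A \<union> D. (if a \<in> D then d a else 0) * knorm \<phi> a z)"
      by (rule sum.mono_neutral_cong_left) (use f h in auto)
    ultimately show ?thesis by (simp add: f h e_def left_diff_distrib sum_subtractf)
  qed
  moreover have "finite (A \<union> D)" using f h by simp
  ultimately show ?thesis unfolding kspan_def by blast
qed

end

section \<open>The Hankel operator on the span of the kernels\<close>

locale hankel_symbol = laplace_weight +
  fixes g :: "complex \<Rightarrow> complex"
  assumes g_hol: "g holomorphic_on UNIV"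
    and g_kernel: "\<And>a. L2w \<phi> (\<lambda>z. cnj (g z) * knorm \<phi> a z)"
begin

lemma gf_L2:
  assumes "f \<in> kspan \<phi>" shows "L2 M\<phi> (\<lambda>z. cnj (g z) * f z)"
proof -
  obtain A c where f: "finite A" "f = (\<lambda>z. \<Sum>a\<in>A. c a * knorm \<phi> a z)" using assms by (auto simp: kspan_def)
  have "L2 M\<phi> (\<lambda>z. \<Sum>a\<in>A. c a * (cnj (g z) * knorm \<phi> a z))"
    by (intro L2_sum f L2_cmult) (use g_kernel in \<open>simp add: L2w_iff\<close>)
  moreover have "(\<lambda>z. \<Sum>a\<in>A. c a * (cnj (g z) * knorm \<phi> a z)) = (\<lambda>z. cnj (g z) * f z)"
    by (simp add: f sum_distrib_left mult_ac)
  ultimately show ?thesis by simp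
qed

abbreviation H :: "(complex \<Rightarrow> complex) \<Rightarrow> complex \<Rightarrow> complex" where "H \<equiv> Hankel \<phi> g"

lemma H_L2: "f \<in> kspan \<phi> \<Longrightarrow> L2 M\<phi> (H f)"
  unfolding Hankel_def using gf_L2 Proj(1) Fock_L2 L2_diff by blast

lemma H_diff:
  assumes "f \<in> kspan \<phi>" "h \<in> kspan \<phi>"
  shows "H (\<lambda>z. f z - h z) = (\<lambda>z. H f z - H h z)"
proof -
  have "(\<lambda>z. cnj (g z) * (f z - h z)) = (\<lambda>z. cnj (g z) * f z - cnj (g z) * h z)" by (simp add: right_diff_distrib)
  then show ?thesis
    unfolding Hankel_def using Proj_diff[OF gf_L2[OF assms(1)] gf_L2[OF assms(2)]] by (auto simp: algebra_simps)
qed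

lemma gf_partials:
  assumes f: "f holomorphic_on UNIV"
  shows "((\<lambda>z. cnj (g z) * f z) has_derivative (\<lambda>k. complex_of_real (Re k) * (cnj (deriv g z) * f z + cnj (g z) * deriv f z)
     + complex_of_real (Im k) * (cnj (\<i> * deriv g z) * f z + cnj (g z) * (\<i> * deriv f z)))) (at z)"
proof -
  have 1: "((\<lambda>z. cnj (g z)) has_derivative (\<lambda>k. cnj (complex_of_real (Re k) * deriv g z + complex_of_real (Im k) * (\<i> * deriv g z)))) (at z)"
    by (intro has_derivative_cnj holomorphic_partials[OF g_hol]) auto
  show ?thesis
    by (rule has_derivative_eq_rhs[OF has_derivative_mult[OF 1 holomorphic_partials[OF f open_UNIV UNIV_I]]])
       (auto simp: fun_eq_iff algebra_simps)
qed

lemma gf_dbar: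
  assumes f: "f holomorphic_on UNIV" and b: "b \<in> TF"
  shows "(LINT z|lborel. cnj (g z) * f z * dzb b z) = -2 * (LINT z|lborel. cnj (deriv g z) * f z * b z)"
proof -
  have c: "continuous_on UNIV f" "continuous_on UNIV g" "continuous_on UNIV (deriv f)" "continuous_on UNIV (deriv g)"
    using f g_hol holomorphic_deriv[OF f] holomorphic_deriv[OF g_hol] holomorphic_on_imp_continuous_on by auto
  have "(LINT z|lborel. cnj (g z) * f z * dzb b z) = - (LINT z|lborel. ((cnj (deriv g z) * f z + cnj (g z) * deriv f z)
       + \<i> * (cnj (\<i> * deriv g z) * f z + cnj (g z) * (\<i> * deriv f z))) * b z)"
    by (rule dbar_by_parts(1)[OF open_UNIV closed_UNIV order_refl b _ gf_partials[OF f]]) (auto intro!: continuous_intros c)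
  also have "(\<lambda>z. ((cnj (deriv g z) * f z + cnj (g z) * deriv f z)
       + \<i> * (cnj (\<i> * deriv g z) * f z + cnj (g z) * (\<i> * deriv f z))) * b z) = (\<lambda>z. 2 * (cnj (deriv g z) * f z * b z))"
  proof
    fix z
    have "\<i> * (cnj (\<i> * deriv g z) * f z + cnj (g z) * (\<i> * deriv f z)) = (- (\<i> * \<i>)) * (cnj (deriv g z) * f z) + (\<i> * \<i>) * (cnj (g z) * deriv f z)"
      by (simp add: algebra_simps del: i_squared)
    then show "((cnj (deriv g z) * f z + cnj (g z) * deriv f z) + \<i> * (cnj (\<i> * deriv g z) * f z + cnj (g z) * (\<i> * deriv f z))) * b z = 2 * (cnj (deriv g z) * f z * b z)"
      by (simp add: algebra_simps)
  qed
  finally show ?thesis by simp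
qed

text \<open>The lower bound of \<open>dens_lower\<close> enters as N = c / \<rho>^2 and puts the
  factor \<rho>^2 on the right side. The constant combines 2/c from the d-bar estimate with the loss
  exp(\<open>gap\<close>)^2 from passing back to the weight of \<phi>. Finiteness of the right side
  is a premise because nothing is assumed on the symbol yet.\<close>

lemma Hankel_bound:
  "\<exists>K\<ge>0. \<forall>f\<in>kspan \<phi>. integrable lborel (\<lambda>z. (cmod (deriv g z) * \<rho> z)\<^sup>2 * ((cmod (f z))\<^sup>2 * exp (-2 * psi z))) \<longrightarrow>
     (nrm M\<phi> (H f))\<^sup>2 \<le> K * (LINT z|lborel. (cmod (deriv g z) * \<rho> z)\<^sup>2 * ((cmod (f z))\<^sup>2 * exp (-2 * psi z)))"
proof -
  obtain px py pxx pxy pyy where p: "C2 psi px py pxx pxy pyy" "\<And>z. pxx z + pyy z = dens z" using psi_C2 by blast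
  obtain c where c: "c > 0" "\<And>z. dens z \<ge> c / (\<rho> z)\<^sup>2" using dens_lower by blast
  define N where "N z = c / (\<rho> z)\<^sup>2" for z
  have N0: "N z > 0" for z using c(1) rho_pos[of z] by (simp add: N_def)
  have rm [measurable]: "\<rho> \<in> borel_measurable borel" using rho_continuous by (rule borel_measurable_continuous_onI)
  have Nm: "N \<in> borel_measurable borel" unfolding N_def[abs_def] by measurable
  have dg [measurable]: "deriv g \<in> borel_measurable borel" by (rule holomorphic_borel[OF holomorphic_deriv[OF g_hol open_UNIV]])
  have gm [measurable]: "g \<in> borel_measurable borel" by (rule holomorphic_borel[OF g_hol])
  define K where "K = (exp gap)\<^sup>2 * (2 / c)"
  have "(nrm M\<phi> (H f))\<^sup>2 \<le> K * (LINT z|lborel. (cmod (deriv g z) * \<rho> z)\<^sup>2 * ((cmod (f z))\<^sup>2 * exp (-2 * psi z)))"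
    if f: "f \<in> kspan \<phi>" and i: "integrable lborel (\<lambda>z. (cmod (deriv g z) * \<rho> z)\<^sup>2 * ((cmod (f z))\<^sup>2 * exp (-2 * psi z)))" for f
  proof -
    have fh: "f holomorphic_on UNIV" using kspan_Fock[OF f] by (simp add: Fock_iff)
    have fm [measurable]: "f \<in> borel_measurable borel" by (rule holomorphic_borel[OF fh])
    define F where "F z = cnj (g z) * f z" for z
    have LF: "L2 M\<phi> F" unfolding F_def by (rule gf_L2[OF f])
    have Fm: "F \<in> borel_measurable borel" unfolding F_def by measurable
    define f0 where "f0 z = cnj (deriv g z) * f z" for z
    have f0m: "f0 \<in> borel_measurable borel" unfolding f0_def by measurable
    have e: "(cmod (f0 z))\<^sup>2 * exp (-2 * psi z) / N z = (1/c) * ((cmod (deriv g z) * \<rho> z)\<^sup>2 * ((cmod (f z))\<^sup>2 * exp (-2 * psi z)))" for z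
      using c(1) rho_pos[of z] by (simp add: f0_def N_def norm_mult power_mult_distrib field_simps)
    define I where "I = (LINT z|lborel. (cmod (deriv g z) * \<rho> z)\<^sup>2 * ((cmod (f z))\<^sup>2 * exp (-2 * psi z)))"
    have ie: "integrable lborel (\<lambda>z. (cmod (f0 z))\<^sup>2 * exp (-2 * psi z) / N z)" unfolding e using i by (rule integrable_mult_right)
    have Ie: "(LINT z|lborel. (cmod (f0 z))\<^sup>2 * exp (-2 * psi z) / N z) = I / c" unfolding e by (simp add: I_def)
    have Nd: "N z \<le> pxx z + pyy z" for z using c(2) p(2) by (simp add: N_def)
    obtain u where u: "L2 (Mw lborel psi) u" "(nrm (Mw lborel psi) u)\<^sup>2 \<le> 2 * (I / c)"
       "\<And>b. b \<in> TF \<Longrightarrow> (LINT z|lborel. u z * dzb b z) = -2 * (LINT z|lborel. f0 z * b z)"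
      using dbar_solution[OF p(1) N0 Nd Nm f0m ie] unfolding Ie by blast
    have "(LINT z|lborel. F z * dzb b z) = (LINT z|lborel. u z * dzb b z)" if "b \<in> TF" for b
      using gf_dbar[OF fh that] u(3)[OF that] by (simp add: F_def f0_def)
    then obtain W where W: "W \<in> Fock \<phi>" "AE z in lborel. F z - u z = W z"
      using distance_to_Fock[OF LF Fm u(1)] by blast
    have um: "u \<in> borel_measurable borel" using u(1) by (auto simp: Mw_L2)
    have Wm: "W \<in> borel_measurable borel" using W(1) by (intro holomorphic_borel) (simp add: Fock_iff)
    have "nrm M\<phi> (H f) \<le> nrm M\<phi> (\<lambda>z. F z - W z)"
      using Proj_minimal[OF LF W(1)] by (simp add: Hankel_def F_def[abs_def])
    also have "\<dots> \<le> exp gap * nrm (Mw lborel psi) (\<lambda>z. F z - W z)"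
      by (rule L2_psi_phi(3)) (use Fm Wm L2_diff[OF LF Fock_L2[OF W(1)]] in auto)
    also have "nrm (Mw lborel psi) (\<lambda>z. F z - W z) = nrm (Mw lborel psi) u"
    proof (rule nrm_AE_cong)
      have "AE z in lborel. F z - W z = u z" using W(2) by eventually_elim (simp add: algebra_simps)
      then show "AE z in Mw lborel psi. F z - W z = u z" by (rule AE_Mw) simp
    qed (use Fm Wm um in \<open>auto simp: Mw_def\<close>)
    finally have "(nrm M\<phi> (H f))\<^sup>2 \<le> (exp gap * nrm (Mw lborel psi) u)\<^sup>2" by (intro power_mono nrm_nonneg)
    also have "\<dots> \<le> (exp gap)\<^sup>2 * (2 * (I / c))" unfolding power_mult_distrib using u(2) by (intro mult_left_mono) auto
    finally show ?thesis by (simp add: K_def I_def)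
  qed
  moreover have "K \<ge> 0" using c(1) by (simp add: K_def)
  ultimately show ?thesis by blast
qed

lemma symbol_continuous: "continuous_on UNIV (\<lambda>z. cmod (deriv g z) * \<rho> z)"
  using holomorphic_on_imp_continuous_on[OF holomorphic_deriv[OF g_hol open_UNIV]]
  by (intro continuous_intros rho_continuous) auto

text \<open>The integral of \<open>Hankel_bound\<close> is split at radius R: outside, the symbol is
  small and the norm of f bounded; inside, f itself is uniformly small. The norm bound 2 is the one
  satisfied by differences of elements of the unit ball.\<close>

lemma Hankel_small:
  assumes lim: "((\<lambda>a. cmod (deriv g a) * \<rho> a) \<longlongrightarrow> 0) at_infinity" and e: "e > 0"
  shows "\<exists>R d. d > 0 \<and> (\<forall>f\<in>kspan \<phi>. nrm M\<phi> f \<le> 2 \<longrightarrow> (\<forall>z\<in>cball 0 R. cmod (f z) \<le> d) \<longrightarrow> nrm M\<phi> (H f) < e)"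
proof -
  define h where "h z = cmod (deriv g z) * \<rho> z" for z
  have hc: "continuous_on UNIV h" unfolding h_def[abs_def] by (rule symbol_continuous)
  have h0: "h z \<ge> 0" for z using rho_pos[of z] by (simp add: h_def)
  obtain K where K: "K \<ge> 0" "\<And>f. f \<in> kspan \<phi> \<Longrightarrow> integrable lborel (\<lambda>z. (h z)\<^sup>2 * ((cmod (f z))\<^sup>2 * exp (-2 * psi z))) \<Longrightarrow>
     (nrm M\<phi> (H f))\<^sup>2 \<le> K * (LINT z|lborel. (h z)\<^sup>2 * ((cmod (f z))\<^sup>2 * exp (-2 * psi z)))"
    using Hankel_bound unfolding h_def by blast
  \<comment> \<open>With the norm bound 2, the outer part contributes at most e^2/4 to the squared
    norm; \<open>d\<close> is chosen below so that the inner part contributes the same. The summand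
    1 guards against K = 0, as does V + 1 in \<open>d\<close>.\<close>
  define s where "s = e / (4 * sqrt (K + 1))"
  have s: "s > 0" using e K by (simp add: s_def)
  obtain R where R: "\<And>z. norm z \<ge> R \<Longrightarrow> h z < s"
  proof -
    have "\<forall>\<^sub>F z in at_infinity. h z < s" using order_tendstoD(2)[OF lim s] by (simp add: h_def)
    then show ?thesis using that by (auto simp: eventually_at_infinity)
  qed
  define v where "v z = (h z)\<^sup>2 * exp (-2 * psi z)" for z
  have vc: "continuous_on UNIV v" unfolding v_def by (intro continuous_intros hc psi_continuous)
  define V where "V = (LINT z|lborel. indicator (cball 0 R) z * v z)"
  have iV: "integrable lborel (\<lambda>z. indicator (cball 0 R) z * v z)" using locint_continuous[OF vc] by (simp add: locint_def)
  have V0: "V \<ge> 0" unfolding V_def by (rule Bochner_Integration.integral_nonneg) (simp add: v_def)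
  define d where "d = e / (2 * sqrt ((K + 1) * (V + 1)))"
  have d: "d > 0" using e K V0 by (simp add: d_def)
  have "nrm M\<phi> (H f) < e" if f: "f \<in> kspan \<phi>" "nrm M\<phi> f \<le> 2" and fd: "\<And>z. z \<in> cball 0 R \<Longrightarrow> cmod (f z) \<le> d" for f
  proof -
    have L: "L2 M\<phi> f" using Fock_L2[OF kspan_Fock[OF f(1)]] .
    have fm [measurable]: "f \<in> borel_measurable borel" using kspan_Fock[OF f(1)] by (intro holomorphic_borel) (simp add: Fock_iff)
    have [measurable]: "h \<in> borel_measurable borel" using hc by (rule borel_measurable_continuous_onI)
    have Lp: "L2 (Mw lborel psi) f" using L2_psi_phi(1)[OF fm] L by simp
    then have i: "integrable lborel (\<lambda>z. (cmod (f z))\<^sup>2 * exp (-2 * psi z))" by (simp add: Mw_L2)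
    have n: "(LINT z|lborel. (cmod (f z))\<^sup>2 * exp (-2 * psi z)) \<le> 4"
    proof -
      have "nrm (Mw lborel psi) f \<le> 2" using L2_psi_phi(2)[OF fm L] f(2) by simp
      then have "(nrm (Mw lborel psi) f)\<^sup>2 \<le> 2\<^sup>2" by (intro power_mono nrm_nonneg)
      then show ?thesis by (simp add: Mw_nrm)
    qed
    define Bd where "Bd z = d\<^sup>2 * (indicator (cball 0 R) z * v z) + s\<^sup>2 * ((cmod (f z))\<^sup>2 * exp (-2 * psi z))" for z
    have iB: "integrable lborel Bd" unfolding Bd_def
      by (intro Bochner_Integration.integrable_add integrable_mult_right iV i)
    have pw: "(h z)\<^sup>2 * ((cmod (f z))\<^sup>2 * exp (-2 * psi z)) \<le> Bd z" for z
    proof (cases "norm z \<le> R")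
      case True
      have "(cmod (f z))\<^sup>2 \<le> d\<^sup>2" using fd[of z] True by (intro power_mono) auto
      then have "(cmod (f z))\<^sup>2 * v z \<le> d\<^sup>2 * v z" by (intro mult_right_mono) (auto simp: v_def)
      moreover have "0 \<le> s\<^sup>2 * ((cmod (f z))\<^sup>2 * exp (-2 * psi z))" by simp
      moreover have "(h z)\<^sup>2 * ((cmod (f z))\<^sup>2 * exp (-2 * psi z)) = (cmod (f z))\<^sup>2 * v z" by (simp add: v_def mult_ac)
      moreover have "Bd z = d\<^sup>2 * v z + s\<^sup>2 * ((cmod (f z))\<^sup>2 * exp (-2 * psi z))" using True by (simp add: Bd_def)
      ultimately show ?thesis by linarith
    next
      case False
      have "(h z)\<^sup>2 \<le> s\<^sup>2" using R[of z] False h0[of z] by (intro power_mono) auto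
      then have "(h z)\<^sup>2 * ((cmod (f z))\<^sup>2 * exp (-2 * psi z)) \<le> s\<^sup>2 * ((cmod (f z))\<^sup>2 * exp (-2 * psi z))" by (intro mult_right_mono) auto
      then show ?thesis unfolding Bd_def using False by simp
    qed
    have ih: "integrable lborel (\<lambda>z. (h z)\<^sup>2 * ((cmod (f z))\<^sup>2 * exp (-2 * psi z)))"
      by (rule Bochner_Integration.integrable_bound[OF iB]) (use pw in \<open>auto intro: order_trans[OF _ abs_ge_self]\<close>)
    have "(LINT z|lborel. (h z)\<^sup>2 * ((cmod (f z))\<^sup>2 * exp (-2 * psi z))) \<le> (LINT z|lborel. Bd z)" by (rule integral_mono[OF ih iB pw])
    also have "\<dots> = d\<^sup>2 * V + s\<^sup>2 * (LINT z|lborel. (cmod (f z))\<^sup>2 * exp (-2 * psi z))"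
      unfolding Bd_def V_def using iV i by simp
    also have "\<dots> \<le> d\<^sup>2 * V + s\<^sup>2 * 4" using n by (intro add_left_mono mult_left_mono) auto
    finally have b: "(LINT z|lborel. (h z)\<^sup>2 * ((cmod (f z))\<^sup>2 * exp (-2 * psi z))) \<le> d\<^sup>2 * V + s\<^sup>2 * 4" .
    have "(nrm M\<phi> (H f))\<^sup>2 \<le> K * (LINT z|lborel. (h z)\<^sup>2 * ((cmod (f z))\<^sup>2 * exp (-2 * psi z)))" by (rule K(2)[OF f(1) ih])
    also have "\<dots> \<le> K * (d\<^sup>2 * V + s\<^sup>2 * 4)" using b K(1) by (rule mult_left_mono)
    also have "\<dots> \<le> (K + 1) * (d\<^sup>2 * (V + 1) + s\<^sup>2 * 4)"
      using K(1) V0 by (intro mult_mono add_mono mult_left_mono) auto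
    also have "\<dots> = e\<^sup>2 / 4 + e\<^sup>2 / 4"
    proof -
      have "k * ((e / (2 * sqrt (k * w)))\<^sup>2 * w) = e\<^sup>2 / 4 \<and> k * ((e / (4 * sqrt k))\<^sup>2 * 4) = e\<^sup>2 / 4" if "k > 0" "w > 0" for k w :: real
        using that by (simp add: power_divide power_mult_distrib)
      from this[of "K + 1" "V + 1"] have "(K + 1) * (d\<^sup>2 * (V + 1)) = e\<^sup>2 / 4" "(K + 1) * (s\<^sup>2 * 4) = e\<^sup>2 / 4"
        using K(1) V0 unfolding d_def s_def by auto
      then show ?thesis by (simp only: distrib_left)
    qed
    also have "\<dots> < e\<^sup>2" using e by simp
    finally show ?thesis using e by (auto intro: power_less_imp_less_base)
  qed
  then show ?thesis using d by blast
qed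

lemma compact_if_vanishing:
  assumes lim: "((\<lambda>a. cmod (deriv g a) * \<rho> a) \<longlongrightarrow> 0) at_infinity"
  shows "hankel_compact \<phi> g"
  unfolding hankel_compact_def
proof (intro allI impI)
  fix e :: real assume e: "e > 0"
  define B where "B = {f \<in> kspan \<phi>. nrm M\<phi> f \<le> 1}"
  have BL: "L2 M\<phi> f" if "f \<in> B" for f using that Fock_L2[OF kspan_Fock] by (simp add: B_def)
  have "\<exists>T. finite T \<and> T \<subseteq> B \<and> (\<forall>f\<in>B. \<exists>t\<in>T. nrm M\<phi> (H (\<lambda>z. f z - t z)) < e)"
  proof (rule ccontr)
    assume neg: "\<not> ?thesis"
    \<comment> \<open>Without a finite net there is a sequence in the unit ball whose images under H
      are pairwise at distance at least e.\<close>
    have "\<exists>f. \<forall>n::nat. f n \<in> B \<and> (\<forall>m<n. nrm M\<phi> (H (\<lambda>z. f n z - f m z)) \<ge> e)"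
      by (rule infinitely_many_separated[where R="\<lambda>f t. nrm M\<phi> (H (\<lambda>z. f z - t z)) \<ge> e"])
         (use neg in \<open>meson not_le\<close>)
    then obtain f where f: "\<And>n::nat. f n \<in> B" "\<And>n m. m < n \<Longrightarrow> nrm M\<phi> (H (\<lambda>z. f n z - f m z)) \<ge> e" by blast
    obtain R d where Rd: "d > 0" "\<And>f. f \<in> kspan \<phi> \<Longrightarrow> nrm M\<phi> f \<le> 2 \<Longrightarrow> (\<And>z. z \<in> cball 0 R \<Longrightarrow> cmod (f z) \<le> d) \<Longrightarrow> nrm M\<phi> (H f) < e"
      using Hankel_small[OF lim e] by blast
    have bdd: "\<exists>b. \<forall>h\<in>B. \<forall>z\<in>K. norm (h z) \<le> b" if K: "compact K" for K
    proof -
      obtain R where R: "\<And>z. z \<in> K \<Longrightarrow> norm z \<le> R" using compact_imp_bounded[OF K] bounded_iff by metis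
      obtain b where b: "b \<ge> 0" "\<And>f z. f \<in> Fock \<phi> \<Longrightarrow> norm z \<le> R \<Longrightarrow> cmod (f z) \<le> b * nrm M\<phi> f" using Fock_bound[of R] by blast
      have "norm (h z) \<le> b" if "h \<in> B" "z \<in> K" for h z
      proof -
        have "cmod (h z) \<le> b * nrm M\<phi> h" using that R by (intro b(2) kspan_Fock) (auto simp: B_def)
        also have "\<dots> \<le> b * 1" using that b(1) by (intro mult_left_mono) (auto simp: B_def)
        finally show ?thesis by simp
      qed
      then show ?thesis by blast
    qed
    have hol: "h holomorphic_on UNIV" if "h \<in> B" for h using that kspan_Fock by (auto simp: B_def Fock_iff)
    obtain k r where k: "strict_mono r" "\<And>K. compact K \<Longrightarrow> K \<subseteq> UNIV \<Longrightarrow> uniform_limit K (f \<circ> r) k sequentially"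
    proof (rule Montel[of UNIV B f])
      show "range f \<subseteq> B" using f(1) by blast
    qed (use hol bdd in auto)
    have "uniform_limit (cball 0 R) (f \<circ> r) k sequentially" by (rule k(2)) auto
    then have "\<forall>\<^sub>F n in sequentially. \<forall>z\<in>cball 0 R. dist ((f \<circ> r) n z) (k z) < d / 2"
      using Rd(1) unfolding uniform_limit_iff by (meson half_gt_zero)
    then obtain n0 where n0: "\<And>n z. n \<ge> n0 \<Longrightarrow> z \<in> cball 0 R \<Longrightarrow> dist (f (r n) z) (k z) < d / 2"
      unfolding eventually_sequentially comp_def by blast
    \<comment> \<open>Two consecutive terms of the subsequence are both within d/2 of its locally
      uniform limit, so \<open>Hankel_small\<close> applies to their difference and contradicts the
      separation.\<close>
    define i where "i = r n0"
    define j where "j = r (Suc n0)"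
    have ij: "i < j" using k(1) by (simp add: i_def j_def strict_mono_def)
    have "nrm M\<phi> (H (\<lambda>z. f j z - f i z)) < e"
    proof (rule Rd(2))
      show "(\<lambda>z. f j z - f i z) \<in> kspan \<phi>" using f(1) by (intro kspan_diff) (auto simp: B_def)
      have "nrm M\<phi> (\<lambda>z. f j z - f i z) \<le> nrm M\<phi> (\<lambda>z. f j z - 0) + nrm M\<phi> (\<lambda>z. 0 - f i z)"
        by (rule nrm_triangle_diff[OF BL[OF f(1)] L2_zero BL[OF f(1)]])
      also have "\<dots> \<le> 2" using f(1)[of i] f(1)[of j] nrm_minus_commute[of M\<phi> "\<lambda>z. 0" "f i"] by (simp add: B_def)
      finally show "nrm M\<phi> (\<lambda>z. f j z - f i z) \<le> 2" .
      fix z :: complex assume z: "z \<in> cball 0 R"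
      have "dist (f j z) (f i z) \<le> dist (f j z) (k z) + dist (f i z) (k z)" by (rule dist_triangle2)
      also have "\<dots> \<le> d" using n0[OF order_refl z] n0[OF le_SucI[OF order_refl] z] by (simp add: i_def j_def)
      finally show "cmod (f j z - f i z) \<le> d" by (simp add: dist_norm)
    qed
    then show False using f(2)[OF ij] by simp
  qed
  then obtain T where T: "finite T" "T \<subseteq> B" "\<And>f. f \<in> B \<Longrightarrow> \<exists>t\<in>T. nrm M\<phi> (H (\<lambda>z. f z - t z)) < e" by blast
  show "\<exists>S. finite S \<and> (\<forall>s\<in>S. L2w \<phi> s) \<and> (\<forall>f\<in>kspan \<phi>. wnorm \<phi> f \<le> 1 \<longrightarrow> (\<exists>s\<in>S. wnorm \<phi> (\<lambda>z. H f z - s z) < e))"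
  proof (intro exI[of _ "H ` T"] conjI ballI impI)
    show "finite (H ` T)" using T by simp
    show "L2w \<phi> s" if "s \<in> H ` T" for s using that T(2) H_L2 by (auto simp: L2w_iff B_def)
    fix f assume f: "f \<in> kspan \<phi>" "wnorm \<phi> f \<le> 1"
    then have "f \<in> B" using wnorm_eq[OF Fock_L2[OF kspan_Fock[OF f(1)]]] by (simp add: B_def)
    then obtain t where t: "t \<in> T" "nrm M\<phi> (H (\<lambda>z. f z - t z)) < e" using T(3) by blast
    then have tk: "t \<in> kspan \<phi>" using T(2) by (auto simp: B_def)
    have "wnorm \<phi> (\<lambda>z. H f z - H t z) < e"
      using t(2) wnorm_eq[OF L2_diff[OF H_L2[OF f(1)] H_L2[OF tk]]] H_diff[OF f(1) tk] by simp
    then show "\<exists>s\<in>H ` T. wnorm \<phi> (\<lambda>z. H f z - s z) < e" using t(1) by blast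
  qed
qed

end

section \<open>Peak functions and kernel estimates\<close>

lemma TF_mult:
  assumes s: "SM (\<lambda>z. Re (s z))" "SM (\<lambda>z. Im (s z))" and b: "b \<in> TF"
  shows "(\<lambda>z. s z * b z) \<in> TF" "dzb (\<lambda>z. s z * b z) z = s z * dzb b z + b z * dzb s z"
proof -
  note t = TF_D[OF b]
  have e: "(\<lambda>z. Re (s z * b z)) = (\<lambda>z. Re (s z) * Re (b z) - Im (s z) * Im (b z))" "(\<lambda>z. Im (s z * b z)) = (\<lambda>z. Re (s z) * Im (b z) + Im (s z) * Re (b z))" by auto
  have "SM (\<lambda>z. Re (s z * b z))" "SM (\<lambda>z. Im (s z * b z))"
    unfolding e by (intro SM_diff SM_add SM_mult t s)+
  moreover have "\<exists>R. \<forall>z. norm z > R \<longrightarrow> s z * b z = 0" using b by (auto simp: TF_def)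
  ultimately show "(\<lambda>z. s z * b z) \<in> TF" by (simp only: TF_def mem_Collect_eq)
  note d1 = D1_diff[OF D1_mult[OF SM_D1(1)[OF s(1)] t(3)] D1_mult[OF SM_D1(1)[OF s(2)] t(4)]]
  note d2 = D1_add[OF D1_mult[OF SM_D1(1)[OF s(1)] t(4)] D1_mult[OF SM_D1(1)[OF s(2)] t(3)]]
  show "dzb (\<lambda>z. s z * b z) z = s z * dzb b z + b z * dzb s z"
    unfolding dzb_def e dx_eq[OF d1] dy_eq[OF d1] dx_eq[OF d2] dy_eq[OF d2] by (simp add: complex_eq_iff algebra_simps)
qed

lemma dzb_shift: "SM (\<lambda>z. Re (z - a))" "SM (\<lambda>z. Im (z - a))" "dzb (\<lambda>z. z - a) z = 0"
proof -
  show s: "SM (\<lambda>z. Re (z - a))" "SM (\<lambda>z. Im (z - a))"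
    using SM_shift[OF SM_Re, of a] SM_shift[OF SM_Im, of a] by auto
  have d: "D1 (\<lambda>z. Re (z - a)) (\<lambda>z. 1) (\<lambda>z. 0)" "D1 (\<lambda>z. Im (z - a)) (\<lambda>z. 0) (\<lambda>z. 1)"
    using D1_shift[OF D1_Re, of a] D1_shift[OF D1_Im, of a] by auto
  show "dzb (\<lambda>z. z - a) z = 0"
    unfolding dzb_def dx_eq[OF d(1)] dy_eq[OF d(1)] dx_eq[OF d(2)] dy_eq[OF d(2)] by (simp add: complex_eq_iff)
qed

text \<open>A cut-off that depends on |w - a|^2 only, so its \<open>dzb\<close> carries the explicit
  factor w - a. The source term in \<open>peak_function\<close> can be divided by w - a for that
  reason.\<close>

definition chi :: "real \<Rightarrow> complex \<Rightarrow> complex \<Rightarrow> complex" where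
  "chi r a w = complex_of_real (1 - step (nq r (w - a)))"

lemma chi:
  assumes r: "r > 0"
  shows "SM (\<lambda>w. Re (chi r a w))" "SM (\<lambda>w. Im (chi r a w))"
    "dzb (chi r a) w = complex_of_real (-2 * pi * eta r (w - a)) * (w - a)"
    "norm (w - a) \<ge> r \<Longrightarrow> chi r a w = 0" "norm (w - a) \<le> r / 2 \<Longrightarrow> chi r a w = 1" "norm (chi r a w) \<le> 1"
proof -
  have s: "SM (\<lambda>w. 1 - step (nq r (w - a)))"
    by (rule SM_diff[OF SM_const step_SM(1)[OF SM_shift[OF SM_nq]]])
  show "SM (\<lambda>w. Re (chi r a w))" "SM (\<lambda>w. Im (chi r a w))" using s SM_const[of 0] by (auto simp: chi_def)
  have d: "D1 (\<lambda>w. 1 - step (nq r (w - a))) (\<lambda>w. 0 - step' (nq r (w - a)) * (2 * Re (w - a) * inverse (r\<^sup>2))) (\<lambda>w. 0 - step' (nq r (w - a)) * (2 * Im (w - a) * inverse (r\<^sup>2)))"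
    by (rule D1_diff[OF D1_const D1_compose[OF D1_shift[OF C2_D(1)[OF nq_C2]] step_deriv]])
  show "dzb (chi r a) w = complex_of_real (-2 * pi * eta r (w - a)) * (w - a)"
    unfolding dzb_def chi_def Re_complex_of_real Im_complex_of_real dx_eq[OF d] dy_eq[OF d] dx_eq[OF D1_const] dy_eq[OF D1_const]
  proof -
    have gen: "Complex (0 - S * (2 * Re z * I) - 0) (0 + (0 - S * (2 * Im z * I))) = complex_of_real (-2 * (S * I)) * z" for S I :: real and z
      by (simp add: complex_eq_iff)
    have "pi * eta r (w - a) = step' (nq r (w - a)) * inverse (r\<^sup>2)"
      using r by (simp add: eta_def)
    then have e: "-2 * pi * eta r (w - a) = -2 * (step' (nq r (w - a)) * inverse (r\<^sup>2))" by simp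
    show "Complex (0 - step' (nq r (w - a)) * (2 * Re (w - a) * inverse (r\<^sup>2)) - 0)
       (0 + (0 - step' (nq r (w - a)) * (2 * Im (w - a) * inverse (r\<^sup>2)))) = complex_of_real (-2 * pi * eta r (w - a)) * (w - a)"
      unfolding e by (rule gen)
  qed
  show "norm (w - a) \<ge> r \<Longrightarrow> chi r a w = 0" using r by (simp add: chi_def nq_norm step_high)
  show "norm (w - a) \<le> r / 2 \<Longrightarrow> chi r a w = 1"
  proof -
    assume "norm (w - a) \<le> r / 2"
    then have "(norm (w - a) / r)\<^sup>2 \<le> (1/2)\<^sup>2" using r by (intro power_mono) (auto simp: field_simps)
    then show ?thesis by (simp add: chi_def nq_norm step_low power2_eq_square)
  qed
  show "norm (chi r a w) \<le> 1"
    using step_bounds[of "nq r (w - a)"] unfolding chi_def norm_of_real by simp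
qed

lemma area_cball: "r \<ge> 0 \<Longrightarrow> measure lborel (cball (a::complex) r) = pi * r\<^sup>2"
  using content_cball[of r a] by (simp add: unit_ball_vol_2)

lemma indicator_cball_integrable: "integrable lborel (indicat_real (cball (a::complex) r))"
  using emeasure_bounded_finite[of "cball a r"] by (intro integrable_real_indicator) auto

context laplace_weight
begin

text \<open>W = exp(G) \<open>chi\<close> - (z - a) u, where u solves the d-bar equation with source
  exp(G) times d-bar of \<open>chi\<close>, divided by z - a. The correction vanishes at a. Both
  terms have norm of order \<rho>(a): the first by the area of its support, the second because |z -
  a|^2 exp(-2 psi) is at most m^2 times the weight used for u, where m = M \<rho>(a).\<close>

lemma peak_function:
  assumes K: "K \<ge> 0"
  shows "\<exists>A>0. \<forall>a G. G holomorphic_on ball a (\<rho> a) \<longrightarrow> (\<forall>z\<in>ball a (\<rho> a). \<bar>psi z - Re (G z)\<bar> \<le> K) \<longrightarrow>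
     (\<exists>W\<in>Fock \<phi>. W a = exp (G a) \<and> nrm M\<phi> W \<le> A * \<rho> a)"
proof -
  obtain px py pxx pxy pyy where p: "C2 psi px py pxx pxy pyy" "\<And>z. pxx z + pyy z = dens z" using psi_C2 by blast
  obtain c where c: "c > 0" "\<And>z. dens z \<ge> c / (\<rho> z)\<^sup>2" using dens_lower by blast
  \<comment> \<open>With this slope, \<open>rho_growth\<close> gives 4 \<rho>(z)^2 \<le> c (m^2 + |z
    - a|^2), so the Laplacian of the logarithmic term is at most half of the lower bound for
    \<open>dens\<close>.\<close>
  define e where "e = sqrt (c / 8)"
  have e: "e > 0" "e\<^sup>2 = c / 8" using c(1) by (auto simp: e_def)
  obtain M where M: "M \<ge> 1" "\<And>a z. \<rho> z \<le> e * (M * \<rho> a + dist z a)" using rho_growth[OF e(1)] by blast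
  \<comment> \<open>The half of the curvature of \<open>psi\<close> that survives the logarithmic
    term.\<close>
  define N where "N z = c / (2 * (\<rho> z)\<^sup>2)" for z
  have N0: "N z > 0" for z using c(1) rho_pos[of z] by (simp add: N_def)
  have Nc: "continuous_on UNIV (\<lambda>z. inverse (N z))"
    unfolding N_def by (intro continuous_intros rho_continuous) (use c(1) rho_pos in \<open>auto simp: less_imp_neq[symmetric] intro!: less_imp_neq[symmetric]\<close>)
  have Nm: "N \<in> borel_measurable borel"
  proof -
    have [measurable]: "\<rho> \<in> borel_measurable borel" using rho_continuous by (rule borel_measurable_continuous_onI)
    show ?thesis unfolding N_def[abs_def] by measurable
  qed
  \<comment> \<open>A bound for the source integral without \<rho>: the supremum of the mollifier
    gives the inverse square of the scale, 1/N its square, and the remaining mollifier integrates to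
    \<open>mass\<close>.\<close>
  define I0 where "I0 = pi\<^sup>2 * (4 * etasup) * (16 * exp (2 * K) / c) * mass"
  have I0: "I0 \<ge> 0" using etasup(1) mass_pos c(1) by (simp add: I0_def)
  define A where "A = exp gap * (sqrt (exp (2 * K) * pi) + M * sqrt (2 * I0))"
  have A: "A > 0" using M(1) I0 by (auto simp: A_def intro!: mult_pos_pos add_pos_nonneg)
  have "\<exists>W\<in>Fock \<phi>. W a = exp (G a) \<and> nrm M\<phi> W \<le> A * \<rho> a"
    if G: "G holomorphic_on ball a (\<rho> a)" and GK: "\<And>z. z \<in> ball a (\<rho> a) \<Longrightarrow> \<bar>psi z - Re (G z)\<bar> \<le> K" for a G
  proof -
    define R where "R = \<rho> a"
    have R: "R > 0" using rho_pos by (simp add: R_def)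
    define r where "r = R / 2"
    have r: "0 < r" "r < R" using R by (auto simp: r_def)
    define m where "m = M * R"
    have m: "m \<ge> R" "m > 0" using M(1) R by (auto simp: m_def)
    define s where "s z = nq m (z - a)" for z
    have s0: "s z \<ge> 0" for z by (simp add: s_def nq_nonneg)
    \<comment> \<open>Then exp(-2P) = (1 + s) exp(-2 psi), and m^2 s = |z - a|^2. An estimate with
      weight P therefore survives multiplication by z - a in the weight \<open>psi\<close>.\<close>
    define P where "P z = psi z - ln (1 + s z) / 2" for z
    have sC: "C2 s (\<lambda>z. 2 * Re (z - a) * inverse (m\<^sup>2)) (\<lambda>z. 2 * Im (z - a) * inverse (m\<^sup>2)) (\<lambda>z. 2 * inverse (m\<^sup>2)) (\<lambda>z. 0) (\<lambda>z. 2 * inverse (m\<^sup>2))"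
      unfolding s_def using C2_shift[OF nq_C2[of m], of a] by simp
    define F1 where "F1 t = inverse (2 * (1 + t))" for t :: real
    define F2 where "F2 t = - (inverse (2 * (1 + t)) * 2 * inverse (2 * (1 + t)))" for t :: real
    have lC: "C2 (\<lambda>z. ln (1 + s z) / 2) (\<lambda>z. F1 (s z) * (2 * Re (z - a) * inverse (m\<^sup>2))) (\<lambda>z. F1 (s z) * (2 * Im (z - a) * inverse (m\<^sup>2)))
      (\<lambda>z. F2 (s z) * (2 * Re (z - a) * inverse (m\<^sup>2)) * (2 * Re (z - a) * inverse (m\<^sup>2)) + F1 (s z) * (2 * inverse (m\<^sup>2)))
      (\<lambda>z. F2 (s z) * (2 * Re (z - a) * inverse (m\<^sup>2)) * (2 * Im (z - a) * inverse (m\<^sup>2)) + F1 (s z) * 0)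
      (\<lambda>z. F2 (s z) * (2 * Im (z - a) * inverse (m\<^sup>2)) * (2 * Im (z - a) * inverse (m\<^sup>2)) + F1 (s z) * (2 * inverse (m\<^sup>2)))"
    proof (rule C2_compose[OF sC, of "\<lambda>t. ln (1 + t) / 2"])
      fix z
      have "1 + s z > 0" using s0[of z] by simp
      then show "((\<lambda>t. ln (1 + t) / 2) has_real_derivative F1 (s z)) (at (s z))"
        by (auto intro!: derivative_eq_intros simp: F1_def field_simps)
      show "(F1 has_real_derivative F2 (s z)) (at (s z))"
        unfolding F1_def[abs_def] F2_def using \<open>1 + s z > 0\<close>
        by (auto intro!: derivative_eq_intros)
    next
      have "2 * (1 + s z) \<noteq> 0" for z using s0[of z] by simp
      then show "continuous_on UNIV (\<lambda>z. F2 (s z))"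
        unfolding F2_def by (intro continuous_intros C2_D(4)[OF sC]) blast+
    qed
    note PC = C2_diff[OF p(1) lC]
    have lapl: "(F2 (s z) * (2 * Re (z - a) * inverse (m\<^sup>2)) * (2 * Re (z - a) * inverse (m\<^sup>2)) + F1 (s z) * (2 * inverse (m\<^sup>2)))
       + (F2 (s z) * (2 * Im (z - a) * inverse (m\<^sup>2)) * (2 * Im (z - a) * inverse (m\<^sup>2)) + F1 (s z) * (2 * inverse (m\<^sup>2)))
       = 2 * inverse (m\<^sup>2) / (1 + s z)\<^sup>2" for z
    proof -
      have sz: "1 + s z > 0" using s0[of z] by simp
      have q: "Re (z - a) * Re (z - a) * inverse (m\<^sup>2) + Im (z - a) * Im (z - a) * inverse (m\<^sup>2) = s z"
        by (simp add: s_def nq_def distrib_right)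
      have "(F2 (s z) * (2 * Re (z - a) * inverse (m\<^sup>2)) * (2 * Re (z - a) * inverse (m\<^sup>2)) + F1 (s z) * (2 * inverse (m\<^sup>2)))
       + (F2 (s z) * (2 * Im (z - a) * inverse (m\<^sup>2)) * (2 * Im (z - a) * inverse (m\<^sup>2)) + F1 (s z) * (2 * inverse (m\<^sup>2)))
       = inverse (m\<^sup>2) * (4 * F2 (s z) * (Re (z - a) * Re (z - a) * inverse (m\<^sup>2) + Im (z - a) * Im (z - a) * inverse (m\<^sup>2)) + 4 * F1 (s z))"
        by (simp only: algebra_simps)
      also have "\<dots> = inverse (m\<^sup>2) * (4 * F2 (s z) * s z + 4 * F1 (s z))" unfolding q ..
      \<comment> \<open>A radial function F(s) with s = |z - a|^2 / m^2 has Laplacian (4 / m^2) (s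
        F'' + F'); for F = ln(1 + s) / 2 the bracket is 1 / (2 (1 + s)^2).\<close>
      also have "4 * F2 (s z) * s z + 4 * F1 (s z) = 2 / (1 + s z)\<^sup>2"
      proof -
        define x where "x = 1 + s z"
        have x: "x > 0" "s z = x - 1" using sz by (auto simp: x_def)
        show ?thesis unfolding F1_def F2_def x_def[symmetric] using x
          by (simp add: field_simps power2_eq_square)
      qed
      finally show ?thesis by simp
    qed
    have Nlap: "N z \<le> (pxx z - (F2 (s z) * (2 * Re (z - a) * inverse (m\<^sup>2)) * (2 * Re (z - a) * inverse (m\<^sup>2)) + F1 (s z) * (2 * inverse (m\<^sup>2))))
       + (pyy z - (F2 (s z) * (2 * Im (z - a) * inverse (m\<^sup>2)) * (2 * Im (z - a) * inverse (m\<^sup>2)) + F1 (s z) * (2 * inverse (m\<^sup>2))))" for z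
    proof -
      define t where "t = dist z a"
      have t0: "t \<ge> 0" by (simp add: t_def)
      have st: "s z = t\<^sup>2 / m\<^sup>2" by (simp add: s_def nq_norm t_def dist_norm power_divide)
      have "\<rho> z \<le> e * (m + t)" using M(2)[of z a] by (simp add: m_def R_def t_def)
      then have "(\<rho> z)\<^sup>2 \<le> (e * (m + t))\<^sup>2" using rho_pos[of z] by (intro power_mono) auto
      also have "\<dots> = c / 8 * (m + t)\<^sup>2" by (simp add: power_mult_distrib e)
      also have "\<dots> \<le> c / 8 * (2 * (m\<^sup>2 + t\<^sup>2))"
        using c(1) sum_squares_bound[of m t] by (intro mult_left_mono) (auto simp: power2_sum)
      also have "c / 8 * (2 * (m\<^sup>2 + t\<^sup>2)) = (c * (m\<^sup>2 + t\<^sup>2)) / 4" by simp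
      finally have rr: "4 * (\<rho> z)\<^sup>2 \<le> c * (m\<^sup>2 + t\<^sup>2)" by linarith
      have "2 * inverse (m\<^sup>2) / (1 + s z)\<^sup>2 \<le> 2 * inverse (m\<^sup>2) / (1 + s z)"
        using s0[of z] m(2) by (intro divide_left_mono) (auto simp: power2_eq_square mult_pos_pos add_pos_nonneg)
      also have "\<dots> = 2 / (m\<^sup>2 + t\<^sup>2)" using m(2) by (simp add: st field_simps)
      also have "\<dots> \<le> c / (2 * (\<rho> z)\<^sup>2)"
        using rr rho_pos[of z] m(2) by (simp add: field_simps add_pos_nonneg)
      finally have "2 * inverse (m\<^sup>2) / (1 + s z)\<^sup>2 \<le> c / (2 * (\<rho> z)\<^sup>2)" .
      moreover have "c / (\<rho> z)\<^sup>2 = 2 * (c / (2 * (\<rho> z)\<^sup>2))" by simp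
      ultimately show ?thesis using lapl[of z] p(2)[of z] c(2)[of z] unfolding N_def by linarith
    qed
    have expP: "exp (-2 * P z) = (1 + s z) * exp (-2 * psi z)" for z
    proof -
      have "-2 * P z = ln (1 + s z) + -2 * psi z" by (simp add: P_def)
      moreover have "1 + s z > 0" using s0[of z] by simp
      ultimately show ?thesis by (simp only: exp_add exp_ln)
    qed
    have cG: "continuous_on (ball a R) (\<lambda>z. exp (G z))"
      using G by (intro continuous_intros holomorphic_on_imp_continuous_on) (simp add: R_def)
    have hG: "(\<lambda>z. exp (G z)) holomorphic_on ball a R" using G by (intro holomorphic_intros) (simp add: R_def)
    \<comment> \<open>By the formula in \<open>chi\<close>, d-bar of the cut-off is -pi
      \<open>eta\<close> (w - a), so the quotient by w - a is free of singularities.\<close>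
    define f0 where "f0 w = exp (G w) * complex_of_real (- pi * eta r (w - a))" for w
    have eta0: "complex_of_real (eta r (w - a)) = 0" if "w \<notin> cball a r" for w by (rule TF_eta(2)[OF r(1) that])
    have f0c: "continuous_on UNIV f0"
      unfolding f0_def
    proof (rule continuous_glue[of "ball a R" "cball a r", OF _ _ _ cG])
      show "continuous_on UNIV (\<lambda>w. complex_of_real (- pi * eta r (w - a)))"
        by (intro continuous_intros continuous_on_compose2[OF eta_continuous[of UNIV]]) auto
    qed (use r eta0 in auto)
    have f0m: "f0 \<in> borel_measurable borel" using f0c by (rule borel_measurable_continuous_onI)
    have f00: "f0 w = 0" if "norm w > norm a + r" for w
    proof -
      have "norm (w - a) \<ge> r" using that norm_triangle_ineq2[of w a] by simp
      then show ?thesis by (simp add: f0_def eta_outside r)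
    qed
    have Pc: "continuous_on UNIV P" using C2_D(4)[OF PC] by (simp add: P_def[abs_def])
    have int: "integrable lborel (\<lambda>z. (cmod (f0 z))\<^sup>2 * exp (-2 * P z) / N z)"
      unfolding divide_inverse
      by (rule integrable_compact_support[of _ "norm a + r"]) (auto intro!: continuous_intros f0c Pc Nc simp: f00)
    have Ib: "(LINT z|lborel. (cmod (f0 z))\<^sup>2 * exp (-2 * P z) / N z) \<le> I0"
    proof -
      define B where "B = pi\<^sup>2 * (4 * etasup) * (16 * exp (2 * K) / c)"
      have b: "(cmod (f0 z))\<^sup>2 * exp (-2 * P z) / N z \<le> B * eta r (z - a)" for z
      proof (cases "dist a z < r")
        case False
        then have "eta r (z - a) = 0" by (intro eta_outside r) (simp add: dist_norm norm_minus_commute)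
        then show ?thesis by (simp add: f0_def)
      next
        case True
        then have zb: "z \<in> ball a R" using r by simp
        have 1: "(cmod (f0 z))\<^sup>2 = exp (2 * Re (G z)) * (pi\<^sup>2 * (eta r (z - a))\<^sup>2)"
          by (simp add: f0_def norm_mult power_mult_distrib exp_double eta_nonneg)
        have "s z \<le> 1"
        proof -
          have "dist z a / m \<le> 1" using True r m by (simp add: field_simps dist_commute)
          then have "(dist z a / m)\<^sup>2 \<le> 1" using m by (intro power_le_one) auto
          then show ?thesis by (simp add: s_def nq_norm dist_norm)
        qed
        then have 2: "exp (-2 * P z) \<le> 2 * exp (-2 * psi z)" unfolding expP by (intro mult_right_mono) auto
        have "exp (2 * Re (G z)) * exp (-2 * psi z) \<le> exp (2 * K)"
          using GK[of z] zb by (simp add: R_def flip: exp_add)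
        moreover have "exp (2 * Re (G z)) * exp (-2 * P z) \<le> exp (2 * Re (G z)) * (2 * exp (-2 * psi z))" using 2 by (intro mult_left_mono) auto
        moreover have "exp (2 * Re (G z)) * (2 * exp (-2 * psi z)) = 2 * (exp (2 * Re (G z)) * exp (-2 * psi z))" by (rule mult.left_commute)
        ultimately have 3: "exp (2 * Re (G z)) * exp (-2 * P z) \<le> 2 * exp (2 * K)" by linarith
        have "\<rho> z \<le> 2 * R" using rho_lipschitz[of z a] True r by (simp add: R_def dist_commute)
        then have "(\<rho> z)\<^sup>2 \<le> (2 * R)\<^sup>2" using rho_pos[of z] by (intro power_mono) auto
        then have 4: "inverse (N z) \<le> 8 * R\<^sup>2 / c" using c(1) by (simp add: N_def power_mult_distrib divide_right_mono)
        have 5: "(eta r (z - a))\<^sup>2 \<le> 4 * etasup / R\<^sup>2 * eta r (z - a)"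
          using mult_right_mono[OF eta_le[OF r(1), of "z - a"] eta_nonneg[of r "z - a"]] by (simp add: power2_eq_square r_def mult_ac)
        have "(cmod (f0 z))\<^sup>2 * exp (-2 * P z) / N z = (exp (2 * Re (G z)) * exp (-2 * P z)) * (pi\<^sup>2 * (eta r (z - a))\<^sup>2) * inverse (N z)"
          unfolding 1 by (simp add: divide_inverse mult_ac)
        also have "\<dots> \<le> (2 * exp (2 * K)) * (pi\<^sup>2 * (4 * etasup / R\<^sup>2 * eta r (z - a))) * (8 * R\<^sup>2 / c)"
          by (rule mult_mono[OF mult_mono[OF 3 mult_left_mono[OF 5]] 4]) (use N0[of z] etasup(1) eta_nonneg[of r "z - a"] in auto)
        also have "\<dots> = B * eta r (z - a)" using R by (simp add: B_def field_simps)
        finally show ?thesis .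
      qed
      have "(LINT z|lborel. (cmod (f0 z))\<^sup>2 * exp (-2 * P z) / N z) \<le> (LINT z|lborel. B * eta r (z - a))"
        by (rule integral_mono[OF int _ b]) (use eta_shift_integral(1)[OF r(1)] in simp)
      also have "\<dots> = I0" using eta_shift_integral(2)[OF r(1), of a] by (simp add: B_def I0_def)
      finally show ?thesis .
    qed
    have "\<exists>u. L2 (Mw lborel P) u \<and> (nrm (Mw lborel P) u)\<^sup>2 \<le> 2 * (LINT z|lborel. (cmod (f0 z))\<^sup>2 * exp (-2 * P z) / N z) \<and>
       (\<forall>b\<in>TF. (LINT z|lborel. u z * dzb b z) = -2 * (LINT z|lborel. f0 z * b z))"
      using dbar_solution[OF PC N0 Nlap Nm f0m] int unfolding P_def[abs_def] by blast
    then obtain u where u: "L2 (Mw lborel P) u" "(nrm (Mw lborel P) u)\<^sup>2 \<le> 2 * (LINT z|lborel. (cmod (f0 z))\<^sup>2 * exp (-2 * P z) / N z)"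
       "\<And>b. b \<in> TF \<Longrightarrow> (LINT z|lborel. u z * dzb b z) = -2 * (LINT z|lborel. f0 z * b z)" by blast
    have Pm [measurable]: "P \<in> borel_measurable borel" using Pc by (rule borel_measurable_continuous_onI)
    have um [measurable]: "u \<in> borel_measurable borel" and ui: "integrable lborel (\<lambda>z. (cmod (u z))\<^sup>2 * exp (-2 * P z))"
      using u(1) by (auto simp: Mw_L2)
    have un: "(LINT z|lborel. (cmod (u z))\<^sup>2 * exp (-2 * P z)) \<le> 2 * I0"
      using u(2) Ib by (simp add: Mw_nrm)
    define v where "v z = (z - a) * u z" for z
    have vm [measurable]: "v \<in> borel_measurable borel" unfolding v_def[abs_def] by measurable
    have vb: "(cmod (v z))\<^sup>2 * exp (-2 * psi z) \<le> m\<^sup>2 * ((cmod (u z))\<^sup>2 * exp (-2 * P z))" for z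
    proof -
      have "(cmod (z - a))\<^sup>2 = m\<^sup>2 * s z" using m by (simp add: s_def nq_norm power_divide)
      also have "\<dots> \<le> m\<^sup>2 * (1 + s z)" by (intro mult_left_mono) auto
      finally have "(cmod (z - a))\<^sup>2 * ((cmod (u z))\<^sup>2 * exp (-2 * psi z)) \<le> m\<^sup>2 * (1 + s z) * ((cmod (u z))\<^sup>2 * exp (-2 * psi z))"
        by (intro mult_right_mono) auto
      then show ?thesis unfolding expP by (simp add: v_def norm_mult power_mult_distrib mult_ac)
    qed
    have vi: "integrable lborel (\<lambda>z. (cmod (v z))\<^sup>2 * exp (-2 * psi z))"
      by (rule Bochner_Integration.integrable_bound[OF integrable_mult_right[OF ui, of "m\<^sup>2"]])
         (use vb in \<open>auto intro: order_trans[OF _ abs_ge_self]\<close>)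
    have Lv: "L2 (Mw lborel psi) v" using vi by (simp add: Mw_L2)
    have vn: "nrm (Mw lborel psi) v \<le> M * sqrt (2 * I0) * R"
    proof (rule power2_le_imp_le)
      have "(nrm (Mw lborel psi) v)\<^sup>2 = (LINT z|lborel. (cmod (v z))\<^sup>2 * exp (-2 * psi z))" by (simp add: Mw_nrm)
      also have "\<dots> \<le> (LINT z|lborel. m\<^sup>2 * ((cmod (u z))\<^sup>2 * exp (-2 * P z)))"
        by (rule integral_mono[OF vi integrable_mult_right[OF ui] vb])
      also have "\<dots> \<le> m\<^sup>2 * (2 * I0)" using un by (simp add: mult_left_mono)
      finally show "(nrm (Mw lborel psi) v)\<^sup>2 \<le> (M * sqrt (2 * I0) * R)\<^sup>2"
        using I0 by (simp add: m_def power_mult_distrib mult_ac)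
    qed (use M(1) I0 R in auto)
    define F where "F w = exp (G w) * chi r a w" for w
    note ch = chi[OF r(1)]
    have chc: "continuous_on UNIV (chi r a)"
    proof -
      have "continuous_on UNIV (\<lambda>w. Complex (Re (chi r a w)) (Im (chi r a w)))"
        unfolding Complex_eq by (intro continuous_intros SM_continuous[OF ch(1)] SM_continuous[OF ch(2)])
      then show ?thesis by simp
    qed
    have ch0: "chi r a w = 0" if "w \<notin> cball a r" for w using that ch(4)[of w a] by (simp add: dist_norm norm_minus_commute)
    have Fc: "continuous_on UNIV F"
      unfolding F_def by (rule continuous_glue[of "ball a R" "cball a r", OF _ _ _ cG chc]) (use r ch0 in auto)
    have Fm [measurable]: "F \<in> borel_measurable borel" using Fc by (rule borel_measurable_continuous_onI)
    have Fb: "(cmod (F z))\<^sup>2 * exp (-2 * psi z) \<le> exp (2 * K) * indicator (cball a r) z" for z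
    proof (cases "z \<in> cball a r")
      case True
      then have "z \<in> ball a R" using r by simp
      then have "exp (2 * Re (G z)) * exp (-2 * psi z) \<le> exp (2 * K)"
        using GK[of z] by (simp add: R_def flip: exp_add)
      moreover have "(cmod (F z))\<^sup>2 \<le> exp (2 * Re (G z))"
      proof -
        have "cmod (F z) \<le> exp (Re (G z)) * 1" unfolding F_def norm_mult norm_exp_eq_Re using ch(6) by (intro mult_left_mono) auto
        then have "(cmod (F z))\<^sup>2 \<le> (exp (Re (G z)))\<^sup>2" by (intro power_mono) auto
        then show ?thesis by (simp add: exp_double)
      qed
      ultimately have "(cmod (F z))\<^sup>2 * exp (-2 * psi z) \<le> exp (2 * K)"
        by (meson exp_ge_zero mult_right_mono order_trans)
      then show ?thesis using True by simp
    next
      case False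
      then show ?thesis by (simp add: F_def ch0)
    qed
    have iFb: "integrable lborel (\<lambda>z. exp (2 * K) * indicator (cball a r) z)"
      using indicator_cball_integrable by (rule integrable_mult_right)
    have Fi: "integrable lborel (\<lambda>z. (cmod (F z))\<^sup>2 * exp (-2 * psi z))"
      by (rule Bochner_Integration.integrable_bound[OF iFb]) (use Fb in \<open>auto intro: order_trans[OF _ abs_ge_self]\<close>)
    have LF: "L2 (Mw lborel psi) F" using Fi by (simp add: Mw_L2)
    have Fn: "nrm (Mw lborel psi) F \<le> sqrt (exp (2 * K) * pi) * R"
    proof (rule power2_le_imp_le)
      have "(nrm (Mw lborel psi) F)\<^sup>2 = (LINT z|lborel. (cmod (F z))\<^sup>2 * exp (-2 * psi z))" by (simp add: Mw_nrm)
      also have "\<dots> \<le> (LINT z|lborel. exp (2 * K) * indicator (cball a r) z)" by (rule integral_mono[OF Fi iFb Fb])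
      also have "\<dots> = exp (2 * K) * (pi * r\<^sup>2)" using area_cball[of r a] r by simp
      also have "\<dots> \<le> exp (2 * K) * (pi * R\<^sup>2)" using r by (intro mult_left_mono power_mono) auto
      finally show "(nrm (Mw lborel psi) F)\<^sup>2 \<le> (sqrt (exp (2 * K) * pi) * R)\<^sup>2" by (simp add: power_mult_distrib)
    qed (use R in auto)
    have LFp: "L2 M\<phi> F" using LF L2_psi_phi(1)[OF Fm] by simp
    \<comment> \<open>Both sides have weak d-bar derivative exp(G) times that of \<open>chi\<close>:
      for F by testing the holomorphic exp(G) against \<open>chi\<close> b, for v by testing u
      against (z - a) b, as z - a commutes with d-bar.\<close>
    have tst: "(LINT z|lborel. F z * dzb b z) = (LINT z|lborel. v z * dzb b z)" if b: "b \<in> TF" for b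
    proof -
      note cb = TF_mult[OF ch(1,2) b]
      have z1: "(LINT w|lborel. exp (G w) * dzb (\<lambda>z. chi r a z * b z) w) = 0"
        by (rule holomorphic_test_zero[OF hG, of "cball a r"]) (use r cb ch0 in auto)
      have ca: "continuous_on UNIV (\<lambda>w. chi r a w * dzb b w)" by (intro continuous_intros chc TF_continuous[OF b])
      have cbb: "continuous_on UNIV (\<lambda>w. b w * dzb (chi r a) w)"
        unfolding ch(3) by (intro continuous_intros TF_continuous[OF b] continuous_on_compose2[OF eta_continuous[of UNIV]]) auto
      have e0: "dzb (chi r a) w = 0" if "w \<notin> cball a r" for w using eta0[OF that] by (simp add: ch(3))
      have big: "w \<notin> cball a r" if "norm w > norm a + r" for w using that norm_triangle_ineq2[of w a] by (simp add: dist_norm norm_minus_commute)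
      have i1: "integrable lborel (\<lambda>w. exp (G w) * (chi r a w * dzb b w))"
        by (rule integrable_compact_support[of _ "norm a + r"])
           (rule continuous_glue[of "ball a R" "cball a r", OF _ _ _ cG ca], use r ch0 big in auto)
      have i2: "integrable lborel (\<lambda>w. exp (G w) * (b w * dzb (chi r a) w))"
        by (rule integrable_compact_support[of _ "norm a + r"])
           (rule continuous_glue[of "ball a R" "cball a r", OF _ _ _ cG cbb], use r e0 big in auto)
      have "(LINT w|lborel. exp (G w) * (chi r a w * dzb b w)) + (LINT w|lborel. exp (G w) * (b w * dzb (chi r a) w)) = 0"
        using z1 i1 i2 unfolding cb(2) by (simp add: distrib_left)
      then have "(LINT w|lborel. F w * dzb b w) = - (LINT w|lborel. exp (G w) * (b w * dzb (chi r a) w))"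
        by (simp add: F_def mult.assoc eq_neg_iff_add_eq_0)
      also have "\<dots> = - (LINT w|lborel. 2 * (f0 w * ((w - a) * b w)))"
        unfolding ch(3) f0_def by (simp add: mult_ac)
      also have "\<dots> = -2 * (LINT w|lborel. f0 w * ((w - a) * b w))" by simp
      also have "\<dots> = (LINT z|lborel. u z * dzb (\<lambda>z. (z - a) * b z) z)"
        by (rule u(3)[symmetric, OF TF_mult(1)[OF dzb_shift(1,2) b]])
      also have "\<dots> = (LINT z|lborel. v z * dzb b z)"
        unfolding TF_mult(2)[OF dzb_shift(1,2) b] dzb_shift(3) by (simp add: v_def mult_ac)
      finally show ?thesis .
    qed
    obtain W where W: "W \<in> Fock \<phi>" "AE z in lborel. F z - v z = W z"
      using distance_to_Fock[OF LFp Fm Lv tst] by blast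
    have Wh: "W holomorphic_on UNIV" and WL: "L2 M\<phi> W" using W(1) by (auto simp: Fock_iff)
    have Wm [measurable]: "W \<in> borel_measurable borel" by (rule holomorphic_borel[OF Wh])
    have nW: "nrm M\<phi> W \<le> A * \<rho> a"
    proof -
      have "nrm M\<phi> W \<le> exp gap * nrm (Mw lborel psi) W" by (rule L2_psi_phi(3)[OF Wm WL])
      also have "nrm (Mw lborel psi) W = nrm (Mw lborel psi) (\<lambda>z. F z - v z)"
      proof (rule nrm_AE_cong)
        have "AE z in lborel. W z = F z - v z" using W(2) by eventually_elim simp
        then show "AE z in Mw lborel psi. W z = F z - v z" by (rule AE_Mw) simp
      qed (auto simp: Mw_def)
      also have "\<dots> \<le> nrm (Mw lborel psi) (\<lambda>z. F z - 0) + nrm (Mw lborel psi) (\<lambda>z. 0 - v z)"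
        by (rule nrm_triangle_diff[OF LF L2_zero Lv])
      also have "\<dots> \<le> sqrt (exp (2 * K) * pi) * R + M * sqrt (2 * I0) * R"
        using Fn vn nrm_minus_commute[of "Mw lborel psi" "\<lambda>z. 0" v] by simp
      finally show ?thesis by (simp add: A_def R_def algebra_simps)
    qed
    \<comment> \<open>u is only square integrable, so the vanishing of (z - a) u at a is read off
      from averages at shrinking scale t. Below r/2 the cut-off is 1, and the average of v is at
      most a constant times the root of the mass of |u|^2 exp(-2 psi) on the disc of radius t, which
      tends to 0.\<close>
    have Wa: "W a = exp (G a)"
    proof -
      define sn where "sn n = r / (2 * real (n + 2))" for n
      have sn: "0 < sn n" "sn n < r / 2" "sn n < R" for n
      proof -
        show 1: "0 < sn n" using r by (simp add: sn_def)
        have "r / (2 * real (n + 2)) < r / 2" using r by (intro divide_strict_left_mono) auto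
        then show 2: "sn n < r / 2" by (simp add: sn_def)
        then show "sn n < R" using r by simp
      qed
      have snl: "sn \<longlonglongrightarrow> 0"
      proof -
        have "(\<lambda>n. (r / 2) * inverse (real (Suc (Suc n)))) \<longlonglongrightarrow> (r / 2) * 0"
          by (intro tendsto_mult tendsto_const LIMSEQ_Suc[OF LIMSEQ_inverse_real_of_nat])
        then show ?thesis by (simp add: sn_def[abs_def] field_simps)
      qed
      have up: "integrable lborel (\<lambda>z. (cmod (u z))\<^sup>2 * exp (-2 * psi z))"
      proof (rule Bochner_Integration.integrable_bound[OF ui])
        have "(cmod (u z))\<^sup>2 * exp (-2 * psi z) \<le> (cmod (u z))\<^sup>2 * exp (-2 * P z)" for z
          unfolding expP using s0[of z] by (intro mult_left_mono) (auto simp: distrib_right)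
        then show "AE z in lborel. norm ((cmod (u z))\<^sup>2 * exp (-2 * psi z)) \<le> norm ((cmod (u z))\<^sup>2 * exp (-2 * P z))" by auto
      qed measurable
      define X where "X n = (LINT z|lborel. indicator (ball a (sn n)) z * ((cmod (u z))\<^sup>2 * exp (-2 * psi z)))" for n
      have iX: "integrable lborel (\<lambda>z. indicator (ball a (sn n)) z * ((cmod (u z))\<^sup>2 * exp (-2 * psi z)))" for n
        using integrable_mult_indicator[OF _ up, of "ball a (sn n)"] by simp
      have Xl: "X \<longlonglongrightarrow> 0"
      proof -
        have "X \<longlonglongrightarrow> (LINT z|(lborel::complex measure). 0)"
          unfolding X_def[abs_def]
        proof (rule integral_dominated_convergence[OF _ _ up])
          show "AE z in lborel. (\<lambda>n. indicator (ball a (sn n)) z * ((cmod (u z))\<^sup>2 * exp (-2 * psi z))) \<longlonglongrightarrow> 0"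
            using AE_lborel_singleton[of a]
          proof eventually_elim
            case (elim z)
            then have "dist a z > 0" by simp
            then have "\<forall>\<^sub>F n in sequentially. sn n < dist a z" using order_tendstoD(2)[OF snl] by blast
            then have "\<forall>\<^sub>F n in sequentially. indicator (ball a (sn n)) z * ((cmod (u z))\<^sup>2 * exp (-2 * psi z)) = 0"
              by eventually_elim simp
            then show ?case by (rule tendsto_eventually)
          qed
          show "AE z in lborel. norm (indicator (ball a (sn n)) z * ((cmod (u z))\<^sup>2 * exp (-2 * psi z))) \<le> (cmod (u z))\<^sup>2 * exp (-2 * psi z)" for n
            by (rule AE_I2) (auto simp: indicator_def)
        qed (use iX in auto)
        then show ?thesis by simp
      qed
      have "compact (psi ` cball a r)" by (intro compact_continuous_image psi_continuous) auto
      then obtain B where B: "\<forall>x\<in>psi ` cball a r. norm x \<le> B" using compact_imp_bounded bounded_iff by metis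
      define D where "D = sqrt (etasup * exp (2 * B) * mass)"
      have bnd: "cmod (complex_of_real mass * (W a - exp (G a))) \<le> sqrt (X n) * D" for n
      proof -
        define t where "t = sn n"
        have t: "0 < t" "t < r / 2" "t < R" using sn by (auto simp: t_def)
        define h1 where "h1 z = complex_of_real (indicator (ball a t) z * exp (- psi z)) * u z" for z
        \<comment> \<open>In |h2|^2 the factor |z - a|^2 \<le> t^2 cancels the 1/t^2 in the supremum
          of \<open>eta t\<close>, so the norm stays bounded as t shrinks.\<close>
        define h2 where "h2 z = cnj (z - a) * complex_of_real (eta t (z - a) * exp (psi z))" for z
        have h1s: "(cmod (h1 z))\<^sup>2 = indicator (ball a t) z * ((cmod (u z))\<^sup>2 * exp (-2 * psi z))" for z
          using exp_double[of "- psi z"] by (auto simp: h1_def norm_mult power_mult_distrib indicator_def)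
        have h1m: "h1 \<in> borel_measurable lborel"
        proof -
          have [measurable]: "ball a t \<in> sets borel" by simp
          have "h1 \<in> borel_measurable borel" unfolding h1_def[abs_def] by measurable
          then show ?thesis by simp
        qed
        have L1: "L2 lborel h1" using iX[of n] h1m unfolding L2_def h1s t_def by simp
        have n1: "nrm lborel h1 = sqrt (X n)" unfolding nrm_def h1s X_def t_def ..
        have h2c: "continuous_on UNIV h2"
          unfolding h2_def by (intro continuous_intros psi_continuous continuous_on_compose2[OF eta_continuous[of UNIV]]) auto
        have h2b: "(cmod (h2 z))\<^sup>2 \<le> etasup * exp (2 * B) * eta t (z - a)" for z
        proof (cases "dist a z < t")
          case False
          then have "eta t (z - a) = 0" by (intro eta_outside t) (simp add: dist_norm norm_minus_commute)
          then show ?thesis by (simp add: h2_def)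
        next
          case True
          have "(cmod (z - a))\<^sup>2 \<le> t\<^sup>2" using True by (intro power_mono) (auto simp: dist_norm norm_minus_commute)
          moreover have "(eta t (z - a))\<^sup>2 \<le> etasup / t\<^sup>2 * eta t (z - a)"
            using mult_right_mono[OF eta_le[OF t(1), of "z - a"] eta_nonneg[of t "z - a"]] by (simp add: power2_eq_square)
          moreover have "(exp (psi z))\<^sup>2 \<le> exp (2 * B)"
          proof -
            have "psi z \<le> B" using B True t r by (force simp: abs_le_iff)
            then show ?thesis by (simp flip: exp_double)
          qed
          ultimately have "(cmod (z - a))\<^sup>2 * ((eta t (z - a))\<^sup>2 * (exp (psi z))\<^sup>2) \<le> t\<^sup>2 * ((etasup / t\<^sup>2 * eta t (z - a)) * exp (2 * B))"
            using etasup(1) eta_nonneg[of t "z - a"] by (intro mult_mono) auto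
          also have "\<dots> = etasup * exp (2 * B) * eta t (z - a)" using t by simp
          finally show ?thesis by (simp add: h2_def norm_mult power_mult_distrib del: complex_cnj_diff)
        qed
        have h20: "h2 z = 0" if "norm z > norm a + t" for z
        proof -
          have "norm (z - a) \<ge> t" using that norm_triangle_ineq2[of z a] by simp
          then show ?thesis by (simp add: h2_def eta_outside t)
        qed
        have h2i: "integrable lborel (\<lambda>z. (cmod (h2 z))\<^sup>2)"
          by (rule integrable_compact_support[of _ "norm a + t"]) (auto intro!: continuous_intros h2c simp: h20)
        have L2': "L2 lborel h2" unfolding L2_def using h2i borel_measurable_continuous_onI[OF h2c] by simp
        have n2: "nrm lborel h2 \<le> D"
        proof -
          have "(LINT z|lborel. (cmod (h2 z))\<^sup>2) \<le> (LINT z|lborel. etasup * exp (2 * B) * eta t (z - a))"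
            by (rule integral_mono[OF h2i _ h2b]) (use eta_shift_integral(1)[OF t(1)] in simp)
          also have "\<dots> = etasup * exp (2 * B) * mass" using eta_shift_integral(2)[OF t(1), of a] by simp
          finally show ?thesis unfolding nrm_def D_def by (rule real_sqrt_le_mono)
        qed
        have prod: "h1 z * cnj (h2 z) = v z * complex_of_real (eta t (z - a))" for z
        proof (cases "dist a z < t")
          case False
          then have "eta t (z - a) = 0" by (intro eta_outside t) (simp add: dist_norm norm_minus_commute)
          then show ?thesis by (simp add: h2_def)
        next
          case True
          have "exp (- psi z) * exp (psi z) = 1" by (simp flip: exp_add)
          then have "complex_of_real (exp (- psi z)) * complex_of_real (exp (psi z)) = 1" unfolding of_real_mult[symmetric] by simp
          then show ?thesis using True by (simp add: h1_def h2_def v_def mult_ac)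
        qed
        have iv: "integrable lborel (\<lambda>z. v z * complex_of_real (eta t (z - a)))"
          using ip_integrable[OF L1 L2'] unfolding prod .
        have mG: "(LINT z|lborel. exp (G z) * complex_of_real (eta t (z - a))) = complex_of_real mass * exp (G a)"
          by (rule mean_value_eta[OF hG t(1,3)])
        have iG: "integrable lborel (\<lambda>z. exp (G z) * complex_of_real (eta t (z - a)))"
          by (rule eta_glue_integrable[OF cG t(1,3)])
        have mW: "(LINT z|lborel. W z * complex_of_real (eta t (z - a))) = complex_of_real mass * W a"
          by (rule mean_value_eta[OF holomorphic_on_subset[OF Wh] t(1,3)]) simp
        have "(LINT z|lborel. W z * complex_of_real (eta t (z - a))) = (LINT z|lborel. exp (G z) * complex_of_real (eta t (z - a)) - v z * complex_of_real (eta t (z - a)))"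
        proof (rule integral_cong_AE)
          have "(\<lambda>w. eta t (w - a)) \<in> borel_measurable borel"
            by (rule borel_measurable_continuous_onI) (intro continuous_on_compose2[OF eta_continuous[of UNIV]] continuous_intros, auto)
          then show "(\<lambda>z. W z * complex_of_real (eta t (z - a))) \<in> borel_measurable lborel" by simp
          show "(\<lambda>z. exp (G z) * complex_of_real (eta t (z - a)) - v z * complex_of_real (eta t (z - a))) \<in> borel_measurable lborel"
            using iG iv by auto
          show "AE z in lborel. W z * complex_of_real (eta t (z - a)) = exp (G z) * complex_of_real (eta t (z - a)) - v z * complex_of_real (eta t (z - a))"
            using W(2)
          proof eventually_elim
            case (elim z)
            show ?case
            proof (cases "dist a z < t")
              case True
              then have "chi r a z = 1" using t by (intro ch(5)) (simp add: dist_norm norm_minus_commute)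
              then have "W z = exp (G z) - v z" using elim by (simp add: F_def)
              then show ?thesis by (simp add: left_diff_distrib)
            next
              case False
              then have "eta t (z - a) = 0" by (intro eta_outside t) (simp add: dist_norm norm_minus_commute)
              then show ?thesis by simp
            qed
          qed
        qed
        then have "complex_of_real mass * (W a - exp (G a)) = - (LINT z|lborel. v z * complex_of_real (eta t (z - a)))"
          using mG mW iG iv by (simp add: right_diff_distrib)
        also have "\<dots> = - ip lborel h1 h2" unfolding ip_def prod ..
        finally have "cmod (complex_of_real mass * (W a - exp (G a))) \<le> nrm lborel h1 * nrm lborel h2"
          using Cauchy_Schwarz[OF L1 L2'] by simp
        also have "\<dots> \<le> sqrt (X n) * D" unfolding n1[symmetric] by (intro mult_left_mono n2 nrm_nonneg)
        finally show ?thesis .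
      qed
      have "(\<lambda>n. sqrt (X n) * D) \<longlonglongrightarrow> sqrt 0 * D" by (intro tendsto_intros Xl)
      then have "cmod (complex_of_real mass * (W a - exp (G a))) \<le> sqrt 0 * D"
        using bnd by (intro LIMSEQ_le_const) auto
      then show ?thesis using mass_pos by simp
    qed
    show ?thesis using W(1) Wa nW by blast
  qed
  then show ?thesis using A by blast
qed

end

section \<open>Decay of the symbol from compactness\<close>

lemma D1_scale:
  "D1 f fx fy \<Longrightarrow> D1 (\<lambda>z. f (complex_of_real k * z)) (\<lambda>z. k * fx (complex_of_real k * z)) (\<lambda>z. k * fy (complex_of_real k * z))"
  unfolding D1_def
proof
  fix z :: complex assume "\<forall>z. (f has_derivative (\<lambda>h. Re h * fx z + Im h * fy z)) (at z)"
  then have 1: "(f has_derivative (\<lambda>h. Re h * fx (k * z) + Im h * fy (k * z))) (at (complex_of_real k * z))" by blast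
  have 2: "((\<lambda>z. complex_of_real k * z) has_derivative (\<lambda>h. complex_of_real k * h)) (at z)"
    by (auto intro!: derivative_eq_intros)
  have "((\<lambda>z. f (complex_of_real k * z)) has_derivative (\<lambda>h. Re (complex_of_real k * h) * fx (k * z) + Im (complex_of_real k * h) * fy (k * z))) (at z)"
    by (rule has_derivative_compose[OF 2 1])
  then show "((\<lambda>z. f (complex_of_real k * z)) has_derivative (\<lambda>h. Re h * (k * fx (k * z)) + Im h * (k * fy (k * z)))) (at z)"
    by (simp add: mult_ac)
qed

text \<open>By scaling, \<open>eta s\<close> is s^(-2) times \<open>eta 1\<close> at argument w/s,
  and differentiation adds one more factor 1/s. A bound at scale 1 gives all scales.\<close>

lemma dzb_eta:
  "\<exists>D>0. \<forall>s>0. \<forall>a z. cmod (dzb (\<lambda>w. complex_of_real (eta s (w - a))) z) \<le> D / s ^ 3 * indicator (cball a s) z"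
proof -
  define b where "b = (\<lambda>w. complex_of_real (eta 1 w))"
  have b: "b \<in> TF" using TF_eta(1)[of 1 0] by (simp add: b_def)
  have d: "D1 (eta 1) (dx (eta 1)) (dy (eta 1))" by (rule SM_D1(1)[OF eta_SM])
  have bz: "dzb b z = Complex (dx (eta 1) z) (dy (eta 1) z)" for z
    unfolding dzb_def b_def Re_complex_of_real Im_complex_of_real dx_eq[OF D1_const] dy_eq[OF D1_const] by simp
  have sup: "dzb b z = 0" if "norm z > 1" for z
    using D1_support[OF d, of 1 z] eta_outside[of 1] that by (simp add: bz complex_eq_iff)
  have "compact (dzb b ` cball 0 1)"
    by (intro compact_continuous_image continuous_on_subset[OF TF_continuous(3)[OF b]]) auto
  then obtain B where B: "\<forall>x\<in>dzb b ` cball 0 1. norm x \<le> B" using compact_imp_bounded bounded_iff by metis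
  have "cmod (dzb (\<lambda>w. complex_of_real (eta s (w - a))) z) \<le> (\<bar>B\<bar> + 1) / s ^ 3 * indicator (cball a s) z" if s: "s > 0" for s a z
  proof -
    define c where "c = inverse (s\<^sup>2)"
    define k where "k = inverse s"
    have nk: "cmod (complex_of_real k * u) = cmod u / s" for u
      unfolding norm_mult norm_of_real k_def using s by (simp add: field_simps)
    have "eta s w = c * eta 1 (complex_of_real k * w)" for w
      unfolding eta_def nq_norm nk c_def by (simp add: field_simps)
    then have e: "(\<lambda>w. eta s (w - a)) = (\<lambda>w. c * eta 1 (complex_of_real k * (w - a)))" by auto
    note D = D1_shift[OF D1_cmult[OF D1_scale[OF d, of k], of c], of a]
    have scaled: "dzb (\<lambda>w. complex_of_real (eta s (w - a))) z = complex_of_real (c * k) * dzb b (complex_of_real k * (z - a))"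
      unfolding bz unfolding dzb_def Re_complex_of_real Im_complex_of_real e dx_eq[OF D] dy_eq[OF D] dx_eq[OF D1_const] dy_eq[OF D1_const]
      by (simp add: complex_eq_iff)
    have n: "cmod (dzb (\<lambda>w. complex_of_real (eta s (w - a))) z) = cmod (dzb b (complex_of_real k * (z - a))) / s ^ 3"
    proof -
      have "\<bar>c * k\<bar> = 1 / s ^ 3" using s by (simp add: c_def k_def field_simps power2_eq_square power3_eq_cube)
      then show ?thesis unfolding scaled norm_mult norm_of_real by simp
    qed
    show ?thesis
    proof (cases "z \<in> cball a s")
      case True
      then have "cmod (complex_of_real k * (z - a)) \<le> 1"
        unfolding nk using s by (simp add: dist_norm norm_minus_commute)
      then have "cmod (dzb b (complex_of_real k * (z - a))) \<le> \<bar>B\<bar> + 1" using B by force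
      then show ?thesis unfolding n using True s by (simp add: divide_right_mono)
    next
      case False
      then have "cmod (complex_of_real k * (z - a)) > 1"
        unfolding nk using s by (simp add: dist_norm norm_minus_commute)
      then show ?thesis unfolding n using False sup by simp
    qed
  qed
  moreover have "\<bar>B\<bar> + 1 > 0" by simp
  ultimately show ?thesis by blast
qed

lemma L2_mono:
  assumes h: "L2 M h" and f: "f \<in> borel_measurable M" and le: "\<And>x. cmod (f x) \<le> cmod (h x)"
  shows "L2 M f" "nrm M f \<le> nrm M h"
proof -
  have le2: "(cmod (f x))\<^sup>2 \<le> (cmod (h x))\<^sup>2" for x using le by (intro power_mono) auto
  have i: "integrable M (\<lambda>x. (cmod (f x))\<^sup>2)"
    by (rule Bochner_Integration.integrable_bound[OF L2_sq[OF h]]) (use f le2 in auto)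
  then show "L2 M f" using f by (simp add: L2_def)
  show "nrm M f \<le> nrm M h"
    unfolding nrm_def by (intro real_sqrt_le_mono integral_mono i L2_sq[OF h] le2)
qed

lemma L2_tail:
  fixes M :: "complex measure"
  assumes t: "L2 M t" and M: "\<And>r. - cball 0 r \<inter> space M \<in> sets M"
  shows "(\<lambda>n. nrm M (\<lambda>z. indicator (- cball 0 (real n)) z * t z)) \<longlonglongrightarrow> 0"
proof -
  have tm [measurable]: "t \<in> borel_measurable M" by (rule L2_measurable[OF t])
  have e: "(cmod (indicator (- cball 0 (real n)) z * t z))\<^sup>2 = indicator (- cball 0 (real n)) z * (cmod (t z))\<^sup>2" for n and z :: complex
    by (simp add: indicator_def)
  have "(\<lambda>n. LINT z|M. indicator (- cball 0 (real n)) z * (cmod (t z))\<^sup>2) \<longlonglongrightarrow> (LINT z|M. (0::real))"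
  proof (rule integral_dominated_convergence[OF _ _ L2_sq[OF t]])
    show "AE z in M. (\<lambda>n. indicator (- cball 0 (real n)) z * (cmod (t z))\<^sup>2) \<longlonglongrightarrow> 0"
    proof (rule AE_I2)
      fix z :: complex
      have "\<forall>\<^sub>F n in sequentially. norm z \<le> real n"
        using real_arch_simple[of "norm z"] by (metis eventually_sequentiallyI of_nat_le_iff order_trans)
      then have "\<forall>\<^sub>F n in sequentially. indicator (- cball 0 (real n)) z * (cmod (t z))\<^sup>2 = 0"
        by eventually_elim simp
      then show "(\<lambda>n. indicator (- cball 0 (real n)) z * (cmod (t z))\<^sup>2) \<longlonglongrightarrow> 0" by (rule tendsto_eventually)
    qed
    show "(\<lambda>z. indicator (- cball 0 (real n)) z * (cmod (t z))\<^sup>2) \<in> borel_measurable M" for n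
    proof -
      have "indicat_real (- cball 0 (real n)) \<in> borel_measurable M" using M[of "real n"] by (simp add: borel_measurable_indicator_iff)
      then show ?thesis by measurable
    qed
    show "AE z in M. norm (indicator (- cball 0 (real n)) z * (cmod (t z))\<^sup>2) \<le> (cmod (t z))\<^sup>2" for n
      by (rule AE_I2) (auto simp: indicator_def)
  qed simp
  then have "(\<lambda>n. sqrt (LINT z|M. indicator (- cball 0 (real n)) z * (cmod (t z))\<^sup>2)) \<longlonglongrightarrow> sqrt 0"
    by (intro tendsto_real_sqrt) simp
  then show ?thesis unfolding nrm_def e by simp
qed

context laplace_weight
begin

text \<open>The reproducing property with Cauchy-Schwarz bounds |W(a)| by the norm of W times the
  norm n of the kernel. Since W(a) is nonzero, n is positive, \<open>csqrt\<close> of n^2 is n, and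
  the normalised kernel takes the value n at a.\<close>

lemma knorm_unit:
  assumes W: "W \<in> Fock \<phi>" "W a \<noteq> 0"
  shows "nrm M\<phi> (knorm \<phi> a) = 1" "cmod (W a) \<le> cmod (knorm \<phi> a a) * nrm M\<phi> W"
proof -
  define k where "k = Kern \<phi> a"
  define n where "n = nrm M\<phi> k"
  have k: "k \<in> Fock \<phi>" "k a = complex_of_real (n\<^sup>2)"
    using Kern(1)[of a] Kern(2)[OF Kern(1)[of a], of a] by (auto simp: k_def n_def ip_self)
  have Wn: "cmod (W a) \<le> nrm M\<phi> W * n"
    using Kern(2)[OF W(1), of a] Cauchy_Schwarz[OF Fock_L2[OF W(1)] Fock_L2[OF k(1)]] by (simp add: k_def n_def)
  have n: "n > 0"
  proof (rule ccontr)
    assume "\<not> n > 0"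
    then have "n = 0" using nrm_nonneg[of M\<phi> k] by (simp add: n_def)
    then show False using Wn W(2) by simp
  qed
  have "csqrt (complex_of_real (n\<^sup>2)) = complex_of_real n"
    using n by (simp add: csqrt_of_real_nonneg)
  then have e: "knorm \<phi> a = (\<lambda>z. complex_of_real (1 / n) * k z)" using k by (simp add: knorm_def k_def[symmetric])
  show "nrm M\<phi> (knorm \<phi> a) = 1" unfolding e nrm_cmult using n by (simp add: n_def[symmetric] norm_divide)
  have "cmod (knorm \<phi> a a) = n" unfolding e using n k by (simp add: norm_mult power2_eq_square)
  then show "cmod (W a) \<le> cmod (knorm \<phi> a a) * nrm M\<phi> W" using Wn by (simp add: mult.commute)
qed

lemma knorm_kspan: "knorm \<phi> a \<in> kspan \<phi>"
  unfolding kspan_def by (rule CollectI, rule exI[of _ "{a}"], rule exI[of _ "\<lambda>_. 1"]) simp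

text \<open>F = k exp(-G) is holomorphic with |F| comparable to |k| exp(-psi). The peak function
  bounds |F(a)| below by 1 / (A \<rho>), while the unit norm bounds |F| above by B / \<rho> on the
  half disc. Cauchy's inequality then limits the variation of F, so the lower bound persists,
  halved, on a fixed fraction of the disc.\<close>

lemma kernel_lower_bound:
  "\<exists>d A. 0 < d \<and> d \<le> 1/8 \<and> A > 0 \<and> (\<forall>a. nrm M\<phi> (knorm \<phi> a) = 1 \<and>
     (\<forall>z\<in>cball a (d * \<rho> a). knorm \<phi> a z \<noteq> 0 \<and> 1 / cmod (knorm \<phi> a z) \<le> A * \<rho> a * exp (- psi z)))"
proof -
  obtain K where K: "K \<ge> 0" "\<And>a. \<exists>G. G holomorphic_on ball a (\<rho> a) \<and> (\<forall>z\<in>ball a (\<rho> a). \<bar>psi z - Re (G z)\<bar> \<le> K)"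
    using psi_local by blast
  obtain A where A: "A > 0" "\<And>a G. G holomorphic_on ball a (\<rho> a) \<Longrightarrow> (\<forall>z\<in>ball a (\<rho> a). \<bar>psi z - Re (G z)\<bar> \<le> K) \<Longrightarrow>
     \<exists>W\<in>Fock \<phi>. W a = exp (G a) \<and> nrm M\<phi> W \<le> A * \<rho> a"
    using peak_function[OF K(1)] by blast
  define B where "B = sqrt (16 * etasup * exp (2 * K) / mass)"
  have B: "B > 0" using etasup(1) mass_pos by (simp add: B_def)
  \<comment> \<open>Small enough that 8 B d \<le> 1 / (2A), half of the value at the centre in units
    of the scale; the summand 8 gives d \<le> 1/8.\<close>
  define d where "d = 1 / (16 * A * B + 8)"
  have AB: "A * B > 0" using A B by simp
  then have d: "0 < d" "d \<le> 1/8" by (auto simp: d_def field_simps)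
  have dB: "8 * B * d \<le> 1 / (2 * A)"
  proof -
    have "8 * B * d \<le> 8 * B * (1 / (16 * A * B))"
      unfolding d_def using AB B by (intro mult_left_mono divide_left_mono) auto
    also have "\<dots> = 1 / (2 * A)" using A(1) B by (simp add: field_simps)
    finally show ?thesis .
  qed
  have "nrm M\<phi> (knorm \<phi> a) = 1 \<and>
     (\<forall>z\<in>cball a (d * \<rho> a). knorm \<phi> a z \<noteq> 0 \<and> 1 / cmod (knorm \<phi> a z) \<le> (2 * A * exp K) * \<rho> a * exp (- psi z))" for a
  proof -
    obtain G where G: "G holomorphic_on ball a (\<rho> a)" "\<forall>z\<in>ball a (\<rho> a). \<bar>psi z - Re (G z)\<bar> \<le> K" using K(2) by blast
    obtain W where W: "W \<in> Fock \<phi>" "W a = exp (G a)" "nrm M\<phi> W \<le> A * \<rho> a" using A(2)[OF G] by blast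
    define R where "R = \<rho> a"
    have R: "R > 0" using rho_pos by (simp add: R_def)
    note GR = G[folded R_def]
    have W0: "W a \<noteq> 0" using W by simp
    define k where "k = knorm \<phi> a"
    have kh: "k holomorphic_on UNIV" and kL: "L2 M\<phi> k" using knorm_Fock[of a] by (auto simp: k_def Fock_iff)
    have km: "k \<in> borel_measurable borel" by (rule holomorphic_borel[OF kh])
    have k1: "nrm M\<phi> k = 1" using knorm_unit(1)[OF W(1) W0] by (simp add: k_def)
    have kp: "L2 (Mw lborel psi) k" "nrm (Mw lborel psi) k \<le> 1"
      using L2_psi_phi(1)[OF km] L2_psi_phi(2)[OF km kL] kL k1 by auto
    have ki: "integrable lborel (\<lambda>z. (cmod (k z))\<^sup>2 * exp (-2 * psi z))" using kp(1) by (simp add: Mw_L2)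
    have kn: "(LINT z|lborel. (cmod (k z))\<^sup>2 * exp (-2 * psi z)) \<le> 1"
    proof -
      have "(nrm (Mw lborel psi) k)\<^sup>2 \<le> 1\<^sup>2" by (intro power_mono kp nrm_nonneg)
      then show ?thesis using km by (simp add: Mw_nrm)
    qed
    define F where "F z = k z * exp (- G z)" for z
    have Fh: "F holomorphic_on ball a R"
      unfolding F_def by (intro holomorphic_intros holomorphic_on_subset[OF kh] GR) auto
    have Fa: "cmod (F a) \<ge> 1 / (A * R)"
    proof -
      have "exp (Re (G a)) \<le> cmod (k a) * (A * R)"
      proof -
        have "exp (Re (G a)) = cmod (W a)" by (simp add: W)
        also have "\<dots> \<le> cmod (k a) * nrm M\<phi> W" using knorm_unit(2)[OF W(1) W0] by (simp add: k_def)
        also have "\<dots> \<le> cmod (k a) * (A * R)" using W(3) by (intro mult_left_mono) (auto simp: R_def)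
        finally show ?thesis .
      qed
      then have "1 \<le> cmod (k a) * exp (- Re (G a)) * (A * R)" by (simp add: exp_minus field_simps)
      also have "cmod (k a) * exp (- Re (G a)) = cmod (F a)" by (simp add: F_def norm_mult)
      finally show ?thesis using A(1) R by (simp add: pos_divide_le_eq)
    qed
    \<comment> \<open>Mean square over a disc of radius R/4, where exp(-2 Re G) is at most exp(2K)
      exp(-2 psi) and k has norm at most 1.\<close>
    have Fb: "cmod (F z) \<le> B / R" if z: "dist a z < R / 2" for z
    proof -
      have r: "0 < R / 4" "R / 4 < R / 2" using R by auto
      have sub: "ball z (R / 2) \<subseteq> ball a R"
      proof
        fix w assume "w \<in> ball z (R / 2)"
        then show "w \<in> ball a R" using z dist_triangle[of a w z] by simp
      qed
      note m = mean_square_eta[OF holomorphic_on_subset[OF Fh sub] r]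
      define c where "c = exp (2 * K) * (16 * etasup / R\<^sup>2)"
      have pw: "(cmod (F w))\<^sup>2 * eta (R / 4) (w - z) \<le> c * ((cmod (k w))\<^sup>2 * exp (-2 * psi w))" for w
      proof (cases "dist z w < R / 4")
        case False
        then have "eta (R / 4) (w - z) = 0" using r by (intro eta_outside) (auto simp: dist_norm norm_minus_commute)
        then show ?thesis using etasup(1) by (simp add: c_def)
      next
        case True
        then have w: "w \<in> ball a R" using subsetD[OF sub, of w] R by simp
        have "(cmod (F w))\<^sup>2 = (cmod (k w))\<^sup>2 * exp (-2 * Re (G w))"
          using exp_double[of "- Re (G w)"] by (simp add: F_def norm_mult power_mult_distrib)
        also have "exp (-2 * Re (G w)) \<le> exp (2 * K) * exp (-2 * psi w)"
          using GR(2) w unfolding exp_add[symmetric] by (force simp: abs_le_iff)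
        finally have "(cmod (F w))\<^sup>2 \<le> (cmod (k w))\<^sup>2 * (exp (2 * K) * exp (-2 * psi w))" by (simp add: mult_left_mono)
        moreover have "eta (R / 4) (w - z) \<le> 16 * etasup / R\<^sup>2" using eta_le[OF r(1), of "w - z"] by (simp add: power_divide mult_ac)
        ultimately have "(cmod (F w))\<^sup>2 * eta (R / 4) (w - z) \<le> ((cmod (k w))\<^sup>2 * (exp (2 * K) * exp (-2 * psi w))) * (16 * etasup / R\<^sup>2)"
          by (rule mult_mono) (auto simp: eta_nonneg)
        also have "\<dots> = c * ((cmod (k w))\<^sup>2 * exp (-2 * psi w))" unfolding c_def by (simp only: mult_ac)
        finally show ?thesis .
      qed
      have "mass * (cmod (F z))\<^sup>2 \<le> (LINT w|lborel. (cmod (F w))\<^sup>2 * eta (R / 4) (w - z))" by (rule m(1))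
      also have "\<dots> \<le> (LINT w|lborel. c * ((cmod (k w))\<^sup>2 * exp (-2 * psi w)))"
        by (rule integral_mono[OF m(2) integrable_mult_right[OF ki] pw])
      also have "\<dots> = c * (LINT w|lborel. (cmod (k w))\<^sup>2 * exp (-2 * psi w))" by (rule Bochner_Integration.integral_mult_right_zero)
      also have "\<dots> \<le> c * 1" using kn etasup(1) by (intro mult_left_mono) (auto simp: c_def)
      also have "\<dots> = mass * (B / R)\<^sup>2" using mass_pos etasup(1) by (simp add: c_def B_def power_divide)
      finally have "(cmod (F z))\<^sup>2 \<le> (B / R)\<^sup>2" using mass_pos by simp
      then show ?thesis using B R by (auto intro: power2_le_imp_le)
    qed
    have dF: "cmod (deriv F z) \<le> 8 * B / R\<^sup>2" if z: "z \<in> ball a (R / 4)" for z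
    proof -
      have sub: "cball z (R / 8) \<subseteq> ball a (R / 2)"
      proof
        fix w assume "w \<in> cball z (R / 8)"
        then show "w \<in> ball a (R / 2)" using z dist_triangle[of a w z] R by simp
      qed
      have "cmod ((deriv ^^ 1) F z) \<le> fact 1 * (B / R) / (R / 8) ^ 1"
      proof (rule Cauchy_inequality)
        have "ball a (R / 2) \<subseteq> ball a R" using R by auto
        then have "F holomorphic_on cball z (R / 8)" by (rule holomorphic_on_subset[OF Fh order_trans[OF sub]])
        then show "F holomorphic_on ball z (R / 8)" "continuous_on (cball z (R / 8)) F"
          using holomorphic_on_subset[of F "cball z (R/8)" "ball z (R/8)"] holomorphic_on_imp_continuous_on by auto
        show "0 < R / 8" using R by simp
        fix w assume "cmod (z - w) = R / 8"
        then show "cmod (F w) \<le> B / R" using sub by (intro Fb) (auto simp: subset_eq dist_norm)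
      qed
      then show ?thesis using R by (simp add: power2_eq_square mult.commute)
    qed
    have main: "k z \<noteq> 0 \<and> 1 / cmod (k z) \<le> (2 * A * exp K) * R * exp (- psi z)" if z: "z \<in> cball a (d * R)" for z
    proof -
      have dR: "d * R < R / 4" using d R by (simp add: field_simps)
      have "dist a z < R / 4" using z dR unfolding mem_cball by (rule le_less_trans)
      then have zb: "z \<in> ball a (R / 4)" "z \<in> ball a R" using R by auto
      have gz: "\<bar>psi z - Re (G z)\<bar> \<le> K" using GR(2) zb by blast
      have "cmod (F z - F a) \<le> (8 * B / R\<^sup>2) * cmod (z - a)"
      proof (rule field_differentiable_bound[of "ball a (R / 4)" F "deriv F"])
        fix w assume w: "w \<in> ball a (R / 4)"
        have "F field_differentiable at w"
          by (rule holomorphic_on_imp_differentiable_at[OF Fh open_ball]) (use w R in auto)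
        then show "(F has_field_derivative deriv F w) (at w within ball a (R / 4))"
          using DERIV_deriv_iff_field_differentiable has_field_derivative_at_within by blast
        show "cmod (deriv F w) \<le> 8 * B / R\<^sup>2" using dF[OF w] .
      qed (use zb R in auto)
      also have "\<dots> \<le> (8 * B / R\<^sup>2) * (d * R)" using z B by (intro mult_left_mono) (auto simp: dist_norm norm_minus_commute)
      also have "\<dots> = (8 * B * d) / R" using R by (simp add: power2_eq_square)
      also have "\<dots> \<le> 1 / (2 * A) / R" using dB R by (intro divide_right_mono) auto
      finally have "cmod (F z - F a) \<le> 1 / (2 * A * R)" by simp
      moreover have "cmod (F a) \<le> cmod (F z) + cmod (F z - F a)" using norm_triangle_ineq2[of "F a" "F z"] by (simp add: norm_minus_commute)
      moreover have "1 / (A * R) = 2 * (1 / (2 * A * R))" by simp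
      ultimately have Fz: "cmod (F z) \<ge> 1 / (2 * A * R)" using Fa by linarith
      have AR: "2 * A * R > 0" using A(1) R by simp
      have "1 / (2 * A * R) > 0" using AR by (rule divide_pos_pos[OF zero_less_one])
      then have Fp: "cmod (F z) > 0" using Fz by linarith
      then have k0: "k z \<noteq> 0" by (auto simp: F_def)
      have "1 / cmod (k z) = exp (- Re (G z)) / cmod (F z)" using k0 by (simp add: F_def norm_mult)
      also have "\<dots> \<le> exp (- Re (G z)) * (2 * A * R)" using Fz Fp AR by (simp add: field_simps)
      also have "\<dots> \<le> (exp K * exp (- psi z)) * (2 * A * R)"
        using gz AR unfolding exp_add[symmetric] by (intro mult_right_mono) auto
      also have "\<dots> = (2 * A * exp K) * R * exp (- psi z)" by (simp only: mult_ac)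
      finally show ?thesis using k0 by blast
    qed
    show ?thesis using k1 main unfolding k_def R_def by blast
  qed
  moreover have "2 * A * exp K > 0" using A(1) by simp
  ultimately show ?thesis using d by blast
qed

end

context hankel_symbol
begin

text \<open>The constant is scale free: the derivative of the bump costs s^(-3), division by k costs
  \<rho>, the L2 norm over the disc gives a factor s, and s is a fixed fraction of \<rho>. Together
  this is of order 1 / \<rho>, which the factor \<rho> on the left compensates.\<close>

lemma Hankel_local_lower_bound:
  "\<exists>C\<ge>0. \<forall>a. \<exists>s. 0 < s \<and> s \<le> \<rho> a / 4 \<and>
     cmod (deriv g a) * \<rho> a \<le> C * nrm M\<phi> (\<lambda>z. indicator (cball a s) z * H (knorm \<phi> a) z)"
proof -
  obtain d A where dA: "0 < d" "d \<le> 1/8" "A > 0"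
    and low: "\<And>a z. z \<in> cball a (d * \<rho> a) \<Longrightarrow> knorm \<phi> a z \<noteq> 0 \<and> 1 / cmod (knorm \<phi> a z) \<le> A * \<rho> a * exp (- psi z)"
    using kernel_lower_bound by blast
  obtain D where D: "D > 0" "\<And>s a z. s > 0 \<Longrightarrow> cmod (dzb (\<lambda>w. complex_of_real (eta s (w - a))) z) \<le> D / s ^ 3 * indicator (cball a s) z"
    using dzb_eta by blast
  define C where "C = 2 * D * A * sqrt pi / (d\<^sup>2 * mass)"
  have C: "C \<ge> 0" using D dA mass_pos by (simp add: C_def)
  have "\<exists>s. 0 < s \<and> s \<le> \<rho> a / 4 \<and> cmod (deriv g a) * \<rho> a \<le> C * nrm M\<phi> (\<lambda>z. indicator (cball a s) z * H (knorm \<phi> a) z)" for a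
  proof -
    define R where "R = \<rho> a"
    have R: "R > 0" using rho_pos by (simp add: R_def)
    \<comment> \<open>Half of the radius on which k is known not to vanish, so that the bump is
      supported in the interior of the domain of p / k.\<close>
    define s where "s = d * R / 2"
    have s: "0 < s" "s < d * R" "s \<le> R / 4" using dA R by (auto simp: s_def field_simps)
    define k where "k = knorm \<phi> a"
    define p where "p = Proj \<phi> (\<lambda>w. cnj (g w) * k w)"
    have kk: "k \<in> kspan \<phi>" using knorm_kspan by (simp add: k_def)
    have kh: "k holomorphic_on UNIV" using kspan_Fock[OF kk] by (simp add: Fock_iff)
    have ph: "p holomorphic_on UNIV" using Proj(1)[OF gf_L2[OF kk]] by (simp add: p_def Fock_iff)
    have Hk: "H k z = cnj (g z) * k z - p z" for z by (simp add: Hankel_def p_def)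
    have HL: "L2 M\<phi> (H k)" by (rule H_L2[OF kk])
    have [measurable]: "k \<in> borel_measurable borel" "p \<in> borel_measurable borel" "g \<in> borel_measurable borel"
      by (intro holomorphic_borel kh ph g_hol)+
    have Hm [measurable]: "H k \<in> borel_measurable borel" unfolding Hk[abs_def] by measurable
    define b where "b w = complex_of_real (eta s (w - a))" for w
    have b: "b \<in> TF" using TF_eta(1)[OF s(1), of a] by (simp add: b_def[abs_def])
    have b0: "b w = 0" if "w \<notin> cball a s" for w using TF_eta(2)[OF s(1) that] by (simp add: b_def)
    have db: "cmod (dzb b w) \<le> D / s ^ 3 * indicator (cball a s) w" for w using D(2)[OF s(1), of a w] by (simp add: b_def[abs_def])
    have db0: "dzb b w = 0" if "w \<notin> cball a s" for w using db[of w] that by simp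
    have big: "w \<notin> cball a s" if "norm w > norm a + s" for w
      using that norm_triangle_ineq2[of w a] by (simp add: dist_norm norm_minus_commute)
    have [measurable]: "dzb b \<in> borel_measurable borel" by (rule borel_measurable_continuous_onI[OF TF_continuous(3)[OF b]])
    have k0: "k z \<noteq> 0" "1 / cmod (k z) \<le> A * R * exp (- psi z)" if "z \<in> cball a (d * R)" for z
      using low[of z a] that by (auto simp: k_def R_def)
    have sub: "cball a s \<subseteq> ball a (d * R)" using s by auto
    \<comment> \<open>Dividing H k by k leaves \<open>cnj g\<close> minus this holomorphic quotient,
      which is annihilated by \<open>dzb b\<close>.\<close>
    have pk: "(\<lambda>z. p z / k z) holomorphic_on ball a (d * R)"
      using k0(1) by (intro holomorphic_intros holomorphic_on_subset[OF kh] holomorphic_on_subset[OF ph]) auto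
    have pk0: "(LINT w|lborel. p w / k w * dzb b w) = 0"
      by (rule holomorphic_test_zero[OF pk open_ball closed_cball sub b b0])
    have ipk: "integrable lborel (\<lambda>w. p w / k w * dzb b w)"
      by (rule integrable_compact_support[of _ "norm a + s", OF continuous_glue[OF open_ball closed_cball sub
            holomorphic_on_imp_continuous_on[OF pk] TF_continuous(3)[OF b] db0]])
         (use db0 big in auto)
    have ig: "integrable lborel (\<lambda>w. cnj (g w) * dzb b w)"
      by (rule integrable_compact_support[of _ "norm a + s"])
         (use db0 big in \<open>auto intro!: continuous_intros TF_continuous[OF b] holomorphic_on_imp_continuous_on[OF g_hol]\<close>)
    \<comment> \<open>Integration by parts moves d-bar to \<open>cnj g\<close>; the mean value
      property of g' extracts its value at the centre.\<close>
    have mv: "(LINT w|lborel. cnj (g w) * dzb b w) = -2 * (complex_of_real mass * cnj (deriv g a))"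
    proof -
      have "(LINT w|lborel. cnj (g w) * dzb b w) = -2 * (LINT w|lborel. cnj (deriv g w) * b w)"
        using gf_dbar[of "\<lambda>_. 1", OF _ b] by simp
      also have "(LINT w|lborel. cnj (deriv g w) * b w) = (LINT w|lborel. cnj (deriv g w * complex_of_real (eta s (w - a))))"
        by (simp add: b_def)
      also have "\<dots> = cnj (LINT w|lborel. deriv g w * complex_of_real (eta s (w - a)))" by (rule Bochner_Integration.integral_cnj)
      also have "(LINT w|lborel. deriv g w * complex_of_real (eta s (w - a))) = complex_of_real mass * deriv g a"
        by (rule mean_value_eta[OF holomorphic_on_subset[OF holomorphic_deriv[OF g_hol open_UNIV] subset_UNIV] s(1,2)])
      finally show ?thesis by simp
    qed
    define h1 where "h1 z = indicator (cball a s) z * H k z" for z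
    \<comment> \<open>The test function is divided by k and freed of the weight, so that its
      weighted pairing with H k is the plain integral of H k / k against
      \<open>dzb b\<close>.\<close>
    define h2 where "h2 z = cnj (dzb b z / k z * complex_of_real (exp (2 * psi z)))" for z
    have cb [measurable]: "cball a s \<in> sets borel" by simp
    have h1m [measurable]: "h1 \<in> borel_measurable borel" unfolding h1_def[abs_def] by measurable
    have h2m [measurable]: "h2 \<in> borel_measurable borel" unfolding h2_def[abs_def] by measurable
    have L1: "L2 M\<phi> h1"
    proof (rule L2_mono(1)[OF HL])
      show "h1 \<in> borel_measurable M\<phi>" using measurable_completion[of h1 lborel borel] h1m by (simp add: Mw_def)
    qed (auto simp: h1_def indicator_def)
    have L1p: "L2 (Mw lborel psi) h1" "nrm (Mw lborel psi) h1 \<le> nrm M\<phi> h1"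
      using L2_psi_phi(1,2)[OF h1m] L1 by auto
    define E where "E = D / s ^ 3 * (A * R)"
    have E: "E \<ge> 0" using D dA R s by (simp add: E_def)
    have h2b: "(cmod (h2 z))\<^sup>2 * exp (-2 * psi z) \<le> E\<^sup>2 * indicator (cball a s) z" for z
    proof (cases "z \<in> cball a s")
      case True
      then have z: "z \<in> cball a (d * R)" using sub by auto
      have "cmod (dzb b z) \<le> D / s ^ 3" using db[of z] True by simp
      then have "cmod (dzb b z) * (1 / cmod (k z)) \<le> D / s ^ 3 * (A * R * exp (- psi z))"
        using k0(2)[OF z] D s by (intro mult_mono) auto
      then have "(cmod (dzb b z) * (1 / cmod (k z))) * exp (psi z) \<le> D / s ^ 3 * (A * R * exp (- psi z)) * exp (psi z)"
        by (rule mult_right_mono) simp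
      also have "\<dots> = E * (exp (- psi z) * exp (psi z))" unfolding E_def by (simp only: mult_ac)
      also have "\<dots> = E" by (simp flip: exp_add)
      finally have "((cmod (dzb b z) * (1 / cmod (k z))) * exp (psi z))\<^sup>2 \<le> E\<^sup>2" by (intro power_mono) auto
      moreover have "(cmod (h2 z))\<^sup>2 * exp (-2 * psi z) = ((cmod (dzb b z) * (1 / cmod (k z))) * exp (psi z))\<^sup>2"
      proof -
        have "(exp (2 * psi z))\<^sup>2 * exp (-2 * psi z) = (exp (psi z))\<^sup>2"
          by (simp add: power2_eq_square flip: exp_add)
        then show ?thesis by (simp add: h2_def norm_mult norm_divide power_mult_distrib power_divide)
      qed
      ultimately show ?thesis using True by simp
    next
      case False
      then show ?thesis by (simp add: h2_def db0)
    qed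
    have iE: "integrable lborel (\<lambda>z. E\<^sup>2 * indicator (cball a s) z)"
      using indicator_cball_integrable by (rule integrable_mult_right)
    have h2i: "integrable lborel (\<lambda>z. (cmod (h2 z))\<^sup>2 * exp (-2 * psi z))"
      by (rule Bochner_Integration.integrable_bound[OF iE]) (use h2b in \<open>auto intro: order_trans[OF _ abs_ge_self]\<close>)
    have L2p: "L2 (Mw lborel psi) h2" using h2i by (simp add: Mw_L2)
    have h2n: "nrm (Mw lborel psi) h2 \<le> E * sqrt pi * s"
    proof (rule power2_le_imp_le)
      have "(nrm (Mw lborel psi) h2)\<^sup>2 = (LINT z|lborel. (cmod (h2 z))\<^sup>2 * exp (-2 * psi z))" by (simp add: Mw_nrm)
      also have "\<dots> \<le> (LINT z|lborel. E\<^sup>2 * indicator (cball a s) z)" by (rule integral_mono[OF h2i iE h2b])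
      also have "\<dots> = E\<^sup>2 * (pi * s\<^sup>2)" using area_cball[of s a] s by simp
      finally show "(nrm (Mw lborel psi) h2)\<^sup>2 \<le> (E * sqrt pi * s)\<^sup>2" by (simp add: power_mult_distrib)
    qed (use E s in auto)
    have "ip (Mw lborel psi) h1 h2 = (LINT w|lborel. h1 w * cnj (h2 w) * complex_of_real (exp (-2 * psi w)))"
      by (rule Mw_ip) auto
    also have "\<dots> = (LINT w|lborel. cnj (g w) * dzb b w - p w / k w * dzb b w)"
    proof (rule integral_cong_eq)
      fix w
      show "h1 w * cnj (h2 w) * complex_of_real (exp (-2 * psi w)) = cnj (g w) * dzb b w - p w / k w * dzb b w"
      proof (cases "w \<in> cball a s")
        case True
        then have kw: "k w \<noteq> 0" using sub by (intro k0) auto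
        have "exp (2 * psi w) * exp (-2 * psi w) = 1" by (simp flip: exp_add)
        then have x: "complex_of_real (exp (2 * psi w)) * complex_of_real (exp (-2 * psi w)) = 1" unfolding of_real_mult[symmetric] by simp
        have "h1 w * cnj (h2 w) * complex_of_real (exp (-2 * psi w)) = (cnj (g w) * k w - p w) * (dzb b w / k w) * (complex_of_real (exp (2 * psi w)) * complex_of_real (exp (-2 * psi w)))"
          using True unfolding h1_def h2_def Hk complex_cnj_cnj by (simp only: indicator_simps mult_1 mult.assoc)
        then show ?thesis unfolding x using kw by (simp add: field_simps)
      qed (simp add: h1_def db0)
    qed
    also have "\<dots> = -2 * (complex_of_real mass * cnj (deriv g a))"
      using mv pk0 ipk ig by simp
    finally have "2 * (mass * cmod (deriv g a)) = cmod (ip (Mw lborel psi) h1 h2)"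
      using mass_pos by (simp add: norm_mult)
    also have "\<dots> \<le> nrm (Mw lborel psi) h1 * nrm (Mw lborel psi) h2" by (rule Cauchy_Schwarz[OF L1p(1) L2p])
    also have "\<dots> \<le> nrm M\<phi> h1 * (E * sqrt pi * s)" by (intro mult_mono L1p h2n nrm_nonneg)
    finally have "cmod (deriv g a) \<le> nrm M\<phi> h1 * (E * sqrt pi * s) / (2 * mass)"
      using mass_pos by (simp add: field_simps)
    then have "cmod (deriv g a) * R \<le> nrm M\<phi> h1 * (E * sqrt pi * s) / (2 * mass) * R" using R by (intro mult_right_mono) auto
    also have "\<dots> = C * nrm M\<phi> h1"
      using R dA mass_pos unfolding C_def E_def s_def by (simp add: field_simps power2_eq_square power3_eq_cube)
    finally have "cmod (deriv g a) * \<rho> a \<le> C * nrm M\<phi> (\<lambda>z. indicator (cball a s) z * H (knorm \<phi> a) z)"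
      by (simp add: R_def h1_def[abs_def] k_def)
    then show ?thesis using s by (auto simp: R_def)
  qed
  then show ?thesis using C by blast
qed

lemma vanishing_if_compact:
  assumes cpt: "hankel_compact \<phi> g"
  shows "((\<lambda>a. cmod (deriv g a) * \<rho> a) \<longlongrightarrow> 0) at_infinity"
proof (rule tendstoI)
  fix e :: real assume e: "e > 0"
  obtain C where C: "C \<ge> 0" "\<And>a. \<exists>s. 0 < s \<and> s \<le> \<rho> a / 4 \<and>
     cmod (deriv g a) * \<rho> a \<le> C * nrm M\<phi> (\<lambda>z. indicator (cball a s) z * H (knorm \<phi> a) z)"
    using Hankel_local_lower_bound by blast
  \<comment> \<open>The net error and the tail of the net element each contribute e'; the summand 1
    covers C = 0.\<close>
  define e' where "e' = e / (2 * (C + 1))"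
  have e': "e' > 0" using e C by (simp add: e'_def)
  obtain S where S: "finite S" "\<And>t. t \<in> S \<Longrightarrow> L2w \<phi> t"
    "\<And>f. f \<in> kspan \<phi> \<Longrightarrow> wnorm \<phi> f \<le> 1 \<Longrightarrow> \<exists>t\<in>S. wnorm \<phi> (\<lambda>z. H f z - t z) < e'"
    using cpt e' unfolding hankel_compact_def by meson
  have SL: "L2 M\<phi> t" if "t \<in> S" for t using S(2)[OF that] by (simp add: L2w_iff)
  have setsM: "X \<in> sets M\<phi>" if "X \<in> sets borel" for X using that by (simp add: Mw_def)
  have "\<forall>t\<in>S. \<forall>\<^sub>F n in sequentially. nrm M\<phi> (\<lambda>z. indicator (- cball 0 (real n)) z * t z) < e'"
  proof
    fix t assume "t \<in> S"
    have "(\<lambda>n. nrm M\<phi> (\<lambda>z. indicator (- cball 0 (real n)) z * t z)) \<longlonglongrightarrow> 0"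
      by (rule L2_tail[OF SL[OF \<open>t \<in> S\<close>]]) (rule setsM, simp add: Mw_def)
    then show "\<forall>\<^sub>F n in sequentially. nrm M\<phi> (\<lambda>z. indicator (- cball 0 (real n)) z * t z) < e'"
      using e' by (rule order_tendstoD)
  qed
  then have "\<forall>\<^sub>F n in sequentially. \<forall>t\<in>S. nrm M\<phi> (\<lambda>z. indicator (- cball 0 (real n)) z * t z) < e'"
    using S(1) by (simp add: eventually_ball_finite)
  then obtain N where N: "\<And>t. t \<in> S \<Longrightarrow> nrm M\<phi> (\<lambda>z. indicator (- cball 0 (real N)) z * t z) < e'"
    unfolding eventually_sequentially by blast
  \<comment> \<open>For such a, s \<le> \<rho>(a)/4 \<le> (\<rho>(0) + |a|)/4 by the Lipschitz
    bound, so points of the disc have modulus at least 3|a|/4 - \<rho>(0)/4, which exceeds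
    N.\<close>
  have "dist (cmod (deriv g a) * \<rho> a) 0 < e" if a: "norm a \<ge> 2 * real N + \<rho> 0 + 1" for a
  proof -
    obtain s where s: "0 < s" "s \<le> \<rho> a / 4"
      "cmod (deriv g a) * \<rho> a \<le> C * nrm M\<phi> (\<lambda>z. indicator (cball a s) z * H (knorm \<phi> a) z)" using C(2) by blast
    define k where "k = knorm \<phi> a"
    have kk: "k \<in> kspan \<phi>" using knorm_kspan by (simp add: k_def)
    have kL: "L2 M\<phi> k" by (rule Fock_L2[OF kspan_Fock[OF kk]])
    have k1: "nrm M\<phi> k = 1" using kernel_lower_bound unfolding k_def by blast
    obtain t where t: "t \<in> S" "wnorm \<phi> (\<lambda>z. H k z - t z) < e'" using S(3)[OF kk] k1 wnorm_eq[OF kL] by auto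
    have HL: "L2 M\<phi> (H k)" by (rule H_L2[OF kk])
    note tL = SL[OF t(1)]
    have dL: "L2 M\<phi> (\<lambda>z. H k z - t z)" by (rule L2_diff[OF HL tL])
    have d: "nrm M\<phi> (\<lambda>z. H k z - t z) < e'" using t(2) wnorm_eq[OF dL] by simp
    have far: "cball a s \<subseteq> - cball 0 (real N)"
    proof
      fix z assume z: "z \<in> cball a s"
      have "\<rho> a \<le> \<rho> 0 + norm a" using rho_lipschitz[of a 0] by simp
      then have "dist a z \<le> (\<rho> 0 + norm a) / 4" using z s(2) by simp
      moreover have "norm a \<le> norm z + dist a z" using norm_triangle_ineq2[of a z] by (simp add: dist_norm)
      ultimately have "norm z > real N" using a rho_pos[of 0] by (simp add: field_simps)
      then show "z \<in> - cball 0 (real N)" by simp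
    qed
    have ind: "(\<lambda>z. indicator X z * f z) \<in> borel_measurable M\<phi>" if "X \<in> sets borel" "L2 M\<phi> f" for X and f :: "complex \<Rightarrow> complex"
      using setsM[OF that(1)] L2_measurable[OF that(2)] by measurable
    have 1: "L2 M\<phi> (\<lambda>z. indicator (cball a s) z * (H k z - t z))" "nrm M\<phi> (\<lambda>z. indicator (cball a s) z * (H k z - t z)) \<le> nrm M\<phi> (\<lambda>z. H k z - t z)"
      by (rule L2_mono[OF dL ind[OF _ dL]]; auto simp: indicator_def)+
    have 2: "L2 M\<phi> (\<lambda>z. indicator (- cball 0 (real N)) z * t z)"
      by (rule L2_mono(1)[OF tL ind[OF _ tL]]) (auto simp: indicator_def)
    have 3: "L2 M\<phi> (\<lambda>z. indicator (cball a s) z * t z)"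
      "nrm M\<phi> (\<lambda>z. indicator (cball a s) z * t z) \<le> nrm M\<phi> (\<lambda>z. indicator (- cball 0 (real N)) z * t z)"
      by (rule L2_mono[OF 2 ind[OF _ tL]]; use far in \<open>auto simp: indicator_def\<close>)+
    have "nrm M\<phi> (\<lambda>z. indicator (cball a s) z * H k z) = nrm M\<phi> (\<lambda>z. indicator (cball a s) z * (H k z - t z) + indicator (cball a s) z * t z)"
      by (simp add: algebra_simps)
    also have "\<dots> \<le> nrm M\<phi> (\<lambda>z. indicator (cball a s) z * (H k z - t z)) + nrm M\<phi> (\<lambda>z. indicator (cball a s) z * t z)"
      by (rule nrm_triangle[OF 1(1) 3(1)])
    also have "\<dots> \<le> 2 * e'" using 1(2) d 3(2) N[OF t(1)] by linarith
    finally have "C * nrm M\<phi> (\<lambda>z. indicator (cball a s) z * H k z) \<le> C * (2 * e')" using C(1) by (rule mult_left_mono)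
    also have "\<dots> < (C + 1) * (2 * e')" using e' by (intro mult_strict_right_mono) auto
    also have "\<dots> = e"
    proof -
      have "x * (2 * (e / (2 * x))) = e" if "x > 0" for x using that by simp
      then show ?thesis unfolding e'_def using C(1) by (metis add_nonneg_pos zero_less_one)
    qed
    finally have "cmod (deriv g a) * \<rho> a < e" using s(3) unfolding k_def by linarith
    then show ?thesis using rho_pos[of a] by (simp add: dist_norm)
  qed
  then show "\<forall>\<^sub>F a in at_infinity. dist (cmod (deriv g a) * \<rho> a) 0 < e"
    unfolding eventually_at_infinity by blast
qed

end

lemma usc_borel:
  assumes "usc f" shows "f \<in> borel_measurable borel"
proof (rule borel_measurableI_less)
  fix t
  have "open {z. f z < t}" using assms by (simp add: usc_def)
  then show "{z \<in> space borel. f z < t} \<in> sets borel" by simp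
qed

text \<open>Non-harmonicity of \<phi> is expressed by its Laplacian \<mu> not being the zero
  measure. Fixing a doubling constant and deriving Borel measurability from upper semicontinuity
  places the data in the locale \<open>hankel_symbol\<close>, where the two implications are
  proved.\<close>

theorem theorem4:
  fixes \<phi> :: "complex \<Rightarrow> real" and \<mu> :: "complex measure" and g :: "complex \<Rightarrow> complex"
  assumes "subharmonic \<phi>"
    and "is_laplacian \<phi> \<mu>"
    and "emeasure \<mu> UNIV \<noteq> 0"
    and "doubling \<mu>"
    and "g holomorphic_on UNIV"
    and "\<And>a. L2w \<phi> (\<lambda>z. cnj (g z) * knorm \<phi> a z)"
  shows "hankel_compact \<phi> g \<longleftrightarrow>
         ((\<lambda>a. cmod (deriv g a) * rho \<mu> a) \<longlongrightarrow> 0) at_infinity"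
proof -
  obtain C where C: "C > 0" "\<forall>z r. r > 0 \<longrightarrow> emeasure \<mu> (ball z (2*r)) \<le> ennreal C * emeasure \<mu> (ball z r)"
    using assms(4) unfolding doubling_def by blast
  have "hankel_symbol \<mu> C \<phi> g"
  proof unfold_locales
    show "sets \<mu> = sets borel" "\<And>K. compact K \<Longrightarrow> emeasure \<mu> K < \<infinity>"
      using assms(2) unfolding is_laplacian_def by blast+
    show "\<phi> \<in> borel_measurable borel" using assms(1) usc_borel unfolding subharmonic_def by blast
  qed (use assms C in auto)
  then show ?thesis
    using hankel_symbol.compact_if_vanishing hankel_symbol.vanishing_if_compact by blast
qed

end
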